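(* For every integer $k\ge1$, every finitely generated projective $A$-submodule $L\subset F^r$ of rank $r$, and every $v\in F^r$, the Eisenstein series $E_{k,v+L}$ is a modular form of weight $k$ (and type $0$) for the group $\Gamma_{v+L}$, i.e. $E_{k,v+L}\in\mathcal{M}_{k}(\Gamma_{v+L})$.
   Context: Let $F$ be a global function field with exact field of constants $\mathbb{F}_q$, fix a place $\infty$ of $F$, and let $A\subset F$ be the ring of elements regular away from $\infty$. Let $F_\infty$ be the completion of $F$ at $\infty$ and $\mathbb{C}_\infty$ the completion of an algebraic closure of $F_\infty$. Fix an integer $r\ge2$ and $\xi\in\mathbb{C}_\infty^\times$. Let $\Omega^r$ be the rigid analytic space of column vectors $\omega=(\omega_1,\dots,\omega_r)^T\in\mathbb{C}_\infty^r$ such that $\omega_1,\dots,\omega_r$ are $F_\infty$-linearly independent and $\omega_r=\xi$; "holomorphic" means rigid analytic. Elements of $F^r$ are row vectors, so $x\omega\in\mathbb{C}_\infty$ for $x\in F^r$, and $\mathrm{GL}_r(F)$ acts on $F^r$ from the right. For $\gamma\in\mathrm{GL}_r(F_\infty)$ and $\omega\in\Omega^r$ put $j(\gamma,\omega):=\xi^{-1}\cdot(\text{last entry of }\gamma\omega)$ and $\gamma(\omega):=j(\gamma,\omega)^{-1}\gamma\omega\in\Omega^r$. For integers $k,m$ and $f:\Omega^r\to\mathbb{C}_\infty$ set $(f|_{k,m}\gamma)(\omega):=\det(\gamma)^m j(\gamma,\omega)^{-k}f(\gamma(\omega))$. An arithmetic subgroup is a subgroup of $\mathrm{GL}_r(F)$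 commensurable with $\mathrm{GL}_r(A)$. A weak modular form of weight $k$ and type $m$ for an arithmetic subgroup $\Gamma$ is a holomorphic $f:\Omega^r\to\mathbb{C}_\infty$ with $f|_{k,m}\gamma=f$ for all $\gamma\in\Gamma$. For a strongly discrete $\mathbb{F}_q$-subspace $H\subset\mathbb{C}_\infty$ let $e_H(z):=z\prod_{0\ne h\in H}(1-z/h)$. For such $f$, let $\Lambda'=\{\lambda'\in F^{r-1}:\left(\begin{smallmatrix}1&\lambda'\\0&I_{r-1}\end{smallmatrix}\right)\in\Gamma\}$; writing $\omega=\binom{\omega_1}{\omega'}$ with $\omega'\in\Omega^{r-1}$ and $u:=e_{\Lambda'\omega'}(\omega_1)^{-1}$, $f$ has a unique $u$-expansion $f(\omega)=\sum_{n\in\mathbb{Z}}f_n(\omega')u^n$ converging on a neighbourhood of infinity. $f$ is holomorphic at infinity if $f_n=0$ for all $n<0$, and vanishes at infinity if $f_n=0$ for all $n\le0$. The space $\mathcal{M}_{k,m}(\Gamma)$ of modular forms (resp. $\mathcal{S}_{k,m}(\Gamma)$ of cusp forms) consists of the weak modular forms $f$ of weight $k$, type $m$ for $\Gamma$ such that for every $\gamma\in\mathrm{GL}_r(F)$ the function $f|_{k,m}\gamma$ (a weak modular form for $\gamma^{-1}\Gamma\gamma$) is holomorphic (resp. vanishes) at infinity; the index $m$ is omitted when $m=0$. For a finitely generated projective $A$-submodule $L\subset F^r$ of rank $r$ and $v\in F^r$, put $\Gamma_{v+L}:=\{\gamma\in\mathrm{GL}_r(F): v\gamma+L\gamma=v+L\}$,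 and for $k\ge1$ define the Eisenstein series $E_{k,v+L}(\omega):=\sum_{0\ne x\in v+L}(x\omega)^{-k}$. *)

theory Defs
  imports
    "HOL-Analysis.Uniform_Limit"
    "HOL-Algebra.Algebraic_Closure"
    "HOL-Algebra.Generated_Fields"
    "Jordan_Normal_Form.DL_Rank"
begin

unbundle no vec_syntax and no inner_syntax

text \<open>
  The function field \<open>F\<close> is a type \<open>'f\<close>, the field \<open>\<complex>\<^sub>\<infinity>\<close> is a type \<open>'c\<close>, and \<open>\<iota> :: 'f \<Rightarrow> 'c\<close> is the
  embedding. \<open>F\<^sub>\<infinity>\<close> is a subset of \<open>'c\<close>. Vectors and matrices are indexed from \<open>0\<close>, so that
  \<open>\<omega>\<^sub>1\<close> is \<open>\<omega> $ 0\<close> and the last entry \<open>\<omega>\<^sub>r\<close> is \<open>\<omega> $ (r - 1)\<close>. Functions on \<open>\<Omega>\<^sup>r\<close> are functions on all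
  vectors, whose values outside \<open>\<Omega>\<^sup>r\<close> never matter.
\<close>

definition global_function_field :: "'f::field set \<Rightarrow> bool" where
  "global_function_field K \<longleftrightarrow>
     subfield K (class_ring :: 'f ring) \<and> finite K \<and>
     (\<forall>x. \<not> ring.transcendental class_ring K x \<longrightarrow> x \<in> K) \<and>
     (\<exists>t. ring.transcendental class_ring K t \<and>
          ring.finite_dimension class_ring (generate_field class_ring (insert t K)) UNIV)"

text \<open>
  A place is given by its normalised valuation. Triviality on the constants is automatic, as they
  form a finite field. The value at \<open>0\<close> is a dummy, fixed so that equal places are equal functions
  and so that \<open>0\<close> is regular at every place.
\<close>

definition place :: "('f::field \<Rightarrow> int) \<Rightarrow> bool" where
  "place w \<longleftrightarrow> w 0 = 0 \<and>
     (\<forall>x y. x \<noteq> 0 \<longrightarrow> y \<noteq> 0 \<longrightarrow> w (x * y) = w x + w y) \<and>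
     (\<forall>x y. x \<noteq> 0 \<longrightarrow> y \<noteq> 0 \<longrightarrow> x + y \<noteq> 0 \<longrightarrow> min (w x) (w y) \<le> w (x + y)) \<and>
     (\<exists>x. x \<noteq> 0 \<and> w x = 1)"

definition regular_ring :: "('f::field \<Rightarrow> int) \<Rightarrow> 'f set" where
  "regular_ring ord_inf = {a. \<forall>w. place w \<and> w \<noteq> ord_inf \<longrightarrow> 0 \<le> w a}"

definition absv :: "'c::{field,metric_space} \<Rightarrow> real" where
  "absv x = dist x 0"

definition F_inf :: "('f \<Rightarrow> 'c::{field,metric_space}) \<Rightarrow> 'c set" where
  "F_inf \<iota> = closure (range \<iota>)"

text \<open>
  Completeness of \<open>'c\<close> is part of its sort. As \<open>'c\<close> is complete, the closure of \<open>F\<close> in it is the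
  completion of \<open>F\<close> at \<open>\<infinity>\<close>. The base \<open>\<theta>\<close> leaves the normalisation of the absolute value open.
\<close>

definition is_C_inf ::
    "('f::field \<Rightarrow> int) \<Rightarrow> real \<Rightarrow> ('f \<Rightarrow> 'c::{field,complete_space}) \<Rightarrow> bool" where
  "is_C_inf ord_inf \<theta> \<iota> \<longleftrightarrow>
     (\<forall>x y :: 'c. dist x y = absv (x - y)) \<and>
     (\<forall>x y :: 'c. absv (x * y) = absv x * absv y) \<and>
     (\<forall>x y :: 'c. absv (x + y) \<le> max (absv x) (absv y)) \<and>
     field_hom \<iota> \<and>
     0 < \<theta> \<and> \<theta> < 1 \<and> (\<forall>a. a \<noteq> 0 \<longrightarrow> absv (\<iota> a) = \<theta> powi ord_inf a) \<and>
     (\<exists>F_bar. algebraic_closure (class_ring\<lparr>carrier := F_bar\<rparr>) (F_inf \<iota>) \<and> closure F_bar = (UNIV :: 'c set))"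

definition pairing :: "('f \<Rightarrow> 'c::field) \<Rightarrow> 'f vec \<Rightarrow> 'c vec \<Rightarrow> 'c" where
  "pairing \<iota> x \<omega> = map_vec \<iota> x \<bullet> \<omega>"

definition Omega :: "('f \<Rightarrow> 'c::{field,metric_space}) \<Rightarrow> 'c \<Rightarrow> nat \<Rightarrow> 'c vec set" where
  "Omega \<iota> \<xi> r = {\<omega> \<in> carrier_vec r. \<omega> $ (r - 1) = \<xi> \<and>
     (\<forall>x \<in> carrier_vec r. set\<^sub>v x \<subseteq> F_inf \<iota> \<longrightarrow> x \<bullet> \<omega> = 0 \<longrightarrow> x = 0\<^sub>v r)}"

definition max_norm :: "'c::{field,metric_space} vec \<Rightarrow> real" where
  "max_norm x = Max (absv ` set\<^sub>v x)"

text \<open>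
  The rigid analytic structure of \<open>\<Omega>\<^sup>r\<close> comes from its standard admissible covering by the affinoids
  \<open>\<Omega>\<^sub>n\<^sup>r = {\<omega>. \<bar>l(\<omega>)\<bar> \<ge> \<bar>\<pi>\<bar>\<^sup>n \<bar>\<omega>\<bar> for all unimodular F\<^sub>\<infinity>-linear forms l}\<close>, where \<open>\<pi>\<close> is a uniformiser at
  \<open>\<infinity>\<close>. Here \<open>\<pi>\<^sup>n\<close> is replaced by an arbitrary \<open>a \<noteq> 0\<close> of \<open>F\<close>; only \<open>\<bar>a\<bar>\<close>, a power of \<open>\<bar>\<pi>\<bar>\<close>, matters.
\<close>

definition Omega_affinoid ::
    "('f \<Rightarrow> 'c::{field,metric_space}) \<Rightarrow> 'c \<Rightarrow> nat \<Rightarrow> 'f \<Rightarrow> 'c vec set" where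
  "Omega_affinoid \<iota> \<xi> r a = {\<omega> \<in> Omega \<iota> \<xi> r.
     \<forall>x \<in> carrier_vec r. set\<^sub>v x \<subseteq> F_inf \<iota> \<longrightarrow> max_norm x = 1 \<longrightarrow>
       absv (\<iota> a) * max_norm \<omega> \<le> absv (x \<bullet> \<omega>)}"

inductive_set poly_funs :: "nat \<Rightarrow> ('c::field vec \<Rightarrow> 'c) set" for d where
  const: "(\<lambda>_. c) \<in> poly_funs d"
| coord: "i < d \<Longrightarrow> (\<lambda>\<omega>. \<omega> $ i) \<in> poly_funs d"
| add: "f \<in> poly_funs d \<Longrightarrow> g \<in> poly_funs d \<Longrightarrow> (\<lambda>\<omega>. f \<omega> + g \<omega>) \<in> poly_funs d"
| mult: "f \<in> poly_funs d \<Longrightarrow> g \<in> poly_funs d \<Longrightarrow> (\<lambda>\<omega>. f \<omega> * g \<omega>) \<in> poly_funs d"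

text \<open>
  On a rational subdomain \<open>U\<close> of a polydisc, which is reduced, the affinoid algebra is the completion
  of the ring of rational functions without poles on \<open>U\<close> with respect to the supremum norm, so its
  elements are the uniform limits of such functions. The \<open>\<Omega>\<^sub>n\<^sup>r\<close> are of this kind: modulo \<open>\<pi>\<^sup>n\<^sup>+\<^sup>1\<close>
  there are finitely many unimodular forms, and \<open>\<omega>\<^sub>r = \<xi>\<close> gives \<open>\<bar>\<omega>\<bar> \<le> \<bar>\<xi>\<bar> / \<bar>\<pi>\<bar>\<^sup>n\<close>.
\<close>

definition affinoid_function :: "nat \<Rightarrow> 'c::{field,metric_space} vec set \<Rightarrow> ('c vec \<Rightarrow> 'c) \<Rightarrow> bool" where
  "affinoid_function d U f \<longleftrightarrow> (\<exists>P Q.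
     (\<forall>n. P n \<in> poly_funs d \<and> Q n \<in> poly_funs d \<and> (\<forall>\<omega>\<in>U. Q n \<omega> \<noteq> 0)) \<and>
     uniform_limit U (\<lambda>n \<omega>. P n \<omega> / Q n \<omega>) f sequentially)"

definition holomorphic_Omega ::
    "('f::field \<Rightarrow> 'c::{field,metric_space}) \<Rightarrow> 'c \<Rightarrow> nat \<Rightarrow> ('c vec \<Rightarrow> 'c) \<Rightarrow> bool" where
  "holomorphic_Omega \<iota> \<xi> r f \<longleftrightarrow> (\<forall>a. a \<noteq> 0 \<longrightarrow> affinoid_function r (Omega_affinoid \<iota> \<xi> r a) f)"

definition GL :: "nat \<Rightarrow> 'f::field mat monoid" where
  "GL r = units_of (ring_mat TYPE('f) r ())"

definition GL_over :: "nat \<Rightarrow> 'f::field set \<Rightarrow> 'f mat set" where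
  "GL_over r A = {\<gamma> \<in> carrier (GL r). elements_mat \<gamma> \<subseteq> A \<and> elements_mat (inv\<^bsub>GL r\<^esub> \<gamma>) \<subseteq> A}"

definition commensurable :: "('g, 'h) monoid_scheme \<Rightarrow> 'g set \<Rightarrow> 'g set \<Rightarrow> bool" where
  "commensurable G H1 H2 \<longleftrightarrow>
     finite (rcosets\<^bsub>G\<lparr>carrier := H1\<rparr>\<^esub> (H1 \<inter> H2)) \<and> finite (rcosets\<^bsub>G\<lparr>carrier := H2\<rparr>\<^esub> (H1 \<inter> H2))"

definition arithmetic_subgroup :: "nat \<Rightarrow> 'f::field set \<Rightarrow> 'f mat set \<Rightarrow> bool" where
  "arithmetic_subgroup r A \<Gamma> \<longleftrightarrow> subgroup \<Gamma> (GL r) \<and> commensurable (GL r) \<Gamma> (GL_over r A)"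

definition row_act :: "'f::field vec \<Rightarrow> 'f mat \<Rightarrow> 'f vec" where
  "row_act x \<gamma> = transpose_mat \<gamma> *\<^sub>v x"

definition j_factor :: "('f \<Rightarrow> 'c::field) \<Rightarrow> 'c \<Rightarrow> nat \<Rightarrow> 'f mat \<Rightarrow> 'c vec \<Rightarrow> 'c" where
  "j_factor \<iota> \<xi> r \<gamma> \<omega> = inverse \<xi> * (map_mat \<iota> \<gamma> *\<^sub>v \<omega>) $ (r - 1)"

definition GL_act :: "('f \<Rightarrow> 'c::field) \<Rightarrow> 'c \<Rightarrow> nat \<Rightarrow> 'f mat \<Rightarrow> 'c vec \<Rightarrow> 'c vec" where
  "GL_act \<iota> \<xi> r \<gamma> \<omega> = inverse (j_factor \<iota> \<xi> r \<gamma> \<omega>) \<cdot>\<^sub>v (map_mat \<iota> \<gamma> *\<^sub>v \<omega>)"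

definition slash ::
    "('f::field \<Rightarrow> 'c::field) \<Rightarrow> 'c \<Rightarrow> nat \<Rightarrow> int \<Rightarrow> int \<Rightarrow> ('c vec \<Rightarrow> 'c) \<Rightarrow> 'f mat \<Rightarrow> 'c vec \<Rightarrow> 'c" where
  "slash \<iota> \<xi> r k m f \<gamma> \<omega> =
     \<iota> (det \<gamma>) powi m * j_factor \<iota> \<xi> r \<gamma> \<omega> powi (- k) * f (GL_act \<iota> \<xi> r \<gamma> \<omega>)"

text \<open>The product over \<open>H - {0}\<close> is the limit over its finite subsets, as in \<open>infsum\<close>.\<close>

definition exp_fun :: "'c::{field,metric_space} set \<Rightarrow> 'c \<Rightarrow> 'c" where
  "exp_fun H z = z * Lim (finite_subsets_at_top (H - {0})) (\<lambda>H'. \<Prod>h\<in>H'. (1 - z / h))"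

definition unipotent_part :: "nat \<Rightarrow> 'f::field mat set \<Rightarrow> 'f vec set" where
  "unipotent_part r \<Gamma> = {l \<in> carrier_vec (r - 1).
     four_block_mat (1\<^sub>m 1) (mat_of_rows (r - 1) [l]) (0\<^sub>m (r - 1) 1) (1\<^sub>m (r - 1)) \<in> \<Gamma>}"

definition u_param ::
    "('f::field \<Rightarrow> 'c::{field,metric_space}) \<Rightarrow> nat \<Rightarrow> 'f mat set \<Rightarrow> 'c vec \<Rightarrow> 'c" where
  "u_param \<iota> r \<Gamma> \<omega> =
     inverse (exp_fun ((\<lambda>l. pairing \<iota> l (vec_last \<omega> (r - 1))) ` unipotent_part r \<Gamma>) (\<omega> $ 0))"

text \<open>
  Neighbourhoods of infinity are tubular: over each affinoid of \<open>\<Omega>\<^sup>r\<^sup>-\<^sup>1\<close> they contain all \<open>\<omega>\<close> with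
  \<open>\<bar>u\<bar> \<le> \<rho>\<close>, where \<open>\<rho> > 0\<close> may depend on the affinoid. The coefficients are unique on \<open>\<Omega>\<^sup>r\<^sup>-\<^sup>1\<close>,
  since for fixed \<open>\<omega>'\<close> the parameter \<open>u\<close> takes every nonzero value of small absolute value.
\<close>

definition u_expansion ::
    "('f::field \<Rightarrow> 'c::{field,metric_space}) \<Rightarrow> 'c \<Rightarrow> nat \<Rightarrow> 'f mat set \<Rightarrow>
     ('c vec \<Rightarrow> 'c) \<Rightarrow> (int \<Rightarrow> 'c vec \<Rightarrow> 'c) \<Rightarrow> bool" where
  "u_expansion \<iota> \<xi> r \<Gamma> f c \<longleftrightarrow>
     (\<forall>n. holomorphic_Omega \<iota> \<xi> (r - 1) (c n)) \<and>
     (\<forall>a. a \<noteq> 0 \<longrightarrow> (\<exists>\<rho>>0. \<forall>\<omega> \<in> Omega \<iota> \<xi> r.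
        vec_last \<omega> (r - 1) \<in> Omega_affinoid \<iota> \<xi> (r - 1) a \<longrightarrow> absv (u_param \<iota> r \<Gamma> \<omega>) \<le> \<rho> \<longrightarrow>
        ((\<lambda>n. c n (vec_last \<omega> (r - 1)) * u_param \<iota> r \<Gamma> \<omega> powi n) has_sum f \<omega>) UNIV))"

definition holomorphic_at_infinity ::
    "('f::field \<Rightarrow> 'c::{field,metric_space}) \<Rightarrow> 'c \<Rightarrow> nat \<Rightarrow> 'f mat set \<Rightarrow> ('c vec \<Rightarrow> 'c) \<Rightarrow> bool" where
  "holomorphic_at_infinity \<iota> \<xi> r \<Gamma> f \<longleftrightarrow>
     (\<exists>c. u_expansion \<iota> \<xi> r \<Gamma> f c \<and> (\<forall>n<0. \<forall>\<omega>' \<in> Omega \<iota> \<xi> (r - 1). c n \<omega>' = 0))"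

definition weak_modular_form ::
    "('f::field \<Rightarrow> 'c::{field,metric_space}) \<Rightarrow> 'c \<Rightarrow> nat \<Rightarrow> 'f set \<Rightarrow> int \<Rightarrow> int \<Rightarrow> 'f mat set \<Rightarrow>
     ('c vec \<Rightarrow> 'c) \<Rightarrow> bool" where
  "weak_modular_form \<iota> \<xi> r A k m \<Gamma> f \<longleftrightarrow>
     arithmetic_subgroup r A \<Gamma> \<and> holomorphic_Omega \<iota> \<xi> r f \<and>
     (\<forall>\<gamma>\<in>\<Gamma>. \<forall>\<omega> \<in> Omega \<iota> \<xi> r. slash \<iota> \<xi> r k m f \<gamma> \<omega> = f \<omega>)"

definition conj_subgroup :: "nat \<Rightarrow> 'f::field mat \<Rightarrow> 'f mat set \<Rightarrow> 'f mat set" where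
  "conj_subgroup r \<gamma> \<Gamma> = (\<lambda>\<delta>. inv\<^bsub>GL r\<^esub> \<gamma> * \<delta> * \<gamma>) ` \<Gamma>"

definition modular_forms ::
    "('f::field \<Rightarrow> 'c::{field,metric_space}) \<Rightarrow> 'c \<Rightarrow> nat \<Rightarrow> 'f set \<Rightarrow> int \<Rightarrow> int \<Rightarrow> 'f mat set \<Rightarrow>
     ('c vec \<Rightarrow> 'c) set" where
  "modular_forms \<iota> \<xi> r A k m \<Gamma> = {f. weak_modular_form \<iota> \<xi> r A k m \<Gamma> f \<and>
     (\<forall>\<gamma> \<in> carrier (GL r).
        holomorphic_at_infinity \<iota> \<xi> r (conj_subgroup r \<gamma> \<Gamma>) (slash \<iota> \<xi> r k m f \<gamma>))}"

definition linear_over :: "'f::field set \<Rightarrow> 'f vec set \<Rightarrow> ('f vec \<Rightarrow> 'f vec) \<Rightarrow> bool" where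
  "linear_over A M f \<longleftrightarrow>
     (\<forall>x\<in>M. \<forall>y\<in>M. f (x + y) = f x + f y) \<and> (\<forall>a\<in>A. \<forall>x\<in>M. f (a \<cdot>\<^sub>v x) = a \<cdot>\<^sub>v f x)"

text \<open>Finitely generated projective means: a direct summand, i.e. a retract, of some \<open>A\<^sup>n\<close>.\<close>

definition fg_projective :: "'f::field set \<Rightarrow> 'f vec set \<Rightarrow> bool" where
  "fg_projective A L \<longleftrightarrow> (\<exists>n p s. let A_n = {x \<in> carrier_vec n. set\<^sub>v x \<subseteq> A} in
     linear_over A A_n p \<and> p ` A_n \<subseteq> L \<and> linear_over A L s \<and> s ` L \<subseteq> A_n \<and> (\<forall>x\<in>L. p (s x) = x))"

text \<open>The rank of an \<open>A\<close>-submodule of \<open>F\<^sup>r\<close> is the dimension of its \<open>F\<close>-span.\<close>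

definition module_rank :: "nat \<Rightarrow> 'f::field vec set \<Rightarrow> nat" where
  "module_rank r L = vectorspace.dim class_ring
     (module_vec TYPE('f) r
        \<lparr>carrier := LinearCombinations.module.span class_ring (module_vec TYPE('f) r) L\<rparr>)"

definition lattice_in :: "nat \<Rightarrow> 'f::field set \<Rightarrow> 'f vec set \<Rightarrow> bool" where
  "lattice_in r A L \<longleftrightarrow>
     L \<subseteq> carrier_vec r \<and> 0\<^sub>v r \<in> L \<and> (\<forall>x\<in>L. \<forall>y\<in>L. x + y \<in> L) \<and> (\<forall>a\<in>A. \<forall>x\<in>L. a \<cdot>\<^sub>v x \<in> L) \<and>
     fg_projective A L \<and> module_rank r L = r"

definition translate :: "'f::field vec \<Rightarrow> 'f vec set \<Rightarrow> 'f vec set" where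
  "translate v L = (\<lambda>x. v + x) ` L"

definition coset_stabilizer :: "nat \<Rightarrow> 'f::field vec \<Rightarrow> 'f vec set \<Rightarrow> 'f mat set" where
  "coset_stabilizer r v L =
     {\<gamma> \<in> carrier (GL r). translate (row_act v \<gamma>) ((\<lambda>x. row_act x \<gamma>) ` L) = translate v L}"

definition eisenstein ::
    "('f::field \<Rightarrow> 'c::{field,metric_space}) \<Rightarrow> nat \<Rightarrow> nat \<Rightarrow> 'f vec set \<Rightarrow> 'c vec \<Rightarrow> 'c" where
  "eisenstein \<iota> r k S \<omega> = (\<Sum>\<^sub>\<infinity>x \<in> S - {0\<^sub>v r}. inverse (pairing \<iota> x \<omega> ^ k))"

end

theory Submission
  imports Defs "HOL-Analysis.Infinite_Sum" "HOL-Computational_Algebra.Polynomial_FPS" "HOL-Library.FuncSet"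
begin

text \<open>
  Holomorphy of \<open>E\<^sub>k\<close> and its invariance are a matter of uniform convergence on the affinoids and of
  reindexing the sum; the slash by \<open>\<gamma>\<close> replaces \<open>v + L\<close> by \<open>v\<gamma> + L\<gamma>\<close>, so that only one cusp has to be
  treated. There the terms with \<open>x\<^sub>1 \<noteq> 0\<close> are grouped into orbits of \<open>\<Lambda>'\<close>, each contributing
  \<open>x\<^sub>1\<^sup>-\<^sup>k \<Sum>\<^sub>\<lambda> (z + \<lambda>\<omega>')\<^sup>-\<^sup>k\<close> with \<open>z = \<omega>\<^sub>1 + b\<close>. This inner sum is a polynomial (a Goss polynomial) without
  constant term in \<open>1/e(z) = u / (1 + e(b) u)\<close>, which is expanded as a geometric series in \<open>u\<close>;
  the representatives of the orbits can be chosen with \<open>b\<close> bounded because \<open>\<Lambda>'\<close> is cocompact. The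
  terms with \<open>x\<^sub>1 = 0\<close> form the constant coefficient, an Eisenstein series of rank \<open>r - 1\<close>.

  That \<open>\<Gamma>\<close> is arithmetic and that \<open>\<Lambda>'\<close> is discrete and cocompact rests on the ring \<open>A\<close> being
  discrete and cocompact in \<open>F\<^sub>\<infinity>\<close> and having \<open>F\<close> as field of fractions. This is derived
  from the definition of a place by valuation-theoretic counting over the finite field of constants.
\<close>

section \<open>Function fields and their places\<close>

text \<open>Over a complete ultrametric field a family is summable as soon as its terms tend to 0,
  so k = 1 stands on the same footing as k > 1, and each exchange of summations reduces to the
  finiteness of a set of large terms. What shapes the analysis is uniformity: the radius of the
  neighbourhood of infinity may depend on the affinoid in rank r - 1 but not on its points, and one
  radius must serve all orbits although infinitely many geometric series are added. Hence the demand
  that b be bounded, and hence \<open>lattice_family\<close>, which carries one lower bound \<delta>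
  for a whole set of parameters. The recursion for the Goss polynomials is an identity of power
  series for a finite additive group; it is carried over to \<Lambda>'\<omega>' by exhausting the
  lattice with balls, which are groups by the ultrametric inequality. On the arithmetic side the
  finiteness statements about places have one source besides the finiteness of K: the bound
  \<open>dep_bounded\<close> on the length of families independent over K[y]. It takes the place of
  the theory of extensions of valuations and of Riemann-Roch.\<close>

locale const_field =
  fixes K :: "'f::field set"
  assumes finite_K: "finite K"
    and zero_K [simp]: "0 \<in> K"
    and one_K [simp]: "1 \<in> K"
    and add_K [intro]: "x \<in> K \<Longrightarrow> y \<in> K \<Longrightarrow> x + y \<in> K"
    and uminus_K [intro]: "x \<in> K \<Longrightarrow> - x \<in> K"
    and mult_K [intro]: "x \<in> K \<Longrightarrow> y \<in> K \<Longrightarrow> x * y \<in> K"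
    and inverse_K [intro]: "x \<in> K \<Longrightarrow> inverse x \<in> K"
begin

lemma diff_K: "x \<in> K \<Longrightarrow> y \<in> K \<Longrightarrow> x - y \<in> K"
  using add_K[OF _ uminus_K] by force

lemma sum_K: "(\<And>i. i \<in> I \<Longrightarrow> f i \<in> K) \<Longrightarrow> sum f I \<in> K"
  by (induction I rule: infinite_finite_induct) auto

definition KP :: "'f poly set" where "KP = {p. \<forall>i. coeff p i \<in> K}"

lemma KP_I: "(\<And>i. coeff p i \<in> K) \<Longrightarrow> p \<in> KP" and KP_D: "p \<in> KP \<Longrightarrow> coeff p i \<in> K"
  by (auto simp: KP_def)

lemma KP_0 [simp]: "0 \<in> KP" and KP_1 [simp]: "1 \<in> KP"
  by (auto simp: KP_def)

lemma KP_add: "p \<in> KP \<Longrightarrow> q \<in> KP \<Longrightarrow> p + q \<in> KP"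
  by (auto simp: KP_def)

lemma KP_uminus: "p \<in> KP \<Longrightarrow> - p \<in> KP"
  by (auto simp: KP_def)

lemma KP_diff: "p \<in> KP \<Longrightarrow> q \<in> KP \<Longrightarrow> p - q \<in> KP"
  by (auto simp: KP_def intro: diff_K)

lemma KP_mult: "p \<in> KP \<Longrightarrow> q \<in> KP \<Longrightarrow> p * q \<in> KP"
  by (auto simp: KP_def coeff_mult intro!: sum_K)

lemma KP_monom: "c \<in> K \<Longrightarrow> monom c n \<in> KP"
  by (auto simp: KP_def)

lemma KP_sum: "(\<And>i. i \<in> I \<Longrightarrow> f i \<in> KP) \<Longrightarrow> sum f I \<in> KP"
  by (induction I rule: infinite_finite_induct) (auto intro: KP_add)

lemma KP_shift: "p \<in> KP \<Longrightarrow> poly_shift n p \<in> KP"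
  by (auto simp: KP_def coeff_poly_shift)

lemma KP_reflect: "p \<in> KP \<Longrightarrow> reflect_poly p \<in> KP"
  by (auto simp: KP_def coeff_reflect_poly)

lemma poly_coeff_0: "poly p y = coeff p 0 + y * poly (poly_shift 1 p) y" for p :: "'f poly"
proof -
  have "p = [:coeff p 0:] + monom 1 1 * poly_shift 1 p"
    by (rule poly_eqI) (auto simp: coeff_monom_mult coeff_poly_shift coeff_pCons split: nat.splits)
  then have "poly p y = poly ([:coeff p 0:] + monom 1 1 * poly_shift 1 p) y" by simp
  then show ?thesis by (simp add: poly_monom)
qed

text \<open>The inverse of the leading coefficient of p lies in K, so quotient and remainder keep
  their coefficients in K. The remainders are what makes A cocompact later.\<close>

lemma KP_euclid:
  assumes "c \<in> KP" "p \<in> KP" "p \<noteq> 0"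
  shows "\<exists>s\<in>KP. \<exists>r\<in>KP. c = p * s + r \<and> (r = 0 \<or> degree r < degree p)"
  using assms(1)
proof (induction "degree c" arbitrary: c rule: less_induct)
  case less
  show ?case
  proof (cases "c = 0 \<or> degree c < degree p")
    case True
    then show ?thesis using less.prems by (intro bexI[of _ 0] bexI[of _ c]) auto
  next
    case False
    define a where "a = lead_coeff c * inverse (lead_coeff p)"
    define m where "m = monom a (degree c - degree p)"
    have aK: "a \<in> K" using less.prems assms(2) by (auto simp: a_def intro: KP_D)
    have a0: "a \<noteq> 0" using False assms(3) by (auto simp: a_def)
    have mKP: "m \<in> KP" using aK by (simp add: m_def KP_monom)
    define c' where "c' = c - p * m"
    have c'KP: "c' \<in> KP" unfolding c'_def by (intro KP_diff KP_mult less.prems assms mKP)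
    have m0: "m \<noteq> 0" using a0 by (simp add: m_def)
    have dpm: "degree (p * m) = degree c"
      using False assms(3) m0 degree_monom_eq[OF a0] by (simp add: degree_mult_eq m_def)
    have lc: "lead_coeff (p * m) = lead_coeff c"
    proof -
      have "lead_coeff m = a" using a0 by (simp add: m_def degree_monom_eq)
      then show ?thesis using assms(3) by (simp only: lead_coeff_mult) (simp add: a_def)
    qed
    show ?thesis
    proof (cases "c' = 0")
      case True
      then show ?thesis using mKP by (intro bexI[of _ m] bexI[of _ 0]) (auto simp: c'_def)
    next
      case F: False
      have "degree c' \<le> degree c" unfolding c'_def
        by (rule order_trans[OF degree_diff_le_max]) (simp add: dpm)
      moreover have "coeff c' (degree c) = 0" using lc dpm by (simp add: c'_def)
      ultimately have "degree c' < degree c" using F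
        by (metis le_neq_implies_less leading_coeff_0_iff)
      from less.hyps[OF this c'KP] obtain s r where
        "s \<in> KP" "r \<in> KP" "c' = p * s + r" "r = 0 \<or> degree r < degree p" by blast
      then show ?thesis
        by (intro bexI[of _ "m + s"] bexI[of _ r]) (auto simp: c'_def algebra_simps KP_add mKP)
    qed
  qed
qed

text \<open>Linear dependence over K(y) with denominators cleared. The coefficients have to be
  nonzero as polynomials, not as values at y; for y algebraic over K every nonempty family is
  therefore dependent, and statements about \<open>dep\<close> hold for all y alike.\<close>

definition dep :: "'f \<Rightarrow> nat \<Rightarrow> (nat \<Rightarrow> 'f) \<Rightarrow> bool" where
  "dep y m g \<longleftrightarrow> (\<exists>c. (\<forall>j<m. c j \<in> KP) \<and> (\<exists>j<m. c j \<noteq> 0) \<and> (\<Sum>j<m. poly (c j) y * g j) = 0)"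

text \<open>A relation may be divided by the largest power of y common to all its coefficients. What
  is left does not become trivial modulo y, and this is how the independence proofs below exploit
  it.\<close>

lemma dep_primitive:
  assumes "dep y m g" "y \<noteq> 0"
  obtains c where "\<And>j. j < m \<Longrightarrow> c j \<in> KP" "\<exists>j<m. coeff (c j) 0 \<noteq> 0"
    "(\<Sum>j<m. poly (c j) y * g j) = 0"
proof -
  obtain c where c: "\<forall>j<m. c j \<in> KP" "\<exists>j<m. c j \<noteq> 0" "(\<Sum>j<m. poly (c j) y * g j) = 0"
    using assms(1) unfolding dep_def by blast
  define n where "n = (LEAST n. \<exists>j<m. coeff (c j) n \<noteq> 0)"
  have ex: "\<exists>n. \<exists>j<m. coeff (c j) n \<noteq> 0" using c(2) by (metis poly_eqI coeff_0)
  have n: "\<exists>j<m. coeff (c j) n \<noteq> 0" unfolding n_def by (rule LeastI_ex[OF ex])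
  have low: "coeff (c j) i = 0" if "i < n" "j < m" for i j
    using not_less_Least[of i "\<lambda>n. \<exists>j<m. coeff (c j) n \<noteq> 0"] that unfolding n_def by blast
  have eq: "c j = monom 1 n * poly_shift n (c j)" if "j < m" for j
    by (rule poly_eqI) (use low that in \<open>auto simp: coeff_monom_mult coeff_poly_shift\<close>)
  have "(\<Sum>j<m. poly (c j) y * g j) = (\<Sum>j<m. y ^ n * (poly (poly_shift n (c j)) y * g j))"
    by (intro sum.cong refl, subst eq) (auto simp: poly_monom algebra_simps)
  then have "y ^ n * (\<Sum>j<m. poly (poly_shift n (c j)) y * g j) = 0"
    using c(3) by (simp add: sum_distrib_left)
  then have "(\<Sum>j<m. poly (poly_shift n (c j)) y * g j) = 0" using assms(2) by simp
  moreover have "\<exists>j<m. coeff (poly_shift n (c j)) 0 \<noteq> 0" using n by (simp add: coeff_poly_shift)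
  ultimately show ?thesis using c(1) by (intro that[of "\<lambda>j. poly_shift n (c j)"]) (auto intro: KP_shift)
qed

text \<open>Multiplying a relation by y^(-d), with d at least all degrees, turns the coefficients
  into polynomials in 1/y. So the ranks over K(y) and K(1/y) agree.\<close>

lemma dep_inverse:
  assumes "dep y m g" "y \<noteq> 0"
  shows "dep (inverse y) m g"
proof -
  obtain c where c: "\<forall>j<m. c j \<in> KP" "\<exists>j<m. c j \<noteq> 0" "(\<Sum>j<m. poly (c j) y * g j) = 0"
    using assms(1) unfolding dep_def by blast
  define d where "d = (\<Sum>j<m. degree (c j))"
  have le: "degree (c j) \<le> d" if "j < m" for j
    unfolding d_def by (rule member_le_sum) (use that in auto)
  define c' where "c' j = monom 1 (d - degree (c j)) * reflect_poly (c j)" for j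
  have ev: "poly (c' j) (inverse y) = inverse y ^ d * poly (c j) y" if "j < m" for j
  proof -
    have "poly (reflect_poly (c j)) (inverse y) = inverse y ^ degree (c j) * poly (c j) y"
      using assms(2) by (simp add: poly_reflect_poly_nz)
    then have "poly (c' j) (inverse y) = inverse y ^ (d - degree (c j) + degree (c j)) * poly (c j) y"
      by (simp only: c'_def poly_mult poly_monom power_add) simp
    then show ?thesis using le[OF that] by simp
  qed
  have "(\<Sum>j<m. poly (c' j) (inverse y) * g j) = inverse y ^ d * (\<Sum>j<m. poly (c j) y * g j)"
    by (simp add: sum_distrib_left ev mult.assoc)
  also have "\<dots> = 0" using c(3) by simp
  finally show ?thesis unfolding dep_def
    by (intro exI[of _ c']) (use c in \<open>auto simp: c'_def intro!: KP_mult KP_reflect KP_monom\<close>)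
qed

end

text \<open>The transcendence degree and finite generation of a function field enter only through
  \<open>span_t\<close>; \<open>alg_K\<close> says that \<open>K\<close> is the exact field of constants.\<close>

locale function_field = const_field K for K :: "'f::field set" +
  assumes alg_K: "\<And>x p. p \<in> KP \<Longrightarrow> p \<noteq> 0 \<Longrightarrow> poly p x = 0 \<Longrightarrow> x \<in> K"
    and span_t: "\<exists>t n bs. t \<notin> K \<and> (\<forall>f. \<exists>p\<in>KP. p \<noteq> 0 \<and>
      (\<exists>c. (\<forall>i<n. c i \<in> KP) \<and> poly p t * f = (\<Sum>i<(n::nat). poly (c i) t * bs i)))"
begin

lemma poly_nonzero: "x \<notin> K \<Longrightarrow> p \<in> KP \<Longrightarrow> p \<noteq> 0 \<Longrightarrow> poly p x \<noteq> 0"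
  using alg_K by blast

text \<open>Pigeonhole: over a finite field, multiplying by \<open>n\<close> powers of \<open>y\<close> enlarges the coefficients
  in \<open>K[t]\<close> only linearly in \<open>n\<close>.\<close>

lemma dep_bounded: "\<exists>N. \<forall>m>N. \<forall>g. dep y m g"
proof -
  obtain t n0 bs where tK: "t \<notin> K" and sp: "\<And>f. \<exists>p\<in>KP. p \<noteq> 0 \<and>
      (\<exists>c. (\<forall>i<n0. c i \<in> KP) \<and> poly p t * f = (\<Sum>i<(n0::nat). poly (c i) t * bs i))"
    using span_t by blast
  \<comment> \<open>\<open>W d\<close> plays the part of a space of functions with bounded poles. It
    is finite, with a size exponential in d.\<close>
  define W where "W d = {f. \<exists>c. (\<forall>i<n0. c i \<in> KP \<and> degree (c i) \<le> d) \<and> f = (\<Sum>i<n0. poly (c i) t * bs i)}" for d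
  have W_add: "f + g \<in> W d" if "f \<in> W d" "g \<in> W d" for f g d
  proof -
    from that obtain c c' where c: "\<forall>i<n0. c i \<in> KP \<and> degree (c i) \<le> d" "f = (\<Sum>i<n0. poly (c i) t * bs i)"
     "\<forall>i<n0. c' i \<in> KP \<and> degree (c' i) \<le> d" "g = (\<Sum>i<n0. poly (c' i) t * bs i)" unfolding W_def by auto
    show ?thesis unfolding W_def mem_Collect_eq
      by (rule exI[of _ "\<lambda>i. c i + c' i"])
        (use c in \<open>auto simp: sum.distrib ring_distribs intro!: KP_add degree_add_le\<close>)
  qed
  have W_0: "0 \<in> W d" for d unfolding W_def mem_Collect_eq by (rule exI[of _ "\<lambda>_. 0"]) auto
  have W_mult: "poly p t * f \<in> W (e + d)" if "f \<in> W d" "p \<in> KP" "degree p \<le> e" for f p d e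
  proof -
    from that obtain c where c: "\<forall>i<n0. c i \<in> KP \<and> degree (c i) \<le> d" "f = (\<Sum>i<n0. poly (c i) t * bs i)"
      unfolding W_def by auto
    show ?thesis unfolding W_def mem_Collect_eq
      by (rule exI[of _ "\<lambda>i. p * c i"])
       (use c that(2,3) in \<open>auto simp: sum_distrib_left mult.assoc intro!: KP_mult order_trans[OF degree_mult_le] add_mono\<close>)
  qed
  have W_sum: "sum h I \<in> W d" if "\<And>i. i \<in> I \<Longrightarrow> h i \<in> W d" for h :: "nat \<Rightarrow> 'f" and I d
    using that by (induction I rule: infinite_finite_induct) (auto intro: W_add W_0)
  have W_mono: "f \<in> W e" if "f \<in> W d" "d \<le> e" for f d e
  proof -
    from that(1) obtain c where c: "\<forall>i<n0. c i \<in> KP \<and> degree (c i) \<le> d" "f = (\<Sum>i<n0. poly (c i) t * bs i)"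
      unfolding W_def by auto
    show ?thesis unfolding W_def mem_Collect_eq
      by (rule exI[of _ c]) (use c that(2) order_trans in blast)
  qed
  have W_card: "finite (W d) \<and> card (W d) \<le> card K ^ (n0 * Suc d)" for d
  proof -
    let ?P = "({..<n0} \<times> {..d}) \<rightarrow>\<^sub>E K"
    have fin: "finite ?P" by (intro finite_PiE finite_K) auto
    have "W d \<subseteq> (\<lambda>\<phi>. \<Sum>i<n0. (\<Sum>j\<le>d. \<phi> (i,j) * t ^ j) * bs i) ` ?P"
    proof
      fix f assume "f \<in> W d"
      then obtain c where c: "\<forall>i<n0. c i \<in> KP \<and> degree (c i) \<le> d" "f = (\<Sum>i<n0. poly (c i) t * bs i)"
        unfolding W_def by auto
      let ?\<phi> = "restrict (\<lambda>(i,j). coeff (c i) j) ({..<n0} \<times> {..d})"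
      have "f = (\<Sum>i<n0. (\<Sum>j\<le>d. ?\<phi> (i,j) * t ^ j) * bs i)"
      proof -
        have "poly (c i) t = (\<Sum>j\<le>d. ?\<phi> (i,j) * t ^ j)" if "i < n0" for i
        proof -
          have "poly (c i) t = (\<Sum>j\<le>degree (c i). coeff (c i) j * t ^ j)" by (rule poly_altdef)
          also have "\<dots> = (\<Sum>j\<le>d. coeff (c i) j * t ^ j)"
            by (rule sum.mono_neutral_left) (use c(1) that in \<open>auto simp: coeff_eq_0\<close>)
          also have "\<dots> = (\<Sum>j\<le>d. ?\<phi> (i,j) * t ^ j)"
            by (rule sum.cong) (use that in auto)
          finally show ?thesis .
        qed
        then show ?thesis unfolding c(2) by (intro sum.cong refl arg_cong2[where f="(*)"]) auto
      qed
      moreover have "?\<phi> \<in> ?P" using c(1) by (auto intro: KP_D)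
      ultimately show "f \<in> (\<lambda>\<phi>. \<Sum>i<n0. (\<Sum>j\<le>d. \<phi> (i,j) * t ^ j) * bs i) ` ?P" by blast
    qed
    then have "finite (W d)" "card (W d) \<le> card ?P"
      using surj_card_le[OF fin] finite_surj[OF fin] by auto
    moreover have "card ?P = card K ^ (n0 * Suc d)" by (subst card_PiE) (auto simp: card_cartesian_product)
    ultimately show ?thesis by simp
  qed
  \<comment> \<open>A single nonzero polynomial in t moves any given finite family into one
    \<open>W d\<close>.\<close>
  have common: "\<exists>Q\<in>KP. Q \<noteq> 0 \<and> (\<exists>d. \<forall>i<m. poly Q t * h i \<in> W d)" for m :: nat and h
  proof (induction m)
    case 0
    show ?case by (rule bexI[of _ 1]) auto
  next
    case (Suc m)
    then obtain Q d where Q: "Q \<in> KP" "Q \<noteq> 0" "\<forall>i<m. poly Q t * h i \<in> W d" by auto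
    obtain p c where p: "p \<in> KP" "p \<noteq> 0" "\<forall>i<n0. c i \<in> KP" "poly p t * h m = (\<Sum>i<n0. poly (c i) t * bs i)"
      using sp[of "h m"] by blast
    have "poly p t * h m \<in> W (\<Sum>i<n0. degree (c i))"
      unfolding W_def mem_Collect_eq p(4) by (rule exI[of _ c]) (use p(3) in \<open>auto intro!: member_le_sum\<close>)
    then have 1: "poly (Q * p) t * h m \<in> W (degree Q + (\<Sum>i<n0. degree (c i)))"
      using W_mult[OF _ Q(1) order_refl] by (simp add: mult.assoc)
    have 2: "poly (Q * p) t * h i \<in> W (degree p + d)" if "i < m" for i
      using W_mult[OF Q(3)[rule_format, OF that] p(1) order_refl] by (simp add: algebra_simps)
    have "\<forall>i<Suc m. poly (Q * p) t * h i \<in> W (degree Q + (\<Sum>i<n0. degree (c i)) + (degree p + d))"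
      using W_mono[OF 1] W_mono[OF 2] by (auto simp: less_Suc_eq)
    then show ?case using Q p by (intro bexI[of _ "Q * p"]) (auto intro: KP_mult)
  qed
  obtain Q e where Q: "Q \<in> KP" "Q \<noteq> 0" "\<forall>i<n0. poly Q t * (y * bs i) \<in> W e"
    using common[of n0 "\<lambda>i. y * bs i"] by blast
  \<comment> \<open>Q is a common denominator for the products of y with the generators.
    Multiplication by Q y, and likewise by Q, then raises the degree bound by at most c, so that Q^n
    y^i with i \<le> n costs c n.\<close>
  define c where "c = e + degree Q"
  have stepy: "poly Q t * y * f \<in> W (c + d)" if "f \<in> W d" for f d
  proof -
    from that obtain a where a: "\<forall>i<n0. a i \<in> KP \<and> degree (a i) \<le> d" "f = (\<Sum>i<n0. poly (a i) t * bs i)"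
      unfolding W_def by auto
    have "poly Q t * y * f = (\<Sum>i<n0. poly (a i) t * (poly Q t * (y * bs i)))"
      unfolding a(2) sum_distrib_left by (intro sum.cong) (auto simp: algebra_simps)
    also have "\<dots> \<in> W (d + e)" using a(1) Q(3) by (intro W_sum W_mult) auto
    finally show ?thesis by (rule W_mono) (simp add: c_def)
  qed
  have step1: "poly Q t * f \<in> W (c + d)" if "f \<in> W d" for f d
    using W_mult[OF that Q(1), of "degree Q"] by (auto simp: c_def intro: W_mono)
  have stepn: "poly Q t ^ n * y ^ i * f \<in> W (c * n + d)" if "f \<in> W d" "i \<le> n" for f d i n
    using that
  proof (induction n arbitrary: i d f)
    case 0 then show ?case by simp
  next
    case (Suc n)
    show ?case
    proof (cases i)
      case 0
      have "poly Q t * (poly Q t ^ n * y ^ 0 * f) \<in> W (c + (c * n + d))"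
        by (intro step1 Suc.IH Suc.prems) simp
      then show ?thesis using 0 by (simp add: algebra_simps)
    next
      case (Suc j)
      have "poly Q t * y * (poly Q t ^ n * y ^ j * f) \<in> W (c + (c * n + d))"
        using Suc Suc.prems by (intro stepy Suc.IH) simp_all
      then show ?thesis using Suc by (simp add: algebra_simps)
    qed
  qed
  have Qt: "poly Q t \<noteq> 0" using poly_nonzero[OF tK] Q by blast
  have K2: "card K \<ge> 2"
  proof -
    have "card {0, 1::'f} \<le> card K" by (rule card_mono) (auto simp: finite_K)
    then show ?thesis by simp
  qed
  show ?thesis
  proof (rule exI[of _ "n0 * c"], intro allI impI)
    fix m :: nat and g :: "nat \<Rightarrow> 'f"
    assume m: "n0 * c < m"
    obtain Q' c' where Q': "Q' \<in> KP" "Q' \<noteq> 0" "\<forall>i<m. poly Q' t * g i \<in> W c'"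
      using common[of m g] by blast
    have Q't: "poly Q' t \<noteq> 0" using poly_nonzero[OF tK] Q' by blast
    \<comment> \<open>For this n the target has at most |K|^(n0 (c n + c' + 1)) = |K|^((n0 c + 1) n)
      elements, while there are |K|^(m (n + 1)) families of coefficients. As m \<ge> n0 c + 1, two
      families have the same value.\<close>
    define n where "n = n0 * Suc c'"
    let ?I = "{..<m} \<times> {..n}"
    let ?P = "?I \<rightarrow>\<^sub>E K"
    define val where "val \<phi> = poly Q t ^ n * poly Q' t * (\<Sum>j<m. (\<Sum>i\<le>n. \<phi> (j,i) * y ^ i) * g j)" for \<phi>
    have "val ` ?P \<subseteq> W (c * n + c')"
    proof safe
      fix \<phi> assume \<phi>: "\<phi> \<in> ?P"
      have "val \<phi> = (\<Sum>j<m. \<Sum>i\<le>n. \<phi> (j,i) * (poly Q t ^ n * y ^ i * (poly Q' t * g j)))"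
        by (simp add: val_def sum_distrib_left sum_distrib_right algebra_simps)
      also have "\<dots> \<in> W (c * n + c')"
      proof (intro W_sum)
        fix j i assume ji: "j \<in> {..<m}" "i \<in> {..n}"
        then have "\<phi> (j,i) \<in> K" using \<phi> by (auto simp: PiE_iff)
        then have "[:\<phi> (j,i):] \<in> KP" by (auto simp: KP_def coeff_pCons split: nat.splits)
        then have "poly [:\<phi> (j,i):] t * (poly Q t ^ n * y ^ i * (poly Q' t * g j)) \<in> W (0 + (c * n + c'))"
          using ji Q'(3) by (intro W_mult stepn) auto
        then show "\<phi> (j,i) * (poly Q t ^ n * y ^ i * (poly Q' t * g j)) \<in> W (c * n + c')" by simp
      qed
      finally show "val \<phi> \<in> W (c * n + c')" .
    qed
    then have "card (val ` ?P) \<le> card K ^ (n0 * Suc (c * n + c'))"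
      using W_card[of "c * n + c'"] card_mono le_trans by meson
    also have "\<dots> < card K ^ (m * Suc n)"
    proof (rule power_strict_increasing)
      have "n0 * Suc (c * n + c') = n0 * c * n + n" by (simp add: n_def algebra_simps)
      also have "\<dots> = (n0 * c + 1) * n" by simp
      also have "\<dots> < (n0 * c + 1) * Suc n" by simp
      also have "\<dots> \<le> m * Suc n" using m by (intro mult_right_mono) auto
      finally show "n0 * Suc (c * n + c') < m * Suc n" .
    qed (use K2 in auto)
    also have "\<dots> = card ?P" by (subst card_PiE) (auto simp: card_cartesian_product)
    finally have "\<not> inj_on val ?P" by (intro pigeonhole) auto
    then obtain \<phi> \<psi> where \<phi>\<psi>: "\<phi> \<in> ?P" "\<psi> \<in> ?P" "\<phi> \<noteq> \<psi>" "val \<phi> = val \<psi>"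
      unfolding inj_on_def by blast
    from \<phi>\<psi>(1-3) obtain j0 i0 where ji0: "j0 < m" "i0 \<le> n" "\<phi> (j0,i0) \<noteq> \<psi> (j0,i0)"
    proof -
      have "\<exists>z\<in>?I. \<phi> z \<noteq> \<psi> z"
        using PiE_ext[OF \<phi>\<psi>(1,2)] \<phi>\<psi>(3) by blast
      then show ?thesis using that by auto
    qed
    define p where "p j = (\<Sum>i\<le>n. monom (\<phi> (j,i) - \<psi> (j,i)) i)" for j
    have cp: "coeff (p j) i = \<phi> (j,i) - \<psi> (j,i)" if "i \<le> n" for i j
      using that by (simp add: p_def coeff_sum)
    have "p j \<in> KP" if "j < m" for j
      unfolding p_def using \<phi>\<psi>(1,2) that by (intro KP_sum KP_monom diff_K) (auto simp: PiE_iff)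
    moreover have "p j0 \<noteq> 0" using cp[OF ji0(2), of j0] ji0(3) by auto
    moreover have "(\<Sum>j<m. poly (p j) y * g j) = 0"
    proof -
      have "(\<Sum>j<m. poly (p j) y * g j) = (\<Sum>j<m. (\<Sum>i\<le>n. \<phi> (j,i) * y ^ i) * g j) - (\<Sum>j<m. (\<Sum>i\<le>n. \<psi> (j,i) * y ^ i) * g j)"
        by (simp add: p_def poly_sum poly_monom ring_distribs sum_subtractf)
      then show ?thesis using \<phi>\<psi>(4) Qt Q't by (simp add: val_def)
    qed
    ultimately show "dep y m g" unfolding dep_def using ji0(1) by blast
  qed
qed

text \<open>For nonconstant y this is a basis of F over K(y); a family of maximal length exists by
  \<open>dep_bounded\<close>.\<close>

lemma dep_rank:
  obtains N g where "\<not> dep y N g" "\<And>m g. m > N \<Longrightarrow> dep y m g"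
proof -
  define S where "S = {m. \<exists>g. \<not> dep y m g}"
  obtain N where N: "\<forall>m>N. \<forall>g. dep y m g" using dep_bounded by blast
  have "S \<subseteq> {..N}"
  proof
    fix m assume "m \<in> S"
    then have "\<not> m > N" using N unfolding S_def by blast
    then show "m \<in> {..N}" by simp
  qed
  then have fin: "finite S" by (rule finite_subset) simp
  have "0 \<in> S" by (auto simp: S_def dep_def)
  then have "Max S \<in> S" using fin by (intro Max_in) auto
  then obtain g where g: "\<not> dep y (Max S) g" by (auto simp: S_def)
  have "dep y m h" if "m > Max S" for m h
  proof -
    have "m \<notin> S" using Max_ge[OF fin, of m] that by auto
    then show ?thesis by (simp add: S_def)
  qed
  with g show ?thesis by (rule that)
qed

text \<open>The relation that arises when f is appended to a maximal independent family must involve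
  f.\<close>

lemma dep_span:
  assumes "\<not> dep y N g" "\<And>m g. m > N \<Longrightarrow> dep y m g"
  obtains p c where "p \<in> KP" "p \<noteq> 0" "\<And>i. i < N \<Longrightarrow> c i \<in> KP"
    "poly p y * f = (\<Sum>i<N. poly (c i) y * g i)"
proof -
  have "dep y (Suc N) (g(N := f))" using assms(2) by blast
  then obtain c where c: "\<forall>j<Suc N. c j \<in> KP" "\<exists>j<Suc N. c j \<noteq> 0"
     "(\<Sum>j<Suc N. poly (c j) y * (g(N := f)) j) = 0" unfolding dep_def by blast
  have eq: "(\<Sum>j<N. poly (c j) y * g j) + poly (c N) y * f = 0"
    using c(3) by simp
  have "c N \<noteq> 0"
  proof
    assume 0: "c N = 0"
    have "dep y N g" unfolding dep_def by (rule exI[of _ c]) (use c eq 0 in \<open>auto simp: less_Suc_eq\<close>)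
    then show False using assms(1) by simp
  qed
  moreover have "poly (c N) y * f = (\<Sum>j<N. poly (- c j) y * g j)"
    using eq by (simp add: sum_negf eq_neg_iff_add_eq_0 add.commute)
  ultimately show ?thesis using c(1) by (intro that[of "c N" "\<lambda>j. - c j"]) (auto intro: KP_uminus)
qed

end

section \<open>Calculus of normalised valuations\<close>

lemma place_0: "place w \<Longrightarrow> w 0 = 0"
  by (simp add: place_def)

lemma place_mult: "place w \<Longrightarrow> x \<noteq> 0 \<Longrightarrow> y \<noteq> 0 \<Longrightarrow> w (x * y) = w x + w y"
  by (simp add: place_def)

lemma place_add: "place w \<Longrightarrow> x \<noteq> 0 \<Longrightarrow> y \<noteq> 0 \<Longrightarrow> x + y \<noteq> 0 \<Longrightarrow> min (w x) (w y) \<le> w (x + y)"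
  by (simp add: place_def)

lemma place_1: "place w \<Longrightarrow> w 1 = 0"
  using place_mult[of w 1 1] by simp

lemma place_inverse: "place w \<Longrightarrow> w (inverse x) = - w x"
  using place_mult[of w x "inverse x"] place_1[of w] by (cases "x = 0") (simp_all add: place_0)

lemma place_power: "place w \<Longrightarrow> x \<noteq> 0 \<Longrightarrow> w (x ^ n) = int n * w x"
  by (induction n) (simp_all add: place_1 place_mult algebra_simps)

lemma place_uminus:
  assumes "place w" shows "w (- x) = w x"
proof (cases "x = 0")
  case False
  have "w (- 1) + w (- 1) = 0" using place_mult[OF assms, of "- 1" "- 1"] place_1[OF assms] by simp
  then have "w (- 1) = 0" by simp
  then show ?thesis using place_mult[OF assms, of "- 1" x] False by simp
qed simp

text \<open>The dummy value at \<open>0\<close> is treated as \<open>\<infinity>\<close>.\<close>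

definition vge :: "('f::field \<Rightarrow> int) \<Rightarrow> int \<Rightarrow> 'f \<Rightarrow> bool" where
  "vge w n x \<longleftrightarrow> x = 0 \<or> n \<le> w x"

lemma vge_0 [simp]: "vge w n 0" by (simp add: vge_def)

lemma vge_mono: "vge w n x \<Longrightarrow> m \<le> n \<Longrightarrow> vge w m x" by (auto simp: vge_def)

lemma vge_add: "place w \<Longrightarrow> vge w n x \<Longrightarrow> vge w n y \<Longrightarrow> vge w n (x + y)"
  using place_add[of w x y] by (cases "x = 0"; cases "y = 0"; cases "x + y = 0") (auto simp: vge_def)

lemma vge_uminus: "place w \<Longrightarrow> vge w n x \<Longrightarrow> vge w n (- x)"
  by (simp add: vge_def place_uminus)

lemma vge_diff: "place w \<Longrightarrow> vge w n x \<Longrightarrow> vge w n y \<Longrightarrow> vge w n (x - y)"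
  using vge_add[of w n x "- y"] vge_uminus[of w n y] by simp

lemma vge_mult: "place w \<Longrightarrow> vge w n x \<Longrightarrow> vge w m y \<Longrightarrow> vge w (n + m) (x * y)"
  using place_mult[of w x y] by (cases "x = 0"; cases "y = 0") (auto simp: vge_def)

lemma vge_sum: "place w \<Longrightarrow> (\<And>i. i \<in> I \<Longrightarrow> vge w n (f i)) \<Longrightarrow> vge w n (sum f I)"
  by (induction I rule: infinite_finite_induct) (auto intro: vge_add)

lemma vge_1: "place w \<Longrightarrow> vge w 0 1"
  by (simp add: vge_def place_1)

lemma vge_power: "place w \<Longrightarrow> vge w 0 x \<Longrightarrow> vge w 0 (x ^ n)"
  by (induction n) (use vge_mult[of w 0 x 0] in \<open>auto intro: vge_1\<close>)

lemma vge_0_iff: "place w \<Longrightarrow> vge w 0 x \<longleftrightarrow> 0 \<le> w x"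
  by (auto simp: vge_def place_0)

text \<open>Values are integers, so "strictly larger than w x" becomes \<open>w x + 1\<close>, and
  \<open>vge\<close> includes the case z = 0. The term of smaller value decides the sum.\<close>

lemma place_add_strict:
  assumes "place w" "x \<noteq> 0" "vge w (w x + 1) z"
  shows "x + z \<noteq> 0" "w (x + z) = w x"
proof -
  show nz: "x + z \<noteq> 0"
  proof
    assume "x + z = 0"
    then have "z = - x" by (simp add: eq_neg_iff_add_eq_0 add.commute)
    then show False using assms by (simp add: vge_def place_uminus)
  qed
  have "vge w (w x) (x + z)"
    by (rule vge_add[OF assms(1)]) (use assms(3) in \<open>auto simp: vge_def\<close>)
  moreover have "w x \<ge> w (x + z)"
  proof (rule ccontr)
    assume "\<not> w x \<ge> w (x + z)"
    then have "vge w (w x + 1) (x + z - z)" using assms by (intro vge_diff) (auto simp: vge_def)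
    then show False using assms(2) by (simp add: vge_def)
  qed
  ultimately show "w (x + z) = w x" using nz by (simp add: vge_def)
qed

section \<open>Subrings of F and the extension of places\<close>

definition ring_set :: "'f::field set \<Rightarrow> bool" where
  "ring_set R \<longleftrightarrow> 1 \<in> R \<and> (\<forall>x\<in>R. \<forall>y\<in>R. x + y \<in> R \<and> x * y \<in> R \<and> - x \<in> R)"

lemma ring_set_0: "ring_set R \<Longrightarrow> 0 \<in> R"
  unfolding ring_set_def by (metis add.right_inverse)

lemma ring_set_diff: "ring_set R \<Longrightarrow> x \<in> R \<Longrightarrow> y \<in> R \<Longrightarrow> x - y \<in> R"
  unfolding ring_set_def by (metis diff_conv_add_uminus)

lemma ring_set_add: "ring_set R \<Longrightarrow> x \<in> R \<Longrightarrow> y \<in> R \<Longrightarrow> x + y \<in> R"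
  and ring_set_mult: "ring_set R \<Longrightarrow> x \<in> R \<Longrightarrow> y \<in> R \<Longrightarrow> x * y \<in> R"
  and ring_set_uminus: "ring_set R \<Longrightarrow> x \<in> R \<Longrightarrow> - x \<in> R"
  and ring_set_1: "ring_set R \<Longrightarrow> 1 \<in> R"
  by (auto simp: ring_set_def)

lemma ring_set_sum: "ring_set R \<Longrightarrow> (\<And>i. i \<in> I \<Longrightarrow> f i \<in> R) \<Longrightarrow> sum f I \<in> R"
  by (induction I rule: infinite_finite_induct) (auto intro: ring_set_0 ring_set_add)

lemma ring_set_power: "ring_set R \<Longrightarrow> x \<in> R \<Longrightarrow> x ^ n \<in> R"
  by (induction n) (auto intro: ring_set_1 ring_set_mult)

lemma ring_set_poly: "ring_set R \<Longrightarrow> (\<And>i. coeff p i \<in> R) \<Longrightarrow> x \<in> R \<Longrightarrow> poly p x \<in> R"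
  unfolding poly_altdef by (intro ring_set_sum ring_set_mult ring_set_power)

lemma ring_set_adjoin:
  assumes R: "ring_set R"
  shows "ring_set {poly p z |p. \<forall>i. coeff p i \<in> R}"
  unfolding ring_set_def
proof (intro conjI ballI)
  show "1 \<in> {poly p z |p. \<forall>i. coeff p i \<in> R}"
    by (rule CollectI, rule exI[of _ 1]) (auto simp: ring_set_0[OF R] ring_set_1[OF R])
next
  fix a b assume "a \<in> {poly p z |p. \<forall>i. coeff p i \<in> R}" "b \<in> {poly p z |p. \<forall>i. coeff p i \<in> R}"
  then obtain p q where pq: "a = poly p z" "b = poly q z" "\<forall>i. coeff p i \<in> R" "\<forall>i. coeff q i \<in> R" by blast
  show "a + b \<in> {poly p z |p. \<forall>i. coeff p i \<in> R}"
    by (rule CollectI, rule exI[of _ "p + q"]) (auto simp: pq ring_set_add[OF R])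
  show "a * b \<in> {poly p z |p. \<forall>i. coeff p i \<in> R}"
    by (rule CollectI, rule exI[of _ "p * q"])
      (auto simp: pq coeff_mult intro!: ring_set_sum[OF R] ring_set_mult[OF R])
  show "- a \<in> {poly p z |p. \<forall>i. coeff p i \<in> R}"
    by (rule CollectI, rule exI[of _ "- p"]) (auto simp: pq ring_set_uminus[OF R])
qed

text \<open>Chevalley's argument. R is maximal, by Zorn, among the rings containing
  \<open>R0\<close> but not 1/y. Inverting 1 + y R never produces 1/y, so these elements are units
  of R. If neither z nor 1/z were in R, both R[z] and R[1/z] would contain 1/y, and the two
  resulting relations can be played off against each other until one has degree 0.\<close>

lemma maximal_subring:
  assumes R0: "ring_set R0" "y \<in> R0" "inverse y \<notin> R0" and y0: "y \<noteq> 0"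
  obtains R where "ring_set R" "R0 \<subseteq> R" "inverse y \<notin> R"
    "\<And>r. r \<in> R \<Longrightarrow> inverse (1 + y * r) \<in> R"
    "\<And>z. z \<notin> R \<Longrightarrow> inverse z \<in> R"
proof -
  define \<A> where "\<A> = {R. ring_set R \<and> R0 \<subseteq> R \<and> inverse y \<notin> R}"
  have "\<exists>M\<in>\<A>. \<forall>B\<in>\<A>. M \<subseteq> B \<longrightarrow> B = M"
  proof (rule subset_Zorn_nonempty)
    show "\<A> \<noteq> {}" using R0 by (auto simp: \<A>_def)
  next
    fix Ch assume C: "Ch \<noteq> {}" "subset.chain \<A> Ch"
    have sub: "B \<in> \<A>" if "B \<in> Ch" for B using C(2) that by (auto simp: subset.chain_def)
    have two: "\<exists>Z\<in>Ch. a \<in> Z \<and> b \<in> Z" if "a \<in> \<Union>Ch" "b \<in> \<Union>Ch" for a b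
    proof -
      from that obtain B Y where XY: "B \<in> Ch" "a \<in> B" "Y \<in> Ch" "b \<in> Y" by blast
      then have "B \<subseteq> Y \<or> Y \<subseteq> B" using C(2) by (auto simp: subset.chain_def)
      then show ?thesis using XY by blast
    qed
    have "ring_set (\<Union>Ch)" unfolding ring_set_def
    proof (intro conjI ballI)
      show "1 \<in> \<Union>Ch" using C(1) sub by (force simp: \<A>_def ring_set_def)
    next
      fix a b assume "a \<in> \<Union>Ch" "b \<in> \<Union>Ch"
      then obtain Z where Z: "Z \<in> Ch" "a \<in> Z" "b \<in> Z" using two by blast
      then have "ring_set Z" using sub by (auto simp: \<A>_def)
      then show "a + b \<in> \<Union>Ch" "a * b \<in> \<Union>Ch" "- a \<in> \<Union>Ch" using Z by (auto simp: ring_set_def)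
    qed
    then show "\<Union>Ch \<in> \<A>" using C(1) sub by (auto simp: \<A>_def)
  qed
  then obtain R where R\<A>: "R \<in> \<A>" and max: "\<And>B. B \<in> \<A> \<Longrightarrow> R \<subseteq> B \<Longrightarrow> B = R" by blast
  then have R: "ring_set R" and R0R: "R0 \<subseteq> R" and yR: "inverse y \<notin> R" by (auto simp: \<A>_def)
  note rs = ring_set_add[OF R] ring_set_mult[OF R] ring_set_uminus[OF R] ring_set_1[OF R] ring_set_diff[OF R]
    ring_set_0[OF R]
  have y_in: "y \<in> R" using R0 R0R by blast
  have nz: "1 + y * s \<noteq> 0" if "s \<in> R" for s
  proof
    assume "1 + y * s = 0"
    moreover have "y * (- s) = 1 - (1 + y * s)" by (simp add: algebra_simps)
    ultimately have "y * (- s) = 1" by simp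
    then have "inverse y = - s" by (rule inverse_unique)
    then show False using yR that rs by auto
  qed
  have unit: "inverse (1 + y * r) \<in> R" if r: "r \<in> R" for r
  proof -
    \<comment> \<open>The localisation of R at 1 + y R. From 1/y = x / (1 + y s) would follow y (x -
      s) = 1 with x - s in R, so \<open>R'\<close> still omits 1/y and equals R by
      maximality.\<close>
    define R' where "R' = {x * inverse (1 + y * s) |x s. x \<in> R \<and> s \<in> R}"
    have "ring_set R'" unfolding ring_set_def
    proof (intro conjI ballI)
      show "1 \<in> R'" unfolding R'_def by (rule CollectI, rule exI[of _ 1], rule exI[of _ 0]) (simp add: rs)
    next
      fix a b assume "a \<in> R'" "b \<in> R'"
      then obtain x s x' s' where e: "a = x * inverse (1 + y * s)" "b = x' * inverse (1 + y * s')"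
        "x \<in> R" "s \<in> R" "x' \<in> R" "s' \<in> R" unfolding R'_def by blast
      have d: "1 + y * (s + s' + y * s * s') = (1 + y * s) * (1 + y * s')" by (simp add: algebra_simps)
      have frac: "x * inverse A + x' * inverse B = (x * B + x' * A) * inverse (A * B)"
        if "A \<noteq> 0" "B \<noteq> 0" for A B
        using that by (simp add: field_simps)
      have "a + b = (x * (1 + y * s') + x' * (1 + y * s)) * inverse (1 + y * (s + s' + y * s * s'))"
        unfolding d e(1,2) by (rule frac) (use nz e in blast)+
      moreover have "x * (1 + y * s') + x' * (1 + y * s) \<in> R" "s + s' + y * s * s' \<in> R"
        using e by (auto intro!: rs(1,2,4) y_in)
      ultimately show "a + b \<in> R'" unfolding R'_def by blast
      have "a * b = (x * x') * inverse (1 + y * (s + s' + y * s * s'))"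
        unfolding d e(1,2) by simp
      then show "a * b \<in> R'" unfolding R'_def using \<open>s + s' + y * s * s' \<in> R\<close> rs(2)[OF e(3,5)] by blast
      show "- a \<in> R'" unfolding R'_def
        by (rule CollectI, rule exI[of _ "- x"], rule exI[of _ s]) (use e in \<open>auto intro!: rs\<close>)
    qed
    moreover have RR': "R \<subseteq> R'"
    proof
      fix x assume "x \<in> R"
      then show "x \<in> R'" unfolding R'_def by (intro CollectI exI[of _ x] exI[of _ 0]) (simp add: rs)
    qed
    moreover have "inverse y \<notin> R'"
    proof
      assume "inverse y \<in> R'"
      then obtain x s where e: "inverse y = x * inverse (1 + y * s)" "x \<in> R" "s \<in> R" unfolding R'_def by blast
      then have "1 + y * s = y * x" using y0 nz[OF e(3)] by (simp add: field_simps)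
      then have "y * (x - s) = 1" by (simp add: algebra_simps)
      then have "inverse y = x - s" by (rule inverse_unique)
      then show False using yR e rs by auto
    qed
    ultimately have "R' = R" using max R0R by (auto simp: \<A>_def)
    moreover have "inverse (1 + y * r) \<in> R'" unfolding R'_def
      by (rule CollectI, rule exI[of _ 1], rule exI[of _ r]) (simp add: rs r)
    ultimately show ?thesis by simp
  qed
  \<comment> \<open>\<open>P z n\<close> says that 1/y is a combination of 1, z, ..., z^n with
    coefficients in R.\<close>
  define P where "P z n \<longleftrightarrow> (\<exists>p. (\<forall>i. coeff p i \<in> R) \<and> degree p \<le> n \<and> y * poly p z = 1)" for z n
  have P_ex: "\<exists>n. P z n" if "z \<notin> R" for z
  proof -
    let ?R = "{poly p z |p. \<forall>i. coeff p i \<in> R}"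
    have sub: "R \<subseteq> ?R"
    proof
      fix x assume "x \<in> R"
      then show "x \<in> ?R" by (intro CollectI exI[of _ "[:x:]"]) (auto simp: coeff_pCons rs split: nat.splits)
    qed
    have zin: "z \<in> ?R" by (intro CollectI exI[of _ "[:0,1:]"]) (auto simp: coeff_pCons rs split: nat.splits)
    have "?R \<notin> \<A>"
    proof
      assume "?R \<in> \<A>"
      from max[OF this sub] have "?R = R" .
      with zin that show False by simp
    qed
    moreover have "R0 \<subseteq> ?R" using R0R sub by (rule subset_trans)
    ultimately have "inverse y \<in> ?R" using ring_set_adjoin[OF R, of z] unfolding \<A>_def mem_Collect_eq by meson
    then obtain p where p: "\<forall>i. coeff p i \<in> R" "inverse y = poly p z" by blast
    moreover have "y * poly p z = 1" using y0 by (simp flip: p(2))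
    ultimately show ?thesis unfolding P_def by blast
  qed
  have P_0: "\<not> P z 0" for z
  proof
    assume "P z 0"
    then obtain p where p: "\<forall>i. coeff p i \<in> R" "degree p = 0" "y * poly p z = 1" unfolding P_def by auto
    then obtain c where "p = [:c:]" by (auto elim: degree_eq_zeroE)
    with p(3) have "y * coeff p 0 = 1" by simp
    then have "inverse y = coeff p 0" by (rule inverse_unique)
    then show False using p yR by auto
  qed
  \<comment> \<open>In the relation for 1/z the constant coefficient is brought to the left, where 1
    - y q(0) is a unit of R. Multiplied by z^n this expresses z^n through lower powers of z, which
    removes the top term from the relation for z.\<close>
  have P_red: "P z (n - 1)" if "P z n" "P (inverse z) m" "m \<le> n" "z \<noteq> 0" for z n m
  proof -
    from that(1,2) obtain p q where p: "\<forall>i. coeff p i \<in> R" "degree p \<le> n" "y * poly p z = 1"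
      and q: "\<forall>i. coeff q i \<in> R" "degree q \<le> m" "y * poly q (inverse z) = 1"
      unfolding P_def by blast
    have m0: "m \<noteq> 0" "n \<noteq> 0" using P_0 that(1,2) by metis+
    define u where "u = inverse (1 + y * (- coeff q 0))"
    have uR: "u \<in> R" unfolding u_def using q(1) by (intro unit rs(3)) blast
    have u: "u * (1 - y * coeff q 0) = 1" using nz[OF rs(3)[OF q(1)[rule_format, of 0]]] by (simp add: u_def)
    have "poly q (inverse z) = (\<Sum>j\<le>m. coeff q j * inverse z ^ j)"
      unfolding poly_altdef by (rule sum.mono_neutral_left) (use q in \<open>auto simp: coeff_eq_0\<close>)
    also have "\<dots> = coeff q 0 + (\<Sum>j=1..m. coeff q j * inverse z ^ j)"
      by (simp add: sum.atMost_shift sum.atLeast1_atMost_eq lessThan_Suc_atMost atLeast0LessThan)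
    finally have E: "1 - y * coeff q 0 = y * (\<Sum>j=1..m. coeff q j * inverse z ^ j)" using q(3)
      by (simp add: algebra_simps)
    have one_eq: "1 = u * y * (\<Sum>j=1..m. coeff q j * inverse z ^ j)" using u unfolding E by (simp add: mult.assoc)
    define h where "h = (\<Sum>j=1..m. monom (u * y * coeff q j) (n - j))"
    have "z ^ n = u * y * (\<Sum>j=1..m. coeff q j * inverse z ^ j) * z ^ n" using one_eq by simp
    also have "\<dots> = (\<Sum>j=1..m. u * y * coeff q j * z ^ (n - j))"
      unfolding sum_distrib_left sum_distrib_right
    proof (rule sum.cong)
      fix j assume "j \<in> {1..m}"
      then have "z ^ n = z ^ (n - j) * z ^ j" using that(3) by (simp flip: power_add)
      then show "u * y * (coeff q j * inverse z ^ j) * z ^ n = u * y * coeff q j * z ^ (n - j)"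
        using that(4) by (simp add: power_inverse)
    qed simp
    finally have h: "poly h z = z ^ n" by (simp add: h_def poly_sum poly_monom)
    have hR: "coeff h i \<in> R" for i unfolding h_def coeff_sum
      by (intro ring_set_sum[OF R]) (use q uR in \<open>auto intro!: rs y_in\<close>)
    have hdeg: "degree h \<le> n - 1" unfolding h_def
      by (intro degree_sum_le) (auto intro!: order_trans[OF degree_monom_le])
    define p' where "p' = p - monom (coeff p n) n + Polynomial.smult (coeff p n) h"
    have "poly p' z = poly p z" using h by (simp add: p'_def poly_monom)
    moreover have "\<forall>i. coeff p' i \<in> R" using p hR by (auto simp: p'_def intro!: rs)
    moreover have "degree p' \<le> n - 1"
    proof (rule degree_le, intro allI impI)
      fix i assume i: "n - 1 < i"
      then have "coeff h i = 0" using hdeg by (intro coeff_eq_0) simp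
      moreover have "coeff p i = coeff (monom (coeff p n) n) i"
        using i p(2) by (cases "i = n") (auto simp: coeff_eq_0)
      ultimately show "coeff p' i = 0" by (simp add: p'_def)
    qed
    ultimately show ?thesis using p(3) unfolding P_def by metis
  qed
  have no: "\<not> (P z n \<and> P (inverse z) m)" if "z \<noteq> 0" for z n m
    using that
  proof (induction "n + m" arbitrary: z n m rule: less_induct)
    case less
    show ?case
    proof
      assume a: "P z n \<and> P (inverse z) m"
      have 0: "n \<noteq> 0" "m \<noteq> 0" using a P_0 by metis+
      consider "m \<le> n" | "n \<le> m" by linarith
      then show False
      proof cases
        case 1
        then have "P z (n - 1)" using P_red a less.prems by blast
        then show False using less.hyps[of "n - 1" m z] a 0 less.prems by simp
      next
        case 2
        then have "P (inverse z) (m - 1)" using P_red[of "inverse z" m n] a less.prems by simp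
        then show False using less.hyps[of n "m - 1" z] a 0 less.prems by simp
      qed
    qed
  qed
  have val: "inverse z \<in> R" if zR: "z \<notin> R" for z
  proof (rule ccontr)
    assume "inverse z \<notin> R"
    then obtain n m where "P z n" "P (inverse z) m" using P_ex[OF zR] P_ex[of "inverse z"] by blast
    moreover have "z \<noteq> 0" using zR rs(6) by metis
    ultimately show False using no by blast
  qed
  show ?thesis by (rule that[OF R R0R yR unit val])
qed

context const_field
begin

text \<open>A constant has only finitely many different powers, so its value cannot be a nonzero
  integer.\<close>

lemma place_K:
  assumes w: "place w" and c: "c \<in> K" shows "w c = 0"
proof (cases "c = 0")
  case True then show ?thesis using w by (simp add: place_0)
next
  case False
  have "finite ((\<lambda>n. c ^ n) ` (UNIV :: nat set))"
  proof (rule finite_subset[OF _ finite_K])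
    have "c ^ n \<in> K" for n by (induction n) (auto intro: c)
    then show "(\<lambda>n. c ^ n) ` UNIV \<subseteq> K" by blast
  qed
  then have "\<not> inj (\<lambda>n::nat. c ^ n)" using finite_imageD by blast
  then obtain m n :: nat where "c ^ m = c ^ n" "m \<noteq> n" unfolding inj_def by blast
  then have "int m * w c = int n * w c" using place_power[OF w False] by metis
  then show ?thesis using \<open>m \<noteq> n\<close> by simp
qed

lemma vge_K: "place w \<Longrightarrow> c \<in> K \<Longrightarrow> vge w 0 c"
  by (simp add: vge_0_iff place_K)

lemma vge_poly: "place w \<Longrightarrow> p \<in> KP \<Longrightarrow> vge w 0 x \<Longrightarrow> vge w 0 (poly p x)"
  unfolding poly_altdef
proof (intro vge_sum)
  fix i assume w: "place w" and p: "p \<in> KP" and x: "vge w 0 x"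
  show "vge w 0 (coeff p i * x ^ i)"
    using vge_mult[OF w vge_K[OF w KP_D[OF p]] vge_power[OF w x]] by simp
qed

lemma place_poly_unit:
  assumes w: "place w" and p: "p \<in> KP" "coeff p 0 \<noteq> 0" and y: "vge w 1 y"
  shows "poly p y \<noteq> 0" "w (poly p y) = 0"
proof -
  have y0: "vge w 0 y" using vge_mono[OF y] by simp
  have "vge w (1 + 0) (y * poly (poly_shift 1 p) y)"
    by (intro vge_mult vge_poly KP_shift w p y y0)
  moreover have "w (coeff p 0) = 0" by (intro place_K KP_D w p)
  ultimately show "poly p y \<noteq> 0" "w (poly p y) = 0"
    using place_add_strict[OF w p(2), of "y * poly (poly_shift 1 p) y"] by (simp_all add: poly_coeff_0[of p y])
qed

lemma KP_nonzero_shift: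
  assumes "p \<in> KP" "p \<noteq> 0"
  obtains m q where "q \<in> KP" "coeff q 0 \<noteq> 0" "p = monom 1 m * q"
proof -
  define m where "m = (LEAST m. coeff p m \<noteq> 0)"
  have ex: "\<exists>m. coeff p m \<noteq> 0" using assms(2) by (metis poly_eqI coeff_0)
  have m: "coeff p m \<noteq> 0" unfolding m_def by (rule LeastI_ex[OF ex])
  have low: "coeff p i = 0" if "i < m" for i
    using not_less_Least[of i "\<lambda>m. coeff p m \<noteq> 0"] that unfolding m_def by blast
  have "p = monom 1 m * poly_shift m p"
    by (rule poly_eqI) (use low in \<open>auto simp: coeff_monom_mult coeff_poly_shift\<close>)
  then show ?thesis using m assms(1) by (intro that[of "poly_shift m p"]) (auto simp: coeff_poly_shift KP_shift)
qed

end

context function_field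
begin

text \<open>R is a valuation ring; the point is its discreteness. If the maximal ideal M were not
  principal, it would contain arbitrarily long families independent over K[y]. If an element were
  divisible by all powers of a generator \<pi> of M, its own powers would be independent over
  K[\<pi>]. Both contradict \<open>dep_bounded\<close>, and then the exponent of \<pi> is a
  normalised valuation.\<close>

lemma place_of_valuation_ring:
  assumes R: "ring_set R" and KR: "K \<subseteq> R" and yR: "y \<in> R" and yi: "inverse y \<notin> R" and y0: "y \<noteq> 0"
    and unit: "\<And>r. r \<in> R \<Longrightarrow> inverse (1 + y * r) \<in> R"
    and val: "\<And>z. z \<notin> R \<Longrightarrow> inverse z \<in> R"
  shows "\<exists>w. place w \<and> 0 < w y \<and> (\<forall>f\<in>R. 0 \<le> w f)"
proof -
  note radd = ring_set_add[OF R] and rmult = ring_set_mult[OF R] and rone = ring_set_1[OF R]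
    and rzero = ring_set_0[OF R] and ruminus = ring_set_uminus[OF R]
  define U where "U = {x. x \<noteq> 0 \<and> x \<in> R \<and> inverse x \<in> R}"
  define M where "M = {x \<in> R. x = 0 \<or> inverse x \<notin> R}"
  have MR: "x \<in> R" if "x \<in> M" for x using that by (simp add: M_def)
  have U_or_M: "x \<in> U \<or> x \<in> M" if "x \<in> R" for x using that by (auto simp: U_def M_def)
  have not_both: "x \<notin> M" if "x \<in> U" for x using that by (auto simp: U_def M_def)
  have U1: "1 \<in> U" by (simp add: U_def rone)
  have Umult: "x * y \<in> U" if "x \<in> U" "y \<in> U" for x y using that by (auto simp: U_def rmult)
  have Uinv: "inverse x \<in> U" if "x \<in> U" for x using that by (auto simp: U_def)
  have Mmult: "x * r \<in> M" if "x \<in> M" "r \<in> R" for x r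
  proof -
    have "inverse x \<in> R" if "x * r \<noteq> 0" "inverse (x * r) \<in> R"
    proof -
      have "inverse x = inverse (x * r) * r" using that(1) by (simp add: field_simps)
      then show ?thesis using that(2) \<open>r \<in> R\<close> rmult by metis
    qed
    then show ?thesis using that by (auto simp: M_def rmult)
  qed
  have M0: "0 \<in> M" by (simp add: M_def rzero)
  have Madd: "a + b \<in> M" if ab: "a \<in> M" "b \<in> M" for a b
  proof (cases "a = 0 \<or> b = 0")
    case True then show ?thesis using ab by auto
  next
    case False
    have swap: "c + d \<in> M" if "c \<in> M" "c \<noteq> 0" "d * inverse c \<in> R" for c d
    proof -
      have "c + d = c * (1 + d * inverse c)" using that(2) by (simp add: field_simps)
      then show ?thesis using Mmult[OF that(1) radd[OF rone that(3)]] by simp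
    qed
    show ?thesis
    proof (cases "b * inverse a \<in> R")
      case True then show ?thesis using swap ab False by blast
    next
      case F: False
      then have "a * inverse b \<in> R" using val[OF F] by (simp add: mult.commute)
      then show ?thesis using swap[of b a] ab False by (simp add: add.commute)
    qed
  qed
  have Msum: "sum h I \<in> M" if "\<And>i. i \<in> I \<Longrightarrow> h i \<in> M" for h :: "nat \<Rightarrow> 'f" and I
    using that by (induction I rule: infinite_finite_induct) (auto intro: Madd M0)
  have Muminus: "- x \<in> M" if "x \<in> M" for x using Mmult[OF that ruminus[OF rone]] by simp
  have yM: "y \<in> M" using yR yi by (simp add: M_def)
  have KU: "c \<in> U" if "c \<in> K" "c \<noteq> 0" for c using that KR inverse_K by (auto simp: U_def)
  have UM_add: "u + m \<in> U" if "u \<in> U" "m \<in> M" for u m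
  proof (rule ccontr)
    assume "u + m \<notin> U"
    moreover have "u + m \<in> R" using that MR by (auto simp: U_def intro: radd)
    ultimately have "u + m \<in> M" using U_or_M by blast
    from Madd[OF this Muminus[OF that(2)]] have "u + m + - m \<in> M" .
    then show False using not_both[OF that(1)] by simp
  qed
  have KPR: "poly c x \<in> R" if "c \<in> KP" "x \<in> R" for c x
    by (rule ring_set_poly[OF R]) (use that KR KP_D in auto)
  have KPU: "poly c x \<in> U" if "c \<in> KP" "coeff c 0 \<noteq> 0" "x \<in> M" for c x
    unfolding poly_coeff_0[of c x]
    by (intro UM_add Mmult KU KP_D KPR KP_shift MR that)
  have MK: "x \<notin> K" if "x \<in> M" "x \<noteq> 0" for x
    using that KU[of x] not_both[of x] by auto
  \<comment> \<open>Let i be least such that the i-th coefficient has a nonzero constant term, and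
    divide the relation by \<open>g i\<close>. The i-th term becomes a unit; earlier terms lie in M
    through their factor y, later ones through the ratio of the g's.\<close>
  have indep: "\<not> dep y n g"
    if g: "\<And>i. i < n \<Longrightarrow> g i \<in> R \<and> g i \<noteq> 0 \<and> y * inverse (g i) \<in> M"
      and gg: "\<And>i j. i < j \<Longrightarrow> j < n \<Longrightarrow> g j * inverse (g i) \<in> M" for n g
  proof
    assume "dep y n g"
    then obtain c where c: "\<And>j. j < n \<Longrightarrow> c j \<in> KP" "\<exists>j<n. coeff (c j) 0 \<noteq> 0"
      "(\<Sum>j<n. poly (c j) y * g j) = 0" using y0 by (rule dep_primitive) blast
    define i where "i = (LEAST i. i < n \<and> coeff (c i) 0 \<noteq> 0)"
    have i: "i < n \<and> coeff (c i) 0 \<noteq> 0" unfolding i_def by (rule LeastI_ex) (use c(2) in blast)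
    have low: "coeff (c j) 0 = 0" if "j < i" for j
      using not_less_Least[of j "\<lambda>i. i < n \<and> coeff (c i) 0 \<noteq> 0"] that i unfolding i_def by auto
    have "poly (c j) y * (g j * inverse (g i)) \<in> M" if j: "j < n" "j \<noteq> i" for j
    proof (cases "j < i")
      case True
      have "poly (c j) y * (g j * inverse (g i)) = y * inverse (g i) * (poly (poly_shift 1 (c j)) y * g j)"
        using low[OF True] by (simp add: poly_coeff_0[of "c j" y])
      also have "\<dots> \<in> M"
      proof (rule Mmult)
        show "y * inverse (g i) \<in> M" using g i by blast
        show "poly (poly_shift 1 (c j)) y * g j \<in> R" using g[OF j(1)] c(1)[OF j(1)]
          by (intro rmult KPR KP_shift yR) auto
      qed
      finally show ?thesis .
    next
      case False
      then have "g j * inverse (g i) \<in> M" using gg[of i j] j by auto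
      then have "g j * inverse (g i) * poly (c j) y \<in> M" by (rule Mmult[OF _ KPR[OF c(1)[OF j(1)] yR]])
      then show ?thesis by (simp add: mult.commute)
    qed
    then have "(\<Sum>j\<in>{..<n} - {i}. poly (c j) y * (g j * inverse (g i))) \<in> M" by (intro Msum) auto
    then have "poly (c i) y + (\<Sum>j\<in>{..<n} - {i}. poly (c j) y * (g j * inverse (g i))) \<in> U"
      using i by (intro UM_add KPU c(1) yM) auto
    moreover have "poly (c i) y + (\<Sum>j\<in>{..<n} - {i}. poly (c j) y * (g j * inverse (g i)))
      = (\<Sum>j<n. poly (c j) y * g j) * inverse (g i)"
      using i g[of i] by (simp add: sum.remove[of "{..<n}" i] sum_distrib_right distrib_right mult.assoc)
    ultimately show False using c(3) by (simp add: U_def)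
  qed
  have "\<exists>\<pi>\<in>M. \<pi> \<noteq> 0 \<and> (\<forall>x\<in>M. x * inverse \<pi> \<in> R)"
  proof (rule ccontr)
    assume no: "\<not> (\<exists>\<pi>\<in>M. \<pi> \<noteq> 0 \<and> (\<forall>x\<in>M. x * inverse \<pi> \<in> R))"
    \<comment> \<open>p does not generate M, so some x in M is not a multiple of p; in a valuation
      ring p is then a proper multiple of x.\<close>
    have step: "\<exists>x. (x \<in> M \<and> x \<noteq> 0) \<and> p * inverse x \<in> M" if p: "p \<in> M \<and> p \<noteq> 0" for p
    proof -
      from no p obtain x where x: "x \<in> M" "x * inverse p \<notin> R" by blast
      have "x \<noteq> 0" using x(2) rzero by auto
      have eq: "inverse (x * inverse p) = p * inverse x" using p by (simp add: mult.commute)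
      have "p * inverse x \<in> R" using val[OF x(2)] by (simp add: mult.commute)
      moreover have "inverse (p * inverse x) \<notin> R" using x(2) by (simp add: mult.commute)
      ultimately have "p * inverse x \<in> M" by (simp add: M_def)
      then show ?thesis using x(1) \<open>x \<noteq> 0\<close> by blast
    qed
    have "\<exists>h. \<forall>n. ((h n \<in> M \<and> h n \<noteq> 0) \<and> (n = 0 \<longrightarrow> h n = y)) \<and> h n * inverse (h (Suc n)) \<in> M"
    proof (rule dependent_nat_choice)
      show "\<exists>x. (x \<in> M \<and> x \<noteq> 0) \<and> (0 = (0::nat) \<longrightarrow> x = y)" using yM y0 by blast
    next
      fix x and n :: nat assume "(x \<in> M \<and> x \<noteq> 0) \<and> (n = 0 \<longrightarrow> x = y)"
      then show "\<exists>z. ((z \<in> M \<and> z \<noteq> 0) \<and> (Suc n = 0 \<longrightarrow> z = y)) \<and> x * inverse z \<in> M"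
        using step[of x] by auto
    qed
    then obtain h where h0: "h 0 = y" and h: "\<And>n. h n \<in> M \<and> h n \<noteq> 0" "\<And>n. h n * inverse (h (Suc n)) \<in> M"
      by blast
    have chain: "h i * inverse (h (i + Suc d)) \<in> M" for i d
    proof (induction d)
      case 0 then show ?case using h(2) by simp
    next
      case (Suc d)
      have "h i * inverse (h (i + Suc (Suc d))) = h i * inverse (h (i + Suc d)) * (h (i + Suc d) * inverse (h (Suc (i + Suc d))))"
        using h(1) by (simp add: field_simps)
      also have "\<dots> \<in> M" by (rule Mmult[OF Suc MR[OF h(2)]])
      finally show ?case .
    qed
    \<comment> \<open>The chain descends from y to ever smaller values. Read backwards, each entry
      is a proper multiple of the earlier ones and y is a proper multiple of all, as
      \<open>indep\<close> requires.\<close>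
    have "\<not> dep y n (\<lambda>j. h (n - j))" for n
    proof (rule indep)
      fix i assume i: "i < n"
      then have "0 + Suc (n - i - 1) = n - i" by simp
      with chain[of 0 "n - i - 1"] have "h 0 * inverse (h (n - i)) \<in> M" by (simp only:)
      then show "h (n - i) \<in> R \<and> h (n - i) \<noteq> 0 \<and> y * inverse (h (n - i)) \<in> M"
        using h(1)[of "n - i"] MR by (auto simp: h0)
    next
      fix i j assume "i < j" "j < n"
      then have "n - j + Suc (j - i - 1) = n - i" by simp
      with chain[of "n - j" "j - i - 1"] show "h (n - j) * inverse (h (n - i)) \<in> M" by (simp only:)
    qed
    moreover obtain N where "\<forall>m>N. \<forall>g. dep y m g" using dep_bounded by blast
    ultimately show False using lessI[of N] by metis
  qed
  then obtain \<pi> where \<pi>: "\<pi> \<in> M" "\<pi> \<noteq> 0" "\<And>x. x \<in> M \<Longrightarrow> x * inverse \<pi> \<in> R" by blast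
  have \<pi>R: "\<pi> \<in> R" using \<pi>(1) MR by blast
  \<comment> \<open>If f were divisible by every power of \<pi>, the lowest power of f in a relation
    would dominate whatever its coefficient, as that coefficient is merely a power of \<pi> times a
    unit.\<close>
  have sep: "\<exists>n. f * inverse \<pi> ^ n \<notin> R" if f: "f \<noteq> 0" "f \<in> R" for f
  proof (rule ccontr)
    assume "\<not> ?thesis"
    then have all: "f * inverse \<pi> ^ n \<in> R" for n by blast
    have fM: "f * inverse \<pi> ^ n \<in> M" for n
    proof -
      have "f * inverse \<pi> ^ n = \<pi> * (f * inverse \<pi> ^ Suc n)" using \<pi>(2) by (simp add: field_simps)
      then show ?thesis using Mmult[OF \<pi>(1) all[of "Suc n"]] by (simp only:)
    qed
    have "\<not> dep \<pi> n (\<lambda>j. f ^ j)" for n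
    proof
      assume "dep \<pi> n (\<lambda>j. f ^ j)"
      then obtain c where c: "\<forall>j<n. c j \<in> KP" "\<exists>j<n. c j \<noteq> 0" "(\<Sum>j<n. poly (c j) \<pi> * f ^ j) = 0"
        unfolding dep_def by blast
      define i where "i = (LEAST i. i < n \<and> c i \<noteq> 0)"
      have i: "i < n \<and> c i \<noteq> 0" unfolding i_def by (rule LeastI_ex) (use c(2) in blast)
      have low: "c j = 0" if "j < i" for j
        using not_less_Least[of j "\<lambda>i. i < n \<and> c i \<noteq> 0"] that i unfolding i_def by auto
      from c(1) i have "c i \<in> KP" "c i \<noteq> 0" by auto
      then obtain m q where q: "q \<in> KP" "coeff q 0 \<noteq> 0" "c i = monom 1 m * q"
        by (rule KP_nonzero_shift) blast
      have "poly (c j) \<pi> * f ^ j * inverse (\<pi> ^ m * f ^ i) \<in> M" if j: "j < n" "j \<noteq> i" for j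
      proof (cases "j < i")
        case True then show ?thesis using low M0 by simp
      next
        case False
        then obtain d where d: "j = i + Suc d" using j by (metis add_Suc_right linorder_neqE_nat less_imp_Suc_add)
        have "poly (c j) \<pi> * f ^ j * inverse (\<pi> ^ m * f ^ i) = f * inverse \<pi> ^ m * (poly (c j) \<pi> * f ^ d)"
          using f(1) by (simp add: d power_add power_inverse)
        also have "\<dots> \<in> M" using c(1) j
          by (intro Mmult[OF fM] rmult KPR \<pi>R ring_set_power[OF R] f) auto
        finally show ?thesis .
      qed
      then have "(\<Sum>j\<in>{..<n} - {i}. poly (c j) \<pi> * f ^ j * inverse (\<pi> ^ m * f ^ i)) \<in> M" by (intro Msum) auto
      then have "poly q \<pi> + (\<Sum>j\<in>{..<n} - {i}. poly (c j) \<pi> * f ^ j * inverse (\<pi> ^ m * f ^ i)) \<in> U"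
        by (intro UM_add KPU q \<pi>(1))
      moreover have "poly q \<pi> = poly (c i) \<pi> * f ^ i * inverse (\<pi> ^ m * f ^ i)"
        using \<pi>(2) f(1) by (simp add: q(3) poly_monom field_simps)
      moreover have "poly (c i) \<pi> * f ^ i * inverse (\<pi> ^ m * f ^ i) + (\<Sum>j\<in>{..<n} - {i}. poly (c j) \<pi> * f ^ j * inverse (\<pi> ^ m * f ^ i))
        = (\<Sum>j<n. poly (c j) \<pi> * f ^ j) * inverse (\<pi> ^ m * f ^ i)"
        using i by (simp add: sum.remove[of "{..<n}" i] sum_distrib_right distrib_right)
      ultimately show False using c(3) by (simp add: U_def)
    qed
    moreover obtain N where "\<forall>m>N. \<forall>g. dep \<pi> m g" using dep_bounded by blast
    ultimately show False using lessI[of N] by blast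
  qed
  have ex_R: "\<exists>n::nat. f * inverse \<pi> ^ n \<in> U" if f: "f \<noteq> 0" "f \<in> R" for f
  proof -
    \<comment> \<open>The last quotient still in R is not in M, since M is generated by \<pi>; hence
      it is a unit.\<close>
    define n where "n = (LEAST n. f * inverse \<pi> ^ n \<notin> R)"
    have n: "f * inverse \<pi> ^ n \<notin> R" unfolding n_def by (rule LeastI_ex) (rule sep[OF f])
    then obtain m where m: "n = Suc m" using f(2) by (cases n) auto
    have "f * inverse \<pi> ^ m \<in> R"
      using not_less_Least[of m "\<lambda>n. f * inverse \<pi> ^ n \<notin> R"] m unfolding n_def by auto
    moreover have "f * inverse \<pi> ^ m \<notin> M"
    proof
      assume "f * inverse \<pi> ^ m \<in> M"
      from \<pi>(3)[OF this] n m show False by (simp add: mult_ac)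
    qed
    ultimately have "f * inverse \<pi> ^ m \<in> U" using U_or_M[of "f * inverse \<pi> ^ m"] by auto
    then show ?thesis by (rule exI)
  qed
  define rel where "rel f n \<longleftrightarrow> f * \<pi> powi (- n) \<in> U" for f and n :: int
  have ex: "\<exists>n. rel f n" if f: "f \<noteq> 0" for f
  proof (cases "f \<in> R")
    case True
    then obtain n where "f * inverse \<pi> ^ n \<in> U" using ex_R[OF f] by auto
    then have "rel f (int n)" by (simp add: rel_def power_int_minus power_inverse)
    then show ?thesis by blast
  next
    case False
    then have "inverse f \<in> R" "inverse f \<noteq> 0" using val f by auto
    then obtain n where "inverse f * inverse \<pi> ^ n \<in> U" using ex_R[of "inverse f"] by auto
    then have "inverse (inverse f * inverse \<pi> ^ n) \<in> U" by (rule Uinv)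
    then have "rel f (- int n)" by (simp add: rel_def power_inverse)
    then show ?thesis by blast
  qed
  have \<pi>pos: "\<pi> powi n \<in> M" if "0 < n" for n
  proof -
    define m where "m = nat n - 1"
    have "n = int (Suc m)" using that by (simp add: m_def)
    then have "\<pi> powi n = \<pi> * \<pi> ^ m" by (simp only: power_int_of_nat power_Suc)
    then show ?thesis using Mmult[OF \<pi>(1) ring_set_power[OF R \<pi>R]] by simp
  qed
  have \<pi>U: "n = 0" if "\<pi> powi n \<in> U" for n
  proof (rule ccontr)
    assume "n \<noteq> 0"
    moreover have "\<pi> powi (- n) \<in> U" using Uinv[OF that] by (simp add: power_int_minus)
    ultimately show False using \<pi>pos[of n] \<pi>pos[of "- n"] not_both that by (cases "0 < n") auto
  qed
  have uniq: "m = n" if "rel f m" "rel f n" for f m n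
  proof -
    have "f * \<pi> powi (- m) * inverse (f * \<pi> powi (- n)) \<in> U"
      using that unfolding rel_def by (rule Umult[OF _ Uinv])
    moreover have "f \<noteq> 0" using that by (auto simp: rel_def U_def)
    ultimately have "\<pi> powi (n - m) \<in> U" using \<pi>(2)
      by (simp add: power_int_minus power_int_diff field_simps)
    then show ?thesis using \<pi>U by fastforce
  qed
  define w where "w f = (if f = 0 then 0 else THE n. rel f n)" for f
  have w: "rel f (w f)" if "f \<noteq> 0" for f
    unfolding w_def using that theI'[of "rel f"] ex[OF that] uniq by auto
  have weq: "w f = n" if "rel f n" for f n
    using w[of f] uniq[OF _ that] that by (auto simp: rel_def U_def)
  have wR: "0 \<le> w f" if f: "f \<in> R" for f
  proof (cases "f = 0")
    case True then show ?thesis by (simp add: w_def)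
  next
    case False
    then obtain n where "f * inverse \<pi> ^ n \<in> U" using ex_R[OF _ f] by auto
    then have "rel f (int n)" by (simp add: rel_def power_int_minus power_inverse)
    then show ?thesis using weq by simp
  qed
  have Rw: "f \<in> R" if "f \<noteq> 0" "0 \<le> w f" for f
  proof -
    have "f * \<pi> powi (- w f) \<in> R" using w[OF that(1)] by (simp add: rel_def U_def)
    moreover have "\<pi> powi (w f) \<in> R" using that(2) ring_set_power[OF R \<pi>R, of "nat (w f)"]
      by (simp add: power_int_def)
    ultimately have "f * \<pi> powi (- w f) * \<pi> powi (w f) \<in> R" by (rule rmult)
    then show ?thesis using \<pi>(2) by (simp add: power_int_minus mult.assoc)
  qed
  have wmult: "w (f * g) = w f + w g" if "f \<noteq> 0" "g \<noteq> 0" for f g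
  proof (rule weq)
    have "f * \<pi> powi (- w f) * (g * \<pi> powi (- w g)) \<in> U"
      using w[OF that(1)] w[OF that(2)] unfolding rel_def by (rule Umult)
    moreover have "\<pi> powi (- (w f + w g)) = \<pi> powi (- w f) * \<pi> powi (- w g)"
      using power_int_add[of \<pi> "- w f" "- w g"] \<pi>(2) by simp
    ultimately show "rel (f * g) (w f + w g)" by (simp only: rel_def mult_ac)
  qed
  have winv: "w (inverse f) = - w f" if "f \<noteq> 0" for f
  proof -
    have "w 1 = 0" by (rule weq) (simp add: rel_def U1)
    then show ?thesis using wmult[of f "inverse f"] that by simp
  qed
  have wadd1: "w f \<le> w (f + g)" if "f \<noteq> 0" "g \<noteq> 0" "f + g \<noteq> 0" "w f \<le> w g" for f g
  proof -
    have "0 \<le> w (g * inverse f)" using that by (simp add: wmult winv)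
    then have "1 + g * inverse f \<in> R" using that by (intro radd rone Rw) auto
    then have "0 \<le> w (1 + g * inverse f)" by (rule wR)
    moreover have fg: "f + g = f * (1 + g * inverse f)" using that(1) by (simp add: field_simps)
    moreover have "1 + g * inverse f \<noteq> 0" using that(3) fg by auto
    ultimately show ?thesis using wmult[OF that(1), of "1 + g * inverse f"] by simp
  qed
  have "place w" unfolding place_def
  proof (intro conjI allI impI)
    show "w 0 = 0" by (simp add: w_def)
    show "\<exists>x. x \<noteq> 0 \<and> w x = 1"
      by (rule exI[of _ \<pi>]) (use \<pi>(2) U1 in \<open>auto intro!: weq simp: rel_def\<close>)
    fix f g :: 'f assume fg: "f \<noteq> 0" "g \<noteq> 0"
    then show "w (f * g) = w f + w g" by (rule wmult)
    assume "f + g \<noteq> 0"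
    then show "min (w f) (w g) \<le> w (f + g)"
      using wadd1[OF fg] wadd1[of g f] fg by (cases "w f \<le> w g") (auto simp: add.commute)
  qed
  moreover have "0 < w y"
  proof (rule ccontr)
    assume "\<not> 0 < w y"
    then have "0 \<le> w (inverse y)" using winv[OF y0] by simp
    then show False using Rw[of "inverse y"] y0 yi by simp
  qed
  ultimately show ?thesis using wR by blast
qed

theorem place_exists:
  assumes "ring_set R0" "K \<subseteq> R0" "y \<in> R0" "inverse y \<notin> R0" "y \<noteq> 0"
  shows "\<exists>w. place w \<and> 0 < w y \<and> (\<forall>f\<in>R0. 0 \<le> w f)"
proof -
  show ?thesis
  proof (rule maximal_subring[OF assms(1,3,4,5)])
    fix R assume R: "ring_set R" "R0 \<subseteq> R" "inverse y \<notin> R"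
      "\<And>r. r \<in> R \<Longrightarrow> inverse (1 + y * r) \<in> R" "\<And>z. z \<notin> R \<Longrightarrow> inverse z \<in> R"
    have "K \<subseteq> R" "y \<in> R" using R(2) assms by auto
    from place_of_valuation_ring[OF R(1) this R(3) assms(5) R(4,5)]
    obtain w where "place w" "0 < w y" "\<forall>f\<in>R. 0 \<le> w f" by auto
    then show ?thesis using R(2) by (intro exI[of _ w]) auto
  qed
qed

text \<open>Apply the extension theorem to K[1/x]. If this ring contained x, then 1/x would be
  algebraic over K and therefore constant.\<close>

lemma pole_exists:
  assumes "x \<notin> K" shows "\<exists>w. place w \<and> w x < 0"
proof -
  let ?R = "{poly p (inverse x) |p. \<forall>i. coeff p i \<in> K}"
  have x0: "x \<noteq> 0" using assms by auto
  have rK: "ring_set K" unfolding ring_set_def by auto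
  have 1: "K \<subseteq> ?R"
  proof
    fix c assume "c \<in> K"
    then show "c \<in> ?R" by (intro CollectI exI[of _ "[:c:]"]) (auto simp: coeff_pCons split: nat.splits)
  qed
  have 2: "inverse x \<in> ?R" by (intro CollectI exI[of _ "[:0,1:]"]) (auto simp: coeff_pCons split: nat.splits)
  have 3: "inverse (inverse x) \<notin> ?R"
  proof
    assume "inverse (inverse x) \<in> ?R"
    then obtain p where p: "\<forall>i. coeff p i \<in> K" "x = poly p (inverse x)" by auto
    have "inverse x \<notin> K" using inverse_K[of "inverse x"] assms by auto
    moreover have "[:1:] - monom 1 1 * p \<in> KP" using p(1)
      by (intro KP_diff KP_mult KP_monom KP_I) (auto simp: KP_def coeff_pCons split: nat.splits)
    moreover have "coeff ([:1:] - monom 1 1 * p) 0 \<noteq> 0" by (simp add: coeff_monom_mult)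
    moreover have "poly ([:1:] - monom 1 1 * p) (inverse x) = 0"
      using x0 p(2)[symmetric] by (simp add: poly_monom)
    ultimately show False using poly_nonzero by (metis coeff_0)
  qed
  have "inverse x \<noteq> 0" using x0 by simp
  from place_exists[OF ring_set_adjoin[OF rK] 1 2 3 this]
  obtain w where w: "place w" "0 < w (inverse x)" by blast
  then show ?thesis using place_inverse[OF w(1), of x] by (intro exI[of _ w]) auto
qed

end

section \<open>Finiteness of residue rings\<close>

context function_field
begin

text \<open>K-linear independence of the classes of u in R/yR. The ring is a parameter because it
  will be the valuation ring of a place as well as the semilocal ring \<open>R y\<close>.\<close>

definition modindep :: "'f \<Rightarrow> 'f set \<Rightarrow> nat \<Rightarrow> (nat \<Rightarrow> 'f) \<Rightarrow> bool" where
  "modindep y R n u \<longleftrightarrow> (\<forall>i<n. u i \<in> R) \<and>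
     (\<forall>c. (\<forall>i<n. c i \<in> K) \<longrightarrow> (\<Sum>i<n. c i * u i) \<in> (*) y ` R \<longrightarrow> (\<forall>i<n. c i = 0))"

lemma constant_terms_in_multiples:
  assumes R: "ring_set R" "K \<subseteq> R" "y \<in> R" and u: "\<And>i. i < n \<Longrightarrow> u i \<in> R"
    and c: "\<And>i. i < n \<Longrightarrow> c i \<in> KP" and z: "(\<Sum>i<n. poly (c i) y * u i) \<in> (*) y ` R"
  shows "(\<Sum>i<n. coeff (c i) 0 * u i) \<in> (*) y ` R"
proof -
  obtain r where r: "r \<in> R" "(\<Sum>i<n. poly (c i) y * u i) = y * r" using z by blast
  let ?s = "\<Sum>i<n. poly (poly_shift 1 (c i)) y * u i"
  have "?s \<in> R"
  proof (rule ring_set_sum[OF R(1)])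
    fix i assume "i \<in> {..<n}"
    then have i: "i < n" by simp
    have "poly (poly_shift 1 (c i)) y \<in> R"
      by (rule ring_set_poly[OF R(1)]) (use KP_D[OF KP_shift[OF c[OF i]]] R in auto)
    then show "poly (poly_shift 1 (c i)) y * u i \<in> R" using u[OF i] by (rule ring_set_mult[OF R(1)])
  qed
  moreover have "(\<Sum>i<n. coeff (c i) 0 * u i) = y * (r - ?s)"
  proof -
    have "poly (c i) y * u i = coeff (c i) 0 * u i + y * (poly (poly_shift 1 (c i)) y * u i)" for i
      by (subst poly_coeff_0) (simp add: algebra_simps)
    then have "(\<Sum>i<n. poly (c i) y * u i) = (\<Sum>i<n. coeff (c i) 0 * u i) + y * ?s"
      by (simp only: sum.distrib sum_distrib_left)
    then show ?thesis using r(2) by (simp add: algebra_simps)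
  qed
  ultimately show ?thesis using ring_set_diff[OF R(1) r(1)] by blast
qed

text \<open>A primitive relation over K[y] reduces modulo y to a nontrivial relation over K.
  Consequently R/yR has finite dimension over K, at most the rank of F over K(y).\<close>

lemma modindep_not_dep:
  assumes R: "ring_set R" "K \<subseteq> R" "y \<in> R" "y \<noteq> 0" and u: "modindep y R n u"
  shows "\<not> dep y n u"
proof
  assume "dep y n u"
  then obtain c where c: "\<And>j. j < n \<Longrightarrow> c j \<in> KP" "\<exists>j<n. coeff (c j) 0 \<noteq> 0"
    "(\<Sum>j<n. poly (c j) y * u j) = 0" using R(4) by (rule dep_primitive) blast
  have "(\<Sum>j<n. poly (c j) y * u j) \<in> (*) y ` R"
    unfolding c(3) by (rule image_eqI[of _ _ 0]) (simp_all add: ring_set_0[OF R(1)])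
  then have "(\<Sum>i<n. coeff (c i) 0 * u i) \<in> (*) y ` R"
    using u by (intro constant_terms_in_multiples R c(1)) (auto simp: modindep_def)
  moreover have "\<forall>i<n. coeff (c i) 0 \<in> K" using c(1) KP_D by blast
  ultimately have "\<forall>i<n. coeff (c i) 0 = 0"
    using u unfolding modindep_def by (auto dest!: spec[of _ "\<lambda>i. coeff (c i) 0"])
  then show False using c(2) by blast
qed

lemma modindep_basis:
  assumes R: "ring_set R" "K \<subseteq> R" "y \<in> R" "y \<noteq> 0"
  obtains n u where "modindep y R n u"
    "\<forall>f\<in>R. \<exists>c. (\<forall>i<n. c i \<in> K) \<and> f - (\<Sum>i<n. c i * u i) \<in> (*) y ` R"
proof -
  define S where "S = {n. \<exists>u. modindep y R n u}"
  obtain N where N: "\<forall>m>N. \<forall>g. dep y m g" using dep_bounded by blast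
  have "S \<subseteq> {..N}"
  proof
    fix n assume "n \<in> S"
    then obtain u where "modindep y R n u" unfolding S_def by blast
    then have "\<not> dep y n u" by (rule modindep_not_dep[OF R])
    then have "\<not> n > N" using N by blast
    then show "n \<in> {..N}" by simp
  qed
  then have fin: "finite S" by (rule finite_subset) simp
  have "0 \<in> S" by (auto simp: S_def modindep_def)
  then have "Max S \<in> S" using fin by (intro Max_in) auto
  then obtain u where u: "modindep y R (Max S) u" unfolding S_def by auto
  define n where "n = Max S"
  have un: "modindep y R n u" using u by (simp add: n_def)
  have un2: "\<forall>i<n. c i = 0" if "\<forall>i<n. c i \<in> K" "(\<Sum>i<n. c i * u i) \<in> (*) y ` R" for c
  proof -
    from un have "\<forall>c. (\<forall>i<n. c i \<in> K) \<longrightarrow> (\<Sum>i<n. c i * u i) \<in> (*) y ` R \<longrightarrow> (\<forall>i<n. c i = 0)"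
      unfolding modindep_def by (rule conjunct2)
    from mp[OF mp[OF spec[OF this, of c] that(1)] that(2)] show ?thesis .
  qed
  show ?thesis
  proof (rule that[OF un], rule ballI)
    fix f assume f: "f \<in> R"
    have "Suc n \<notin> S" using Max_ge[OF fin, of "Suc n"] by (auto simp: n_def)
    then have "\<not> modindep y R (Suc n) (u(n := f))" unfolding S_def by blast
    moreover have "\<forall>i<Suc n. (u(n := f)) i \<in> R" using un f by (auto simp: modindep_def less_Suc_eq)
    ultimately obtain c where c: "\<forall>i<Suc n. c i \<in> K" "(\<Sum>i<Suc n. c i * (u(n := f)) i) \<in> (*) y ` R"
      "\<not> (\<forall>i<Suc n. c i = 0)" unfolding modindep_def by auto
    have s: "(\<Sum>i<n. c i * u i) + c n * f \<in> (*) y ` R" using c(2) by simp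
    have cn: "c n \<noteq> 0"
    proof
      assume 0: "c n = 0"
      then have "(\<Sum>i<n. c i * u i) \<in> (*) y ` R" using s by simp
      moreover have "\<forall>i<n. c i \<in> K" using c(1) by simp
      ultimately have "\<forall>i<n. c i = 0" by (intro un2)
      then show False using c(3) 0 by (auto simp: less_Suc_eq)
    qed
    define d where "d i = - inverse (c n) * c i" for i
    have "inverse (c n) \<in> K" using c(1) by (intro inverse_K) auto
    then have dK: "\<forall>i<n. d i \<in> K" using c(1) unfolding d_def by (intro allI impI mult_K uminus_K) auto
    obtain r where r: "r \<in> R" "(\<Sum>i<n. c i * u i) + c n * f = y * r" using s by blast
    have "(\<Sum>i<n. d i * u i) = - inverse (c n) * (\<Sum>i<n. c i * u i)"
      unfolding sum_distrib_left d_def by (simp only: mult.assoc)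
    then have "f - (\<Sum>i<n. d i * u i) = inverse (c n) * ((\<Sum>i<n. c i * u i) + c n * f)"
      using cn by (simp add: distrib_left)
    also have "\<dots> = y * (inverse (c n) * r)" unfolding r(2) by (simp only: mult_ac)
    finally have "f - (\<Sum>i<n. d i * u i) \<in> (*) y ` R"
      using r(1) \<open>inverse (c n) \<in> K\<close> R(2) ring_set_mult[OF R(1)] by auto
    then show "\<exists>c. (\<forall>i<n. c i \<in> K) \<and> f - (\<Sum>i<n. c i * u i) \<in> (*) y ` R" using dK by blast
  qed
qed

lemma finite_combinations:
  shows "finite ((\<lambda>c. \<Sum>i<n. c i * u i) ` ({..<n} \<rightarrow>\<^sub>E K))"
    and "card ((\<lambda>c. \<Sum>i<n. c i * u i) ` ({..<n} \<rightarrow>\<^sub>E K)) \<le> card K ^ n"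
proof -
  have fin: "finite ({..<n} \<rightarrow>\<^sub>E K)" by (intro finite_PiE finite_K) auto
  then show "finite ((\<lambda>c. \<Sum>i<n. c i * u i) ` ({..<n} \<rightarrow>\<^sub>E K))" by simp
  have "card ((\<lambda>c. \<Sum>i<n. c i * u i) ` ({..<n} \<rightarrow>\<^sub>E K)) \<le> card ({..<n} \<rightarrow>\<^sub>E K)" using fin by (rule card_image_le)
  also have "\<dots> = card K ^ n" by (subst card_PiE) auto
  finally show "card ((\<lambda>c. \<Sum>i<n. c i * u i) ` ({..<n} \<rightarrow>\<^sub>E K)) \<le> card K ^ n" .
qed

lemma combinations_mem:
  assumes "\<forall>i<n. c i \<in> K"
  shows "(\<Sum>i<n. c i * u i) \<in> (\<lambda>c. \<Sum>i<n. c i * u i) ` ({..<n} \<rightarrow>\<^sub>E K)"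
  by (rule image_eqI[of _ _ "restrict c {..<n}"]) (use assms in auto)

text \<open>With R the valuation ring and y a uniformiser, R/yR is the residue field,
  finite-dimensional over the finite field K.\<close>

lemma residue_field_finite:
  assumes w: "place (w :: 'f \<Rightarrow> int)"
  shows "\<exists>D. finite D \<and> (\<forall>f. vge w 0 f \<longrightarrow> (\<exists>d\<in>D. vge w 1 (f - d)))"
proof -
  obtain y where y: "y \<noteq> 0" "w y = 1" using w unfolding place_def by blast
  let ?R = "{f. vge w 0 f}"
  have R: "ring_set ?R" unfolding ring_set_def
    using vge_1[OF w] vge_add[OF w, of 0] vge_mult[OF w, of 0 _ 0] vge_uminus[OF w, of 0] by auto
  have KR: "K \<subseteq> ?R" using vge_K[OF w] by auto
  have yR: "y \<in> ?R" using y by (simp add: vge_def)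
  obtain n u where "modindep y ?R n u"
    and u: "\<forall>f\<in>?R. \<exists>c. (\<forall>i<n. c i \<in> K) \<and> f - (\<Sum>i<n. c i * u i) \<in> (*) y ` ?R"
    by (rule modindep_basis[OF R KR yR y(1)])
  show ?thesis
  proof (intro exI conjI allI impI)
    show "finite ((\<lambda>c. \<Sum>i<n. c i * u i) ` ({..<n} \<rightarrow>\<^sub>E K))" by (rule finite_combinations)
    fix f assume "vge w 0 f"
    then obtain c where c: "\<forall>i<n. c i \<in> K" "f - (\<Sum>i<n. c i * u i) \<in> (*) y ` ?R" using u by blast
    then obtain r where "vge w 0 r" "f - (\<Sum>i<n. c i * u i) = y * r" by auto
    moreover have "vge w 1 y" using y by (simp add: vge_def)
    ultimately have "vge w 1 (f - (\<Sum>i<n. c i * u i))" using vge_mult[OF w, of 1 y 0 r] by simp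
    then show "\<exists>d\<in>(\<lambda>c. \<Sum>i<n. c i * u i) ` ({..<n} \<rightarrow>\<^sub>E K). vge w 1 (f - d)"
      using combinations_mem[OF c(1)] by blast
  qed
qed

text \<open>Elements of pole order below k modulo the maximal ideal are filtered by k copies of the
  residue field. The shift by 1 makes k = 0 the case of the maximal ideal itself.\<close>

lemma finite_approximations:
  assumes w: "place (w :: 'f \<Rightarrow> int)"
  shows "\<exists>D. finite D \<and> (\<forall>f. vge w (1 - int k) f \<longrightarrow> (\<exists>d\<in>D. vge w 1 (f - d)))"
proof (induction k)
  case 0 then show ?case by (intro exI[of _ "{0}"]) auto
next
  case (Suc k)
  then obtain D where D: "finite D" "\<And>f. vge w (1 - int k) f \<Longrightarrow> \<exists>d\<in>D. vge w 1 (f - d)" by blast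
  obtain E where E: "finite E" "\<And>f. vge w 0 f \<Longrightarrow> \<exists>d\<in>E. vge w 1 (f - d)"
    using residue_field_finite[OF w] by blast
  obtain p where p: "p \<noteq> 0" "w p = 1" using w unfolding place_def by blast
  define t where "t = inverse p ^ k"
  have t: "t \<noteq> 0" "w t = - int k" using p w by (simp_all add: t_def place_power place_inverse)
  show ?case
  proof (intro exI[of _ "(\<lambda>(d,e). d + t * e) ` (D \<times> E)"] conjI allI impI)
    show "finite ((\<lambda>(d,e). d + t * e) ` (D \<times> E))" using D(1) E(1) by simp
    fix f assume f: "vge w (1 - int (Suc k)) f"
    have "vge w 0 (f * inverse t)"
      using vge_mult[OF w f, of "int k" "inverse t"] t place_inverse[OF w, of t] by (simp add: vge_def)
    then obtain e where e: "e \<in> E" "vge w 1 (f * inverse t - e)" using E(2) by blast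
    have "vge w (1 - int k) ((f * inverse t - e) * t)"
      using vge_mult[OF w e(2), of "- int k" t] t by (simp add: vge_def)
    moreover have "(f * inverse t - e) * t = f - t * e" using t(1) by (simp add: field_simps)
    ultimately obtain d where "d \<in> D" "vge w 1 (f - t * e - d)" using D(2)[of "f - t * e"] by auto
    moreover have "f - t * e - d = f - (d + t * e)" by simp
    ultimately show "\<exists>d\<in>(\<lambda>(d,e). d + t * e) ` (D \<times> E). vge w 1 (f - d)" using e(1) by force
  qed
qed

end

section \<open>Weak approximation and the number of zeros\<close>

text \<open>Units at w are units at v, so v is w times the value at v of a uniformiser of w. This
  factor is not negative, and it divides 1 because v takes the value 1.\<close>

lemma place_eqI:
  assumes v: "place v" and w: "place w" and le: "\<And>a. 0 \<le> w a \<Longrightarrow> 0 \<le> v a"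
  shows "v = w"
proof -
  have unit: "v a = 0" if "w a = 0" for a
    using le[of a] le[of "inverse a"] that place_inverse[OF v, of a] place_inverse[OF w, of a] by simp
  obtain p where p: "p \<noteq> 0" "w p = 1" using w unfolding place_def by blast
  have powi: "u (p powi n) = n * u p" if u: "place u" for u n
  proof (cases "0 \<le> n")
    case True
    then show ?thesis using place_power[OF u p(1), of "nat n"] by (simp add: power_int_def)
  next
    case False
    then show ?thesis using place_power[OF u p(1), of "nat (- n)"] place_inverse[OF u, of "p ^ nat (- n)"]
      by (simp add: power_int_def power_inverse)
  qed
  have eq: "v a = w a * v p" if a: "a \<noteq> 0" for a
  proof -
    have "p powi (- w a) \<noteq> 0" using p by simp
    then have "w (a * p powi (- w a)) = 0" "v (a * p powi (- w a)) = v a - w a * v p"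
      using place_mult[OF w a, of "p powi (- w a)"] place_mult[OF v a, of "p powi (- w a)"] powi[OF v] powi[OF w] p by auto
    then show ?thesis using unit by fastforce
  qed
  obtain s where s: "s \<noteq> 0" "v s = 1" using v unfolding place_def by blast
  have "0 \<le> v p" using le[of p] p by simp
  moreover have "w s * v p = 1" using eq[OF s(1)] s by simp
  ultimately have "v p = 1" using zmult_eq_1_iff by force
  then have "v a = w a" for a using eq[of a] place_0[OF v] place_0[OF w] by (cases "a = 0") auto
  then show ?thesis by blast
qed

lemma places_separate:
  assumes v: "place v" and w: "place w" and "v \<noteq> w"
  shows "\<exists>z. v z < 0 \<and> 0 < w z"
proof -
  obtain a where a: "0 \<le> w a" "v a < 0" using place_eqI[OF v w] assms(3) by force
  obtain b where b: "0 \<le> v b" "w b < 0" using place_eqI[OF w v] assms(3) by force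
  have "a \<noteq> 0" "b \<noteq> 0" using a b place_0[OF v] place_0[OF w] by auto
  then have "v (a * inverse b) = v a - v b" "w (a * inverse b) = w a - w b"
    using place_mult[OF v, of a "inverse b"] place_mult[OF w, of a "inverse b"] place_inverse[OF v] place_inverse[OF w] by auto
  then show ?thesis using a b by (intro exI[of _ "a * inverse b"]) auto
qed

text \<open>By induction z is right for T, and y separates v from the new place \<open>w0\<close>.
  If z is regular at \<open>w0\<close>, then z^m y works for large m. If z has a pole there, z^m is
  replaced by z^m / (1 + z^m), which has value 0 at v and \<open>w0\<close> but value m w(z) at each
  w in T. The exponent m only has to outweigh the values of y on T.\<close>

lemma weak_approximation:
  assumes v: "place v" and fin: "finite T" and T: "\<And>w. w \<in> T \<Longrightarrow> place w \<and> w \<noteq> v"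
  shows "\<exists>z. v z < 0 \<and> (\<forall>w\<in>T. 0 < w z)"
  using fin T
proof (induction T rule: finite_induct)
  case empty
  obtain p where "p \<noteq> 0" "v p = 1" using v unfolding place_def by blast
  then show ?case using place_inverse[OF v, of p] by (intro exI[of _ "inverse p"]) auto
next
  case (insert w0 T)
  then obtain z where z: "v z < 0" "\<And>w. w \<in> T \<Longrightarrow> 0 < w z" by blast
  have w0: "place w0" and pT: "\<And>w. w \<in> T \<Longrightarrow> place w" using insert.prems by auto
  obtain y where y: "v y < 0" "0 < w0 y" using places_separate[OF v w0] insert.prems by blast
  have z0: "z \<noteq> 0" and y0: "y \<noteq> 0" using z(1) y(1) place_0[OF v] by auto
  define m where "m = Suc (\<Sum>w\<in>T. nat \<bar>w y\<bar>)"
  have mpos: "0 < int m" unfolding m_def of_nat_0_less_iff by (rule zero_less_Suc)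
  have m: "0 < int m * w z + w y" if "w \<in> T" for w
  proof -
    have "nat \<bar>w y\<bar> \<le> (\<Sum>w\<in>T. nat \<bar>w y\<bar>)" by (rule member_le_sum) (use that insert.hyps in auto)
    then have "nat \<bar>w y\<bar> < m" by (simp add: m_def)
    then have "- w y < int m" by linarith
    also have "\<dots> \<le> int m * w z" using mult_left_mono[of 1 "w z" "int m"] z(2)[OF that] by simp
    finally show ?thesis by simp
  qed
  show ?case
  proof (cases "0 \<le> w0 z")
    case True
    have val: "u (z ^ m * y) = int m * u z + u y" if "place u" for u
      using that z0 y0 by (simp add: place_mult place_power)
    have "v (z ^ m * y) < 0" using z(1) y(1) val[OF v] by (simp add: m_def mult_nonneg_nonpos add_nonpos_neg)
    moreover have "0 < w0 (z ^ m * y)" using True y(2) val[OF w0] by (simp add: add_nonneg_pos)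
    moreover have "\<forall>w\<in>T. 0 < w (z ^ m * y)" using m val pT by auto
    ultimately show ?thesis by blast
  next
    case False
    define s where "s = inverse (z ^ m)"
    have s0: "s \<noteq> 0" using z0 by (simp add: s_def)
    have ws: "u s = - (int m * u z)" if "place u" for u
      using that z0 by (simp add: s_def place_inverse place_power)
    have pos: "1 + s \<noteq> 0" "u (1 + s) = 0" if "place u" "u z < 0" for u
    proof -
      have "0 < u s" using ws[OF that(1)] mult_pos_neg[OF mpos that(2)] by simp
      then have "vge u (u 1 + 1) s" using place_1[OF that(1)] by (simp add: vge_def)
      then show "1 + s \<noteq> 0" "u (1 + s) = 0" using place_add_strict[OF that(1), of 1 s] place_1[OF that(1)] by auto
    qed
    have neg: "w (1 + s) = w s" if "w \<in> T" for w
    proof -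
      have "w s < 0" using ws[OF pT[OF that]] mult_pos_pos[OF mpos z(2)[OF that]] by simp
      then have "vge w (w s + 1) 1" using place_1[OF pT[OF that]] by (simp add: vge_def)
      then show ?thesis using place_add_strict[OF pT[OF that] s0, of 1] by (simp add: add.commute)
    qed
    have s1: "1 + s \<noteq> 0" by (rule pos[OF v z(1)])
    define t where "t = y * inverse (1 + s)"
    have val: "u t = u y - u (1 + s)" if "place u" for u
      using that s1 y0 by (simp add: t_def place_mult place_inverse)
    have "v t < 0" using val[OF v] pos(2)[OF v z(1)] y(1) by simp
    moreover have "0 < w0 t" using val[OF w0] pos(2)[OF w0] False y(2) by simp
    moreover have "0 < w t" if "w \<in> T" for w
      using val[OF pT[OF that]] neg[OF that] ws[OF pT[OF that]] m[OF that] by simp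
    ultimately show ?thesis by blast
  qed
qed

context function_field
begin

text \<open>Functions z_i, each with a pole at one zero of y and zeros at the others considered, are
  independent over K[y]: at the place belonging to a coefficient with nonzero constant term exactly
  one term of a relation has a pole. So the number of zeros of y obeys
  \<open>dep_bounded\<close>.\<close>

lemma finite_places_over:
  assumes y: "y \<notin> K"
  shows "finite {w. place w \<and> 0 < w y}"
proof (rule ccontr)
  assume inf: "infinite {w. place w \<and> 0 < w y}"
  have y0: "y \<noteq> 0" using y by auto
  obtain N where N: "\<forall>m>N. \<forall>g. dep y m g" using dep_bounded by blast
  obtain T where T: "finite T" "card T = Suc N" "T \<subseteq> {w. place w \<and> 0 < w y}"
    using infinite_arbitrarily_large[OF inf] by blast
  obtain h where h: "bij_betw h {..<Suc N} T"
    using ex_bij_betw_nat_finite[OF T(1)] T(2) by (auto simp: atLeast0LessThan)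
  have hT: "place (h i)" "0 < h i y" if "i < Suc N" for i
    using h T(3) that unfolding bij_betw_def by auto
  have ex: "\<exists>z. h i z < 0 \<and> (\<forall>j<Suc N. j \<noteq> i \<longrightarrow> 0 < h j z)" if i: "i < Suc N" for i
  proof -
    have "\<exists>z. h i z < 0 \<and> (\<forall>w\<in>h ` ({..<Suc N} - {i}). 0 < w z)"
    proof (rule weak_approximation[OF hT(1)[OF i]])
      fix w assume "w \<in> h ` ({..<Suc N} - {i})"
      then obtain j where "j < Suc N" "j \<noteq> i" "w = h j" by auto
      then show "place w \<and> w \<noteq> h i" using hT h i unfolding bij_betw_def inj_on_def by auto
    qed simp
    then show ?thesis by auto
  qed
  define z where "z i = (SOME z. h i z < 0 \<and> (\<forall>j<Suc N. j \<noteq> i \<longrightarrow> 0 < h j z))" for i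
  have z: "h i (z i) < 0 \<and> (\<forall>j<Suc N. j \<noteq> i \<longrightarrow> 0 < h j (z i))" if "i < Suc N" for i
    unfolding z_def by (rule someI_ex[OF ex[OF that]])
  have "dep y (Suc N) z" using N by blast
  then obtain c where c: "\<And>j. j < Suc N \<Longrightarrow> c j \<in> KP" "\<exists>j<Suc N. coeff (c j) 0 \<noteq> 0"
    "(\<Sum>j<Suc N. poly (c j) y * z j) = 0" using y0 by (rule dep_primitive) blast
  from c(2) obtain i where i: "i < Suc N" "coeff (c i) 0 \<noteq> 0" by blast
  note w = hT(1)[OF i(1)]
  have y1: "vge (h i) 1 y" using hT(2)[OF i(1)] by (simp add: vge_def)
  have u: "poly (c i) y \<noteq> 0" "h i (poly (c i) y) = 0" using place_poly_unit[OF w c(1)[OF i(1)] i(2) y1] by auto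
  have zi: "z i \<noteq> 0" using z[OF i(1)] place_0[OF w] by auto
  have neg: "h i (poly (c i) y * z i) < 0" using place_mult[OF w u(1) zi] u(2) z[OF i(1)] by simp
  have "vge (h i) 0 (\<Sum>j\<in>{..<Suc N} - {i}. poly (c j) y * z j)"
  proof (rule vge_sum[OF w])
    fix j assume j: "j \<in> {..<Suc N} - {i}"
    have "0 < h i (z j)" using z[of j] i(1) j by auto
    then have "vge (h i) 0 (z j)" by (simp add: vge_def)
    moreover have "vge (h i) 0 (poly (c j) y)"
      using j vge_mono[OF y1] by (intro vge_poly w c(1)) auto
    ultimately show "vge (h i) 0 (poly (c j) y * z j)" using vge_mult[OF w, of 0 _ 0] by auto
  qed
  then have "vge (h i) (h i (poly (c i) y * z i) + 1) (\<Sum>j\<in>{..<Suc N} - {i}. poly (c j) y * z j)"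
    by (rule vge_mono) (use neg in simp)
  moreover have "poly (c i) y * z i + (\<Sum>j\<in>{..<Suc N} - {i}. poly (c j) y * z j) = 0"
    using c(3) sum.remove[of "{..<Suc N}" i "\<lambda>j. poly (c j) y * z j"] i(1) by simp
  ultimately show False using place_add_strict(1)[OF w _, of "poly (c i) y * z i"] u(1) zi by simp
qed

text \<open>Clearing denominators: \<open>h = C f\<close> with \<open>C\<close> the leading coefficient of an algebraic equation
  for \<open>f\<close> is integral over \<open>K[x]\<close>.\<close>

lemma clear_denominators:
  assumes x: "x \<notin> K"
  shows "\<exists>p\<in>KP. p \<noteq> 0 \<and> (\<forall>w. place w \<longrightarrow> 0 \<le> w x \<longrightarrow> vge w 0 (poly p x * f))"
proof -
  obtain N where N: "\<forall>m>N. \<forall>g. dep x m g" using dep_bounded by blast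
  then have "dep x (Suc N) (\<lambda>i. f ^ i)" by blast
  then obtain c where c: "\<forall>j<Suc N. c j \<in> KP" "\<exists>j<Suc N. c j \<noteq> 0" "(\<Sum>j<Suc N. poly (c j) x * f ^ j) = 0"
    unfolding dep_def by blast
  define d where "d = (GREATEST j. j < Suc N \<and> c j \<noteq> 0)"
  have d: "d < Suc N \<and> c d \<noteq> 0" unfolding d_def
    by (rule GreatestI_ex_nat[of _ N]) (use c(2) in auto)
  have high: "c j = 0" if "d < j" "j < Suc N" for j
    using Greatest_le_nat[of "\<lambda>j. j < Suc N \<and> c j \<noteq> 0" j N] that unfolding d_def by fastforce
  have "(\<Sum>j<Suc N. poly (c j) x * f ^ j) = (\<Sum>j<Suc d. poly (c j) x * f ^ j)"
    by (rule sum.mono_neutral_right) (use d high in \<open>auto simp: not_less Suc_le_eq\<close>)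
  then have sum0: "(\<Sum>j<d. poly (c j) x * f ^ j) + poly (c d) x * f ^ d = 0" using c(3) by simp
  have cd: "c d \<in> KP" "c d \<noteq> 0" using c(1) d by auto
  define C where "C = poly (c d) x"
  have C0: "C \<noteq> 0" unfolding C_def using poly_nonzero[OF x cd] .
  have d1: "d \<noteq> 0" using sum0 C0 by (intro notI) (simp add: C_def)
  define h where "h = C * f"
  \<comment> \<open>Multiplying the equation of degree d for f by C^(d - 1) makes it monic in h = C
    f.\<close>
  have "h ^ d + (\<Sum>j<d. poly (c j) x * C ^ (d - 1 - j) * h ^ j)
    = C ^ (d - 1) * ((\<Sum>j<d. poly (c j) x * f ^ j) + poly (c d) x * f ^ d)"
  proof -
    have "h ^ d = C ^ (d - 1) * (poly (c d) x * f ^ d)"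
      using d1 by (cases d) (simp_all add: h_def C_def power_mult_distrib)
    moreover have T: "poly (c j) x * C ^ (d - 1 - j) * h ^ j = C ^ (d - 1) * (poly (c j) x * f ^ j)" if "j < d" for j
    proof -
      have "C ^ (d - 1) = C ^ (d - 1 - j) * C ^ j" using that by (simp flip: power_add)
      then show ?thesis by (simp add: h_def power_mult_distrib)
    qed
    moreover have "(\<Sum>j<d. poly (c j) x * C ^ (d - 1 - j) * h ^ j) = C ^ (d - 1) * (\<Sum>j<d. poly (c j) x * f ^ j)"
      unfolding sum_distrib_left by (intro sum.cong refl T) simp
    ultimately show ?thesis by (simp only: distrib_left add.commute)
  qed
  then have rel: "h ^ d + (\<Sum>j<d. poly (c j) x * C ^ (d - 1 - j) * h ^ j) = 0" using sum0 by simp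
  have "vge w 0 h" if w: "place w" and wx: "0 \<le> w x" for w
  proof (rule ccontr)
    assume "\<not> vge w 0 h"
    then have h0: "h \<noteq> 0" "w h < 0" by (auto simp: vge_def)
    have vx: "vge w 0 x" using wx by (simp add: vge_def)
    have "vge w (w (h ^ d) + 1) (\<Sum>j<d. poly (c j) x * C ^ (d - 1 - j) * h ^ j)"
    proof (rule vge_sum[OF w])
      fix j assume j: "j \<in> {..<d}"
      have 1: "vge w 0 (poly (c j) x)" using c(1) d j by (intro vge_poly w vx) auto
      have 2: "vge w 0 (C ^ (d - 1 - j))" unfolding C_def by (intro vge_power vge_poly w vx cd)
      have 3: "vge w (int j * w h) (h ^ j)" using h0 by (simp add: vge_def place_power[OF w])
      have "vge w (0 + 0 + int j * w h) (poly (c j) x * C ^ (d - 1 - j) * h ^ j)"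
        by (intro vge_mult w 1 2 3)
      moreover have "w (h ^ d) + 1 \<le> int j * w h"
      proof -
        have "int d * w h \<le> (int j + 1) * w h" using j h0 by (intro mult_right_mono_neg) auto
        also have "\<dots> \<le> int j * w h - 1" using h0 by (simp add: distrib_right)
        finally show ?thesis unfolding place_power[OF w h0(1)] by linarith
      qed
      ultimately show "vge w (w (h ^ d) + 1) (poly (c j) x * C ^ (d - 1 - j) * h ^ j)"
        by (auto elim: vge_mono)
    qed
    then show False using place_add_strict(1)[OF w, of "h ^ d"] h0 rel by simp
  qed
  then show ?thesis using cd unfolding h_def C_def by blast
qed

end

section \<open>The ring of functions regular away from a place\<close>

context function_field
begin

lemma dep_scale:
  assumes "\<not> dep x N g" "x \<notin> K" and p: "\<And>i. i < N \<Longrightarrow> p i \<in> KP \<and> p i \<noteq> 0"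
  shows "\<not> dep x N (\<lambda>i. poly (p i) x * g i)"
proof
  assume "dep x N (\<lambda>i. poly (p i) x * g i)"
  then obtain c where c: "\<forall>j<N. c j \<in> KP" "\<exists>j<N. c j \<noteq> 0" "(\<Sum>j<N. poly (c j) x * (poly (p j) x * g j)) = 0"
    unfolding dep_def by blast
  have "dep x N g" unfolding dep_def
    by (rule exI[of _ "\<lambda>j. c j * p j"]) (use c p in \<open>auto simp: mult.assoc intro!: KP_mult\<close>)
  then show False using assms(1) by simp
qed

lemma integral_basis:
  assumes x: "x \<notin> K" and g: "\<not> dep x N g"
  obtains b where "\<not> dep x N b" "\<And>i w. i < N \<Longrightarrow> place w \<Longrightarrow> 0 \<le> w x \<Longrightarrow> vge w 0 (b i)"
proof -
  have "\<forall>i. \<exists>p. p \<in> KP \<and> p \<noteq> 0 \<and> (\<forall>w. place w \<longrightarrow> 0 \<le> w x \<longrightarrow> vge w 0 (poly p x * g i))"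
    using clear_denominators[OF x] by blast
  then obtain p where p: "\<forall>i. p i \<in> KP \<and> p i \<noteq> 0 \<and> (\<forall>w. place w \<longrightarrow> 0 \<le> w x \<longrightarrow> vge w 0 (poly (p i) x * g i))"
    using choice[of "\<lambda>i p. p \<in> KP \<and> p \<noteq> 0 \<and> (\<forall>w. place w \<longrightarrow> 0 \<le> w x \<longrightarrow> vge w 0 (poly p x * g i))"] by auto
  have "\<not> dep x N (\<lambda>i. poly (p i) x * g i)" using p by (intro dep_scale[OF g x]) auto
  then show ?thesis by (rule that) (use p in auto)
qed

end

locale function_field_at = function_field K for K :: "'f::field set" +
  fixes v :: "'f \<Rightarrow> int"
  assumes place_v: "place v"
begin

abbreviation A :: "'f set" where "A \<equiv> regular_ring v"

lemma A_iff: "a \<in> A \<longleftrightarrow> (\<forall>w. place w \<longrightarrow> w \<noteq> v \<longrightarrow> vge w 0 a)"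
  unfolding regular_ring_def using vge_0_iff by blast

lemma A_vge: "a \<in> A \<Longrightarrow> place w \<Longrightarrow> w \<noteq> v \<Longrightarrow> vge w 0 a"
  by (simp add: A_iff)

lemma A_ring: "ring_set A"
  unfolding ring_set_def
proof (intro conjI ballI)
  show "1 \<in> A" using vge_1 by (auto simp: A_iff)
  fix a b assume ab: "a \<in> A" "b \<in> A"
  show "a + b \<in> A" unfolding A_iff using ab A_vge vge_add by blast
  show "- a \<in> A" unfolding A_iff using ab A_vge vge_uminus by blast
  show "a * b \<in> A" unfolding A_iff
  proof (intro allI impI)
    fix w assume w: "place w" "w \<noteq> v"
    show "vge w 0 (a * b)" using vge_mult[OF w(1) A_vge[OF ab(1) w] A_vge[OF ab(2) w]] by simp
  qed
qed

lemma K_A: "K \<subseteq> A"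
  using vge_K by (auto simp: A_iff)

text \<open>A nonconstant element of A has a pole, which can only be v; a nonzero constant has value
  0 at v.\<close>

lemma A_positive_zero:
  assumes a: "a \<in> A" "vge v 1 a" shows "a = 0"
proof (rule ccontr)
  assume a0: "a \<noteq> 0"
  show False
  proof (cases "a \<in> K")
    case True
    then show False using place_K[OF place_v True] a a0 by (simp add: vge_def)
  next
    case False
    then obtain w where w: "place w" "w a < 0" using pole_exists by blast
    then have "w = v" using A_vge[OF a(1) w(1)] a0 by (auto simp: vge_def)
    then show False using w a a0 by (simp add: vge_def)
  qed
qed

text \<open>Two elements of A in the same class modulo the maximal ideal at v differ by an element
  of A vanishing at v, hence coincide. Only finitely many classes have bounded pole order.\<close>

theorem A_discrete: "finite {a \<in> A. vge v n a}"
proof -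
  define k where "k = nat (1 - n)"
  obtain D where D: "finite D" "\<forall>f. vge v (1 - int k) f \<longrightarrow> (\<exists>d\<in>D. vge v 1 (f - d))"
    using finite_approximations[OF place_v, of k] by blast
  have "{a \<in> A. vge v n a} \<subseteq> (\<Union>d\<in>D. {a \<in> A. vge v 1 (a - d)})"
  proof
    fix a assume a: "a \<in> {a \<in> A. vge v n a}"
    have "1 - int k \<le> n" unfolding k_def by linarith
    then have "vge v (1 - int k) a" using a by (auto elim: vge_mono)
    then show "a \<in> (\<Union>d\<in>D. {a \<in> A. vge v 1 (a - d)})" using D(2) a by blast
  qed
  moreover have "finite {a \<in> A. vge v 1 (a - d)}" for d
  proof (cases "{a \<in> A. vge v 1 (a - d)} = {}")
    case True
    show ?thesis unfolding True by simp
  next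
    case False
    then obtain b where b: "b \<in> A" "vge v 1 (b - d)" by blast
    have "{a \<in> A. vge v 1 (a - d)} \<subseteq> {b}"
    proof
      fix a assume a: "a \<in> {a \<in> A. vge v 1 (a - d)}"
      then have "vge v 1 (a - b)" using vge_diff[OF place_v _ b(2), of "a - d"] by simp
      then have "a - b = 0" using a b by (intro A_positive_zero ring_set_diff[OF A_ring]) auto
      then show "a \<in> {b}" by simp
    qed
    then show ?thesis by (rule finite_subset) simp
  qed
  ultimately show ?thesis using D(1) by (auto intro: finite_subset)
qed

text \<open>The semilocal ring of all places other than \<open>v\<close> above the zero of \<open>y\<close>.\<close>

definition R :: "'f \<Rightarrow> 'f set" where
  "R y = {f. \<forall>w. place w \<longrightarrow> w \<noteq> v \<longrightarrow> 0 < w y \<longrightarrow> vge w 0 f}"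

lemma R_ring: "ring_set (R y)"
  unfolding ring_set_def
proof (intro conjI ballI)
  show "1 \<in> R y" using vge_1 by (auto simp: R_def)
  fix a b assume ab: "a \<in> R y" "b \<in> R y"
  show "a + b \<in> R y" using ab vge_add unfolding R_def by blast
  show "- a \<in> R y" using ab vge_uminus unfolding R_def by blast
  show "a * b \<in> R y" unfolding R_def mem_Collect_eq
  proof (intro allI impI)
    fix w assume w: "place w" "w \<noteq> v" "0 < w y"
    have "vge w 0 a" "vge w 0 b" using ab w unfolding R_def by auto
    then show "vge w 0 (a * b)" using vge_mult[OF w(1), of 0 a 0 b] by simp
  qed
qed

lemma K_R: "K \<subseteq> R y"
  using vge_K by (auto simp: R_def)

lemma y_R: "y \<in> R y"
  by (auto simp: R_def vge_def)

text \<open>If the residue ring of \<open>R y\<close> modulo \<open>y\<close> had the full dimension, \<open>R y\<close> would be finitely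
  generated over a local ring of \<open>K(y)\<close>, hence contained in the valuation ring of \<open>v\<close>.\<close>

lemma residue_dimension_less:
  assumes y: "v y = 1" and N: "\<And>m g. m > N \<Longrightarrow> dep y m g" and u: "modindep y (R y) n u"
  shows "n < N"
proof (rule ccontr)
  have yK: "y \<notin> K" using place_K[OF place_v, of y] y by auto
  have y0: "y \<noteq> 0" using yK by auto
  have vy: "vge v 1 y" using y by (simp add: vge_def)
  assume "\<not> n < N"
  then have dep: "dep y (Suc n) g" for g using N by simp
  \<comment> \<open>Every f in \<open>R y\<close> will be a combination of the u j with coefficients
    c_j(y) / c_n(y), up to sign, whose denominators are units at v. So f has value at least \<mu>
    there.\<close>
  define \<mu> where "\<mu> = Min (insert 0 ((\<lambda>i. v (u i)) ` {..<n}))"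
  have \<mu>: "vge v \<mu> (u i)" if "i < n" for i unfolding vge_def \<mu>_def
    by (rule disjI2, rule Min_le) (use that in auto)
  have bound: "vge v \<mu> f" if f: "f \<in> R y" for f
  proof -
    have "dep y (Suc n) (u(n := f))" by (rule dep)
    then obtain c where c: "\<And>j. j < Suc n \<Longrightarrow> c j \<in> KP" "\<exists>j<Suc n. coeff (c j) 0 \<noteq> 0"
      "(\<Sum>j<Suc n. poly (c j) y * (u(n := f)) j) = 0" using y0 by (rule dep_primitive) blast
    have s: "(\<Sum>j<n. poly (c j) y * u j) = - (poly (c n) y * f)"
      using c(3) by (simp add: eq_neg_iff_add_eq_0)
    have cn: "coeff (c n) 0 \<noteq> 0"
    proof
      assume z: "coeff (c n) 0 = 0"
      have "poly (poly_shift 1 (c n)) y \<in> R y"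
        by (rule ring_set_poly[OF R_ring]) (use KP_D[OF KP_shift[OF c(1)[of n]]] K_R y_R in auto)
      then have "- (poly (poly_shift 1 (c n)) y * f) \<in> R y"
        by (intro ring_set_uminus[OF R_ring] ring_set_mult[OF R_ring] f)
      moreover have "- (poly (c n) y * f) = y * (- (poly (poly_shift 1 (c n)) y * f))"
        by (subst poly_coeff_0) (simp add: z)
      ultimately have "(\<Sum>j<n. poly (c j) y * u j) \<in> (*) y ` R y" unfolding s by blast
      then have "(\<Sum>j<n. coeff (c j) 0 * u j) \<in> (*) y ` R y"
        using u by (intro constant_terms_in_multiples R_ring K_R y_R c(1)) (auto simp: modindep_def)
      moreover have "\<forall>j<n. coeff (c j) 0 \<in> K" using KP_D[OF c(1)] by simp
      ultimately have "\<forall>j<n. coeff (c j) 0 = 0"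
        using u unfolding modindep_def by (auto dest!: spec[of _ "\<lambda>j. coeff (c j) 0"])
      then show False using c(2) z by (auto simp: less_Suc_eq)
    qed
    have unit: "poly (c n) y \<noteq> 0" "v (poly (c n) y) = 0"
      using place_poly_unit[OF place_v c(1) cn vy] by auto
    have "vge v \<mu> (\<Sum>j<n. poly (c j) y * u j)"
    proof (rule vge_sum[OF place_v])
      fix j assume j: "j \<in> {..<n}"
      have "vge v 0 (poly (c j) y)" using j vge_mono[OF vy] by (intro vge_poly place_v c(1)) auto
      from vge_mult[OF place_v this \<mu>[of j]] j show "vge v \<mu> (poly (c j) y * u j)" by simp
    qed
    then have "vge v \<mu> (- (- (poly (c n) y * f)))" unfolding s by (rule vge_uminus[OF place_v])
    then have "vge v \<mu> (poly (c n) y * f)" by simp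
    then show ?thesis using unit place_mult[OF place_v unit(1), of f] by (cases "f = 0") (auto simp: vge_def)
  qed
  \<comment> \<open>Weak approximation yields an element of \<open>R y\<close> with a pole at v,
    whose powers violate the bound.\<close>
  have "finite ({w. place w \<and> 0 < w y} - {v})" using finite_places_over[OF yK] by simp
  from weak_approximation[OF place_v this]
  obtain z where z: "v z < 0" "\<forall>w\<in>{w. place w \<and> 0 < w y} - {v}. 0 < w z" by blast
  have z0: "z \<noteq> 0" using z(1) place_0[OF place_v] by auto
  have "z \<in> R y" unfolding R_def mem_Collect_eq
  proof (intro allI impI)
    fix w assume "place w" "w \<noteq> v" "0 < w y"
    then have "0 < w z" using z(2) by blast
    then show "vge w 0 z" by (simp add: vge_def)
  qed
  then have "vge v \<mu> (z ^ m)" for m by (intro bound ring_set_power[OF R_ring])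
  moreover define m where "m = Suc (nat (- \<mu>))"
  ultimately have "vge v \<mu> (z ^ m)" by blast
  then have "\<mu> \<le> int m * v z" using z0 by (simp add: vge_def place_power[OF place_v])
  also have "\<dots> \<le> int m * (- 1)" using z(1) by (intro mult_left_mono) auto
  also have "\<dots> < \<mu>" unfolding m_def by simp
  finally show False by simp
qed

text \<open>D represents \<open>R y\<close> modulo y^m: each of the m steps of the y-adic expansion
  costs n coefficients in K.\<close>

lemma residue_powers:
  assumes y: "v y = 1" and u: "\<forall>f\<in>R y. \<exists>c. (\<forall>i<n. c i \<in> K) \<and> f - (\<Sum>i<n. c i * u i) \<in> (*) y ` R y"
  shows "\<exists>D. finite D \<and> card D \<le> card K ^ (n * m) \<and> (\<forall>f\<in>R y. \<exists>d\<in>D. f - d \<in> (*) (y ^ m) ` R y)"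
proof (induction m)
  case 0
  then show ?case by (intro exI[of _ "{0}"]) auto
next
  case (Suc m)
  then obtain D where D: "finite D" "card D \<le> card K ^ (n * m)" "\<forall>f\<in>R y. \<exists>d\<in>D. f - d \<in> (*) (y ^ m) ` R y" by blast
  let ?E = "(\<lambda>c. \<Sum>i<n. c i * u i) ` ({..<n} \<rightarrow>\<^sub>E K)"
  let ?D = "(\<lambda>(d,e). d + y ^ m * e) ` (D \<times> ?E)"
  have finE: "finite ?E" by (rule finite_combinations)
  have "finite (D \<times> ?E)" using D(1) finE by (rule finite_cartesian_product)
  then have "finite ?D" by (rule finite_imageI)
  moreover have "card ?D \<le> card K ^ (n * Suc m)"
  proof -
    have "card ?D \<le> card (D \<times> ?E)" using \<open>finite (D \<times> ?E)\<close> by (rule card_image_le)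
    also have "\<dots> = card D * card ?E" by (rule card_cartesian_product)
    also have "\<dots> \<le> card K ^ (n * m) * card K ^ n" using D(2) finite_combinations(2)[of u n] by (rule mult_le_mono)
    also have "\<dots> = card K ^ (n * Suc m)" by (simp flip: power_add add: algebra_simps)
    finally show ?thesis .
  qed
  moreover have "\<exists>d\<in>?D. f - d \<in> (*) (y ^ Suc m) ` R y" if f: "f \<in> R y" for f
  proof -
    obtain d r where d: "d \<in> D" "r \<in> R y" "f - d = y ^ m * r" using D(3) f by blast
    obtain c where c: "\<forall>i<n. c i \<in> K" "r - (\<Sum>i<n. c i * u i) \<in> (*) y ` R y" using u d(2) by blast
    then obtain s where s: "s \<in> R y" "r - (\<Sum>i<n. c i * u i) = y * s" by blast
    have "f - (d + y ^ m * (\<Sum>i<n. c i * u i)) = (f - d) - y ^ m * (\<Sum>i<n. c i * u i)" by simp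
    also have "\<dots> = y ^ m * (r - (\<Sum>i<n. c i * u i))" unfolding d(3) by (simp only: right_diff_distrib)
    also have "\<dots> = y ^ Suc m * s" unfolding s(2) by simp
    finally have "f - (d + y ^ m * (\<Sum>i<n. c i * u i)) \<in> (*) (y ^ Suc m) ` R y" using s(1) by blast
    moreover have "d + y ^ m * (\<Sum>i<n. c i * u i) \<in> ?D"
      by (rule image_eqI[of _ _ "(d, \<Sum>i<n. c i * u i)"]) (use d(1) combinations_mem[OF c(1), of u] in auto)
    ultimately show ?thesis by blast
  qed
  ultimately show ?case by blast
qed

lemma large_fiber:
  assumes fin: "finite B" "finite D" and f: "\<And>b. b \<in> B \<Longrightarrow> f b \<in> D" and card: "card D * q < card B"
  shows "\<exists>d\<in>D. q < card {b \<in> B. f b = d}"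
proof (rule ccontr)
  assume "\<not> ?thesis"
  then have le: "card {b \<in> B. f b = d} \<le> q" if "d \<in> D" for d using that by (meson not_le)
  have "B = (\<Union>d\<in>D. {b \<in> B. f b = d})" using f by auto
  then have "card B \<le> (\<Sum>d\<in>D. card {b \<in> B. f b = d})" using card_UN_le[OF fin(2)] by metis
  also have "\<dots> \<le> card D * q" using sum_bounded_above[of D "\<lambda>d. card {b \<in> B. f b = d}" q] le by simp
  finally show False using card by simp
qed

text \<open>Riemann's inequality in its crudest form: among the \<open>K\<close>-combinations of the \<open>y\<^sup>-\<^sup>j b\<^sub>i\<close> with
  \<open>j \<le> M\<close> there are too many for all of them to be distinguished by their polar parts away from \<open>v\<close>.\<close>

theorem A_nonconstant: "\<exists>x\<in>A. x \<notin> K"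
proof -
  obtain y where y0: "y \<noteq> 0" and y: "v y = 1" using place_v unfolding place_def by blast
  define x where "x = inverse y"
  have yK: "y \<notin> K" using place_K[OF place_v, of y] y by auto
  have xK: "x \<notin> K" using inverse_K[of x] yK by (auto simp: x_def)
  have x0: "x \<noteq> 0" using y0 by (simp add: x_def)
  obtain N g where Ng: "\<not> dep y N g" and N: "\<And>m g. m > N \<Longrightarrow> dep y m g" by (rule dep_rank) blast
  have "\<not> dep x N g" using dep_inverse[of x N g] x0 Ng by (auto simp: x_def)
  then obtain b where b: "\<not> dep x N b" "\<And>i w. i < N \<Longrightarrow> place w \<Longrightarrow> 0 \<le> w x \<Longrightarrow> vge w 0 (b i)"
    by (rule integral_basis[OF xK]) blast
  obtain n u where u: "modindep y (R y) n u"
    "\<forall>f\<in>R y. \<exists>c. (\<forall>i<n. c i \<in> K) \<and> f - (\<Sum>i<n. c i * u i) \<in> (*) y ` R y"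
    by (rule modindep_basis[OF R_ring K_R y_R y0])
  have nN: "n < N" by (rule residue_dimension_less[OF y N u(1)])
  define T where "T = {w. place w \<and> 0 < w y}"
  have finT: "finite T" unfolding T_def by (rule finite_places_over[OF yK])
  \<comment> \<open>e bounds the pole orders of all b i at all zeros of y at once.\<close>
  define e where "e = (\<Sum>w\<in>T. \<Sum>i<N. nat \<bar>w (b i)\<bar>)"
  have e: "y ^ e * b i \<in> R y" if i: "i < N" for i
    unfolding R_def mem_Collect_eq
  proof (intro allI impI)
    fix w assume w: "place w" "w \<noteq> v" "0 < w y"
    then have wT: "w \<in> T" by (simp add: T_def)
    have "nat \<bar>w (b i)\<bar> \<le> (\<Sum>i<N. nat \<bar>w (b i)\<bar>)" by (rule member_le_sum) (use i in auto)
    also have "\<dots> \<le> e" unfolding e_def by (rule member_le_sum[OF wT]) (use finT in auto)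
    finally have "nat \<bar>w (b i)\<bar> \<le> e" .
    then have "- w (b i) \<le> int e" by linarith
    also have "\<dots> \<le> int e * w y" using mult_left_mono[of 1 "w y" "int e"] w(3) by simp
    finally have "0 \<le> int e * w y + w (b i)" by simp
    moreover have "w (y ^ e * b i) = int e * w y + w (b i)" if "b i \<noteq> 0"
      using place_mult[OF w(1) _ that, of "y ^ e"] place_power[OF w(1) y0] y0 by simp
    ultimately show "vge w 0 (y ^ e * b i)" by (auto simp: vge_def)
  qed
  \<comment> \<open>M is chosen to give n (M + e) + 1 < N (M + 1), which is possible because n + 1
    \<le> N: the inequality has to absorb n e \<le> N e and the extra 1.\<close>
  define M where "M = Suc (N * e)"
  define val where "val \<phi> = (\<Sum>i<N. (\<Sum>j\<le>M. \<phi> (i,j) * x ^ j) * b i)" for \<phi>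
  let ?P = "({..<N} \<times> {..M}) \<rightarrow>\<^sub>E K"
  have finP: "finite ?P" by (intro finite_PiE finite_K) auto
  have cardP: "card ?P = card K ^ (N * Suc M)" by (subst card_PiE) (auto simp: card_cartesian_product)
  have inj: "\<phi> = \<psi>" if P: "\<phi> \<in> ?P" "\<psi> \<in> ?P" and eq: "val \<phi> = val \<psi>" for \<phi> \<psi>
  proof (rule ccontr)
    assume "\<phi> \<noteq> \<psi>"
    then have "\<exists>z\<in>{..<N} \<times> {..M}. \<phi> z \<noteq> \<psi> z" using PiE_ext[OF P] by blast
    then obtain i0 j0 where ij: "i0 < N" "j0 \<le> M" "\<phi> (i0,j0) \<noteq> \<psi> (i0,j0)" by auto
    define p where "p i = (\<Sum>j\<le>M. monom (\<phi> (i,j) - \<psi> (i,j)) j)" for i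
    have cp: "coeff (p i) j = \<phi> (i,j) - \<psi> (i,j)" if "j \<le> M" for i j
      using that by (simp add: p_def coeff_sum)
    have "p i \<in> KP" if "i < N" for i
      unfolding p_def using P that by (intro KP_sum KP_monom diff_K) (auto simp: PiE_iff)
    moreover have "p i0 \<noteq> 0" using cp[OF ij(2), of i0] ij(3) by auto
    moreover have "(\<Sum>i<N. poly (p i) x * b i) = 0"
    proof -
      have "(\<Sum>i<N. poly (p i) x * b i) = val \<phi> - val \<psi>"
        by (simp add: p_def val_def poly_sum poly_monom left_diff_distrib sum_subtractf)
      then show ?thesis using eq by simp
    qed
    ultimately have "dep x N b" unfolding dep_def using ij(1) by blast
    then show False using b(1) by simp
  qed
  have xy: "y ^ M * x ^ j = y ^ (M - j)" if "j \<le> M" for j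
  proof -
    have "y ^ M = y ^ (M - j) * y ^ j" using that by (simp flip: power_add)
    then show ?thesis using y0 by (simp add: x_def field_simps)
  qed
  have valR: "y ^ (M + e) * val \<phi> \<in> R y" if \<phi>: "\<phi> \<in> ?P" for \<phi>
  proof -
    have "y ^ (M + e) * val \<phi> = (\<Sum>i<N. (\<Sum>j\<le>M. \<phi> (i,j) * (y ^ M * x ^ j)) * (y ^ e * b i))"
      by (simp add: val_def power_add sum_distrib_left sum_distrib_right mult_ac)
    also have "\<dots> = (\<Sum>i<N. (\<Sum>j\<le>M. \<phi> (i,j) * y ^ (M - j)) * (y ^ e * b i))"
      using xy by simp
    also have "\<dots> \<in> R y"
    proof (rule ring_set_sum[OF R_ring])
      fix i assume i: "i \<in> {..<N}"
      have "(\<Sum>j\<le>M. \<phi> (i,j) * y ^ (M - j)) \<in> R y"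
      proof (rule ring_set_sum[OF R_ring])
        fix j assume "j \<in> {..M}"
        then have "\<phi> (i,j) \<in> R y" using \<phi> i K_R by (auto simp: PiE_iff)
        then show "\<phi> (i,j) * y ^ (M - j) \<in> R y"
          by (rule ring_set_mult[OF R_ring _ ring_set_power[OF R_ring y_R]])
      qed
      then show "(\<Sum>j\<le>M. \<phi> (i,j) * y ^ (M - j)) * (y ^ e * b i) \<in> R y"
        using i by (intro ring_set_mult[OF R_ring] e) auto
    qed
    finally show ?thesis .
  qed
  have val_fin: "vge w 0 (val \<phi>)" if \<phi>: "\<phi> \<in> ?P" and w: "place w" "0 \<le> w x" for \<phi> w
    unfolding val_def
  proof (rule vge_sum[OF w(1)])
    fix i assume i: "i \<in> {..<N}"
    have "vge w 0 (\<Sum>j\<le>M. \<phi> (i,j) * x ^ j)"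
    proof (rule vge_sum[OF w(1)])
      fix j assume "j \<in> {..M}"
      then have "vge w 0 (\<phi> (i,j))" using \<phi> i vge_K[OF w(1)] by (auto simp: PiE_iff)
      moreover have "vge w 0 (x ^ j)" by (intro vge_power w) (use w in \<open>simp add: vge_def\<close>)
      ultimately show "vge w 0 (\<phi> (i,j) * x ^ j)" using vge_mult[OF w(1), of 0 _ 0] by auto
    qed
    then show "vge w 0 ((\<Sum>j\<le>M. \<phi> (i,j) * x ^ j) * b i)"
      using vge_mult[OF w(1), of 0 _ 0 "b i"] b(2)[OF _ w] i by auto
  qed
  obtain D where D: "finite D" "card D \<le> card K ^ (n * (M + e))" "\<forall>f\<in>R y. \<exists>d\<in>D. f - d \<in> (*) (y ^ (M + e)) ` R y"
    using residue_powers[OF y u(2)] by blast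
  define \<delta> where "\<delta> \<phi> = (SOME d. d \<in> D \<and> y ^ (M + e) * val \<phi> - d \<in> (*) (y ^ (M + e)) ` R y)" for \<phi>
  have \<delta>: "\<delta> \<phi> \<in> D \<and> y ^ (M + e) * val \<phi> - \<delta> \<phi> \<in> (*) (y ^ (M + e)) ` R y" if "\<phi> \<in> ?P" for \<phi>
    unfolding \<delta>_def by (rule someI_ex) (use D(3) valR[OF that] in blast)
  have K2: "card K \<ge> 2"
  proof -
    have "card {0, 1::'f} \<le> card K" by (rule card_mono) (auto simp: finite_K)
    then show ?thesis by simp
  qed
  \<comment> \<open>More than |K| combinations must share their polar parts: of their differences
    from a fixed one, at most |K| are constant.\<close>
  have "card D * card K \<le> card K ^ (n * (M + e)) * card K" using D(2) by (rule mult_le_mono1)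
  also have "\<dots> = card K ^ (n * (M + e) + 1)" by simp
  also have "\<dots> < card K ^ (N * Suc M)"
  proof (rule power_strict_increasing)
    have "n * (M + e) + 1 = n * M + n * e + 1" by (simp add: algebra_simps)
    also have "\<dots> \<le> n * M + N * e + 1" using nN by simp
    also have "\<dots> = n * M + M" by (simp add: M_def)
    also have "\<dots> = Suc n * M" by simp
    also have "\<dots> < Suc n * Suc M" by simp
    also have "\<dots> \<le> N * Suc M" using nN by (intro mult_le_mono1) simp
    finally show "n * (M + e) + 1 < N * Suc M" .
  qed (use K2 in auto)
  finally have "card D * card K < card ?P" using cardP by simp
  then obtain d where d: "d \<in> D" "card K < card {\<phi> \<in> ?P. \<delta> \<phi> = d}"
    using large_fiber[OF finP D(1), of \<delta> "card K"] \<delta> by blast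
  then have "{\<phi> \<in> ?P. \<delta> \<phi> = d} \<noteq> {}" by (metis card.empty not_less0)
  then obtain \<phi>0 where \<phi>0: "\<phi>0 \<in> ?P" "\<delta> \<phi>0 = d" by blast
  let ?Z = "(\<lambda>\<phi>. val \<phi> - val \<phi>0) ` {\<phi> \<in> ?P. \<delta> \<phi> = d}"
  have "inj_on (\<lambda>\<phi>. val \<phi> - val \<phi>0) {\<phi> \<in> ?P. \<delta> \<phi> = d}" using inj by (auto intro!: inj_onI)
  then have "card K < card ?Z" using d(2) by (simp add: card_image)
  then have "\<not> ?Z \<subseteq> K" using card_mono[OF finite_K, of ?Z] by linarith
  then obtain \<phi> where \<phi>: "\<phi> \<in> ?P" "\<delta> \<phi> = d" "val \<phi> - val \<phi>0 \<notin> K" by blast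
  \<comment> \<open>The poles of x are the zeros of y. Away from them each combination is regular;
    at those different from v both combinations have the same polar part.\<close>
  have "val \<phi> - val \<phi>0 \<in> A" unfolding A_iff
  proof (intro allI impI)
    fix w assume w: "place w" "w \<noteq> v"
    show "vge w 0 (val \<phi> - val \<phi>0)"
    proof (cases "0 \<le> w x")
      case True
      then show ?thesis by (intro vge_diff val_fin w \<phi> \<phi>0)
    next
      case False
      then have wy: "0 < w y" using place_inverse[OF w(1), of y] by (simp add: x_def)
      obtain r1 where r1: "r1 \<in> R y" "y ^ (M + e) * val \<phi> - d = y ^ (M + e) * r1" using \<delta>[OF \<phi>(1)] \<phi>(2) by blast
      obtain r2 where r2: "r2 \<in> R y" "y ^ (M + e) * val \<phi>0 - d = y ^ (M + e) * r2" using \<delta>[OF \<phi>0(1)] \<phi>0(2) by blast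
      have "y ^ (M + e) * (val \<phi> - val \<phi>0) = y ^ (M + e) * (r1 - r2)"
        using r1(2) r2(2) by (simp add: right_diff_distrib algebra_simps)
      then have "val \<phi> - val \<phi>0 = r1 - r2" using y0 by simp
      then have "val \<phi> - val \<phi>0 \<in> R y" using ring_set_diff[OF R_ring r1(1) r2(1)] by simp
      then show ?thesis using w wy by (simp add: R_def)
    qed
  qed
  then show ?thesis using \<phi>(3) by blast
qed

lemma A_pole: "x \<in> A \<Longrightarrow> x \<notin> K \<Longrightarrow> v x < 0"
proof -
  assume x: "x \<in> A" "x \<notin> K"
  then obtain w where w: "place w" "w x < 0" using pole_exists by blast
  moreover have "x \<noteq> 0" using x by auto
  ultimately show ?thesis using A_vge[OF x(1) w(1)] by (cases "w = v") (auto simp: vge_def)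
qed

lemma vge_poly_pole:
  assumes x: "v x < 0" and p: "p \<in> KP" "degree p \<le> m"
  shows "vge v (int m * v x) (poly p x)"
  unfolding poly_altdef
proof (rule vge_sum[OF place_v])
  fix i assume i: "i \<in> {..degree p}"
  have x0: "x \<noteq> 0" using x place_0[OF place_v] by auto
  have "vge v (0 + int i * v x) (coeff p i * x ^ i)"
    using x0 by (intro vge_mult place_v vge_K KP_D p) (simp add: vge_def place_power[OF place_v])
  moreover have "int m * v x \<le> 0 + int i * v x" using i x p(2) by (auto intro!: mult_right_mono_neg)
  ultimately show "vge v (int m * v x) (coeff p i * x ^ i)" by (rule vge_mono)
qed

text \<open>At a pole of x the leading term has strictly the smallest value, and its coefficient is
  a nonzero constant, of value 0.\<close>

lemma place_poly_pole:
  assumes x: "v x < 0" and p: "p \<in> KP" "p \<noteq> 0"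
  shows "poly p x \<noteq> 0" "v (poly p x) = int (degree p) * v x"
proof -
  have x0: "x \<noteq> 0" using x place_0[OF place_v] by auto
  let ?d = "degree p"
  have l: "lead_coeff p \<noteq> 0" using p by simp
  have vl: "v (lead_coeff p * x ^ ?d) = int ?d * v x"
    using place_mult[OF place_v l, of "x ^ ?d"] place_K[OF place_v KP_D[OF p(1)]] place_power[OF place_v x0] x0 by simp
  have "vge v (int ?d * v x + 1) (\<Sum>i<?d. coeff p i * x ^ i)"
  proof (rule vge_sum[OF place_v])
    fix i assume i: "i \<in> {..<?d}"
    have "vge v (0 + int i * v x) (coeff p i * x ^ i)"
      using x0 by (intro vge_mult place_v vge_K KP_D p) (simp add: vge_def place_power[OF place_v])
    moreover have "int ?d * v x + 1 \<le> 0 + int i * v x"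
    proof -
      have "int ?d * v x \<le> (int i + 1) * v x" using i x by (intro mult_right_mono_neg) auto
      then show ?thesis using x by (simp add: distrib_right)
    qed
    ultimately show "vge v (int ?d * v x + 1) (coeff p i * x ^ i)" by (rule vge_mono)
  qed
  then have *: "vge v (v (lead_coeff p * x ^ ?d) + 1) (\<Sum>i<?d. coeff p i * x ^ i)" unfolding vl .
  have "poly p x = lead_coeff p * x ^ ?d + (\<Sum>i<?d. coeff p i * x ^ i)"
    unfolding poly_altdef by (simp add: lessThan_Suc_atMost[symmetric])
  then show "poly p x \<noteq> 0" "v (poly p x) = int (degree p) * v x"
    using place_add_strict[OF place_v _ *] vl l x0 by simp_all
qed

text \<open>Let x be a nonconstant element of A and b a basis of F over K(x) inside A. Clearing the
  denominator of the coordinates of f gives the first claim. For the second, the numerators are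
  divided by the denominator p: the quotients make up a, and the remaining coordinates r_i(x)/p(x)
  are regular at v because x has a pole there and r_i is 0 or of smaller degree than p. So f - a is
  bounded by the values of the b i.\<close>

theorem A_fractions_cocompact:
  shows "\<exists>d\<in>A. d \<noteq> 0 \<and> d * f \<in> A" and "\<exists>C. \<forall>f. \<exists>a\<in>A. vge v C (f - a)"
proof -
  obtain x where x: "x \<in> A" "x \<notin> K" using A_nonconstant by blast
  have vx: "v x < 0" by (rule A_pole[OF x])
  obtain N g where Ng: "\<not> dep x N g" and N: "\<And>m g. m > N \<Longrightarrow> dep x m g" by (rule dep_rank) blast
  obtain b where b: "\<not> dep x N b" "\<And>i w. i < N \<Longrightarrow> place w \<Longrightarrow> 0 \<le> w x \<Longrightarrow> vge w 0 (b i)"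
    using Ng by (rule integral_basis[OF x(2)]) blast
  have bA: "b i \<in> A" if "i < N" for i unfolding A_iff
  proof (intro allI impI)
    fix w assume w: "place w" "w \<noteq> v"
    have "0 \<le> w x" using A_vge[OF x(1) w] vge_0_iff[OF w(1)] by blast
    then show "vge w 0 (b i)" by (rule b(2)[OF that w(1)])
  qed
  have pA: "poly p x \<in> A" if "p \<in> KP" for p
    by (rule ring_set_poly[OF A_ring]) (use KP_D[OF that] K_A x in auto)
  show "\<exists>d\<in>A. d \<noteq> 0 \<and> d * f \<in> A"
  proof -
    obtain p c where p: "p \<in> KP" "p \<noteq> 0" "\<And>i. i < N \<Longrightarrow> c i \<in> KP" "poly p x * f = (\<Sum>i<N. poly (c i) x * b i)"
      using dep_span[OF b(1) N, of f] by blast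
    have "poly p x * f \<in> A" unfolding p(4)
      by (intro ring_set_sum[OF A_ring] ring_set_mult[OF A_ring] pA p(3) bA) auto
    then show ?thesis using pA[OF p(1)] place_poly_pole(1)[OF vx p(1,2)] by blast
  qed
  define C where "C = Min (insert 0 ((\<lambda>i. v (b i)) ` {..<N}))"
  have C: "vge v C (b i)" if "i < N" for i unfolding vge_def C_def
    by (rule disjI2, rule Min_le) (use that in auto)
  have "\<exists>a\<in>A. vge v C (f - a)" for f
  proof -
    obtain p c where p: "p \<in> KP" "p \<noteq> 0" "\<And>i. i < N \<Longrightarrow> c i \<in> KP" "poly p x * f = (\<Sum>i<N. poly (c i) x * b i)"
      using dep_span[OF b(1) N, of f] by blast
    have "\<forall>i. \<exists>sr. i < N \<longrightarrow> fst sr \<in> KP \<and> snd sr \<in> KP \<and> c i = p * fst sr + snd sr \<and> (snd sr = 0 \<or> degree (snd sr) < degree p)"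
    proof
      fix i
      show "\<exists>sr. i < N \<longrightarrow> fst sr \<in> KP \<and> snd sr \<in> KP \<and> c i = p * fst sr + snd sr \<and> (snd sr = 0 \<or> degree (snd sr) < degree p)"
      proof (cases "i < N")
        case True
        obtain s r where "s \<in> KP" "r \<in> KP" "c i = p * s + r" "r = 0 \<or> degree r < degree p"
          using KP_euclid[OF p(3)[OF True] p(1,2)] by blast
        then show ?thesis by (intro exI[of _ "(s,r)"]) simp
      qed simp
    qed
    then obtain sr where sr: "\<forall>i. i < N \<longrightarrow> fst (sr i) \<in> KP \<and> snd (sr i) \<in> KP \<and> c i = p * fst (sr i) + snd (sr i)
        \<and> (snd (sr i) = 0 \<or> degree (snd (sr i)) < degree p)" using choice[of "\<lambda>i sr. i < N \<longrightarrow> fst sr \<in> KP \<and> snd sr \<in> KP \<and> c i = p * fst sr + snd sr \<and> (snd sr = 0 \<or> degree (snd sr) < degree p)"] by auto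
    define s where "s i = fst (sr i)" for i
    define r where "r i = snd (sr i)" for i
    have sr: "s i \<in> KP" "r i \<in> KP" "c i = p * s i + r i" "r i = 0 \<or> degree (r i) < degree p" if "i < N" for i
      using sr that by (auto simp: s_def r_def)
    have pn: "poly p x \<noteq> 0" "v (poly p x) = int (degree p) * v x" using place_poly_pole[OF vx p(1,2)] by auto
    define a where "a = (\<Sum>i<N. poly (s i) x * b i)"
    have "a \<in> A" unfolding a_def
      by (intro ring_set_sum[OF A_ring] ring_set_mult[OF A_ring] pA sr bA) auto
    moreover have "vge v C (f - a)"
    proof -
      have "poly p x * (f - a) = (\<Sum>i<N. poly (c i) x * b i - poly p x * (poly (s i) x * b i))"
        unfolding right_diff_distrib p(4) a_def sum_subtractf sum_distrib_left ..
      also have "\<dots> = (\<Sum>i<N. poly (r i) x * b i)"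
        by (intro sum.cong refl) (simp add: sr(3) algebra_simps)
      finally have eq: "poly p x * (f - a) = (\<Sum>i<N. poly (r i) x * b i)" .
      have "vge v (int (degree p) * v x + C) (\<Sum>i<N. poly (r i) x * b i)"
      proof (rule vge_sum[OF place_v])
        fix i assume "i \<in> {..<N}"
        then have i: "i < N" by simp
        have "vge v (int (degree p) * v x) (poly (r i) x)"
          using sr(4)[OF i] by (intro vge_poly_pole vx sr(2) i) auto
        then show "vge v (int (degree p) * v x + C) (poly (r i) x * b i)" by (rule vge_mult[OF place_v _ C[OF i]])
      qed
      then have "vge v (int (degree p) * v x + C) (poly p x * (f - a))" unfolding eq .
      then show ?thesis using pn place_mult[OF place_v pn(1), of "f - a"] by (cases "f - a = 0") (auto simp: vge_def)
    qed
    ultimately show ?thesis by blast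
  qed
  then show "\<exists>C. \<forall>f. \<exists>a\<in>A. vge v C (f - a)" by blast
qed

end

section \<open>From subfields, transcendence and dimension over \<open>class_ring\<close> to the
  locale \<open>function_field\<close>\<close>

lemma class_ring_ring: "ring (class_ring :: 'f::field ring)"
  by (rule cring.axioms(1)[OF domain.axioms(1)[OF field.axioms(1)[OF class_field]]])

lemma class_ring_uminus: "\<ominus>\<^bsub>class_ring\<^esub> x = - (x :: 'f::field)"
  by (simp add: class_ring_simps)

lemma class_ring_inverse: "x \<noteq> 0 \<Longrightarrow> inv\<^bsub>class_ring\<^esub> x = inverse (x :: 'f::field)"
  unfolding m_inv_def by (rule the_equality) (auto simp: inverse_unique)

lemma class_ring_pow: "x [^]\<^bsub>class_ring\<^esub> (n::nat) = (x :: 'f::field) ^ n"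
  by (induction n) (simp_all add: mult.commute)

text \<open>There polynomials are lists with the leading coefficient first, hence the
  \<open>rev\<close>.\<close>

lemma class_ring_eval: "ring.eval class_ring p x = poly (Poly (rev p)) (x :: 'f::field)"
proof (induction p)
  case (Cons a p)
  have "Poly (rev p @ [a]) = Poly (rev p) + monom 1 (length p) * [:a:]"
    by (simp add: Poly_append)
  then show ?case using Cons
    by (simp add: ring.eval.simps[OF class_ring_ring] class_ring_pow poly_monom mult.commute add.commute class_ring_simps)
qed (simp add: ring.eval.simps[OF class_ring_ring])

lemma const_field_class_ring:
  assumes "subfield K (class_ring :: 'f::field ring)" "finite K"
  shows "const_field K"
proof
  interpret sf: subfield K "class_ring :: 'f ring" by fact
  have sr: "subring K (class_ring :: 'f ring)" using assms(1) by (rule subfieldE)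
  note e = subringE[OF sr]
  show "finite K" by fact
  show "0 \<in> K" "1 \<in> K" using e(2,3) by simp_all
  fix x y assume x: "x \<in> K"
  show "y \<in> K \<Longrightarrow> x + y \<in> K" "y \<in> K \<Longrightarrow> x * y \<in> K" using e(6,7) x by auto
  show "- x \<in> K" using e(5)[OF x] by (simp only: class_ring_uminus)
  show "inverse x \<in> K"
  proof (cases "x = 0")
    case False
    then have "inv\<^bsub>class_ring\<^esub> x \<in> K"
      using ring.subfield_m_inv(1)[OF class_ring_ring assms(1), of x] x by auto
    then show ?thesis by (simp only: class_ring_inverse[OF False])
  qed (use \<open>0 \<in> K\<close> in simp)
qed

text \<open>Transcendence is defined by injectivity of evaluation on K[X]; evaluation being
  additive, this is the vanishing of its kernel.\<close>

lemma transcendental_iff: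
  assumes "subfield K (class_ring :: 'f::field ring)" "finite K"
  shows "ring.transcendental class_ring K x \<longleftrightarrow> (\<forall>p\<in>const_field.KP K. poly p (x :: 'f) = 0 \<longrightarrow> p = 0)"
proof -
  interpret c: const_field K by (rule const_field_class_ring) fact+
  have carr: "p \<in> carrier (univ_poly class_ring K) \<longleftrightarrow> p = [] \<or> (set p \<subseteq> K \<and> hd p \<noteq> 0)" for p :: "'f list"
    by (simp add: univ_poly_def polynomial_def)
  have PKP: "Poly (rev p) \<in> c.KP" if "p \<in> carrier (univ_poly class_ring K)" for p
  proof (rule c.KP_I)
    fix i
    have "rev p ! i \<in> K" if "i < length p"
      using \<open>p \<in> carrier _\<close> nth_mem[of i "rev p"] that by (auto simp: carr)
    then show "coeff (Poly (rev p)) i \<in> K" by (simp add: coeff_Poly_eq nth_default_def)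
  qed
  show ?thesis
  proof
    assume tr: "ring.transcendental class_ring K x"
    show "\<forall>p\<in>c.KP. poly p x = 0 \<longrightarrow> p = 0"
    proof (intro ballI impI)
      fix p :: "'f poly" assume p: "p \<in> c.KP" "poly p x = 0"
      have "rev (coeffs p) \<in> carrier (univ_poly class_ring K)"
        using p(1) by (auto simp: carr c.KP_def coeffs_def hd_rev last_coeffs_eq_coeff_degree)
      moreover have "[] \<in> carrier (univ_poly class_ring K)" by (simp add: carr)
      moreover have "ring.eval class_ring (rev (coeffs p)) x = ring.eval class_ring [] x"
        using p(2) by (simp add: class_ring_eval)
      ultimately have "rev (coeffs p) = []"
        using tr unfolding ring.transcendental_def[OF class_ring_ring] inj_on_def by blast
      then show "p = 0" by simp
    qed
  next
    assume a: "\<forall>p\<in>c.KP. poly p x = 0 \<longrightarrow> p = 0"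
    show "ring.transcendental class_ring K x" unfolding ring.transcendental_def[OF class_ring_ring]
    proof (rule inj_onI)
      fix p q assume pq: "p \<in> carrier (univ_poly class_ring K)" "q \<in> carrier (univ_poly class_ring K)"
        "ring.eval class_ring p x = ring.eval class_ring q x"
      have "poly (Poly (rev p) - Poly (rev q)) x = 0" using pq(3) by (simp add: class_ring_eval)
      then have "Poly (rev p) - Poly (rev q) = 0"
        using a c.KP_diff[OF PKP[OF pq(1)] PKP[OF pq(2)]] by blast
      then have eq: "Poly (rev p) = Poly (rev q)" by simp
      have co: "coeffs (Poly (rev p)) = rev p" if "p \<in> carrier (univ_poly class_ring K)" for p
        using that by (cases p) (auto simp: carr coeffs_Poly)
      show "p = q" using co[OF pq(1)] co[OF pq(2)] eq by simp
    qed
  qed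
qed

lemma dimension_span:
  assumes "ring.dimension class_ring n E V"
  shows "\<exists>bs. \<forall>f\<in>V. \<exists>e. (\<forall>i<n. e i \<in> E) \<and> (f :: 'f::field) = (\<Sum>i<n. e i * bs i)"
  using assms
proof (induction rule: ring.dimension.induct[OF class_ring_ring, consumes 1, case_names zero_dim Suc_dim])
  case (zero_dim E)
  then show ?case by auto
next
  case (Suc_dim v V n E)
  then obtain bs where bs: "\<forall>f\<in>V. \<exists>e. (\<forall>i<n. e i \<in> E) \<and> f = (\<Sum>i<n. e i * bs i)" by blast
  show ?case
  proof (rule exI[of _ "bs(n := v)"], rule ballI)
    fix f assume "f \<in> ring.line_extension class_ring E v V"
    then obtain k w where kw: "k \<in> E" "w \<in> V" "f = k * v + w"
      unfolding ring.line_extension_def[OF class_ring_ring] set_add_def set_mult_def r_coset_def by auto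
    obtain e where e: "\<forall>i<n. e i \<in> E" "w = (\<Sum>i<n. e i * bs i)" using bs kw(2) by blast
    show "\<exists>e. (\<forall>i<Suc n. e i \<in> E) \<and> f = (\<Sum>i<Suc n. e i * (bs(n := v)) i)"
      by (rule exI[of _ "e(n := k)"]) (use e kw in \<open>auto simp: less_Suc_eq\<close>)
  qed
qed

text \<open>Induction over the generation of the field. The fraction p(t)/q(t) is kept multiplied
  out, so each closure step is an identity between polynomials in t.\<close>

lemma (in const_field) generate_field_fractions:
  assumes t: "\<And>p. p \<in> KP \<Longrightarrow> p \<noteq> 0 \<Longrightarrow> poly p t \<noteq> 0"
    and h: "h \<in> generate_field class_ring (insert t K)"
  shows "\<exists>p\<in>KP. \<exists>q\<in>KP. q \<noteq> 0 \<and> poly q t * h = poly p t"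
  using h
proof (induction rule: generate_field.induct)
  case one
  show ?case by (intro bexI[of _ 1]) auto
next
  case (incl h)
  have "\<exists>p\<in>KP. h = poly p t"
  proof (cases "h = t")
    case True
    have "[:0,1:] \<in> KP" by (auto simp: KP_def coeff_pCons split: nat.splits)
    then show ?thesis using True by (intro bexI[of _ "[:0,1:]"]) auto
  next
    case False
    then have "[:h:] \<in> KP" using incl by (auto simp: KP_def coeff_pCons split: nat.splits)
    then show ?thesis by (intro bexI[of _ "[:h:]"]) auto
  qed
  then obtain p where "p \<in> KP" "h = poly p t" by blast
  then show ?case by (intro bexI[of _ p] bexI[of _ 1]) auto
next
  case (a_inv h)
  then obtain p q where "p \<in> KP" "q \<in> KP" "q \<noteq> 0" "poly q t * h = poly p t" by blast
  then show ?case by (intro bexI[of _ "- p"] bexI[of _ q]) (auto simp: class_ring_uminus KP_uminus)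
next
  case (m_inv h)
  then obtain p q where pq: "p \<in> KP" "q \<in> KP" "q \<noteq> 0" "poly q t * h = poly p t" by blast
  have h0: "h \<noteq> 0" using m_inv by simp
  have "poly p t \<noteq> 0" using pq t[of q] h0 by (metis mult_eq_0_iff)
  then have "p \<noteq> 0" by auto
  moreover have "poly p t * inverse h = poly q t" using h0 by (simp flip: pq(4))
  ultimately show ?case using pq by (intro bexI[of _ q] bexI[of _ p]) (auto simp: class_ring_inverse[OF h0])
next
  case (eng_add a b)
  then obtain p q p' q' where pq: "p \<in> KP" "q \<in> KP" "q \<noteq> 0" "poly q t * a = poly p t"
    "p' \<in> KP" "q' \<in> KP" "q' \<noteq> 0" "poly q' t * b = poly p' t" by blast
  have "poly (q * q') t * (a + b) = poly (p * q' + p' * q) t"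
    by (simp add: pq(4)[symmetric] pq(8)[symmetric] algebra_simps)
  then show ?case using pq
    by (intro bexI[of _ "p * q' + p' * q"] bexI[of _ "q * q'"]) (auto intro!: KP_add KP_mult)
next
  case (eng_mult a b)
  then obtain p q p' q' where pq: "p \<in> KP" "q \<in> KP" "q \<noteq> 0" "poly q t * a = poly p t"
    "p' \<in> KP" "q' \<in> KP" "q' \<noteq> 0" "poly q' t * b = poly p' t" by blast
  have "poly (q * q') t * (a * b) = poly (p * p') t"
    by (simp add: pq(4)[symmetric] pq(8)[symmetric] algebra_simps)
  then show ?case using pq
    by (intro bexI[of _ "p * p'"] bexI[of _ "q * q'"]) (auto intro!: KP_mult)
qed

lemma (in const_field) common_denominator:
  fixes n :: nat
  assumes "\<And>i. i < n \<Longrightarrow> \<exists>p\<in>KP. \<exists>q\<in>KP. q \<noteq> 0 \<and> poly q t * e i = poly p t"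
  shows "\<exists>Q\<in>KP. Q \<noteq> 0 \<and> (\<exists>c. \<forall>i<n. c i \<in> KP \<and> poly Q t * e i = poly (c i) t)"
  using assms
proof (induction n)
  case 0
  show ?case by (intro bexI[of _ 1]) auto
next
  case (Suc n)
  have "\<exists>Q\<in>KP. Q \<noteq> 0 \<and> (\<exists>c. \<forall>i<n. c i \<in> KP \<and> poly Q t * e i = poly (c i) t)"
    by (rule Suc.IH, rule Suc.prems, rule less_SucI)
  then obtain Q c where Q: "Q \<in> KP" "Q \<noteq> 0" "\<forall>i<n. c i \<in> KP \<and> poly Q t * e i = poly (c i) t" by (elim bexE conjE exE)
  obtain p q where pq: "p \<in> KP" "q \<in> KP" "q \<noteq> 0" "poly q t * e n = poly p t" using Suc.prems[of n] by blast
  have "\<forall>i<Suc n. (\<lambda>i. if i = n then Q * p else q * c i) i \<in> KP \<and>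
      poly (Q * q) t * e i = poly ((\<lambda>i. if i = n then Q * p else q * c i) i) t"
    using Q pq by (auto simp: less_Suc_eq mult_ac intro!: KP_mult)
  then show ?case using Q(1,2) pq(2,3)
    by (intro bexI[of _ "Q * q"] conjI exI[of _ "\<lambda>i. if i = n then Q * p else q * c i"]) (auto intro: KP_mult)
qed

text \<open>A spanning family of F over K(t) becomes the one of \<open>span_t\<close> once the
  coordinates of f are brought to one denominator in K[t]; the exactness of K is
  \<open>alg_K\<close>.\<close>

theorem function_field_of_global:
  assumes "global_function_field (K :: 'f::field set)"
  shows "function_field K"
proof -
  have sf: "subfield K (class_ring :: 'f ring)" and fin: "finite K"
    and alg: "\<And>x. \<not> ring.transcendental class_ring K x \<Longrightarrow> x \<in> K"
    using assms unfolding global_function_field_def by auto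
  obtain t where t: "ring.transcendental class_ring K t"
    and fd: "ring.finite_dimension class_ring (generate_field class_ring (insert t K)) UNIV"
    using assms unfolding global_function_field_def by blast
  interpret const_field K by (rule const_field_class_ring[OF sf fin])
  have nz: "poly p t \<noteq> 0" if "p \<in> KP" "p \<noteq> 0" for p
    using t that unfolding transcendental_iff[OF sf fin] by blast
  obtain n where "ring.dimension class_ring n (generate_field class_ring (insert t K)) UNIV"
    using fd unfolding ring.finite_dimension_def[OF class_ring_ring] by blast
  from dimension_span[OF this] obtain bs where
    bs: "\<forall>f. \<exists>e. (\<forall>i<n. e i \<in> generate_field class_ring (insert t K)) \<and> f = (\<Sum>i<n. e i * bs i)" by blast
  show ?thesis
  proof unfold_locales
    fix x p assume "p \<in> KP" "p \<noteq> 0" "poly p x = 0"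
    then show "x \<in> K" using alg unfolding transcendental_iff[OF sf fin] by blast
  next
    have "t \<notin> K"
    proof
      assume "t \<in> K"
      then have "[:- t, 1:] \<in> KP" using uminus_K by (auto simp: KP_def coeff_pCons split: nat.splits)
      from nz[OF this] show False by simp
    qed
    moreover have "\<exists>p\<in>KP. p \<noteq> 0 \<and> (\<exists>c. (\<forall>i<n. c i \<in> KP) \<and> poly p t * f = (\<Sum>i<n. poly (c i) t * bs i))" for f
    proof -
      obtain e where e: "\<forall>i<n. e i \<in> generate_field class_ring (insert t K)" "f = (\<Sum>i<n. e i * bs i)" using bs by blast
      have "\<exists>Q\<in>KP. Q \<noteq> 0 \<and> (\<exists>c. \<forall>i<n. c i \<in> KP \<and> poly Q t * e i = poly (c i) t)"
        by (rule common_denominator, rule generate_field_fractions[OF nz]) (simp_all add: e(1))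
      then obtain Q c where Q: "Q \<in> KP" "Q \<noteq> 0"
        "\<forall>i<n. c i \<in> KP \<and> poly Q t * e i = poly (c i) t" by (elim bexE conjE exE)
      have "poly Q t * f = (\<Sum>i<n. poly (c i) t * bs i)"
        unfolding e(2) sum_distrib_left using Q(3) by (intro sum.cong refl) (simp flip: mult.assoc)
      then show ?thesis using Q by (intro bexI[of _ Q] conjI exI[of _ c]) auto
    qed
    ultimately show "\<exists>t n bs. t \<notin> K \<and> (\<forall>f. \<exists>p\<in>KP. p \<noteq> 0 \<and>
      (\<exists>c. (\<forall>i<n. c i \<in> KP) \<and> poly p t * f = (\<Sum>i<(n::nat). poly (c i) t * bs i)))" by blast
  qed
qed

section \<open>Finite additive subgroups\<close>

lemma degree_sub_lead:
  fixes p q :: "'a::comm_ring_1 poly"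
  assumes "degree p \<le> n" "degree q \<le> n" "coeff p n = coeff q n" "p - q \<noteq> 0"
  shows "degree (p - q) < n"
proof -
  have "degree (p - q) \<le> n" using assms by (intro degree_diff_le) auto
  moreover have "coeff (p - q) n = 0" using assms(3) by simp
  ultimately show ?thesis using assms(4) by (metis leading_coeff_0_iff le_neq_implies_less)
qed

lemma poly_zero_by_roots:
  fixes p :: "'a::idom poly"
  assumes "finite H" "\<And>h. h \<in> H \<Longrightarrow> poly p h = 0" "p \<noteq> 0 \<Longrightarrow> degree p < card H"
  shows "p = 0"
proof (rule ccontr)
  assume p: "p \<noteq> 0"
  have "card H \<le> card {x. poly p x = 0}" using assms(2) poly_roots_finite[OF p] by (intro card_mono) auto
  also have "\<dots> \<le> degree p" by (rule card_poly_roots_bound[OF p])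
  finally show False using assms(3)[OF p] by simp
qed

text \<open>The geometric series of 1/(a + X).\<close>

lemma fps_linear_inverse:
  fixes a :: "'a::field"
  assumes "a \<noteq> 0"
  shows "fps_of_poly [:a, 1:] * Abs_fps (\<lambda>m. (- 1) ^ m * inverse (a ^ Suc m)) = 1"
proof (rule fps_ext)
  fix n
  have eq: "fps_of_poly [:a, 1:] = fps_const a + fps_X"
    by (rule fps_ext) (auto simp: coeff_pCons fps_X_def split: nat.splits)
  show "fps_nth (fps_of_poly [:a, 1:] * Abs_fps (\<lambda>m. (- 1) ^ m * inverse (a ^ Suc m))) n = fps_nth 1 n"
    unfolding eq distrib_right using assms by (cases n) (simp_all add: field_simps)
qed

locale finite_subgroup =
  fixes H :: "'a::field set"
  assumes finite_H: "finite H" and zero_H: "0 \<in> H"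
    and add_H: "\<And>x y. x \<in> H \<Longrightarrow> y \<in> H \<Longrightarrow> x + y \<in> H" and uminus_H: "\<And>x. x \<in> H \<Longrightarrow> - x \<in> H"
begin

definition P :: "'a poly" where "P = (\<Prod>h\<in>H. [:- h, 1:])"

lemma card_H: "card H > 0"
  using finite_H zero_H by (auto simp: card_gt_0_iff)

lemma degree_linear_prod: "degree (\<Prod>h\<in>H. [:f h, 1::'a:]) = card H" "lead_coeff (\<Prod>h\<in>H. [:f h, 1::'a:]) = 1"
proof -
  show "degree (\<Prod>h\<in>H. [:f h, 1::'a:]) = card H"
    by (subst degree_prod_eq_sum_degree) auto
  show "lead_coeff (\<Prod>h\<in>H. [:f h, 1::'a:]) = 1"
    by (simp only: lead_coeff_prod) simp
qed

lemma P_shift: "pcompose P [:z, 1:] = (\<Prod>h\<in>H. [:z - h, 1:])"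
  unfolding P_def pcompose_prod by (simp add: pcompose_pCons add.commute)

lemma P_root: "h \<in> H \<Longrightarrow> poly P h = 0"
  unfolding P_def poly_prod using finite_H by (intro prod_zero) auto

lemma P_translate: "h \<in> H \<Longrightarrow> poly P (h + z) = poly P z"
proof -
  assume h: "h \<in> H"
  have "poly P (h + z) = (\<Prod>g\<in>H. z - (g - h))" by (simp add: P_def poly_prod algebra_simps)
  also have "\<dots> = (\<Prod>g\<in>H. z - g)"
  proof (rule prod.reindex_bij_witness[of _ "\<lambda>g. g + h" "\<lambda>g. g - h"])
    fix g assume "g \<in> H"
    then show "g + h \<in> H" "g - h \<in> H" using add_H[of g h] add_H[of g "- h"] uminus_H h by auto
  qed auto
  finally show ?thesis by (simp add: P_def poly_prod)
qed

text \<open>P(X + z) and P(X) + P(z) are monic of degree |H| and agree on H, because P is H-periodic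
  and vanishes there. Their difference has more roots than its degree allows.\<close>

lemma P_additive: "pcompose P [:z, 1:] = P + [:poly P z:]"
proof -
  let ?Q = "pcompose P [:z, 1:] - (P + [:poly P z:])"
  have "?Q = 0"
  proof (rule poly_zero_by_roots[OF finite_H])
    fix h assume h: "h \<in> H"
    show "poly ?Q h = 0" using P_root[OF h] P_translate[OF h, of z] by (simp add: poly_pcompose add.commute)
  next
    assume nz: "?Q \<noteq> 0"
    have d1: "degree (pcompose P [:z, 1:]) = card H" "lead_coeff (pcompose P [:z, 1:]) = 1"
      unfolding P_shift by (rule degree_linear_prod)+
    have d2: "degree P = card H" "lead_coeff P = 1" unfolding P_def by (rule degree_linear_prod)+
    have "coeff (P + [:poly P z:]) (card H) = 1" using d2 card_H by (simp add: coeff_pCons split: nat.splits)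
    moreover have "degree (P + [:poly P z:]) \<le> card H" using d2 by (intro degree_add_le) auto
    ultimately show "degree ?Q < card H" using d1 nz by (intro degree_sub_lead) auto
  qed
  then show ?thesis by simp
qed

text \<open>By additivity the derivative is invariant under all translations, so it takes a single
  value; since its degree is below |H|, agreement with a constant on H makes it constant.\<close>

lemma pderiv_P: "pderiv P = [:poly (pderiv P) 0:]"
proof -
  have inv: "pcompose (pderiv P) [:z, 1:] = pderiv P" for z
    using arg_cong[OF P_additive[of z], of pderiv] by (simp add: pderiv_pcompose pderiv_add pderiv_pCons)
  have "poly (pderiv P) z = poly (pderiv P) 0" for z
    using arg_cong[OF inv[of z], of "\<lambda>p. poly p 0"] by (simp add: poly_pcompose)
  note const = this
  have "pderiv P - [:poly (pderiv P) 0:] = 0"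
  proof (rule poly_zero_by_roots[OF finite_H])
    fix h show "poly (pderiv P - [:poly (pderiv P) 0:]) h = 0" using const[of h] by simp
  next
    have "degree P = card H" unfolding P_def by (rule degree_linear_prod)
    then have "degree (pderiv P) \<le> card H - 1"
      by (intro degree_le) (auto simp: coeff_pderiv coeff_eq_0)
    moreover have "degree (pderiv P - [:poly (pderiv P) 0:]) \<le> max (degree (pderiv P)) 0"
      by (rule order_trans[OF degree_diff_le_max]) simp
    ultimately show "degree (pderiv P - [:poly (pderiv P) 0:]) < card H" using card_H by simp
  qed
  then show ?thesis by simp
qed

text \<open>e/X for the exponential polynomial \<open>e\<close> of H. Its coefficient of X^i is that
  of X^(i+1) in \<open>e\<close>, which is the indexing of the recursion for \<open>S\<close> and of
  \<open>exp_coeff\<close>.\<close>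

definition \<epsilon> :: "'a poly" where "\<epsilon> = (\<Prod>h\<in>H - {0}. [:1, - inverse h:])"

definition e :: "'a poly" where "e = [:0, 1:] * \<epsilon>"

lemma e_P: "e = Polynomial.smult (\<Prod>h\<in>H - {0}. - inverse h) P"
proof -
  have "\<epsilon> = (\<Prod>h\<in>H - {0}. Polynomial.smult (- inverse h) [:- h, 1:])"
    unfolding \<epsilon>_def by (rule prod.cong) auto
  also have "\<dots> = Polynomial.smult (\<Prod>h\<in>H - {0}. - inverse h) (\<Prod>h\<in>H - {0}. [:- h, 1:])"
    by (rule prod_smult)
  finally have "e = Polynomial.smult (\<Prod>h\<in>H - {0}. - inverse h) ([:0, 1:] * (\<Prod>h\<in>H - {0}. [:- h, 1:]))"
    by (simp only: e_def mult_smult_right)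
  also have "[:0, 1:] * (\<Prod>h\<in>H - {0}. [:- h, 1:]) = P"
    unfolding P_def using prod.remove[OF finite_H zero_H, of "\<lambda>h. [:- h, 1:]"] by simp
  finally show ?thesis .
qed

lemma poly_e_additive: "poly e (x + y) = poly e x + poly e y"
  using arg_cong[OF P_additive[of x], of "\<lambda>p. poly p y"] by (simp add: e_P poly_pcompose algebra_simps)

lemma pderiv_e: "pderiv e = 1"
proof -
  have "poly \<epsilon> 0 = 1" by (simp add: \<epsilon>_def poly_prod)
  then have "coeff e 1 = 1" by (simp add: e_def poly_0_coeff_0)
  then have "poly (pderiv e) 0 = 1" by (simp add: poly_0_coeff_0 coeff_pderiv)
  moreover have "pderiv e = [:poly (pderiv e) 0:]"
    unfolding e_P pderiv_smult poly_smult by (subst pderiv_P) simp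
  ultimately show ?thesis by (simp add: one_pCons)
qed

definition S :: "nat \<Rightarrow> 'a \<Rightarrow> 'a" where "S k z = (\<Sum>h\<in>H. inverse ((z + h) ^ k))"

text \<open>Logarithmic derivative of D(X) = e(X + z) = e(z) + e(X): as D' = 1, the sum over H of
  1/(z + h + X) equals 1/D. The identity compares coefficients of X^m in D times this sum, where
  \<open>S\<close> enters through the geometric series of the summands.\<close>

lemma generating_identity:
  assumes z: "z \<notin> H"
  shows "(\<Sum>i=0..m. (if i = 0 then poly e z else coeff e i) * ((- 1) ^ (m - i) * S (Suc (m - i)) z)) = (if m = 0 then 1 else 0)"
proof -
  define c where "c = (\<Prod>h\<in>H - {0}. - inverse h)"
  define D where "D = Polynomial.smult c (\<Prod>h\<in>H. [:z + h, 1:])"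
  have neg: "(\<Prod>h\<in>H. [:z - h, 1:]) = (\<Prod>h\<in>H. [:z + h, 1:])"
  proof (rule prod.reindex_bij_witness[of _ uminus uminus])
    fix h assume "h \<in> H"
    then show "- h \<in> H" "- h \<in> H" by (rule uminus_H)+
  qed simp_all
  have "D = pcompose e [:z, 1:]" unfolding D_def e_P c_def pcompose_smult P_shift neg ..
  also have "\<dots> = e + [:poly e z:]" by (simp add: e_P pcompose_smult P_additive smult_add_right)
  finally have D: "D = e + [:poly e z:]" .
  have "pderiv D = 1" unfolding D by (simp add: pderiv_add pderiv_e pderiv_pCons)
  then have dD: "Polynomial.smult c (\<Sum>h\<in>H. \<Prod>g\<in>H - {h}. [:z + g, 1:]) = 1"
    unfolding D_def pderiv_smult pderiv_prod by (simp add: pderiv_pCons)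
  define G where "G h = Abs_fps (\<lambda>m. (- 1) ^ m * inverse ((z + h) ^ Suc m))" for h
  have G: "fps_of_poly [:z + h, 1:] * G h = 1" if h: "h \<in> H" for h
  proof -
    have "z + h \<noteq> 0"
    proof
      assume "z + h = 0"
      then have "z = - h" by (simp add: eq_neg_iff_add_eq_0)
      with z uminus_H[OF h] show False by simp
    qed
    then show ?thesis unfolding G_def by (rule fps_linear_inverse)
  qed
  have "fps_of_poly D * (\<Sum>h\<in>H. G h) = (\<Sum>h\<in>H. fps_of_poly D * G h)" by (simp add: sum_distrib_left)
  also have "\<dots> = (\<Sum>h\<in>H. fps_of_poly (Polynomial.smult c (\<Prod>g\<in>H - {h}. [:z + g, 1:])))"
  proof (rule sum.cong[OF refl])
    fix h assume h: "h \<in> H"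
    have "D = Polynomial.smult c (\<Prod>g\<in>H - {h}. [:z + g, 1:]) * [:z + h, 1:]"
      unfolding D_def by (subst prod.remove[OF finite_H h]) (simp only: mult_smult_left mult_smult_right mult.commute)
    then have "fps_of_poly D * G h = fps_of_poly (Polynomial.smult c (\<Prod>g\<in>H - {h}. [:z + g, 1:])) * (fps_of_poly [:z + h, 1:] * G h)"
      by (simp only: fps_of_poly_mult mult.assoc)
    then show "fps_of_poly D * G h = fps_of_poly (Polynomial.smult c (\<Prod>g\<in>H - {h}. [:z + g, 1:]))"
      by (simp only: G[OF h] mult_1_right)
  qed
  also have "\<dots> = fps_of_poly (Polynomial.smult c (\<Sum>h\<in>H. \<Prod>g\<in>H - {h}. [:z + g, 1:]))"
    unfolding fps_of_poly_sum[symmetric]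
    by (rule arg_cong[of _ _ fps_of_poly], rule poly_eqI) (simp add: coeff_sum sum_distrib_left)
  also have "\<dots> = 1" by (simp only: dD fps_of_poly_1)
  finally have id: "fps_of_poly D * (\<Sum>h\<in>H. G h) = 1" .
  have e0: "coeff e 0 = 0" by (simp add: e_def)
  have Dn: "fps_nth (fps_of_poly D) i = (if i = 0 then poly e z else coeff e i)" for i
    by (auto simp: D e0 coeff_pCons split: nat.splits)
  have Gn: "fps_nth (\<Sum>h\<in>H. G h) i = (- 1) ^ i * S (Suc i) z" for i
    by (simp add: fps_sum_nth G_def S_def sum_distrib_left)
  have "fps_nth (fps_of_poly D * (\<Sum>h\<in>H. G h)) m = fps_nth 1 m" by (simp only: id)
  then show ?thesis unfolding fps_mult_nth Dn Gn fps_one_nth .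
qed

lemma S_1: "z \<notin> H \<Longrightarrow> poly e z * S 1 z = 1"
  using generating_identity[of z 0] by simp

lemma e_nonzero: "z \<notin> H \<Longrightarrow> poly e z \<noteq> 0"
  using S_1 by fastforce

text \<open>Together with \<open>S_1\<close> this makes \<open>S k z\<close> a polynomial without
  constant term in 1/e(z): the k-th Goss polynomial of H.\<close>

lemma S_rec:
  assumes z: "z \<notin> H" and m: "m > 0"
  shows "S (Suc m) z = inverse (poly e z) * (\<Sum>i<m. (- 1) ^ i * coeff \<epsilon> i * S (m - i) z)"
proof -
  have c: "coeff e (Suc i) = coeff \<epsilon> i" for i by (simp add: e_def)
  have "poly e z * ((- 1) ^ m * S (Suc m) z) + (\<Sum>i<m. coeff \<epsilon> i * ((- 1) ^ (m - Suc i) * S (m - i) z)) = 0"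
  proof -
    have "(\<Sum>i=0..m. (if i = 0 then poly e z else coeff e i) * ((- 1) ^ (m - i) * S (Suc (m - i)) z))
      = poly e z * ((- 1) ^ m * S (Suc m) z) + (\<Sum>i<m. coeff e (Suc i) * ((- 1) ^ (m - Suc i) * S (Suc (m - Suc i)) z))"
      by (simp add: atLeast0AtMost sum.atMost_shift)
    moreover have "(\<Sum>i<m. coeff e (Suc i) * ((- 1) ^ (m - Suc i) * S (Suc (m - Suc i)) z))
      = (\<Sum>i<m. coeff \<epsilon> i * ((- 1) ^ (m - Suc i) * S (m - i) z))"
      by (rule sum.cong) (auto simp: c Suc_diff_Suc)
    ultimately show ?thesis using generating_identity[OF z, of m] m by simp
  qed
  then have "(- 1) ^ m * (poly e z * ((- 1) ^ m * S (Suc m) z))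
    = - ((- 1) ^ m * (\<Sum>i<m. coeff \<epsilon> i * ((- 1) ^ (m - Suc i) * S (m - i) z)))"
    by (simp add: add_eq_0_iff2)
  also have "\<dots> = (\<Sum>i<m. (- 1) ^ i * coeff \<epsilon> i * S (m - i) z)"
    unfolding sum_distrib_left sum_negf[symmetric]
  proof (rule sum.cong[OF refl])
    fix i assume i: "i \<in> {..<m}"
    have "(- 1) ^ m * (- 1) ^ (m - Suc i) = ((- 1) ^ (m + (m - Suc i)) :: 'a)" by (simp add: power_add)
    also have "m + (m - Suc i) = 2 * (m - Suc i) + Suc i" using i by auto
    also have "(- 1) ^ (2 * (m - Suc i) + Suc i) = (- ((- 1) ^ i) :: 'a)" by (simp add: power_add power_mult)
    finally have s: "(- 1) ^ m * (- 1) ^ (m - Suc i) = (- ((- 1) ^ i) :: 'a)" .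
    have "- ((- 1) ^ m * (coeff \<epsilon> i * ((- 1) ^ (m - Suc i) * S (m - i) z)))
      = - (((- 1) ^ m * (- 1) ^ (m - Suc i)) * (coeff \<epsilon> i * S (m - i) z))" by (simp only: mult_ac)
    then show "- ((- 1) ^ m * (coeff \<epsilon> i * ((- 1) ^ (m - Suc i) * S (m - i) z))) = (- 1) ^ i * coeff \<epsilon> i * S (m - i) z"
      unfolding s by simp
  qed
  finally have "(- 1) ^ m * (poly e z * ((- 1) ^ m * S (Suc m) z)) = (\<Sum>i<m. (- 1) ^ i * coeff \<epsilon> i * S (m - i) z)" .
  moreover have "(- 1) ^ m * (poly e z * ((- 1) ^ m * S (Suc m) z)) = poly e z * S (Suc m) z"
  proof -
    have "(- 1) ^ m * (- 1) ^ m = (1::'a)" by (simp flip: power_add add: mult_2[symmetric] power_mult)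
    moreover have "(- 1) ^ m * (x * ((- 1) ^ m * w)) = ((- 1) ^ m * (- 1) ^ m) * (x * w)" for x w :: 'a
      by (simp only: mult_ac)
    ultimately show ?thesis by simp
  qed
  ultimately show ?thesis using e_nonzero[OF z] by (simp add: field_simps)
qed

end

section \<open>Summation over an ultrametric field\<close>

text \<open>The sort of \<open>'c\<close> puts a field structure next to a complete metric without
  relating them; the three assumptions do so, and the rules for limits and sums below are derived
  from them through \<open>absv\<close>. The parameter \<open>ty\<close> names the type.\<close>

locale ultrametric =
  fixes ty :: "'c::{field,complete_space} itself"
  assumes dist_absv: "dist (x::'c) y = absv (x - y)"
    and absv_mult: "absv (x * y :: 'c) = absv x * absv y"
    and absv_add: "absv (x + y :: 'c) \<le> max (absv x) (absv y)"
begin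

lemma absv_nonneg [simp]: "0 \<le> absv (x::'c)" by (simp add: absv_def)
lemma absv_zero [simp]: "absv (0::'c) = 0" by (simp add: absv_def)
lemma absv_eq_0 [simp]: "absv (x::'c) = 0 \<longleftrightarrow> x = 0" by (simp add: absv_def)
lemma absv_pos [simp]: "0 < absv (x::'c) \<longleftrightarrow> x \<noteq> 0" by (simp add: absv_def)

lemma absv_one [simp]: "absv (1::'c) = 1"
  using absv_mult[of 1 1] absv_eq_0[of 1] by (metis mult_cancel_left1 mult_1 one_neq_zero)

lemma absv_uminus [simp]: "absv (- x::'c) = absv x"
proof -
  have "absv (-1::'c) * absv (-1::'c) = 1" using absv_mult[of "-1" "-1"] by simp
  then have "absv (-1::'c) = 1" using absv_nonneg[of "-1"] by (simp add: square_eq_1_iff)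
  then show ?thesis using absv_mult[of "-1" x] by simp
qed

lemma absv_minus_commute: "absv (x - y :: 'c) = absv (y - x)"
  using absv_uminus[of "x - y"] by simp

lemma absv_inverse: "absv (inverse x :: 'c) = inverse (absv x)"
proof (cases "x = 0")
  case False
  then have "absv x * absv (inverse x) = 1" using absv_mult[of x "inverse x"] by simp
  then show ?thesis by (metis inverse_unique)
qed simp

lemma absv_power: "absv (x ^ n :: 'c) = absv x ^ n"
  by (induction n) (auto simp: absv_mult)

lemma absv_add_le: "absv (x::'c) \<le> B \<Longrightarrow> absv y \<le> B \<Longrightarrow> absv (x + y) \<le> B"
  using absv_add[of x y] by simp

lemma absv_diff_le: "absv (x::'c) \<le> B \<Longrightarrow> absv y \<le> B \<Longrightarrow> absv (x - y) \<le> B"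
  using absv_add_le[of x B "- y"] by simp

lemma absv_trans_le: "absv (x - y::'c) \<le> B \<Longrightarrow> absv (y - z) \<le> B \<Longrightarrow> absv (x - z) \<le> B"
  using absv_add_le[of "x - y" B "y - z"] by simp

lemma absv_sum_le: "(\<And>i. i \<in> I \<Longrightarrow> absv (f i :: 'c) \<le> B) \<Longrightarrow> 0 \<le> B \<Longrightarrow> absv (sum f I) \<le> B"
  by (induction I rule: infinite_finite_induct) (auto intro: absv_add_le)

lemma absv_eq_of_diff:
  assumes "absv (x - y::'c) < absv x" shows "absv y = absv x"
proof -
  have "absv y \<le> absv x" using absv_diff_le[of x "absv x" "x - y"] assms by simp
  moreover have "absv x \<le> max (absv (x - y)) (absv y)" using absv_add[of "x - y" y] by simp
  ultimately show ?thesis using assms by linarith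
qed

lemma absv_add_eq: "absv (y::'c) < absv x \<Longrightarrow> absv (x + y) = absv x"
  using absv_eq_of_diff[of x "x + y"] by simp

lemma tendsto_absv: "(f \<longlongrightarrow> (l::'c)) F \<longleftrightarrow> (\<forall>e>0. eventually (\<lambda>x. absv (f x - l) < e) F)"
  by (simp add: tendsto_iff dist_absv)

lemma tendsto_add_absv:
  assumes "(f \<longlongrightarrow> (a::'c)) F" "(g \<longlongrightarrow> b) F" shows "((\<lambda>x. f x + g x) \<longlongrightarrow> a + b) F"
  unfolding tendsto_absv
proof (intro allI impI)
  fix e :: real assume e: "e > 0"
  show "eventually (\<lambda>x. absv (f x + g x - (a + b)) < e) F"
    using assms[unfolded tendsto_absv, rule_format, OF e]
  proof eventually_elim
    case (elim x)
    then show ?case using absv_add[of "f x - a" "g x - b"] by (simp add: algebra_simps)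
  qed
qed

lemma tendsto_mult_absv:
  assumes f: "(f \<longlongrightarrow> (a::'c)) F" and g: "(g \<longlongrightarrow> b) F" shows "((\<lambda>x. f x * g x) \<longlongrightarrow> a * b) F"
  unfolding tendsto_absv
proof (intro allI impI)
  fix e :: real assume e: "e > 0"
  define M where "M = max 1 (max (absv a) (absv b))"
  have M: "1 \<le> M" "absv a \<le> M" "absv b \<le> M" by (auto simp: M_def)
  define d where "d = min 1 (e / M)"
  have d: "0 < d" "d \<le> 1" "d * M \<le> e" using e M by (auto simp: d_def min_def field_simps)
  show "eventually (\<lambda>x. absv (f x * g x - a * b) < e) F"
    using f[unfolded tendsto_absv, rule_format, OF d(1)] g[unfolded tendsto_absv, rule_format, OF d(1)]
  proof eventually_elim
    case (elim x)
    have gx: "absv (g x) \<le> M" using absv_add_le[of "g x - b" M b] elim(2) d M by simp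
    have "absv ((f x - a) * g x) < e"
    proof -
      have "absv ((f x - a) * g x) \<le> absv (f x - a) * M" unfolding absv_mult using gx by (intro mult_left_mono) auto
      also have "\<dots> < d * M" using elim M by (intro mult_strict_right_mono) auto
      finally show ?thesis using d by simp
    qed
    moreover have "absv (a * (g x - b)) < e"
    proof -
      have "absv (a * (g x - b)) \<le> M * absv (g x - b)" unfolding absv_mult using M by (intro mult_right_mono) auto
      also have "\<dots> < M * d" using elim M by (intro mult_strict_left_mono) auto
      finally show ?thesis using d by (simp add: mult.commute)
    qed
    moreover have "f x * g x - a * b = (f x - a) * g x + a * (g x - b)" by (simp add: algebra_simps)
    ultimately show ?case using absv_add[of "(f x - a) * g x" "a * (g x - b)"] by simp
  qed
qed

lemma tendsto_sum_absv:
  "(\<And>i. i \<in> I \<Longrightarrow> (f i \<longlongrightarrow> (a i::'c)) F) \<Longrightarrow> ((\<lambda>x. \<Sum>i\<in>I. f i x) \<longlongrightarrow> (\<Sum>i\<in>I. a i)) F"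
  by (induction I rule: infinite_finite_induct) (auto intro: tendsto_add_absv)

lemma has_sum_absv:
  "(f has_sum (s::'c)) I \<longleftrightarrow> (\<forall>e>0. \<exists>F0. finite F0 \<and> F0 \<subseteq> I \<and> (\<forall>F. finite F \<longrightarrow> F0 \<subseteq> F \<longrightarrow> F \<subseteq> I \<longrightarrow> absv (sum f F - s) < e))"
  unfolding has_sum_def tendsto_absv eventually_finite_subsets_at_top by (simp only: imp_conjL)

lemma has_sum_absvE:
  assumes "(f has_sum (s::'c)) I" "e > 0"
  obtains F0 where "finite F0" "F0 \<subseteq> I" "\<forall>F. finite F \<longrightarrow> F0 \<subseteq> F \<longrightarrow> F \<subseteq> I \<longrightarrow> absv (sum f F - s) < e"
proof -
  from assms(1)[unfolded has_sum_absv, rule_format, OF assms(2)]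
  obtain F0 where F0: "finite F0 \<and> F0 \<subseteq> I \<and> (\<forall>F. finite F \<longrightarrow> F0 \<subseteq> F \<longrightarrow> F \<subseteq> I \<longrightarrow> absv (sum f F - s) < e)" ..
  show ?thesis by (rule that[of F0]) (use F0 in simp_all)
qed

text \<open>The terms tend to 0 along complements of finite sets, which suffices for summability
  over a complete ultrametric field.\<close>

definition vanishing :: "('i \<Rightarrow> 'c) \<Rightarrow> 'i set \<Rightarrow> bool" where
  "vanishing f I \<longleftrightarrow> (\<forall>e>0. finite {i \<in> I. e \<le> absv (f i)})"

lemma vanishing_subset: "vanishing f I \<Longrightarrow> J \<subseteq> I \<Longrightarrow> vanishing f J"
  unfolding vanishing_def
proof (intro allI impI)
  fix e :: real assume "\<forall>e>0. finite {i \<in> I. e \<le> absv (f i)}" "J \<subseteq> I" "e > 0"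
  then have "finite {i \<in> I. e \<le> absv (f i)}" "{i \<in> J. e \<le> absv (f i)} \<subseteq> {i \<in> I. e \<le> absv (f i)}" by auto
  then show "finite {i \<in> J. e \<le> absv (f i)}" by (rule rev_finite_subset)
qed

text \<open>A finite sum is no larger than its largest term, so the error of a partial sum is
  governed by the size of the omitted terms and not by their number.\<close>

lemma has_sum_error:
  assumes s: "(f has_sum (s::'c)) I" and F: "finite F" "F \<subseteq> I" and e: "e > 0" "\<And>i. i \<in> I - F \<Longrightarrow> absv (f i) \<le> e"
  shows "absv (s - sum f F) \<le> e"
proof -
  obtain F0 where F0: "finite F0" "F0 \<subseteq> I" "\<forall>G. finite G \<longrightarrow> F0 \<subseteq> G \<longrightarrow> G \<subseteq> I \<longrightarrow> absv (sum f G - s) < e"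
    by (rule has_sum_absvE[OF s e(1)])
  have "absv (sum f (F0 \<union> F) - s) < e" using F F0(1,2) by (intro F0(3)[rule_format]) auto
  moreover have "sum f (F0 \<union> F) = sum f F + sum f (F0 - F)"
    using F(1) F0(1) by (subst sum.union_disjoint[symmetric]) (auto intro!: arg_cong[of _ _ "sum f"])
  moreover have "absv (sum f (F0 - F)) \<le> e" using F0(2) e by (intro absv_sum_le) auto
  ultimately show ?thesis using absv_diff_le[of "sum f (F0 - F)" e "sum f (F0 \<union> F) - s"] by (simp add: algebra_simps)
qed

lemma has_sumI_vanishing:
  assumes v: "\<And>e. e > 0 \<Longrightarrow> \<exists>F. finite F \<and> F \<subseteq> I \<and> (\<forall>i\<in>I - F. absv (f i) \<le> e) \<and> absv (sum f F - s) \<le> e"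
  shows "(f has_sum (s::'c)) I"
  unfolding has_sum_absv
proof (intro allI impI)
  fix e :: real assume e: "e > 0"
  then have "e / 2 > 0" by simp
  from v[OF this] obtain F where F: "finite F" "F \<subseteq> I" "\<forall>i\<in>I - F. absv (f i) \<le> e / 2" "absv (sum f F - s) \<le> e / 2"
    by (elim exE conjE)
  show "\<exists>F0. finite F0 \<and> F0 \<subseteq> I \<and> (\<forall>F. finite F \<longrightarrow> F0 \<subseteq> F \<longrightarrow> F \<subseteq> I \<longrightarrow> absv (sum f F - s) < e)"
  proof (intro exI[of _ F] conjI allI impI F(1,2))
    fix G assume G: "finite G" "F \<subseteq> G" "G \<subseteq> I"
    have "sum f G = sum f F + sum f (G - F)" using sum.subset_diff[OF G(2,1), of f] by (simp add: add.commute)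
    moreover have "absv (sum f (G - F)) \<le> e / 2" using F(3) G e by (intro absv_sum_le) auto
    ultimately have "absv (sum f G - s) \<le> e / 2"
      using absv_add_le[OF F(4), of "sum f (G - F)"] by (simp add: algebra_simps)
    then show "absv (sum f G - s) < e" using e by simp
  qed
qed

text \<open>The partial sums over the finitely many terms of size at least 1/(n + 1) form a Cauchy
  sequence.\<close>

lemma vanishing_summable:
  assumes v: "vanishing f I" shows "(f has_sum (infsum f I :: 'c)) I"
proof -
  define P where "P n = {i \<in> I. inverse (real (Suc n)) \<le> absv (f i)}" for n
  have finP: "finite (P n)" for n
    unfolding P_def by (rule v[unfolded vanishing_def, rule_format]) simp
  have close: "absv (sum f G - sum f (P n)) \<le> inverse (real (Suc n))" if "finite G" "P n \<subseteq> G" "G \<subseteq> I" for G n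
  proof -
    have "sum f G - sum f (P n) = sum f (G - P n)" using sum_diff[OF that(1,2), of f] by simp
    also have "absv \<dots> \<le> inverse (real (Suc n))" using that(3) by (intro absv_sum_le) (auto simp: P_def)
    finally show ?thesis .
  qed
  have Pmono: "P n \<subseteq> P m" if "n \<le> m" for n m
    using that unfolding P_def by (auto intro: order_trans[rotated] le_imp_inverse_le)
  have PI: "P n \<subseteq> I" for n by (auto simp: P_def)
  have "Cauchy (\<lambda>n. sum f (P n))"
  proof (rule metric_CauchyI)
    fix e :: real assume "e > 0"
    then obtain M where M: "inverse (real (Suc M)) < e" using reals_Archimedean by blast
    have c: "absv (sum f (P m) - sum f (P M)) \<le> inverse (real (Suc M))" if "m \<ge> M" for m
      using close[OF finP Pmono[OF that] PI] .
    show "\<exists>M. \<forall>m\<ge>M. \<forall>n\<ge>M. dist (sum f (P m)) (sum f (P n)) < e"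
    proof (intro exI[of _ M] allI impI)
      fix m n assume mn: "M \<le> m" "M \<le> n"
      have "absv (sum f (P M) - sum f (P n)) \<le> inverse (real (Suc M))"
        using c[OF mn(2)] by (simp only: absv_minus_commute[of "sum f (P M)"])
      from absv_trans_le[OF c[OF mn(1)] this]
      show "dist (sum f (P m)) (sum f (P n)) < e" using M unfolding dist_absv by linarith
    qed
  qed
  then have "convergent (\<lambda>n. sum f (P n))" by (rule Cauchy_convergent)
  then obtain s where s: "(\<lambda>n. sum f (P n)) \<longlonglongrightarrow> s" unfolding convergent_def ..
  have "(f has_sum s) I"
  proof (rule has_sumI_vanishing)
    fix e :: real assume e: "e > 0"
    then obtain M where M: "inverse (real (Suc M)) < e" using reals_Archimedean by blast
    obtain M' where M': "\<forall>n\<ge>M'. absv (sum f (P n) - s) < e"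
      using s[unfolded tendsto_absv eventually_sequentially, rule_format, OF e] ..
    let ?n = "max M M'"
    have h: "inverse (real (Suc ?n)) \<le> inverse (real (Suc M))" by (intro le_imp_inverse_le) auto
    have "absv (f i) \<le> e" if "i \<in> I - P ?n" for i
    proof -
      have "absv (f i) < inverse (real (Suc ?n))" using that by (auto simp: P_def not_le simp del: of_nat_Suc)
      then show ?thesis using h M by linarith
    qed
    then show "\<exists>F. finite F \<and> F \<subseteq> I \<and> (\<forall>i\<in>I - F. absv (f i) \<le> e) \<and> absv (sum f F - s) \<le> e"
      using finP PI M'[rule_format, of ?n] by (intro exI[of _ "P ?n"]) (auto intro: less_imp_le)
  qed
  moreover from this have "infsum f I = s" by (rule infsumI)
  ultimately show ?thesis by simp
qed

lemma has_sum_cmult: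
  assumes "c \<noteq> (0::'c)"
  shows "((\<lambda>i. c * f i) has_sum c * s) I \<longleftrightarrow> (f has_sum s) I"
proof -
  have *: "((\<lambda>i. d * g i) has_sum d * t) I" if "(g has_sum t) I" for d t :: 'c and g
    unfolding has_sum_def sum_distrib_left[symmetric]
    using that unfolding has_sum_def by (intro tendsto_mult_absv tendsto_const)
  show ?thesis
  proof
    assume "((\<lambda>i. c * f i) has_sum c * s) I"
    from *[OF this, of "inverse c"] show "(f has_sum s) I" using assms by (simp flip: mult.assoc)
  qed (rule *)
qed

text \<open>For nonzero c the equation also holds when f is not summable: both sums then have the
  default value 0.\<close>

lemma infsum_cmult:
  assumes "c \<noteq> (0::'c)" shows "infsum (\<lambda>i. c * f i) I = c * infsum f I"
proof (cases "f summable_on I")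
  case True
  then show ?thesis using has_sum_cmult[OF assms, where f = f and s = "infsum f I" and I = I] by (intro infsumI) simp
next
  case False
  have "\<not> (\<lambda>i. c * f i) summable_on I"
  proof
    assume "(\<lambda>i. c * f i) summable_on I"
    then obtain s where "((\<lambda>i. c * f i) has_sum s) I" unfolding summable_on_def by blast
    then have "(f has_sum inverse c * s) I" using has_sum_cmult[OF assms, where f = f and s = "inverse c * s" and I = I] assms by (simp flip: mult.assoc)
    then show False using False unfolding summable_on_def by blast
  qed
  then show ?thesis using False by (simp add: infsum_not_exists)
qed

lemma has_sum_union:
  assumes f: "(f has_sum (a::'c)) I" and g: "(f has_sum b) J" and dis: "I \<inter> J = {}"
  shows "(f has_sum a + b) (I \<union> J)"
  unfolding has_sum_absv
proof (intro allI impI)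
  fix e :: real assume e: "e > 0"
  obtain F1 where F1: "finite F1" "F1 \<subseteq> I" "\<forall>F. finite F \<longrightarrow> F1 \<subseteq> F \<longrightarrow> F \<subseteq> I \<longrightarrow> absv (sum f F - a) < e"
    by (rule has_sum_absvE[OF f e])
  obtain F2 where F2: "finite F2" "F2 \<subseteq> J" "\<forall>F. finite F \<longrightarrow> F2 \<subseteq> F \<longrightarrow> F \<subseteq> J \<longrightarrow> absv (sum f F - b) < e"
    by (rule has_sum_absvE[OF g e])
  show "\<exists>F0. finite F0 \<and> F0 \<subseteq> I \<union> J \<and> (\<forall>F. finite F \<longrightarrow> F0 \<subseteq> F \<longrightarrow> F \<subseteq> I \<union> J \<longrightarrow> absv (sum f F - (a + b)) < e)"
  proof (intro exI[of _ "F1 \<union> F2"] conjI allI impI)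
    fix F assume F: "finite F" "F1 \<union> F2 \<subseteq> F" "F \<subseteq> I \<union> J"
    have "sum f F = sum f (F \<inter> I) + sum f (F \<inter> J)"
      using F dis by (subst sum.union_disjoint[symmetric]) (auto intro!: arg_cong[of _ _ "sum f"])
    moreover have "absv (sum f (F \<inter> I) - a) < e" using F F1 by (intro F1(3)[rule_format]) auto
    moreover have "absv (sum f (F \<inter> J) - b) < e" using F F2 by (intro F2(3)[rule_format]) auto
    ultimately show "absv (sum f F - (a + b)) < e"
      using absv_add[of "sum f (F \<inter> I) - a" "sum f (F \<inter> J) - b"] by (simp add: algebra_simps)
  qed (use F1 F2 in auto)
qed

text \<open>Let P be the finite set of pairs with terms of size at least e. Rows not meeting P have
  sums of size at most e; the total, and the sum of the remaining row sums, both differ from the sum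
  over P by at most e.\<close>

lemma has_sum_Sigma_absv:
  assumes v: "vanishing f (Sigma I J)"
  shows "((\<lambda>i. infsum (\<lambda>j. f (i, j)) (J i)) has_sum (infsum f (Sigma I J) :: 'c)) I"
    and "i \<in> I \<Longrightarrow> vanishing (\<lambda>j. f (i, j)) (J i)"
proof -
  have slice: "vanishing (\<lambda>j. f (i, j)) (J i)" if "i \<in> I" for i
    unfolding vanishing_def
  proof (intro allI impI)
    fix e :: real assume "e > 0"
    then have "finite {z \<in> Sigma I J. e \<le> absv (f z)}" by (rule v[unfolded vanishing_def, rule_format])
    then have "finite (snd ` {z \<in> Sigma I J. e \<le> absv (f z)})" by simp
    moreover have "{j \<in> J i. e \<le> absv (f (i, j))} \<subseteq> snd ` {z \<in> Sigma I J. e \<le> absv (f z)}"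
      using that by force
    ultimately show "finite {j \<in> J i. e \<le> absv (f (i, j))}" by (rule rev_finite_subset)
  qed
  then show "i \<in> I \<Longrightarrow> vanishing (\<lambda>j. f (i, j)) (J i)" .
  define s where "s i = infsum (\<lambda>j. f (i, j)) (J i)" for i
  have s: "((\<lambda>j. f (i, j)) has_sum s i) (J i)" if "i \<in> I" for i
    unfolding s_def by (rule vanishing_summable[OF slice[OF that]])
  have tot: "(f has_sum infsum f (Sigma I J)) (Sigma I J)" by (rule vanishing_summable[OF v])
  have "(s has_sum infsum f (Sigma I J)) I"
  proof (rule has_sumI_vanishing)
    fix e :: real assume e: "e > 0"
    define P where "P = {z \<in> Sigma I J. e \<le> absv (f z)}"
    have finP: "finite P" unfolding P_def by (rule v[unfolded vanishing_def, rule_format, OF e])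
    define F where "F = fst ` P"
    have finF: "finite F" and FI: "F \<subseteq> I" using finP by (auto simp: F_def P_def)
    define Q where "Q i = {j. (i, j) \<in> P}" for i
    have PQ: "P = Sigma F Q" by (force simp: F_def Q_def)
    have finQ: "finite (Q i)" for i
    proof (rule finite_subset)
      show "Q i \<subseteq> snd ` P" unfolding Q_def by force
    qed (use finP in simp)
    have QJ: "Q i \<subseteq> J i" for i by (auto simp: Q_def P_def)
    have err: "absv (s i - (\<Sum>j\<in>Q i. f (i, j))) \<le> e" if "i \<in> I" for i
      by (rule has_sum_error[OF s[OF that] finQ QJ e]) (use that in \<open>auto simp: Q_def P_def\<close>)
    have small: "absv (s i) \<le> e" if "i \<in> I - F" for i
    proof -
      have "Q i = {}" using that by (force simp: Q_def F_def)
      then show ?thesis using err[of i] that by simp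
    qed
    have "absv (infsum f (Sigma I J) - sum f P) \<le> e"
      by (rule has_sum_error[OF tot finP _ e]) (auto simp: P_def)
    moreover have "sum f P = (\<Sum>i\<in>F. \<Sum>j\<in>Q i. f (i, j))"
      unfolding PQ using finF finQ by (simp add: sum.Sigma)
    moreover have "absv (sum s F - (\<Sum>i\<in>F. \<Sum>j\<in>Q i. f (i, j))) \<le> e"
      unfolding sum_subtractf[symmetric] using err FI e by (intro absv_sum_le) auto
    ultimately have "absv (sum s F - infsum f (Sigma I J)) \<le> e"
      using absv_trans_le[of "sum s F" "sum f P" e "infsum f (Sigma I J)"]
        absv_minus_commute[of "sum f P" "infsum f (Sigma I J)"] by simp
    then show "\<exists>F. finite F \<and> F \<subseteq> I \<and> (\<forall>i\<in>I - F. absv (s i) \<le> e) \<and> absv (sum s F - infsum f (Sigma I J)) \<le> e"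
      using finF FI small by blast
  qed
  then show "((\<lambda>i. infsum (\<lambda>j. f (i, j)) (J i)) has_sum infsum f (Sigma I J)) I" unfolding s_def[abs_def] .
qed

text \<open>A bound for the Gauss norm, which is submultiplicative and dominates the value at
  1.\<close>

definition pbound :: "real \<Rightarrow> 'c poly \<Rightarrow> bool" where
  "pbound B p \<longleftrightarrow> (\<forall>i. absv (coeff p i) \<le> B)"

lemma pbound_mult:
  assumes "pbound B p" "pbound D q" "0 \<le> B" "0 \<le> D" shows "pbound (B * D) (p * q)"
  unfolding pbound_def coeff_mult
  using assms by (auto intro!: absv_sum_le mult_mono simp: absv_mult pbound_def)

lemma pbound_add: "pbound B p \<Longrightarrow> pbound B q \<Longrightarrow> pbound B (p + q)"
  by (simp add: pbound_def absv_add_le)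

lemma pbound_mono: "pbound B p \<Longrightarrow> B \<le> D \<Longrightarrow> pbound D p"
  unfolding pbound_def by (meson order_trans)

lemma pbound_nonneg: "pbound B p \<Longrightarrow> 0 \<le> B"
  using order_trans[OF absv_nonneg, of "coeff p 0" B] by (simp add: pbound_def)

lemma pbound_poly_1: "pbound B p \<Longrightarrow> absv (poly p 1) \<le> B"
  unfolding poly_altdef by (intro absv_sum_le pbound_nonneg) (auto simp: pbound_def)

lemma pbound_factor: "absv b \<le> Q \<Longrightarrow> 1 \<le> Q \<Longrightarrow> pbound Q [:1, b:]"
  by (auto simp: pbound_def coeff_pCons split: nat.splits)

lemma pbound_prod:
  assumes "\<And>t. t \<in> T \<Longrightarrow> absv (b t) \<le> Q" "1 \<le> Q"
  shows "pbound (Q ^ card T) (\<Prod>t\<in>T. [:1, b t:])"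
  using assms
proof (induction T rule: infinite_finite_induct)
  case (insert t T)
  have "pbound (Q * Q ^ card T) ([:1, b t:] * (\<Prod>t\<in>T. [:1, b t:]))"
    using insert by (intro pbound_mult pbound_factor insert.IH) auto
  then show ?case using insert.hyps by simp
qed (auto simp: pbound_def)

text \<open>Each factor changes the product by at most \<eta> in Gauss norm, and by the ultrametric
  inequality these changes do not add up. So the number of factors does not enter.\<close>

lemma pbound_prod_near_1:
  assumes "\<And>t. t \<in> T \<Longrightarrow> absv (b t) \<le> \<eta>" "0 \<le> \<eta>" "\<eta> \<le> 1"
  shows "pbound \<eta> ((\<Prod>t\<in>T. [:1, b t:]) - 1)"
  using assms
proof (induction T rule: infinite_finite_induct)
  case (insert t T)
  have "pbound (\<eta> * 1) (((\<Prod>t\<in>T. [:1, b t:]) - 1) * [:1, b t:])"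
    using insert by (intro pbound_mult pbound_factor insert.IH) (auto intro: order_trans)
  moreover have "pbound \<eta> [:0, b t:]" using insert by (auto simp: pbound_def coeff_pCons split: nat.splits)
  ultimately have "pbound \<eta> (((\<Prod>t\<in>T. [:1, b t:]) - 1) * [:1, b t:] + [:0, b t:])" using pbound_add by auto
  moreover have "((\<Prod>t\<in>T. [:1, b t:]) - 1) * [:1, b t:] + [:0, b t:] = (\<Prod>t\<in>insert t T. [:1, b t:]) - 1"
    using insert.hyps by (simp add: algebra_simps one_pCons)
  ultimately show ?case by (simp only:)
qed (auto simp: pbound_def)

end

section \<open>Exponential functions of families of lattices\<close>

definition ball_set :: "'i set \<Rightarrow> 'i \<Rightarrow> ('i \<Rightarrow> real) \<Rightarrow> nat \<Rightarrow> 'i set" where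
  "ball_set \<Lambda> o0 N n = {t \<in> \<Lambda>. t \<noteq> o0 \<and> N t \<le> real n}"

text \<open>A partial product of e(bX)/(bX). With b = 1 its coefficients approximate those of the
  exponential function; with b = z its value at 1 approximates e(z)/z. One estimate serves both
  purposes.\<close>

definition exp_prod :: "('w \<Rightarrow> 'i \<Rightarrow> 'c::field) \<Rightarrow> 'c \<Rightarrow> 'i set \<Rightarrow> 'w \<Rightarrow> 'c poly" where
  "exp_prod h b T w = (\<Prod>t\<in>T. [:1, - b * inverse (h w t):])"

text \<open>The coefficient of \<open>z\<^sup>i\<^sup>+\<^sup>1\<close> in the exponential function of the lattice \<open>h w ` \<Lambda>\<close>.\<close>

definition exp_coeff :: "('w \<Rightarrow> 'i \<Rightarrow> 'c::{field,complete_space}) \<Rightarrow> 'i set \<Rightarrow> 'i \<Rightarrow> ('i \<Rightarrow> real) \<Rightarrow> nat \<Rightarrow> 'w \<Rightarrow> 'c" where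
  "exp_coeff h \<Lambda> o0 N i w = lim (\<lambda>n. coeff (exp_prod h 1 (ball_set \<Lambda> o0 N n) w) i)"

locale lattice_family = ultrametric ty for ty :: "'c::{field,complete_space} itself" +
  fixes h :: "'w \<Rightarrow> 'i \<Rightarrow> 'c" and \<Lambda> :: "'i set" and o0 :: 'i and N :: "'i \<Rightarrow> real" and W :: "'w set" and \<delta> :: real
  assumes finite_ball: "\<And>R. finite {t \<in> \<Lambda>. N t \<le> R}"
    and o0: "o0 \<in> \<Lambda>" "N o0 = 0" and N_pos: "\<And>t. t \<in> \<Lambda> \<Longrightarrow> t \<noteq> o0 \<Longrightarrow> N t > 0"
    and \<delta>: "\<delta> > 0" and lower: "\<And>w t. w \<in> W \<Longrightarrow> t \<in> \<Lambda> \<Longrightarrow> \<delta> * N t \<le> absv (h w t)"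
    and h_o0: "\<And>w. w \<in> W \<Longrightarrow> h w o0 = 0"
    and h_inj: "\<And>w. w \<in> W \<Longrightarrow> inj_on (h w) \<Lambda>"
    and h_add: "\<And>w n x y. w \<in> W \<Longrightarrow> x \<in> h w ` {t \<in> \<Lambda>. N t \<le> real n} \<Longrightarrow> y \<in> h w ` {t \<in> \<Lambda>. N t \<le> real n}
      \<Longrightarrow> x + y \<in> h w ` {t \<in> \<Lambda>. N t \<le> real n}"
    and h_uminus: "\<And>w n x. w \<in> W \<Longrightarrow> x \<in> h w ` {t \<in> \<Lambda>. N t \<le> real n} \<Longrightarrow> - x \<in> h w ` {t \<in> \<Lambda>. N t \<le> real n}"
begin

abbreviation B :: "nat \<Rightarrow> 'i set" where "B n \<equiv> ball_set \<Lambda> o0 N n"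

lemma finite_B: "finite (B n)"
  using finite_ball[of "real n"] unfolding ball_set_def by (rule rev_finite_subset) auto

lemma B_mono: "n \<le> m \<Longrightarrow> B n \<subseteq> B m"
  unfolding ball_set_def by auto

lemma B_sub: "B n \<subseteq> \<Lambda> - {o0}"
  unfolding ball_set_def by auto

lemma h_nonzero: "w \<in> W \<Longrightarrow> t \<in> \<Lambda> - {o0} \<Longrightarrow> h w t \<noteq> 0"
  using lower[of w t] N_pos[of t] \<delta> by (auto dest: mult_pos_pos)

lemma min_norm: "\<exists>m>0. \<forall>t\<in>\<Lambda> - {o0}. m \<le> N t"
proof (cases "{t \<in> \<Lambda>. t \<noteq> o0 \<and> N t \<le> 1} = {}")
  case True
  then show ?thesis by (intro exI[of _ 1]) force
next
  case False
  let ?S = "{t \<in> \<Lambda>. t \<noteq> o0 \<and> N t \<le> 1}"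
  have fin: "finite ?S" using finite_ball[of 1] by (rule rev_finite_subset) auto
  define m where "m = Min (N ` ?S)"
  have "m \<in> N ` ?S" unfolding m_def using fin False by (intro Min_in) auto
  then have "0 < m" "m \<le> 1" using N_pos by auto
  moreover have "m \<le> N t" if "t \<in> \<Lambda> - {o0}" for t
  proof (cases "N t \<le> 1")
    case True
    then show ?thesis unfolding m_def using fin that by (intro Min_le) auto
  next
    case False
    then show ?thesis using \<open>m \<le> 1\<close> by simp
  qed
  ultimately show ?thesis by blast
qed

lemma ratio_bound:
  assumes "w \<in> W" "t \<in> \<Lambda> - {o0}" "absv b \<le> D" "0 < R" "R \<le> N t" "0 \<le> D"
  shows "absv (- b * inverse (h w t)) \<le> D / (\<delta> * R)"
proof -
  have "\<delta> * R \<le> absv (h w t)" using lower[of w t] assms \<delta> by (auto intro: order_trans[rotated])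
  moreover have "0 < \<delta> * R" using \<delta> assms by simp
  ultimately have "inverse (absv (h w t)) \<le> inverse (\<delta> * R)" by (intro le_imp_inverse_le)
  then have "absv b * inverse (absv (h w t)) \<le> D * inverse (\<delta> * R)"
    using assms by (intro mult_mono) auto
  then show ?thesis by (simp add: absv_mult absv_inverse divide_inverse)
qed

lemma exp_prod_uniform:
  assumes D: "0 < D"
  obtains Q where "1 \<le> Q"
    "\<forall>w\<in>W. \<forall>b T. absv b \<le> D \<longrightarrow> finite T \<longrightarrow> T \<subseteq> \<Lambda> - {o0} \<longrightarrow> pbound Q (exp_prod h b T w)"
    "\<forall>e>0. \<exists>n0. \<forall>w\<in>W. \<forall>b T. absv b \<le> D \<longrightarrow> finite T \<longrightarrow> B n0 \<subseteq> T \<longrightarrow> T \<subseteq> \<Lambda> - {o0} \<longrightarrow>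
       pbound e (exp_prod h b T w - exp_prod h b (B n0) w)"
proof -
  obtain m where m: "m > 0" "\<forall>t\<in>\<Lambda> - {o0}. m \<le> N t" using min_norm by blast
  define q where "q = max 1 (D / (\<delta> * m))"
  have q: "1 \<le> q" by (simp add: q_def)
  have all: "absv (- b * inverse (h w t)) \<le> q" if "w \<in> W" "t \<in> \<Lambda> - {o0}" "absv b \<le> D" for b w t
    using ratio_bound[OF that m(1)] m(2) that D by (auto simp: q_def)
  \<comment> \<open>Outside the ball of radius n1 all b / h w t have absolute value at most 1, for
    every w. Only the factors inside contribute to Q.\<close>
  obtain n1 :: nat where n1: "D / \<delta> < real n1" "0 < n1" using reals_Archimedean2[of "max 1 (D / \<delta>)"] by auto
  have far: "absv (- b * inverse (h w t)) \<le> D / (\<delta> * real n)"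
    if "w \<in> W" "t \<in> \<Lambda> - {o0}" "absv b \<le> D" "t \<notin> B n" "0 < n" for b w t n
    using ratio_bound[OF that(1-3), of "real n"] that D unfolding ball_set_def by auto
  have small: "D / (\<delta> * real n) \<le> 1" if "n1 \<le> n" for n
  proof -
    have "D / \<delta> \<le> real n" using n1 that by linarith
    then have "D \<le> \<delta> * real n" using \<delta> by (simp add: pos_divide_le_eq mult.commute)
    moreover have "0 < real n" using n1 that by simp
    ultimately show ?thesis using \<delta> by (simp add: pos_divide_le_eq)
  qed
  define Q where "Q = q ^ card (B n1)"
  have Q: "1 \<le> Q" unfolding Q_def using q by simp
  have bnd: "pbound Q (exp_prod h b T w)" if w: "w \<in> W" and b: "absv b \<le> D" and T: "finite T" "T \<subseteq> \<Lambda> - {o0}" for w b T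
  proof -
    have 1: "pbound (q ^ card (T \<inter> B n1)) (exp_prod h b (T \<inter> B n1) w)"
      unfolding exp_prod_def by (rule pbound_prod[OF _ q], rule all[OF w _ b]) (use T in auto)
    have "pbound 1 (exp_prod h b (T - B n1) w - 1)"
      unfolding exp_prod_def
      by (rule pbound_mono[OF pbound_prod_near_1[where \<eta> = "D / (\<delta> * real n1)"]], rule far[OF w _ b])
        (use T n1 small[of n1] D \<delta> in auto)
    then have "pbound 1 (exp_prod h b (T - B n1) w - 1 + 1)"
      by (rule pbound_add) (auto simp: pbound_def)
    then have 2: "pbound 1 (exp_prod h b (T - B n1) w)" by simp
    have "exp_prod h b T w = exp_prod h b (T \<inter> B n1) w * exp_prod h b (T - B n1) w"
      unfolding exp_prod_def by (rule prod.Int_Diff[OF T(1)])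
    then have "pbound (q ^ card (T \<inter> B n1) * 1) (exp_prod h b T w)"
      using pbound_mult[OF 1 2] q by simp
    moreover have "q ^ card (T \<inter> B n1) \<le> Q" unfolding Q_def using q finite_B
      by (intro power_increasing card_mono) auto
    ultimately show ?thesis by (auto elim: pbound_mono)
  qed
  have "\<exists>n0. \<forall>w\<in>W. \<forall>b T. absv b \<le> D \<longrightarrow> finite T \<longrightarrow> B n0 \<subseteq> T \<longrightarrow> T \<subseteq> \<Lambda> - {o0} \<longrightarrow>
       pbound e (exp_prod h b T w - exp_prod h b (B n0) w)" if e: "e > 0" for e
  proof -
    \<comment> \<open>The factors outside the ball of radius n deviate from 1 by at most D /
      (\<delta> n), and Q bounds the product inside; n2 makes Q D / (\<delta> n) \<le> e.\<close>
    obtain n2 :: nat where n2: "Q * D / (\<delta> * e) < real n2" using reals_Archimedean2 by blast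
    define n where "n = max n1 n2"
    have n: "n1 \<le> n" "0 < n" using n1 by (auto simp: n_def)
    have "Q * D / (\<delta> * e) \<le> real n" using n2 unfolding n_def by linarith
    then have "Q * D \<le> real n * (\<delta> * e)" using \<delta> e by (simp add: pos_divide_le_eq)
    then have le: "Q * (D / (\<delta> * real n)) \<le> e"
      using \<delta> n(2) by (simp add: pos_divide_le_eq mult_ac)
    show ?thesis
    proof (intro exI[of _ n] ballI allI impI)
      fix w and b :: 'c and T assume w: "w \<in> W" and b: "absv b \<le> D" and T: "finite T" "B n \<subseteq> T" "T \<subseteq> \<Lambda> - {o0}"
      have "pbound (D / (\<delta> * real n)) (exp_prod h b (T - B n) w - 1)"
        unfolding exp_prod_def
        by (rule pbound_prod_near_1, rule far[OF w _ b]) (use T n small[of n] D \<delta> in auto)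
      then have "pbound (Q * (D / (\<delta> * real n))) (exp_prod h b (B n) w * (exp_prod h b (T - B n) w - 1))"
        using Q D \<delta> by (intro pbound_mult bnd[OF w b finite_B B_sub]) auto
      moreover have "exp_prod h b T w = exp_prod h b (B n) w * exp_prod h b (T - B n) w"
        unfolding exp_prod_def using prod.subset_diff[OF T(2,1)] by (simp add: mult.commute)
      ultimately have "pbound (Q * (D / (\<delta> * real n))) (exp_prod h b T w - exp_prod h b (B n) w)"
        by (simp add: algebra_simps)
      then show "pbound e (exp_prod h b T w - exp_prod h b (B n) w)" using le by (rule pbound_mono)
    qed
  qed
  then show ?thesis using Q bnd by (intro that[of Q]) auto
qed

lemma exp_prod_Cauchy:
  assumes D: "0 < D" and e: "0 < e"
  obtains n0 where "\<forall>w\<in>W. \<forall>b. absv b \<le> D \<longrightarrow> (\<forall>n\<ge>n0. \<forall>m\<ge>n0. pbound e (exp_prod h b (B n) w - exp_prod h b (B m) w))"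
proof -
  obtain Q where "1 \<le> Q"
    "\<forall>w\<in>W. \<forall>b T. absv b \<le> D \<longrightarrow> finite T \<longrightarrow> T \<subseteq> \<Lambda> - {o0} \<longrightarrow> pbound Q (exp_prod h b T w)"
    and Q: "\<forall>e>0. \<exists>n0. \<forall>w\<in>W. \<forall>b T. absv b \<le> D \<longrightarrow> finite T \<longrightarrow> B n0 \<subseteq> T \<longrightarrow> T \<subseteq> \<Lambda> - {o0} \<longrightarrow>
       pbound e (exp_prod h b T w - exp_prod h b (B n0) w)" by (rule exp_prod_uniform[OF D])
  obtain n0 where n0: "\<forall>w\<in>W. \<forall>b T. absv b \<le> D \<longrightarrow> finite T \<longrightarrow> B n0 \<subseteq> T \<longrightarrow> T \<subseteq> \<Lambda> - {o0} \<longrightarrow>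
       pbound e (exp_prod h b T w - exp_prod h b (B n0) w)" using Q[rule_format, OF e] ..
  show ?thesis
  proof (rule that[of n0], intro ballI allI impI)
    fix w and b :: 'c and n m assume w: "w \<in> W" and b: "absv b \<le> D" and nm: "n0 \<le> n" "n0 \<le> m"
    note c = n0[rule_format, OF w b finite_B B_mono B_sub]
    have "pbound e (- (exp_prod h b (B m) w - exp_prod h b (B n0) w))"
      using c[OF nm(2)] unfolding pbound_def coeff_minus absv_uminus .
    from pbound_add[OF c[OF nm(1)] this]
    show "pbound e (exp_prod h b (B n) w - exp_prod h b (B m) w)" by simp
  qed
qed

lemma real_0_less_1: "0 < (1::real)" by simp

lemma exp_coeff_tendsto:
  assumes w: "w \<in> W"
  shows "(\<lambda>n. coeff (exp_prod h 1 (B n) w) i) \<longlonglongrightarrow> exp_coeff h \<Lambda> o0 N i w"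
proof -
  have "Cauchy (\<lambda>n. coeff (exp_prod h 1 (B n) w) i)"
  proof (rule metric_CauchyI)
    fix e :: real assume e: "e > 0"
    then have "e / 2 > 0" by simp
    obtain n0 where n0: "\<forall>w\<in>W. \<forall>b. absv b \<le> 1 \<longrightarrow> (\<forall>n\<ge>n0. \<forall>m\<ge>n0. pbound (e / 2) (exp_prod h b (B n) w - exp_prod h b (B m) w))"
      by (rule exp_prod_Cauchy[OF real_0_less_1 \<open>e / 2 > 0\<close>])
    show "\<exists>M. \<forall>m\<ge>M. \<forall>n\<ge>M. dist (coeff (exp_prod h 1 (B m) w) i) (coeff (exp_prod h 1 (B n) w) i) < e"
    proof (intro exI[of _ n0] allI impI)
      fix m n assume "n0 \<le> m" "n0 \<le> n"
      then have "pbound (e / 2) (exp_prod h 1 (B m) w - exp_prod h 1 (B n) w)" using n0 w by simp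
      then have "absv (coeff (exp_prod h 1 (B m) w) i - coeff (exp_prod h 1 (B n) w) i) \<le> e / 2"
        unfolding pbound_def coeff_diff by blast
      then show "dist (coeff (exp_prod h 1 (B m) w) i) (coeff (exp_prod h 1 (B n) w) i) < e"
        unfolding dist_absv using e by linarith
    qed
  qed
  then have "convergent (\<lambda>n. coeff (exp_prod h 1 (B n) w) i)" by (rule Cauchy_convergent)
  then show ?thesis unfolding exp_coeff_def by (simp add: convergent_LIMSEQ_iff)
qed

lemma absv_lim_bound:
  assumes f: "f \<longlonglongrightarrow> (l::'c)" and e: "0 < e" "\<And>m. m \<ge> n0 \<Longrightarrow> absv (f m - x) \<le> e"
  shows "absv (l - x) \<le> e"
proof -
  have "eventually (\<lambda>n. absv (f n - l) < e) sequentially" using f e(1) unfolding tendsto_absv by blast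
  then obtain n1 where n1: "\<forall>n\<ge>n1. absv (f n - l) < e" unfolding eventually_sequentially ..
  have "absv (l - f (max n0 n1)) \<le> e" using n1[rule_format, of "max n0 n1"] by (simp add: absv_minus_commute[of l])
  moreover have "absv (f (max n0 n1) - x) \<le> e" using e(2)[of "max n0 n1"] by simp
  ultimately show ?thesis by (rule absv_trans_le)
qed

lemma exp_coeff_uniform:
  assumes e: "0 < e"
  obtains n0 where "\<forall>w\<in>W. \<forall>i. \<forall>n\<ge>n0. absv (exp_coeff h \<Lambda> o0 N i w - coeff (exp_prod h 1 (B n) w) i) \<le> e"
proof -
  obtain n0 where n0: "\<forall>w\<in>W. \<forall>b. absv b \<le> 1 \<longrightarrow> (\<forall>n\<ge>n0. \<forall>m\<ge>n0. pbound e (exp_prod h b (B n) w - exp_prod h b (B m) w))"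
    by (rule exp_prod_Cauchy[OF real_0_less_1 e])
  show ?thesis
  proof (rule that[of n0], intro ballI allI impI)
    fix w i n assume w: "w \<in> W" and n: "n0 \<le> n"
    show "absv (exp_coeff h \<Lambda> o0 N i w - coeff (exp_prod h 1 (B n) w) i) \<le> e"
    proof (rule absv_lim_bound[OF exp_coeff_tendsto[OF w] e])
      fix m assume "n0 \<le> m"
      then have "pbound e (exp_prod h 1 (B m) w - exp_prod h 1 (B n) w)" using n0 w n by simp
      then show "absv (coeff (exp_prod h 1 (B m) w) i - coeff (exp_prod h 1 (B n) w) i) \<le> e"
        unfolding pbound_def coeff_diff by blast
    qed
  qed
qed

lemma prod_reindex:
  assumes w: "w \<in> W" and T: "T \<subseteq> \<Lambda> - {o0}"
  shows "(\<Prod>x\<in>h w ` T. 1 - z / x) = poly (exp_prod h z T w) 1"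
proof -
  have "inj_on (h w) T" using h_inj[OF w] T by (rule inj_on_subset[OF _ order_trans]) auto
  then show ?thesis by (simp add: prod.reindex exp_prod_def poly_prod divide_inverse)
qed

text \<open>\<open>exp_fun\<close> is a limit over all finite subsets of the lattice without 0. It
  is identified with the limit l along balls; the factor D in the estimate is the bound for the z in
  front of the product.\<close>

lemma exp_fun_uniform:
  assumes D: "0 < D" and e: "0 < e"
  obtains n0 where "\<forall>w\<in>W. \<forall>z. absv z \<le> D \<longrightarrow> (\<forall>n\<ge>n0. absv (exp_fun (h w ` \<Lambda>) z - z * poly (exp_prod h z (B n) w) 1) \<le> D * e)"
proof -
  obtain Q where "1 \<le> Q"
    "\<forall>w\<in>W. \<forall>b T. absv b \<le> D \<longrightarrow> finite T \<longrightarrow> T \<subseteq> \<Lambda> - {o0} \<longrightarrow> pbound Q (exp_prod h b T w)"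
    and Q: "\<forall>e>0. \<exists>n0. \<forall>w\<in>W. \<forall>b T. absv b \<le> D \<longrightarrow> finite T \<longrightarrow> B n0 \<subseteq> T \<longrightarrow> T \<subseteq> \<Lambda> - {o0} \<longrightarrow>
       pbound e (exp_prod h b T w - exp_prod h b (B n0) w)" by (rule exp_prod_uniform[OF D])
  obtain n0 where n0: "\<forall>w\<in>W. \<forall>b T. absv b \<le> D \<longrightarrow> finite T \<longrightarrow> B n0 \<subseteq> T \<longrightarrow> T \<subseteq> \<Lambda> - {o0} \<longrightarrow>
       pbound e (exp_prod h b T w - exp_prod h b (B n0) w)" using Q[rule_format, OF e] ..
  show ?thesis
  proof (rule that[of n0], intro ballI allI impI)
    fix w and z :: 'c and n assume w: "w \<in> W" and z: "absv z \<le> D" and n: "n0 \<le> n"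
    let ?f = "\<lambda>n. poly (exp_prod h z (B n) w) 1"
    have "Cauchy ?f"
    proof (rule metric_CauchyI)
      fix d :: real assume d: "d > 0"
      then have "d / 2 > 0" by simp
      obtain n1 where n1: "\<forall>w\<in>W. \<forall>b. absv b \<le> D \<longrightarrow> (\<forall>n\<ge>n1. \<forall>m\<ge>n1. pbound (d / 2) (exp_prod h b (B n) w - exp_prod h b (B m) w))"
        by (rule exp_prod_Cauchy[OF D \<open>d / 2 > 0\<close>])
      show "\<exists>M. \<forall>m\<ge>M. \<forall>n\<ge>M. dist (?f m) (?f n) < d"
      proof (intro exI[of _ n1] allI impI)
        fix m n assume "n1 \<le> m" "n1 \<le> n"
        then have "pbound (d / 2) (exp_prod h z (B m) w - exp_prod h z (B n) w)" using n1 w z by simp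
        then have "absv (?f m - ?f n) \<le> d / 2" using pbound_poly_1 by fastforce
        then show "dist (?f m) (?f n) < d" unfolding dist_absv using d by linarith
      qed
    qed
    then have "convergent ?f" by (rule Cauchy_convergent)
    then obtain l where l: "?f \<longlonglongrightarrow> l" unfolding convergent_def ..
    have lim: "((\<lambda>T. \<Prod>x\<in>T. 1 - z / x) \<longlongrightarrow> l) (finite_subsets_at_top (h w ` \<Lambda> - {0}))"
      unfolding tendsto_absv eventually_finite_subsets_at_top
    proof (intro allI impI)
      fix d :: real assume d: "d > 0"
      then have d2: "d / 2 > 0" by simp
      obtain n1 where n1: "\<forall>w\<in>W. \<forall>b T. absv b \<le> D \<longrightarrow> finite T \<longrightarrow> B n1 \<subseteq> T \<longrightarrow> T \<subseteq> \<Lambda> - {o0} \<longrightarrow>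
         pbound (d / 2) (exp_prod h b T w - exp_prod h b (B n1) w)" using Q[rule_format, OF d2] ..
      have near: "absv (poly (exp_prod h z T w) 1 - ?f n1) \<le> d / 2" if "finite T" "B n1 \<subseteq> T" "T \<subseteq> \<Lambda> - {o0}" for T
        using pbound_poly_1[OF n1[rule_format, OF w z that]] by simp
      have ln: "absv (l - ?f n1) \<le> d / 2"
        by (rule absv_lim_bound[OF l d2 near[OF finite_B B_mono B_sub]])
      show "\<exists>F0. finite F0 \<and> F0 \<subseteq> h w ` \<Lambda> - {0} \<and> (\<forall>Y. finite Y \<and> F0 \<subseteq> Y \<and> Y \<subseteq> h w ` \<Lambda> - {0} \<longrightarrow> absv ((\<Prod>x\<in>Y. 1 - z / x) - l) < d)"
      proof (intro exI[of _ "h w ` B n1"] conjI allI impI)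
        show "finite (h w ` B n1)" using finite_B by simp
        show "h w ` B n1 \<subseteq> h w ` \<Lambda> - {0}" using h_nonzero[OF w] B_sub[of n1] by fastforce
        fix Y assume Y: "finite Y \<and> h w ` B n1 \<subseteq> Y \<and> Y \<subseteq> h w ` \<Lambda> - {0}"
        define T where "T = {t \<in> \<Lambda>. h w t \<in> Y}"
        have YT: "Y = h w ` T" using Y unfolding T_def by auto
        have injT: "inj_on (h w) T" using h_inj[OF w] unfolding T_def by (rule inj_on_subset) auto
        have "finite T" using Y YT injT by (metis finite_imageD)
        moreover have "B n1 \<subseteq> T" using Y B_sub[of n1] unfolding T_def by auto
        moreover have TL: "T \<subseteq> \<Lambda> - {o0}" using Y h_o0[OF w] unfolding T_def by auto
        ultimately have "absv (poly (exp_prod h z T w) 1 - ?f n1) \<le> d / 2" by (rule near)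
        moreover have "absv (?f n1 - l) \<le> d / 2" using ln by (simp only: absv_minus_commute[of l])
        ultimately have "absv (poly (exp_prod h z T w) 1 - l) \<le> d / 2" by (rule absv_trans_le)
        then show "absv ((\<Prod>x\<in>Y. 1 - z / x) - l) < d" unfolding YT prod_reindex[OF w TL] using d by linarith
      qed
    qed
    then have ex: "exp_fun (h w ` \<Lambda>) z = z * l"
      unfolding exp_fun_def by (subst tendsto_Lim[OF finite_subsets_at_top_neq_bot lim]) simp
    have cl: "pbound e (exp_prod h z (B m) w - exp_prod h z (B n) w)" if "n0 \<le> m" for m
    proof -
      note c = n0[rule_format, OF w z finite_B B_mono B_sub]
      have "pbound e (- (exp_prod h z (B n) w - exp_prod h z (B n0) w))"
        using c[OF n] unfolding pbound_def coeff_minus absv_uminus .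
      from pbound_add[OF c[OF that] this] show ?thesis by simp
    qed
    have "absv (l - ?f n) \<le> e"
    proof (rule absv_lim_bound[OF l e])
      fix m assume "n0 \<le> m"
      from pbound_poly_1[OF cl[OF this]] show "absv (?f m - ?f n) \<le> e" by simp
    qed
    then have "absv z * absv (l - ?f n) \<le> D * e" using z D by (intro mult_mono) auto
    then show "absv (exp_fun (h w ` \<Lambda>) z - z * ?f n) \<le> D * e"
      unfolding ex right_diff_distrib[symmetric] absv_mult .
  qed
qed

lemma exp_fun_tendsto:
  assumes w: "w \<in> W" shows "(\<lambda>n. z * poly (exp_prod h z (B n) w) 1) \<longlonglongrightarrow> exp_fun (h w ` \<Lambda>) z"
  unfolding tendsto_absv eventually_sequentially
proof (intro allI impI)
  fix e :: real assume e: "e > 0"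
  define D where "D = max 1 (absv z)"
  have D: "0 < D" "absv z \<le> D" by (auto simp: D_def)
  have "0 < e / (2 * D)" using e D by simp
  obtain n0 where n0: "\<forall>w\<in>W. \<forall>z. absv z \<le> D \<longrightarrow> (\<forall>n\<ge>n0. absv (exp_fun (h w ` \<Lambda>) z - z * poly (exp_prod h z (B n) w) 1) \<le> D * (e / (2 * D)))"
    by (rule exp_fun_uniform[OF D(1) \<open>0 < e / (2 * D)\<close>])
  have "absv (z * poly (exp_prod h z (B n) w) 1 - exp_fun (h w ` \<Lambda>) z) < e" if "n0 \<le> n" for n
  proof -
    have "D * (e / (2 * D)) < e" using D e by simp
    then show ?thesis using n0[rule_format, OF w D(2) that] by (simp only: absv_minus_commute[of "exp_fun _ z"])
  qed
  then show "\<exists>n0. \<forall>n\<ge>n0. absv (z * poly (exp_prod h z (B n) w) 1 - exp_fun (h w ` \<Lambda>) z) < e" by blast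
qed

lemma exp_fun_bounded:
  assumes D: "0 < D"
  obtains M where "0 < M" "\<forall>w\<in>W. \<forall>z. absv z \<le> D \<longrightarrow> absv (exp_fun (h w ` \<Lambda>) z) \<le> M"
proof -
  obtain Q where Q: "1 \<le> Q"
    "\<forall>w\<in>W. \<forall>b T. absv b \<le> D \<longrightarrow> finite T \<longrightarrow> T \<subseteq> \<Lambda> - {o0} \<longrightarrow> pbound Q (exp_prod h b T w)"
    "\<forall>e>0. \<exists>n0. \<forall>w\<in>W. \<forall>b T. absv b \<le> D \<longrightarrow> finite T \<longrightarrow> B n0 \<subseteq> T \<longrightarrow> T \<subseteq> \<Lambda> - {o0} \<longrightarrow>
       pbound e (exp_prod h b T w - exp_prod h b (B n0) w)" by (rule exp_prod_uniform[OF D])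
  have "absv (exp_fun (h w ` \<Lambda>) z) \<le> D * Q" if w: "w \<in> W" and z: "absv z \<le> D" for w z
  proof -
    have "absv (exp_fun (h w ` \<Lambda>) z - 0) \<le> D * Q"
    proof (rule absv_lim_bound[OF exp_fun_tendsto[OF w]])
      show "0 < D * Q" using D Q(1) by simp
      fix m
      have "absv (poly (exp_prod h z (B m) w) 1) \<le> Q"
        using Q(2)[rule_format, OF w z finite_B B_sub] by (rule pbound_poly_1)
      then show "absv (z * poly (exp_prod h z (B m) w) 1 - 0) \<le> D * Q"
        using z D Q(1) by (auto simp: absv_mult intro!: mult_mono)
    qed
    then show ?thesis by simp
  qed
  then show ?thesis using D Q(1) by (intro that[of "D * Q"]) auto
qed

definition H :: "'w \<Rightarrow> nat \<Rightarrow> 'c set" where "H w n = h w ` {t \<in> \<Lambda>. N t \<le> real n}"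

lemma H_subgroup: "w \<in> W \<Longrightarrow> finite_subgroup (H w n)"
proof
  assume w: "w \<in> W"
  show "finite (H w n)" unfolding H_def using finite_ball by simp
  have "o0 \<in> {t \<in> \<Lambda>. N t \<le> real n}" using o0 by simp
  then show "0 \<in> H w n" unfolding H_def using h_o0[OF w] by (metis imageI)
qed (auto simp: H_def intro: h_add h_uminus)

lemma H_eps:
  assumes w: "w \<in> W" shows "finite_subgroup.\<epsilon> (H w n) = exp_prod h 1 (B n) w"
proof -
  have "H w n - {0} = h w ` B n"
  proof
    show "H w n - {0} \<subseteq> h w ` B n" using h_o0[OF w] by (auto simp: H_def ball_set_def)
    show "h w ` B n \<subseteq> H w n - {0}" using h_nonzero[OF w] by (auto simp: H_def ball_set_def)
  qed
  moreover have "inj_on (h w) (B n)" using h_inj[OF w] by (rule inj_on_subset) (use B_sub in blast)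
  ultimately show ?thesis unfolding finite_subgroup.\<epsilon>_def[OF H_subgroup[OF w]] exp_prod_def
    by (simp add: prod.reindex)
qed

lemma H_e:
  assumes w: "w \<in> W" shows "poly (finite_subgroup.e (H w n)) z = z * poly (exp_prod h z (B n) w) 1"
  unfolding finite_subgroup.e_def[OF H_subgroup[OF w]] H_eps[OF w]
  by (simp add: exp_prod_def poly_prod mult.commute)

lemma LIMSEQ_unique_c: "f \<longlonglongrightarrow> (a::'c) \<Longrightarrow> f \<longlonglongrightarrow> b \<Longrightarrow> a = b"
  by (rule LIMSEQ_unique)

lemma exp_fun_additive:
  assumes w: "w \<in> W"
  shows "exp_fun (h w ` \<Lambda>) (x + y) = exp_fun (h w ` \<Lambda>) x + exp_fun (h w ` \<Lambda>) y"
proof (rule LIMSEQ_unique_c)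
  have lim: "(\<lambda>n. poly (finite_subgroup.e (H w n)) z) \<longlonglongrightarrow> exp_fun (h w ` \<Lambda>) z" for z
    unfolding H_e[OF w] by (rule exp_fun_tendsto[OF w])
  show "(\<lambda>n. poly (finite_subgroup.e (H w n)) (x + y)) \<longlonglongrightarrow> exp_fun (h w ` \<Lambda>) (x + y)" by (rule lim)
  show "(\<lambda>n. poly (finite_subgroup.e (H w n)) (x + y)) \<longlonglongrightarrow> exp_fun (h w ` \<Lambda>) x + exp_fun (h w ` \<Lambda>) y"
    unfolding finite_subgroup.poly_e_additive[OF H_subgroup[OF w]] by (intro tendsto_add_absv lim)
qed

definition S :: "'w \<Rightarrow> nat \<Rightarrow> 'c \<Rightarrow> 'c" where
  "S w k z = infsum (\<lambda>t. inverse ((z + h w t) ^ k)) \<Lambda>"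

text \<open>Where h w t exceeds z in absolute value it alone determines the size of the term, and
  the lower bound makes such terms small outside a ball.\<close>

lemma vanishing_terms:
  assumes w: "w \<in> W" and z: "z \<notin> h w ` \<Lambda>" and k: "k > 0"
  shows "vanishing (\<lambda>t. inverse ((z + h w t) ^ k)) \<Lambda>"
  unfolding vanishing_def
proof (intro allI impI)
  fix e :: real assume e: "e > 0"
  define R where "R = max (absv z) (max 1 (inverse e))"
  have "{t \<in> \<Lambda>. e \<le> absv (inverse ((z + h w t) ^ k))} \<subseteq> {t \<in> \<Lambda>. N t \<le> R / \<delta>}"
  proof safe
    fix t assume t: "t \<in> \<Lambda>" "e \<le> absv (inverse ((z + h w t) ^ k))"
    show "N t \<le> R / \<delta>"
    proof (rule ccontr)
      assume "\<not> N t \<le> R / \<delta>"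
      then have "R < \<delta> * N t" using \<delta> by (simp add: pos_le_divide_eq not_le pos_divide_less_eq mult.commute)
      also have "\<dots> \<le> absv (h w t)" by (rule lower[OF w t(1)])
      finally have R: "R < absv (h w t)" .
      then have "absv z < absv (h w t)" by (simp add: R_def)
      then have "absv (z + h w t) = absv (h w t)" using absv_add_eq[of z "h w t"] by (simp add: add.commute)
      then have big: "R < absv (z + h w t)" using R by simp
      then have "1 \<le> absv (z + h w t)" by (simp add: R_def)
      then have "absv (z + h w t) \<le> absv (z + h w t) ^ k" using k by (simp add: self_le_power)
      then have "inverse e < absv ((z + h w t) ^ k)" using big unfolding absv_power R_def by linarith
      then have "inverse (absv ((z + h w t) ^ k)) < e" using e by (metis inverse_inverse_eq inverse_less_imp_less less_imp_inverse_less inverse_positive_iff_positive)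
      then show False using t(2) by (simp add: absv_inverse)
    qed
  qed
  then show "finite {t \<in> \<Lambda>. e \<le> absv (inverse ((z + h w t) ^ k))}" using finite_ball by (rule finite_subset)
qed

lemma S_tendsto:
  assumes w: "w \<in> W" and z: "z \<notin> h w ` \<Lambda>" and k: "k > 0"
  shows "(\<lambda>n. finite_subgroup.S (H w n) k z) \<longlonglongrightarrow> S w k z"
  unfolding tendsto_absv eventually_sequentially
proof (intro allI impI)
  fix e :: real assume e: "e > 0"
  let ?f = "\<lambda>t. inverse ((z + h w t) ^ k)"
  have v: "vanishing ?f \<Lambda>" by (rule vanishing_terms[OF assms])
  have hs: "(?f has_sum S w k z) \<Lambda>" unfolding S_def by (rule vanishing_summable[OF v])
  have e2: "e / 2 > 0" using e by simp
  have fin: "finite {t \<in> \<Lambda>. e / 2 \<le> absv (?f t)}" by (rule v[unfolded vanishing_def, rule_format, OF e2])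
  obtain n0 :: nat where n0: "Max (insert 0 (N ` {t \<in> \<Lambda>. e / 2 \<le> absv (?f t)})) < real n0" using reals_Archimedean2 by blast
  have small: "absv (?f t) \<le> e / 2" if "t \<in> \<Lambda> - {t \<in> \<Lambda>. N t \<le> real n}" "n0 \<le> n" for t n
  proof (rule ccontr)
    assume "\<not> absv (?f t) \<le> e / 2"
    then have "N t \<le> Max (insert 0 (N ` {t \<in> \<Lambda>. e / 2 \<le> absv (?f t)}))" using that fin by (intro Max_ge) auto
    then have "N t \<le> real n" using n0 that(2) by linarith
    then show False using that(1) by simp
  qed
  show "\<exists>n0. \<forall>n\<ge>n0. absv (finite_subgroup.S (H w n) k z - S w k z) < e"
  proof (intro exI[of _ n0] allI impI)
    fix n assume n: "n0 \<le> n"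
    have "inj_on (h w) {t \<in> \<Lambda>. N t \<le> real n}" using h_inj[OF w] by (rule inj_on_subset) auto
    then have "finite_subgroup.S (H w n) k z = sum ?f {t \<in> \<Lambda>. N t \<le> real n}"
      unfolding finite_subgroup.S_def[OF H_subgroup[OF w]] unfolding H_def by (simp add: sum.reindex)
    moreover have "absv (S w k z - sum ?f {t \<in> \<Lambda>. N t \<le> real n}) \<le> e / 2"
      by (rule has_sum_error[OF hs finite_ball _ e2 small[OF _ n]]) auto
    ultimately show "absv (finite_subgroup.S (H w n) k z - S w k z) < e"
      using e by (simp add: absv_minus_commute[of _ "S w k z"])
  qed
qed

lemma not_in_H: "z \<notin> h w ` \<Lambda> \<Longrightarrow> z \<notin> H w n"
  unfolding H_def by auto

lemma S_1:
  assumes w: "w \<in> W" and z: "z \<notin> h w ` \<Lambda>"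
  shows "exp_fun (h w ` \<Lambda>) z * S w 1 z = 1"
proof (rule LIMSEQ_unique_c)
  show "(\<lambda>n. poly (finite_subgroup.e (H w n)) z * finite_subgroup.S (H w n) 1 z) \<longlonglongrightarrow> exp_fun (h w ` \<Lambda>) z * S w 1 z"
    unfolding H_e[OF w] by (intro tendsto_mult_absv exp_fun_tendsto S_tendsto w z) simp
  show "(\<lambda>n. poly (finite_subgroup.e (H w n)) z * finite_subgroup.S (H w n) 1 z) \<longlonglongrightarrow> 1"
    unfolding finite_subgroup.S_1[OF H_subgroup[OF w] not_in_H[OF z]] by (rule tendsto_const)
qed

lemma exp_fun_nonzero: "w \<in> W \<Longrightarrow> z \<notin> h w ` \<Lambda> \<Longrightarrow> exp_fun (h w ` \<Lambda>) z \<noteq> 0"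
  using S_1 by fastforce

text \<open>\<open>S w 1 z\<close> stands for the inverse of the exponential function, to which it
  is equal by \<open>S_1\<close>. In this form the passage to the limit involves only sums and
  products.\<close>

lemma S_rec:
  assumes w: "w \<in> W" and z: "z \<notin> h w ` \<Lambda>" and m: "m > 0"
  shows "S w (Suc m) z = S w 1 z * (\<Sum>i<m. (- 1) ^ i * exp_coeff h \<Lambda> o0 N i w * S w (m - i) z)"
proof (rule LIMSEQ_unique_c)
  show "(\<lambda>n. finite_subgroup.S (H w n) (Suc m) z) \<longlonglongrightarrow> S w (Suc m) z"
    by (rule S_tendsto[OF w z]) simp
  have inv: "inverse (poly (finite_subgroup.e (H w n)) z) = finite_subgroup.S (H w n) 1 z" for n
    using finite_subgroup.S_1[OF H_subgroup[OF w] not_in_H[OF z], of n] by (rule inverse_unique)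
  show "(\<lambda>n. finite_subgroup.S (H w n) (Suc m) z) \<longlonglongrightarrow> S w 1 z * (\<Sum>i<m. (- 1) ^ i * exp_coeff h \<Lambda> o0 N i w * S w (m - i) z)"
    unfolding finite_subgroup.S_rec[OF H_subgroup[OF w] not_in_H[OF z] m] inv H_eps[OF w]
    by (intro tendsto_mult_absv tendsto_sum_absv S_tendsto exp_coeff_tendsto w z tendsto_const) auto
qed

end

section \<open>Lattices and arithmetic subgroups\<close>

text \<open>A maximal independent subset of G has n elements, hence is a basis of the whole
  space.\<close>

lemma (in vec_space) full_span:
  assumes G: "finite G" "G \<subseteq> carrier_vec n" and d: "vectorspace.dim class_ring (span_vs G) = n"
  shows "span G = carrier_vec n"
proof -
  let ?P = "\<lambda>T. T \<subseteq> G \<and> lin_indpt T"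
  let ?S = "card ` {T. ?P T}"
  have "{T. ?P T} \<subseteq> Pow G" by blast
  then have fin: "finite {T. ?P T}" by (rule finite_subset) (simp add: G(1))
  have "lin_indpt {}" unfolding lin_dep_def by blast
  then have ne: "?S \<noteq> {}" by blast
  have "Max ?S \<in> ?S" using fin ne by (intro Max_in) auto
  then obtain U where U: "U \<subseteq> G" "lin_indpt U" "card U = Max ?S" by auto
  have max: "card T \<le> card U" if "T \<subseteq> G" "lin_indpt T" for T
    unfolding U(3) using fin that by (intro Max_ge) auto
  have "maximal U ?P" unfolding maximal_def
  proof (intro conjI allI impI U(1,2))
    fix T assume T: "U \<subseteq> T \<and> T \<subseteq> G \<and> lin_indpt T"
    have "finite T" using T G(1) finite_subset by blast
    then show "T = U" using card_seteq[of T U] T max[of T] by auto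
  qed
  then have "card U = n" using dim_span[of G U] G d by simp
  moreover have finU: "finite U" using U(1) G(1) by (rule finite_subset)
  ultimately have "basis U" using U G
    by (intro dim_li_is_basis) (auto simp: dim_is_n)
  then have "span U = carrier_vec n" unfolding basis_def by simp
  moreover have "span U \<subseteq> span G" using span_is_monotone[OF U(1)] .
  moreover have "span G \<subseteq> carrier_vec n" using span_closed[of G] G(2) by auto
  ultimately show ?thesis by auto
qed

section \<open>The general linear group acting on sets of row vectors\<close>

lemma GL_simps: "mult (GL r) = (*)" "one (GL r) = 1\<^sub>m r"
  by (simp_all add: GL_def units_of_def ring_mat_simps)

lemma GL_group: "group (GL r :: 'f::field mat monoid)"
  unfolding GL_def by (rule monoid.units_group[OF ring.axioms(2)[OF ring_mat]])

lemma GL_carrier: "\<gamma> \<in> carrier (GL r) \<Longrightarrow> (\<gamma> :: 'f::field mat) \<in> carrier_mat r r"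
  by (simp add: GL_def units_of_def Units_def ring_mat_simps)

lemma GL_inv:
  assumes "\<gamma> \<in> carrier (GL r)"
  shows "inv\<^bsub>GL r\<^esub> \<gamma> \<in> carrier (GL r)" "inv\<^bsub>GL r\<^esub> \<gamma> * \<gamma> = 1\<^sub>m r" "(\<gamma> :: 'f::field mat) * inv\<^bsub>GL r\<^esub> \<gamma> = 1\<^sub>m r"
  using group.inv_closed[OF GL_group assms] group.l_inv[OF GL_group assms] group.r_inv[OF GL_group assms]
  by (simp_all add: GL_simps)

lemma GL_mult: "\<gamma> \<in> carrier (GL r) \<Longrightarrow> \<delta> \<in> carrier (GL r) \<Longrightarrow> (\<gamma> :: 'f::field mat) * \<delta> \<in> carrier (GL r)"
  using monoid.m_closed[OF group.is_monoid[OF GL_group], of \<gamma> r \<delta>] by (simp add: GL_simps)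

lemma row_act_carrier [simp]: "\<gamma> \<in> carrier_mat r r \<Longrightarrow> row_act x \<gamma> \<in> carrier_vec r"
  unfolding row_act_def by (rule carrier_vecI) (simp add: carrier_matD(2))

lemma row_act_add: "\<gamma> \<in> carrier_mat r r \<Longrightarrow> x \<in> carrier_vec r \<Longrightarrow> y \<in> carrier_vec r \<Longrightarrow>
    row_act (x + y) \<gamma> = row_act x \<gamma> + row_act y \<gamma>"
  unfolding row_act_def by (rule mult_add_distrib_mat_vec[of _ r r]) simp_all

lemma row_act_smult: "\<gamma> \<in> carrier_mat r r \<Longrightarrow> x \<in> carrier_vec r \<Longrightarrow> row_act (a \<cdot>\<^sub>v x) \<gamma> = a \<cdot>\<^sub>v row_act x \<gamma>"
  unfolding row_act_def by (rule mult_mat_vec[of _ r r]) simp_all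

lemma row_act_mult: "\<gamma> \<in> carrier_mat r r \<Longrightarrow> \<delta> \<in> carrier_mat r r \<Longrightarrow> x \<in> carrier_vec r \<Longrightarrow>
    row_act x (\<gamma> * \<delta>) = row_act (row_act x \<gamma>) \<delta>"
  unfolding row_act_def by (simp add: transpose_mult[of _ r r _ r] assoc_mult_mat_vec[of _ r r _ r])

lemma row_act_one: "x \<in> carrier_vec r \<Longrightarrow> row_act x (1\<^sub>m r) = x"
  unfolding row_act_def by simp

lemma row_act_index: "\<gamma> \<in> carrier_mat r r \<Longrightarrow> x \<in> carrier_vec r \<Longrightarrow> j < r \<Longrightarrow> row_act x \<gamma> $ j = (\<Sum>i<r. x $ i * \<gamma> $$ (i, j))"
  unfolding row_act_def by (auto simp: scalar_prod_def lessThan_atLeast0 mult.commute intro!: sum.cong)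

definition act :: "'f::field mat \<Rightarrow> 'f vec set \<Rightarrow> 'f vec set" where "act \<gamma> S = (\<lambda>x. row_act x \<gamma>) ` S"

text \<open>Stabilisers of arbitrary sets of row vectors. \<open>coset_stabilizer\<close>,
  \<open>GL_over\<close> and the conjugates of such groups all take this form, so questions about
  the groups become questions about sets of vectors.\<close>

definition Stab :: "nat \<Rightarrow> 'f::field vec set \<Rightarrow> 'f mat set" where
  "Stab r S = {\<gamma> \<in> carrier (GL r). act \<gamma> S = S}"

lemma act_mult:
  assumes "\<gamma> \<in> carrier_mat r r" "\<delta> \<in> carrier_mat r r" "S \<subseteq> carrier_vec r"
  shows "act (\<gamma> * \<delta>) S = act \<delta> (act \<gamma> S)"
  unfolding act_def image_image using assms by (intro image_cong refl row_act_mult) auto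

lemma act_one: "S \<subseteq> carrier_vec r \<Longrightarrow> act (1\<^sub>m r) S = S"
  unfolding act_def using row_act_one by force

lemma act_carrier: "\<gamma> \<in> carrier_mat r r \<Longrightarrow> act \<gamma> S \<subseteq> carrier_vec r"
  unfolding act_def by auto

lemma act_inv:
  assumes g: "\<gamma> \<in> carrier (GL r)" and S: "S \<subseteq> carrier_vec r"
  shows "act (inv\<^bsub>GL r\<^esub> \<gamma>) (act \<gamma> S) = S" "act \<gamma> (act (inv\<^bsub>GL r\<^esub> \<gamma>) S) = S"
  using GL_carrier[OF g] GL_carrier[OF GL_inv(1)[OF g]] S GL_inv[OF g]
  by (simp_all flip: act_mult add: act_one)

lemma Stab_inv: "\<gamma> \<in> Stab r S \<Longrightarrow> S \<subseteq> carrier_vec r \<Longrightarrow> inv\<^bsub>GL r\<^esub> \<gamma> \<in> Stab r S"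
  unfolding Stab_def using act_inv(1)[of \<gamma> r S] GL_inv(1)[of \<gamma> r] by auto

lemma Stab_subgroup:
  assumes S: "S \<subseteq> carrier_vec r" shows "subgroup (Stab r S) (GL r)"
proof (rule group.subgroupI[OF GL_group])
  show "Stab r S \<subseteq> carrier (GL r)" by (auto simp: Stab_def)
  have "1\<^sub>m r \<in> carrier (GL r :: 'a mat monoid)" using monoid.one_closed[OF group.is_monoid[OF GL_group]] by (simp add: GL_simps)
  then show "Stab r S \<noteq> {}" using act_one[OF S] by (auto simp: Stab_def)
  fix a b assume ab: "a \<in> Stab r S"
  show "inv\<^bsub>GL r\<^esub> a \<in> Stab r S" by (rule Stab_inv[OF ab S])
  assume b: "b \<in> Stab r S"
  show "a \<otimes>\<^bsub>GL r\<^esub> b \<in> Stab r S"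
    using ab b GL_mult[of a r b] act_mult[OF GL_carrier GL_carrier S, of a b] by (auto simp: Stab_def GL_simps)
qed

lemma coset_stabilizer_eq:
  assumes "w \<in> carrier_vec r" "L \<subseteq> carrier_vec r"
  shows "coset_stabilizer r w L = Stab r (translate w L)"
proof -
  have "translate (row_act w \<gamma>) ((\<lambda>x. row_act x \<gamma>) ` L) = act \<gamma> (translate w L)" if "\<gamma> \<in> carrier (GL r)" for \<gamma>
    unfolding translate_def act_def image_image
    using assms row_act_add[OF GL_carrier[OF that] assms(1)] by (intro image_cong refl) auto
  then show ?thesis unfolding coset_stabilizer_def Stab_def by auto
qed

text \<open>The group-theoretic counterpart of \<open>slash_eisenstein\<close>: replacing S by
  \<open>act \<gamma> S\<close> changes the group and the Eisenstein series together. The action is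
  from the right, hence the order in the conjugate.\<close>

lemma conj_Stab:
  assumes g: "\<gamma> \<in> carrier (GL r)" and S: "S \<subseteq> carrier_vec r"
  shows "conj_subgroup r \<gamma> (Stab r S) = Stab r (act \<gamma> S)"
proof -
  let ?i = "inv\<^bsub>GL r\<^esub> \<gamma>"
  note gc = GL_carrier[OF g] and ic = GL_carrier[OF GL_inv(1)[OF g]]
  show ?thesis
  proof (intro equalityI subsetI)
    fix x assume "x \<in> conj_subgroup r \<gamma> (Stab r S)"
    then obtain d where d: "d \<in> carrier (GL r)" "act d S = S" "x = ?i * d * \<gamma>" unfolding conj_subgroup_def Stab_def by auto
    have "x \<in> carrier (GL r)" unfolding d(3) by (intro GL_mult GL_inv(1) g d(1))
    moreover have "act x (act \<gamma> S) = act \<gamma> S"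
    proof -
      have "act x (act \<gamma> S) = act \<gamma> (act d (act ?i (act \<gamma> S)))"
        unfolding d(3) using act_mult[OF mult_carrier_mat[OF ic GL_carrier[OF d(1)]] gc act_carrier[OF gc]]
          act_mult[OF ic GL_carrier[OF d(1)] act_carrier[OF gc]] by simp
      then show ?thesis using act_inv(1)[OF g S] d(2) by simp
    qed
    ultimately show "x \<in> Stab r (act \<gamma> S)" by (simp add: Stab_def)
  next
    fix x assume x: "x \<in> Stab r (act \<gamma> S)"
    then have xG: "x \<in> carrier (GL r)" and xs: "act x (act \<gamma> S) = act \<gamma> S" by (auto simp: Stab_def)
    note xc = GL_carrier[OF xG]
    define d where "d = \<gamma> * x * ?i"
    have "d \<in> carrier (GL r)" unfolding d_def by (intro GL_mult GL_inv(1) g xG)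
    moreover have "act d S = S"
      unfolding d_def using act_mult[OF mult_carrier_mat[OF gc xc] ic S] act_mult[OF gc xc S] xs act_inv(1)[OF g S] by simp
    moreover have "x = ?i * d * \<gamma>"
    proof -
      have "?i * d * \<gamma> = (?i * \<gamma>) * x * (?i * \<gamma>)"
        unfolding d_def using gc ic xc by (simp add: assoc_mult_mat[of _ r r _ r _ r])
      then show ?thesis using GL_inv(2)[OF g] xc by simp
    qed
    ultimately show "x \<in> conj_subgroup r \<gamma> (Stab r S)" unfolding conj_subgroup_def Stab_def by blast
  qed
qed

text \<open>Orbit-stabiliser: the cosets of \<open>Stab S \<inter> Stab S'\<close> in \<open>Stab S\<close> inject into the orbit of \<open>S'\<close>.\<close>

lemma finite_rcosets_Stab:
  assumes S: "S \<subseteq> carrier_vec r" "S' \<subseteq> carrier_vec r" and fin: "finite ((\<lambda>\<gamma>. act \<gamma> S') ` Stab r S)"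
    and H: "H = Stab r S \<inter> Stab r S'"
  shows "finite (rcosets\<^bsub>(GL r)\<lparr>carrier := Stab r S\<rparr>\<^esub> H)"
proof -
  let ?G = "(GL r)\<lparr>carrier := Stab r S\<rparr>"
  have coset: "H #>\<^bsub>?G\<^esub> a = (\<lambda>h. h * a) ` H" for a
    unfolding r_coset_def by (auto simp: GL_simps)
  have sub: "(\<lambda>h. h * a) ` H \<subseteq> (\<lambda>h. h * b) ` H"
    if a: "a \<in> Stab r S" and b: "b \<in> Stab r S" and ab: "act a S' = act b S'" for a b
  proof
    fix x assume "x \<in> (\<lambda>h. h * a) ` H"
    then obtain h where h: "h \<in> H" "x = h * a" by blast
    have G: "a \<in> carrier (GL r)" "b \<in> carrier (GL r)" "h \<in> carrier (GL r)" using a b h H by (auto simp: Stab_def)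
    let ?bi = "inv\<^bsub>GL r\<^esub> b"
    have bi: "?bi \<in> Stab r S" by (rule Stab_inv[OF b S(1)])
    note c = GL_carrier[OF G(1)] GL_carrier[OF G(2)] GL_carrier[OF G(3)] GL_carrier[OF GL_inv(1)[OF G(2)]]
    have sg: "subgroup (Stab r S) (GL r)" by (rule Stab_subgroup[OF S(1)])
    have ha: "h * a \<in> Stab r S" using subgroup.m_closed[OF sg, of h a] h H a by (simp add: GL_simps)
    have 1: "h * a * ?bi \<in> Stab r S" using subgroup.m_closed[OF sg ha bi] by (simp add: GL_simps)
    have "act (h * a * ?bi) S' = act ?bi (act a (act h S'))"
      using act_mult[OF mult_carrier_mat[OF c(3,1)] c(4) S(2)] act_mult[OF c(3,1) S(2)] by simp
    also have "act h S' = S'" using h H by (auto simp: Stab_def)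
    also have "act ?bi (act a S') = S'" unfolding ab by (rule act_inv(1)[OF G(2) S(2)])
    finally have "h * a * ?bi \<in> H" using 1 H by (auto simp: Stab_def)
    moreover have "x = h * a * ?bi * b"
      using h(2) GL_inv(2)[OF G(2)] c by (simp add: assoc_mult_mat[of _ r r _ r _ r])
    ultimately show "x \<in> (\<lambda>h. h * b) ` H" by blast
  qed
  have eq: "(\<lambda>h. h * a) ` H = (\<lambda>h. h * b) ` H" if "a \<in> Stab r S" "b \<in> Stab r S" "act a S' = act b S'" for a b
    using sub[OF that] sub[OF that(2,1) that(3)[symmetric]] by (rule equalityI)
  \<comment> \<open>A coset is recovered from the image of S' under any one of its elements; the
    cosets thus form an image of the finite orbit.\<close>
  define g where "g M = (\<lambda>h. h * (SOME b. b \<in> Stab r S \<and> act b S' = M)) ` H" for M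
  have "rcosets\<^bsub>?G\<^esub> H \<subseteq> g ` ((\<lambda>\<gamma>. act \<gamma> S') ` Stab r S)"
  proof
    fix T assume "T \<in> rcosets\<^bsub>?G\<^esub> H"
    then obtain a where a: "a \<in> Stab r S" "T = (\<lambda>h. h * a) ` H" unfolding RCOSETS_def coset by auto
    let ?b = "SOME b. b \<in> Stab r S \<and> act b S' = act a S'"
    have "?b \<in> Stab r S \<and> act ?b S' = act a S'" by (rule someI[of _ a]) (use a in simp)
    then have "T = g (act a S')" unfolding a(2) g_def by (intro eq a(1)) auto
    then show "T \<in> g ` ((\<lambda>\<gamma>. act \<gamma> S') ` Stab r S)" using a(1) by blast
  qed
  then show ?thesis using fin by (meson finite_imageI finite_subset)
qed

section \<open>Lattices, commensurability and arithmetic groups\<close>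

context function_field_at
begin

definition Avec :: "nat \<Rightarrow> 'f vec set" where "Avec n = {x \<in> carrier_vec n. \<forall>i<n. x $ i \<in> A}"

lemma Avec_eq: "{x \<in> carrier_vec n. set\<^sub>v x \<subseteq> A} = Avec n"
  by (auto simp: Avec_def vec_set_def)

lemma Avec_carrier: "Avec n \<subseteq> carrier_vec n" by (auto simp: Avec_def)

lemma Avec_add: "x \<in> Avec n \<Longrightarrow> y \<in> Avec n \<Longrightarrow> x + y \<in> Avec n"
  by (auto simp: Avec_def intro!: ring_set_add[OF A_ring])

lemma Avec_smult: "a \<in> A \<Longrightarrow> x \<in> Avec n \<Longrightarrow> a \<cdot>\<^sub>v x \<in> Avec n"
  by (auto simp: Avec_def intro!: ring_set_mult[OF A_ring])

lemma A_0: "0 \<in> A" and A_1: "1 \<in> A" and A_m1: "- 1 \<in> A"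
  using ring_set_0[OF A_ring] ring_set_1[OF A_ring] ring_set_uminus[OF A_ring] by blast+

lemma common_denominators:
  assumes "finite E" shows "\<exists>d\<in>A. d \<noteq> 0 \<and> (\<forall>f\<in>E. d * f \<in> A)"
  using assms
proof (induction E rule: finite_induct)
  case empty
  then show ?case using A_1 by (intro bexI[of _ 1]) auto
next
  case (insert f E)
  obtain d where d: "d \<in> A" "d \<noteq> 0" "\<forall>f\<in>E. d * f \<in> A" using insert.IH by blast
  obtain e where e: "e \<in> A" "e \<noteq> 0" "e * f \<in> A" using A_fractions_cocompact(1)[of f] by blast
  have "d * e * g \<in> A" if "g \<in> insert f E" for g
  proof (cases "g = f")
    case True
    then show ?thesis using ring_set_mult[OF A_ring d(1) e(3)] by (simp add: mult.assoc)
  next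
    case False
    then have "d * g \<in> A" using d(3) that by blast
    then show ?thesis using ring_set_mult[OF A_ring e(1)] by (metis mult.assoc mult.commute)
  qed
  then show ?case using d e ring_set_mult[OF A_ring d(1) e(1)] by (intro bexI[of _ "d * e"]) auto
qed

text \<open>Commensurability with A^r: each of the two modules contains a nonzero multiple of the
  other. In this form the lattice property passes to images under matrices over F, and discreteness
  and cocompactness are inherited from A.\<close>

definition alat :: "nat \<Rightarrow> 'f vec set \<Rightarrow> bool" where
  "alat r L \<longleftrightarrow> L \<subseteq> carrier_vec r \<and> (\<forall>x\<in>L. \<forall>y\<in>L. x + y \<in> L) \<and> (\<forall>a\<in>A. \<forall>x\<in>L. a \<cdot>\<^sub>v x \<in> L) \<and>
     (\<exists>d\<in>A. d \<noteq> 0 \<and> (\<forall>x\<in>Avec r. d \<cdot>\<^sub>v x \<in> L)) \<and> (\<exists>d\<in>A. d \<noteq> 0 \<and> (\<forall>x\<in>L. d \<cdot>\<^sub>v x \<in> Avec r))"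

lemma alatD:
  assumes "alat r L"
  shows "L \<subseteq> carrier_vec r" "\<And>x y. x \<in> L \<Longrightarrow> y \<in> L \<Longrightarrow> x + y \<in> L" "\<And>a x. a \<in> A \<Longrightarrow> x \<in> L \<Longrightarrow> a \<cdot>\<^sub>v x \<in> L"
    "\<exists>d\<in>A. d \<noteq> 0 \<and> (\<forall>x\<in>Avec r. d \<cdot>\<^sub>v x \<in> L)" "\<exists>d\<in>A. d \<noteq> 0 \<and> (\<forall>x\<in>L. d \<cdot>\<^sub>v x \<in> Avec r)"
  using assms unfolding alat_def by blast+

lemma alat_0: "alat r L \<Longrightarrow> 0\<^sub>v r \<in> L"
proof -
  assume L: "alat r L"
  then obtain d where "d \<in> A" "\<forall>x\<in>Avec r. d \<cdot>\<^sub>v x \<in> L" using alatD(4) by blast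
  moreover have "0\<^sub>v r \<in> Avec r" using A_0 by (auto simp: Avec_def)
  ultimately have "d \<cdot>\<^sub>v 0\<^sub>v r \<in> L" by blast
  moreover have "d \<cdot>\<^sub>v 0\<^sub>v r = 0\<^sub>v r" by (rule eq_vecI) auto
  ultimately show ?thesis by simp
qed

lemma alat_uminus: "alat r L \<Longrightarrow> x \<in> L \<Longrightarrow> - x \<in> L"
proof -
  assume L: "alat r L" and x: "x \<in> L"
  have "(- 1) \<cdot>\<^sub>v x \<in> L" by (rule alatD(3)[OF L A_m1 x])
  moreover have "(- 1) \<cdot>\<^sub>v x = - x" by (rule eq_vecI) auto
  ultimately show ?thesis by simp
qed

lemma alat_minus: "alat r L \<Longrightarrow> x \<in> L \<Longrightarrow> y \<in> L \<Longrightarrow> x - y \<in> L"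
proof -
  assume L: "alat r L" and x: "x \<in> L" and y: "y \<in> L"
  have "x + - y \<in> L" by (rule alatD(2)[OF L x alat_uminus[OF L y]])
  moreover have "x + - y = x - y" using alatD(1)[OF L] x y by (intro eq_vecI) auto
  ultimately show ?thesis by simp
qed

lemma Avec_alat: "alat r (Avec r)"
  unfolding alat_def using Avec_carrier Avec_add Avec_smult A_1 by (auto intro!: bexI[of _ 1])

text \<open>The images of the unit vectors generate the image of p; the inner induction clears the
  coordinates of y one at a time.\<close>

lemma linear_over_induct:
  assumes lin: "linear_over A (Avec n) p" and pr: "\<And>y. y \<in> Avec n \<Longrightarrow> p y \<in> carrier_vec r"
    and N: "0\<^sub>v r \<in> N" "\<And>x y. x \<in> N \<Longrightarrow> y \<in> N \<Longrightarrow> x + y \<in> N" "\<And>a x. a \<in> A \<Longrightarrow> x \<in> N \<Longrightarrow> a \<cdot>\<^sub>v x \<in> N"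
    and g: "\<And>j. j < n \<Longrightarrow> p (unit_vec n j) \<in> N" and y: "y \<in> Avec n"
  shows "p y \<in> N"
proof -
  have e: "unit_vec n j \<in> Avec n" if "j < n" for j
    using that A_0 A_1 by (auto simp: Avec_def unit_vec_def)
  have padd: "p (x + z) = p x + p z" if "x \<in> Avec n" "z \<in> Avec n" for x z
    using lin that unfolding linear_over_def by blast
  have psm: "p (a \<cdot>\<^sub>v x) = a \<cdot>\<^sub>v p x" if "a \<in> A" "x \<in> Avec n" for a x
    using lin that unfolding linear_over_def by blast
  have "p y \<in> N" if "y \<in> Avec n" "\<forall>i<n. m \<le> i \<longrightarrow> y $ i = 0" for m y
    using that
  proof (induction m arbitrary: y)
    case 0
    then have "y = 0 \<cdot>\<^sub>v y" by (intro eq_vecI) (auto simp: Avec_def)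
    then have "p y = 0 \<cdot>\<^sub>v p y" using psm[OF A_0 0(1)] by simp
    also have "\<dots> = 0\<^sub>v r" using pr[OF 0(1)] by (intro eq_vecI) auto
    finally show ?case using N(1) by simp
  next
    case (Suc m)
    show ?case
    proof (cases "m < n")
      case False
      then show ?thesis using Suc by auto
    next
      case True
      have ym: "y $ m \<in> A" using Suc.prems True by (auto simp: Avec_def)
      define y' where "y' = y + (- (y $ m)) \<cdot>\<^sub>v unit_vec n m"
      have y': "y' \<in> Avec n" unfolding y'_def
        by (intro Avec_add Avec_smult e Suc.prems True ring_set_uminus[OF A_ring] ym)
      have "p y' \<in> N" by (rule Suc.IH[OF y'])
        (use Suc.prems True in \<open>auto simp: y'_def Avec_def unit_vec_def\<close>)
      moreover have "y = y' + (y $ m) \<cdot>\<^sub>v unit_vec n m"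
        using Suc.prems(1) unfolding y'_def by (intro eq_vecI) (auto simp: Avec_def)
      then have "p y = p y' + (y $ m) \<cdot>\<^sub>v p (unit_vec n m)"
        using padd[OF y' Avec_smult[OF ym e[OF True]]] psm[OF ym e[OF True]] by simp
      ultimately show ?thesis using N(2) N(3)[OF ym g[OF True]] by simp
    qed
  qed
  from this[of y n] show ?thesis using y by simp
qed

text \<open>The retraction p maps A^n onto L, so L is generated by the images of unit vectors. A
  common denominator of their coordinates bounds L from above. From below, rank r forces the
  generators to span F^r; the vectors with a nonzero multiple in L form an F-subspace, hence include
  the unit vectors.\<close>

lemma alat_of_lattice_in:
  assumes lat: "lattice_in r A L" shows "alat r L"
proof -
  have Lc: "L \<subseteq> carrier_vec r" and L0: "0\<^sub>v r \<in> L" and Ladd: "\<forall>x\<in>L. \<forall>y\<in>L. x + y \<in> L"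
    and Lsm: "\<forall>a\<in>A. \<forall>x\<in>L. a \<cdot>\<^sub>v x \<in> L" and fg: "fg_projective A L" and rk: "module_rank r L = r"
    using lat unfolding lattice_in_def by auto
  obtain n p s where lin: "linear_over A (Avec n) p" and pL: "p ` Avec n \<subseteq> L" and sL: "s ` L \<subseteq> Avec n"
    and ps: "\<forall>x\<in>L. p (s x) = x"
    using fg unfolding fg_projective_def Let_def Avec_eq by blast
  define g where "g j = p (unit_vec n j)" for j
  have e: "unit_vec n j \<in> Avec n" if "j < n" for j
    using that A_0 A_1 by (auto simp: Avec_def unit_vec_def)
  have gL: "g j \<in> L" if "j < n" for j unfolding g_def using pL e[OF that] by blast
  have pr: "p y \<in> carrier_vec r" if "y \<in> Avec n" for y using pL Lc that by blast
  have L_ind: "x \<in> N" if x: "x \<in> L" and N: "0\<^sub>v r \<in> N" "\<And>x y. x \<in> N \<Longrightarrow> y \<in> N \<Longrightarrow> x + y \<in> N"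
    "\<And>a x. a \<in> A \<Longrightarrow> x \<in> N \<Longrightarrow> a \<cdot>\<^sub>v x \<in> N" "\<And>j. j < n \<Longrightarrow> g j \<in> N" for x N
  proof -
    have "s x \<in> Avec n" using sL x by blast
    with linear_over_induct[OF lin _ N(1-3) N(4)[unfolded g_def], of "s x"] pr have "p (s x) \<in> N" by metis
    then show ?thesis using ps x by simp
  qed
  obtain d where d: "d \<in> A" "d \<noteq> 0" "\<forall>f\<in>(\<lambda>(j,i). g j $ i) ` ({..<n} \<times> {..<r}). d * f \<in> A"
    using common_denominators[of "(\<lambda>(j,i). g j $ i) ` ({..<n} \<times> {..<r})"] by auto
  have up: "d \<cdot>\<^sub>v x \<in> Avec r" if "x \<in> L" for x
  proof -
    have "x \<in> {x \<in> carrier_vec r. d \<cdot>\<^sub>v x \<in> Avec r}"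
    proof (rule L_ind[OF that])
      show "0\<^sub>v r \<in> {x \<in> carrier_vec r. d \<cdot>\<^sub>v x \<in> Avec r}" using A_0 by (auto simp: Avec_def)
    next
      fix x y assume "x \<in> {x \<in> carrier_vec r. d \<cdot>\<^sub>v x \<in> Avec r}" "y \<in> {x \<in> carrier_vec r. d \<cdot>\<^sub>v x \<in> Avec r}"
      then show "x + y \<in> {x \<in> carrier_vec r. d \<cdot>\<^sub>v x \<in> Avec r}"
        using Avec_add[of "d \<cdot>\<^sub>v x" r "d \<cdot>\<^sub>v y"] by (auto simp: smult_add_distrib_vec[of _ r])
    next
      fix a x assume a: "a \<in> A" and x: "x \<in> {x \<in> carrier_vec r. d \<cdot>\<^sub>v x \<in> Avec r}"
      then have "a \<cdot>\<^sub>v (d \<cdot>\<^sub>v x) \<in> Avec r" using Avec_smult by blast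
      then show "a \<cdot>\<^sub>v x \<in> {x \<in> carrier_vec r. d \<cdot>\<^sub>v x \<in> Avec r}" using x by (auto simp: smult_smult_assoc mult.commute)
    next
      fix j assume j: "j < n"
      show "g j \<in> {x \<in> carrier_vec r. d \<cdot>\<^sub>v x \<in> Avec r}" using d(3) gL[OF j] Lc j by (fastforce simp: Avec_def)
    qed
    then show ?thesis by simp
  qed
  interpret vs: vec_space "TYPE('f)" r .
  let ?G = "g ` {..<n}"
  have Gc: "?G \<subseteq> carrier_vec r" using gL Lc by auto
  have Gsub: "vs.span ?G \<subseteq> carrier_vec r" using vs.span_closed[OF Gc] by auto
  have sm: "submodule class_ring (vs.span ?G) vs.V" by (rule vs.span_is_submodule) (use Gc in simp)
  have Lspan: "L \<subseteq> vs.span ?G"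
  proof
    fix x assume x: "x \<in> L"
    show "x \<in> vs.span ?G"
    proof (rule L_ind[OF x, of "vs.span ?G"])
      show "0\<^sub>v r \<in> vs.span ?G" using LinearCombinations.submodule.zero_closed[OF sm] by simp
    next
      fix x y assume "x \<in> vs.span ?G" "y \<in> vs.span ?G"
      then show "x + y \<in> vs.span ?G" by (rule vs.span_add1[OF Gc])
    next
      fix a x assume "x \<in> vs.span ?G"
      then show "a \<cdot>\<^sub>v x \<in> vs.span ?G" by (rule vs.smult_in_span[OF Gc])
    next
      fix j assume "j < n"
      then show "g j \<in> vs.span ?G" using vs.in_own_span[OF Gc] by blast
    qed
  qed
  have GL: "?G \<subseteq> L" using gL by auto
  have "vs.span L = vs.span ?G"
  proof
    show "vs.span L \<subseteq> vs.span ?G" using vs.span_is_subset[OF Lspan sm] .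
    show "vs.span ?G \<subseteq> vs.span L" by (rule vs.span_is_monotone[OF GL])
  qed
  then have "vectorspace.dim class_ring (vs.vs (vs.span ?G)) = r" using rk unfolding module_rank_def by simp
  then have full: "vs.span ?G = carrier_vec r" by (intro vs.full_span Gc) simp
  let ?N = "{x \<in> carrier_vec r. \<exists>d\<in>A. d \<noteq> 0 \<and> d \<cdot>\<^sub>v x \<in> L}"
  have "1 \<cdot>\<^sub>v 0\<^sub>v r \<in> L" using L0 by simp
  then have N0: "0\<^sub>v r \<in> ?N" using A_1 one_neq_zero zero_carrier_vec by blast
  have Nadd: "x + y \<in> ?N" if "x \<in> ?N" "y \<in> ?N" for x y
  proof -
    from that obtain d e where de: "x \<in> carrier_vec r" "y \<in> carrier_vec r" "d \<in> A" "d \<noteq> 0" "d \<cdot>\<^sub>v x \<in> L" "e \<in> A" "e \<noteq> 0" "e \<cdot>\<^sub>v y \<in> L"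
      by blast
    have "(d * e) \<cdot>\<^sub>v (x + y) = e \<cdot>\<^sub>v (d \<cdot>\<^sub>v x) + d \<cdot>\<^sub>v (e \<cdot>\<^sub>v y)"
      using de(1,2) by (intro eq_vecI) (auto simp: algebra_simps)
    also have "\<dots> \<in> L" using Lsm Ladd de by blast
    finally have "(d * e) \<cdot>\<^sub>v (x + y) \<in> L" .
    moreover have "d * e \<in> A" "d * e \<noteq> 0" using de ring_set_mult[OF A_ring de(3,6)] by auto
    moreover have "x + y \<in> carrier_vec r" using de by simp
    ultimately show ?thesis by blast
  qed
  have Nsm: "c \<cdot>\<^sub>v x \<in> ?N" if x: "x \<in> ?N" for c x
  proof -
    obtain d where d: "x \<in> carrier_vec r" "d \<in> A" "d \<noteq> 0" "d \<cdot>\<^sub>v x \<in> L" using x by blast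
    obtain e where e: "e \<in> A" "e \<noteq> 0" "e * c \<in> A" using A_fractions_cocompact(1)[of c] by blast
    have "(d * e) \<cdot>\<^sub>v (c \<cdot>\<^sub>v x) = (e * c) \<cdot>\<^sub>v (d \<cdot>\<^sub>v x)"
      using d(1) by (intro eq_vecI) (auto simp: algebra_simps)
    also have "\<dots> \<in> L" using Lsm d e by blast
    finally have "(d * e) \<cdot>\<^sub>v (c \<cdot>\<^sub>v x) \<in> L" .
    moreover have "d * e \<in> A" "d * e \<noteq> 0" using d e ring_set_mult[OF A_ring d(2) e(1)] by auto
    moreover have "c \<cdot>\<^sub>v x \<in> carrier_vec r" using d by simp
    ultimately show ?thesis by blast
  qed
  have "LinearCombinations.submodule class_ring ?N vs.V"
  proof (rule LinearCombinations.submodule.intro)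
    show "module class_ring vs.V" by (rule vs.module_axioms)
    show "?N \<subseteq> carrier vs.V" by (auto simp: module_vec_simps)
    show "\<zero>\<^bsub>vs.V\<^esub> \<in> ?N" using N0 by (simp only: module_vec_simps)
    show "x \<oplus>\<^bsub>vs.V\<^esub> y \<in> ?N" if "x \<in> ?N" "y \<in> ?N" for x y
      using Nadd[OF that] by (simp only: module_vec_simps)
    show "c \<odot>\<^bsub>vs.V\<^esub> x \<in> ?N" if "c \<in> carrier class_ring" "x \<in> ?N" for c x
      using Nsm[OF that(2)] by (simp only: module_vec_simps)
  qed
  moreover have "?G \<subseteq> ?N"
  proof
    fix x assume "x \<in> ?G"
    then have x: "x \<in> L" "x \<in> carrier_vec r" using GL Gc by blast+
    then have "1 \<cdot>\<^sub>v x \<in> L" by simp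
    then show "x \<in> ?N" using x A_1 one_neq_zero by blast
  qed
  ultimately have "vs.span ?G \<subseteq> ?N" by (intro vs.span_is_subset)
  then have den: "\<exists>d\<in>A. d \<noteq> 0 \<and> d \<cdot>\<^sub>v x \<in> L" if "x \<in> carrier_vec r" for x using that full by blast
  have "\<exists>D\<in>A. D \<noteq> 0 \<and> (\<forall>i<m. D \<cdot>\<^sub>v unit_vec r i \<in> L)" for m
  proof (induction m)
    case 0
    show ?case using A_1 by (intro bexI[of _ 1]) auto
  next
    case (Suc m)
    then obtain D where D: "D \<in> A" "D \<noteq> 0" "\<forall>i<m. D \<cdot>\<^sub>v unit_vec r i \<in> L" by blast
    obtain d where d: "d \<in> A" "d \<noteq> 0" "d \<cdot>\<^sub>v unit_vec r m \<in> L" using den[of "unit_vec r m"] by auto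
    have "(d * D) \<cdot>\<^sub>v unit_vec r i \<in> L" if "i < Suc m" for i
    proof (cases "i = m")
      case True
      then have "D \<cdot>\<^sub>v (d \<cdot>\<^sub>v unit_vec r i) \<in> L" using Lsm D(1) d(3) by blast
      then show ?thesis by (simp add: smult_smult_assoc mult.commute)
    next
      case False
      then have "d \<cdot>\<^sub>v (D \<cdot>\<^sub>v unit_vec r i) \<in> L" using Lsm d(1) D(3) that by auto
      then show ?thesis by (simp add: smult_smult_assoc)
    qed
    then show ?case using d D ring_set_mult[OF A_ring d(1) D(1)] by (intro bexI[of _ "d * D"]) auto
  qed
  from this[of r] obtain D where D: "D \<in> A" "D \<noteq> 0" "\<forall>i<r. D \<cdot>\<^sub>v unit_vec r i \<in> L" by blast
  have down: "D \<cdot>\<^sub>v x \<in> L" if "x \<in> Avec r" for x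
  proof -
    have "(\<lambda>x. x) x \<in> {x \<in> carrier_vec r. D \<cdot>\<^sub>v x \<in> L}"
    proof (rule linear_over_induct[where n = r and r = r])
      show "linear_over A (Avec r) (\<lambda>x. x)" by (simp add: linear_over_def)
      show "0\<^sub>v r \<in> {x \<in> carrier_vec r. D \<cdot>\<^sub>v x \<in> L}" using L0 by simp
    next
      fix y assume "y \<in> Avec r" then show "y \<in> carrier_vec r" using Avec_carrier by blast
    next
      fix x y assume xy: "x \<in> {x \<in> carrier_vec r. D \<cdot>\<^sub>v x \<in> L}" "y \<in> {x \<in> carrier_vec r. D \<cdot>\<^sub>v x \<in> L}"
      then have "D \<cdot>\<^sub>v x + D \<cdot>\<^sub>v y \<in> L" using Ladd by blast
      then show "x + y \<in> {x \<in> carrier_vec r. D \<cdot>\<^sub>v x \<in> L}" using xy by (simp add: smult_add_distrib_vec[of _ r])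
    next
      fix a x assume ax: "a \<in> A" "x \<in> {x \<in> carrier_vec r. D \<cdot>\<^sub>v x \<in> L}"
      then have "a \<cdot>\<^sub>v (D \<cdot>\<^sub>v x) \<in> L" using Lsm by blast
      then show "a \<cdot>\<^sub>v x \<in> {x \<in> carrier_vec r. D \<cdot>\<^sub>v x \<in> L}" using ax by (simp add: smult_smult_assoc mult.commute)
    next
      fix j assume "j < r" then show "unit_vec r j \<in> {x \<in> carrier_vec r. D \<cdot>\<^sub>v x \<in> L}" using D(3) by simp
    qed (rule that)
    then show ?thesis by simp
  qed
  show ?thesis unfolding alat_def using Lc Ladd Lsm D(1,2) down d(1,2) up by blast
qed

lemma Avec_act:
  assumes g: "\<gamma> \<in> carrier_mat r r" and el: "\<And>i j. i < r \<Longrightarrow> j < r \<Longrightarrow> c * \<gamma> $$ (i, j) \<in> A" and x: "x \<in> Avec r"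
  shows "c \<cdot>\<^sub>v row_act x \<gamma> \<in> Avec r"
proof -
  have xc: "x \<in> carrier_vec r" "\<And>i. i < r \<Longrightarrow> x $ i \<in> A" using x by (auto simp: Avec_def)
  have "c * row_act x \<gamma> $ j \<in> A" if "j < r" for j
  proof -
    have "c * row_act x \<gamma> $ j = (\<Sum>i<r. x $ i * (c * \<gamma> $$ (i, j)))"
      unfolding row_act_index[OF g xc(1) that] sum_distrib_left by (intro sum.cong refl) (simp only: mult_ac)
    also have "\<dots> \<in> A" using xc(2) el that by (intro ring_set_sum[OF A_ring] ring_set_mult[OF A_ring, of "x $ _"]) auto
    finally show ?thesis .
  qed
  then show ?thesis using row_act_carrier[OF g, of x] by (auto simp: Avec_def)
qed

lemma mat_denominator: "\<exists>c\<in>A. c \<noteq> 0 \<and> (\<forall>i<r. \<forall>j<r. c * \<gamma> $$ (i, j) \<in> A)"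
  using common_denominators[of "(\<lambda>(i,j). \<gamma> $$ (i,j)) ` ({..<r} \<times> {..<r})"] by auto

text \<open>A denominator of \<gamma> bounds the image from above, a denominator of the inverse
  matrix bounds it from below.\<close>

lemma alat_act:
  assumes g: "\<gamma> \<in> carrier (GL r)" and L: "alat r L" shows "alat r (act \<gamma> L)"
proof -
  note gc = GL_carrier[OF g] and ic = GL_carrier[OF GL_inv(1)[OF g]]
  note Lc = alatD(1)[OF L]
  obtain c where c: "c \<in> A" "c \<noteq> 0" "\<forall>i<r. \<forall>j<r. c * \<gamma> $$ (i, j) \<in> A" using mat_denominator by blast
  obtain b where b: "b \<in> A" "b \<noteq> 0" "\<forall>i<r. \<forall>j<r. b * (inv\<^bsub>GL r\<^esub> \<gamma>) $$ (i, j) \<in> A" using mat_denominator by blast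
  obtain d where d: "d \<in> A" "d \<noteq> 0" "\<forall>x\<in>Avec r. d \<cdot>\<^sub>v x \<in> L" using alatD(4)[OF L] by blast
  obtain e where e: "e \<in> A" "e \<noteq> 0" "\<forall>x\<in>L. e \<cdot>\<^sub>v x \<in> Avec r" using alatD(5)[OF L] by blast
  have 1: "(d * b) \<cdot>\<^sub>v x \<in> act \<gamma> L" if x: "x \<in> Avec r" for x
  proof -
    have xc: "x \<in> carrier_vec r" using x Avec_carrier by blast
    have "b \<cdot>\<^sub>v row_act x (inv\<^bsub>GL r\<^esub> \<gamma>) \<in> Avec r" by (rule Avec_act[OF ic _ x]) (use b in blast)
    then have l: "d \<cdot>\<^sub>v (b \<cdot>\<^sub>v row_act x (inv\<^bsub>GL r\<^esub> \<gamma>)) \<in> L" using d(3) by blast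
    have "row_act (d \<cdot>\<^sub>v (b \<cdot>\<^sub>v row_act x (inv\<^bsub>GL r\<^esub> \<gamma>))) \<gamma> = d \<cdot>\<^sub>v (b \<cdot>\<^sub>v row_act (row_act x (inv\<^bsub>GL r\<^esub> \<gamma>)) \<gamma>)"
      using row_act_carrier[OF ic, of x] by (simp add: row_act_smult[OF gc])
    also have "row_act (row_act x (inv\<^bsub>GL r\<^esub> \<gamma>)) \<gamma> = x"
      by (simp add: row_act_mult[OF ic gc xc, symmetric] GL_inv(2)[OF g] row_act_one[OF xc])
    also have "d \<cdot>\<^sub>v (b \<cdot>\<^sub>v x) = (d * b) \<cdot>\<^sub>v x" by (simp add: smult_smult_assoc)
    finally show ?thesis using l unfolding act_def by (metis imageI)
  qed
  have 2: "(c * e) \<cdot>\<^sub>v y \<in> Avec r" if y: "y \<in> act \<gamma> L" for y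
  proof -
    obtain l where l: "l \<in> L" "y = row_act l \<gamma>" using y unfolding act_def by blast
    have "c \<cdot>\<^sub>v row_act (e \<cdot>\<^sub>v l) \<gamma> \<in> Avec r" by (rule Avec_act[OF gc]) (use c e l in blast)+
    then show ?thesis using l Lc by (auto simp: row_act_smult[OF gc] smult_smult_assoc)
  qed
  show ?thesis unfolding alat_def
  proof (intro conjI ballI)
    show "act \<gamma> L \<subseteq> carrier_vec r" by (rule act_carrier[OF gc])
    fix x assume "x \<in> act \<gamma> L"
    then obtain l where l: "l \<in> L" "x = row_act l \<gamma>" unfolding act_def by blast
    have lc: "l \<in> carrier_vec r" using l Lc by blast
    show "a \<cdot>\<^sub>v x \<in> act \<gamma> L" if "a \<in> A" for a
      using alatD(3)[OF L that l(1)] row_act_smult[OF gc lc, of a] unfolding act_def l(2) by (metis imageI)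
    fix y assume "y \<in> act \<gamma> L"
    then obtain m where m: "m \<in> L" "y = row_act m \<gamma>" unfolding act_def by blast
    have mc: "m \<in> carrier_vec r" using m Lc by blast
    show "x + y \<in> act \<gamma> L"
      using alatD(2)[OF L l(1) m(1)] row_act_add[OF gc lc mc] unfolding act_def l(2) m(2) by (metis imageI)
  next
    show "\<exists>d\<in>A. d \<noteq> 0 \<and> (\<forall>x\<in>Avec r. d \<cdot>\<^sub>v x \<in> act \<gamma> L)"
      using 1 d b ring_set_mult[OF A_ring d(1) b(1)] by (intro bexI[of _ "d * b"]) auto
    show "\<exists>d\<in>A. d \<noteq> 0 \<and> (\<forall>x\<in>act \<gamma> L. d \<cdot>\<^sub>v x \<in> Avec r)"
      using 2 c e ring_set_mult[OF A_ring c(1) e(1)] by (intro bexI[of _ "c * e"]) auto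
  qed
qed

lemma GL_over_eq: "GL_over r A = Stab r (Avec r)"
proof (intro equalityI subsetI)
  fix \<gamma> assume "\<gamma> \<in> GL_over r A"
  then have g: "\<gamma> \<in> carrier (GL r)" and el: "elements_mat \<gamma> \<subseteq> A" "elements_mat (inv\<^bsub>GL r\<^esub> \<gamma>) \<subseteq> A" unfolding GL_over_def by auto
  note gc = GL_carrier[OF g] and ic = GL_carrier[OF GL_inv(1)[OF g]]
  have sub: "act \<delta> (Avec r) \<subseteq> Avec r" if dc: "\<delta> \<in> carrier_mat r r" and del: "elements_mat \<delta> \<subseteq> A" for \<delta>
  proof
    fix y assume "y \<in> act \<delta> (Avec r)"
    then obtain x where x: "x \<in> Avec r" "y = row_act x \<delta>" unfolding act_def by blast
    have "1 * \<delta> $$ (i, j) \<in> A" if "i < r" "j < r" for i j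
      using elements_matI[OF dc that refl] del by auto
    from Avec_act[OF dc this x(1)] show "y \<in> Avec r" unfolding x(2) by simp
  qed
  have "act \<gamma> (Avec r) = Avec r"
  proof
    show "act \<gamma> (Avec r) \<subseteq> Avec r" by (rule sub[OF gc el(1)])
    have "act \<gamma> (act (inv\<^bsub>GL r\<^esub> \<gamma>) (Avec r)) \<subseteq> act \<gamma> (Avec r)"
      using sub[OF ic el(2)] unfolding act_def by (rule image_mono)
    then show "Avec r \<subseteq> act \<gamma> (Avec r)" unfolding act_inv(2)[OF g Avec_carrier] .
  qed
  then show "\<gamma> \<in> Stab r (Avec r)" using g by (simp add: Stab_def)
next
  fix \<gamma> assume s: "\<gamma> \<in> Stab r (Avec r)"
  have el: "elements_mat \<delta> \<subseteq> A" if d: "\<delta> \<in> Stab r (Avec r)" for \<delta>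
  proof
    fix a assume "a \<in> elements_mat \<delta>"
    have dc: "\<delta> \<in> carrier_mat r r" using d GL_carrier by (auto simp: Stab_def)
    with \<open>a \<in> elements_mat \<delta>\<close> obtain i j where ij: "i < r" "j < r" "a = \<delta> $$ (i, j)"
      using elements_matD[of a \<delta>] carrier_matD[OF dc] by auto
    have e: "unit_vec r i \<in> Avec r" using ij A_0 A_1 by (auto simp: Avec_def unit_vec_def)
    then have "row_act (unit_vec r i) \<delta> \<in> Avec r" using d unfolding Stab_def act_def by blast
    then have "row_act (unit_vec r i) \<delta> $ j \<in> A" using ij by (simp add: Avec_def)
    moreover have "row_act (unit_vec r i) \<delta> $ j = \<delta> $$ (i, j)"
    proof -
      have "row_act (unit_vec r i) \<delta> $ j = (\<Sum>k<r. if k = i then \<delta> $$ (i, j) else 0)"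
        unfolding row_act_index[OF dc unit_vec_carrier ij(2)] by (intro sum.cong refl) (auto simp: ij)
      then show ?thesis using ij(1) by simp
    qed
    ultimately show "a \<in> A" using ij(3) by simp
  qed
  show "\<gamma> \<in> GL_over r A" unfolding GL_over_def
    using s el[OF s] el[OF Stab_inv[OF s Avec_carrier]] by (auto simp: Stab_def)
qed

lemma finite_bounded_Avec: "finite {x \<in> Avec n. \<forall>i<n. vge v c (x $ i)}"
proof -
  have "{x \<in> Avec n. \<forall>i<n. vge v c (x $ i)} \<subseteq> (\<lambda>f. vec n f) ` (PiE {..<n} (\<lambda>_. {a \<in> A. vge v c a}))"
  proof
    fix x assume x: "x \<in> {x \<in> Avec n. \<forall>i<n. vge v c (x $ i)}"
    show "x \<in> (\<lambda>f. vec n f) ` (PiE {..<n} (\<lambda>_. {a \<in> A. vge v c a}))"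
      by (rule image_eqI[of _ _ "restrict (\<lambda>i. x $ i) {..<n}"]) (use x in \<open>auto simp: Avec_def intro!: eq_vecI\<close>)
  qed
  moreover have "finite (PiE {..<n} (\<lambda>_. {a \<in> A. vge v c a}))" using A_discrete by (intro finite_PiE) auto
  ultimately show ?thesis by (meson finite_imageI finite_subset)
qed

text \<open>By cocompactness each vector of e^(-1) A^r can be moved by d A^r into a bounded region,
  which by discreteness contains finitely many such vectors. A set periodic under d A^r is
  determined by its part in this region.\<close>

lemma finite_periodic:
  assumes e: "e \<in> A" "e \<noteq> 0" and d: "d \<in> A" "d \<noteq> 0"
  shows "finite {M. M \<subseteq> {x \<in> carrier_vec r. e \<cdot>\<^sub>v x \<in> Avec r} \<and> (\<forall>x\<in>M. \<forall>a\<in>Avec r. x + d \<cdot>\<^sub>v a \<in> M)}"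
proof -
  obtain c where c: "\<forall>f. \<exists>a\<in>A. vge v c (f - a)" using A_fractions_cocompact(2) by blast
  \<comment> \<open>Dividing a coordinate by d, subtracting an element of A and multiplying back
    leaves value at least v d + c; the factor e adds v e.\<close>
  define Rp where "Rp = {y \<in> carrier_vec r. e \<cdot>\<^sub>v y \<in> {x \<in> Avec r. \<forall>i<r. vge v (v e + (v d + c)) (x $ i)}}"
  have "inj_on (\<lambda>y. e \<cdot>\<^sub>v y) Rp"
  proof (rule inj_onI)
    fix x y assume xy: "x \<in> Rp" "y \<in> Rp" "e \<cdot>\<^sub>v x = e \<cdot>\<^sub>v y"
    then have "inverse e \<cdot>\<^sub>v (e \<cdot>\<^sub>v x) = inverse e \<cdot>\<^sub>v (e \<cdot>\<^sub>v y)" by simp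
    then show "x = y" using e(2) by (simp add: smult_smult_assoc)
  qed
  moreover have "finite ((\<lambda>y. e \<cdot>\<^sub>v y) ` Rp)"
    by (rule finite_subset[OF _ finite_bounded_Avec[of r "v e + (v d + c)"]]) (auto simp: Rp_def)
  ultimately have finR: "finite Rp" by (rule finite_imageD[rotated])
  let ?\<M> = "{M. M \<subseteq> {x \<in> carrier_vec r. e \<cdot>\<^sub>v x \<in> Avec r} \<and> (\<forall>x\<in>M. \<forall>a\<in>Avec r. x + d \<cdot>\<^sub>v a \<in> M)}"
  have rep: "\<exists>a\<in>Avec r. x + d \<cdot>\<^sub>v a \<in> Rp" if x: "x \<in> carrier_vec r" "e \<cdot>\<^sub>v x \<in> Avec r" for x
  proof -
    have "\<forall>i. \<exists>a. a \<in> A \<and> vge v c (x $ i * inverse d - a)" using c by blast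
    then obtain a where a: "\<forall>i. a i \<in> A \<and> vge v c (x $ i * inverse d - a i)"
      using choice[of "\<lambda>i a. a \<in> A \<and> vge v c (x $ i * inverse d - a)"] by auto
    define b where "b = vec r (\<lambda>i. - a i)"
    have b: "b \<in> Avec r" using a by (auto simp: b_def Avec_def intro!: ring_set_uminus[OF A_ring])
    have bc: "b \<in> carrier_vec r" by (simp add: b_def)
    have "e \<cdot>\<^sub>v (x + d \<cdot>\<^sub>v b) = e \<cdot>\<^sub>v x + (e * d) \<cdot>\<^sub>v b" using x bc by (intro eq_vecI) (auto simp: algebra_simps)
    also have "\<dots> \<in> Avec r" by (rule Avec_add[OF x(2) Avec_smult[OF ring_set_mult[OF A_ring e(1) d(1)] b]])
    finally have 1: "e \<cdot>\<^sub>v (x + d \<cdot>\<^sub>v b) \<in> Avec r" .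
    have "vge v (v e + (v d + c)) ((e \<cdot>\<^sub>v (x + d \<cdot>\<^sub>v b)) $ i)" if "i < r" for i
    proof -
      have "vge v (v e + (v d + c)) (e * (d * (x $ i * inverse d - a i)))"
        using a e d by (intro vge_mult place_v) (auto simp: vge_def)
      moreover have "e * (d * (x $ i * inverse d - a i)) = (e \<cdot>\<^sub>v (x + d \<cdot>\<^sub>v b)) $ i"
        using that x d by (simp add: b_def field_simps)
      ultimately show ?thesis by simp
    qed
    then have "x + d \<cdot>\<^sub>v b \<in> Rp" using 1 x bc by (simp add: Rp_def)
    then show ?thesis using b by blast
  qed
  have sub: "M \<subseteq> M'" if M: "M \<in> ?\<M>" "M' \<in> ?\<M>" "M \<inter> Rp = M' \<inter> Rp" for M M'
  proof
    fix x assume x: "x \<in> M"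
    have xc: "x \<in> carrier_vec r" "e \<cdot>\<^sub>v x \<in> Avec r" using M(1) x by auto
    obtain a where a: "a \<in> Avec r" "x + d \<cdot>\<^sub>v a \<in> Rp" using rep[OF xc] by blast
    have ac: "a \<in> carrier_vec r" using a Avec_carrier by blast
    have "x + d \<cdot>\<^sub>v a \<in> M" using M(1) x a(1) by auto
    then have "x + d \<cdot>\<^sub>v a \<in> M'" using M(3) a(2) by blast
    moreover have "(- 1) \<cdot>\<^sub>v a \<in> Avec r" by (rule Avec_smult[OF A_m1 a(1)])
    ultimately have "x + d \<cdot>\<^sub>v a + d \<cdot>\<^sub>v ((- 1) \<cdot>\<^sub>v a) \<in> M'" using M(2) by blast
    moreover have "x + d \<cdot>\<^sub>v a + d \<cdot>\<^sub>v ((- 1) \<cdot>\<^sub>v a) = x" using xc ac by (intro eq_vecI) auto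
    ultimately show "x \<in> M'" by simp
  qed
  have "inj_on (\<lambda>M. M \<inter> Rp) ?\<M>"
  proof (rule inj_onI)
    fix M M' assume "M \<in> ?\<M>" "M' \<in> ?\<M>" "M \<inter> Rp = M' \<inter> Rp"
    then show "M = M'" using sub[of M M'] sub[of M' M] by (intro equalityI) auto
  qed
  moreover have "finite ((\<lambda>M. M \<inter> Rp) ` ?\<M>)" by (rule finite_subset[of _ "Pow Rp"]) (use finR in auto)
  ultimately show ?thesis by (rule finite_imageD[rotated])
qed

text \<open>All images of w' + L' are contained in e^(-1) A^r and periodic under d A^r, with e and d
  independent of \<gamma>. The reason is that the stabiliser of w + L preserves L, with which L' can
  be compared.\<close>

lemma finite_orbit:
  assumes L: "alat r L" and L': "alat r L'" and w: "w \<in> carrier_vec r" and w': "w' \<in> carrier_vec r"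
  shows "finite ((\<lambda>\<gamma>. act \<gamma> (translate w' L')) ` Stab r (translate w L))"
proof -
  note Lc = alatD(1)[OF L] and L'c = alatD(1)[OF L']
  obtain d1 where d1: "d1 \<in> A" "d1 \<noteq> 0" "\<forall>x\<in>Avec r. d1 \<cdot>\<^sub>v x \<in> L" using alatD(4)[OF L] by blast
  obtain d2 where d2: "d2 \<in> A" "d2 \<noteq> 0" "\<forall>x\<in>L. d2 \<cdot>\<^sub>v x \<in> Avec r" using alatD(5)[OF L] by blast
  obtain d1' where d1': "d1' \<in> A" "d1' \<noteq> 0" "\<forall>x\<in>Avec r. d1' \<cdot>\<^sub>v x \<in> L'" using alatD(4)[OF L'] by blast
  obtain d2' where d2': "d2' \<in> A" "d2' \<noteq> 0" "\<forall>x\<in>L'. d2' \<cdot>\<^sub>v x \<in> Avec r" using alatD(5)[OF L'] by blast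
  obtain d3 where d3: "d3 \<in> A" "d3 \<noteq> 0" "\<forall>f\<in>(\<lambda>i. w' $ i) ` {..<r}. d3 * f \<in> A"
    using common_denominators[of "(\<lambda>i. w' $ i) ` {..<r}"] by auto
  have w'A: "d3 \<cdot>\<^sub>v w' \<in> Avec r" using d3 w' by (auto simp: Avec_def)
  have wc: "translate w L \<subseteq> carrier_vec r" using w Lc by (auto simp: translate_def)
  \<comment> \<open>Elements of L are differences of elements of the coset.\<close>
  have LL: "row_act l \<gamma> \<in> L" if g: "\<gamma> \<in> Stab r (translate w L)" and l: "l \<in> L" for \<gamma> l
  proof -
    have gc: "\<gamma> \<in> carrier_mat r r" using g GL_carrier by (auto simp: Stab_def)
    have st: "act \<gamma> (translate w L) = translate w L" using g by (simp add: Stab_def)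
    have lc: "l \<in> carrier_vec r" using l Lc by blast
    have "w + l \<in> translate w L" "w + 0\<^sub>v r \<in> translate w L" using l alat_0[OF L] by (auto simp: translate_def)
    then have "row_act (w + l) \<gamma> \<in> translate w L" "row_act (w + 0\<^sub>v r) \<gamma> \<in> translate w L" using st unfolding act_def by blast+
    then obtain a b where ab: "a \<in> L" "b \<in> L" "row_act (w + l) \<gamma> = w + a" "row_act w \<gamma> = w + b"
      using w by (auto simp: translate_def)
    have abc: "a \<in> carrier_vec r" "b \<in> carrier_vec r" using ab Lc by auto
    have "row_act w \<gamma> + row_act l \<gamma> = w + a" using row_act_add[OF gc w lc] ab(3) by simp
    then have eq: "w + b + row_act l \<gamma> = w + a" unfolding ab(4) .
    have "row_act l \<gamma> = a - b"
    proof (rule eq_vecI)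
      show "dim_vec (row_act l \<gamma>) = dim_vec (a - b)" using row_act_carrier[OF gc, of l] abc by simp
      fix i assume "i < dim_vec (a - b)"
      then have i: "i < r" using abc by simp
      have "(w + b + row_act l \<gamma>) $ i = (w + a) $ i" unfolding eq ..
      then have "w $ i + b $ i + row_act l \<gamma> $ i = w $ i + a $ i"
        using i w abc row_act_carrier[OF gc, of l] by (simp del: row_act_carrier)
      then show "row_act l \<gamma> $ i = (a - b) $ i" using i abc by (simp add: algebra_simps)
    qed
    then show ?thesis using alat_minus[OF L ab(1,2)] by simp
  qed
  \<comment> \<open>For ?e: d2' d3 moves w' + L' into A^r, d1 moves this into L, \<gamma> keeps it
    there, and d2 leads back to A^r. For ?d: d1 a lies in L, so does its preimage under \<gamma>,
    and d1' d2 brings this preimage into L'.\<close>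
  let ?e = "d2 * d1 * d2' * d3" and ?d = "d1' * d2 * d1"
  have eA: "?e \<in> A" "?e \<noteq> 0" "?d \<in> A" "?d \<noteq> 0"
    using d1 d2 d1' d2' d3 by (auto intro!: ring_set_mult[OF A_ring])
  have "(\<lambda>\<gamma>. act \<gamma> (translate w' L')) ` Stab r (translate w L)
    \<subseteq> {M. M \<subseteq> {x \<in> carrier_vec r. ?e \<cdot>\<^sub>v x \<in> Avec r} \<and> (\<forall>x\<in>M. \<forall>a\<in>Avec r. x + ?d \<cdot>\<^sub>v a \<in> M)}"
  proof (intro image_subsetI CollectI conjI subsetI ballI)
    fix \<gamma> x assume g: "\<gamma> \<in> Stab r (translate w L)" and x: "x \<in> act \<gamma> (translate w' L')"
    have gG: "\<gamma> \<in> carrier (GL r)" and gc: "\<gamma> \<in> carrier_mat r r" using g GL_carrier by (auto simp: Stab_def)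
    obtain l where l: "l \<in> L'" "x = row_act (w' + l) \<gamma>" using x unfolding act_def translate_def by blast
    have lc: "l \<in> carrier_vec r" using l L'c by blast
    show "x \<in> carrier_vec r" unfolding l(2) using gc by simp
    have "(d2' * d3) \<cdot>\<^sub>v (w' + l) = d2' \<cdot>\<^sub>v (d3 \<cdot>\<^sub>v w') + d3 \<cdot>\<^sub>v (d2' \<cdot>\<^sub>v l)"
      using w' lc by (intro eq_vecI) (auto simp: algebra_simps)
    also have "\<dots> \<in> Avec r"
      by (rule Avec_add[OF Avec_smult[OF d2'(1) w'A] Avec_smult[OF d3(1)]]) (use d2' l in blast)
    finally have "d1 \<cdot>\<^sub>v ((d2' * d3) \<cdot>\<^sub>v (w' + l)) \<in> L" using d1 by blast
    then have "d2 \<cdot>\<^sub>v row_act (d1 \<cdot>\<^sub>v ((d2' * d3) \<cdot>\<^sub>v (w' + l))) \<gamma> \<in> Avec r" using LL[OF g] d2 by blast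
    moreover have "d2 \<cdot>\<^sub>v row_act (d1 \<cdot>\<^sub>v ((d2' * d3) \<cdot>\<^sub>v (w' + l))) \<gamma> = ?e \<cdot>\<^sub>v x"
      using w' lc l(2) by (simp add: row_act_smult[OF gc] smult_smult_assoc mult.assoc)
    ultimately show "?e \<cdot>\<^sub>v x \<in> Avec r" by simp
    fix a assume a: "a \<in> Avec r"
    have ac: "a \<in> carrier_vec r" using a Avec_carrier by blast
    define b where "b = row_act (d1 \<cdot>\<^sub>v a) (inv\<^bsub>GL r\<^esub> \<gamma>)"
    have bL: "b \<in> L" unfolding b_def using d1 a by (intro LL Stab_inv[OF g wc]) auto
    have bc: "b \<in> carrier_vec r" using bL Lc by blast
    have bg: "row_act b \<gamma> = d1 \<cdot>\<^sub>v a"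
      unfolding b_def using GL_carrier[OF GL_inv(1)[OF gG]] gc ac
      by (simp add: row_act_mult[symmetric] GL_inv(2)[OF gG] row_act_one)
    have "d1' \<cdot>\<^sub>v (d2 \<cdot>\<^sub>v b) \<in> L'" using d1' d2 bL by blast
    then have lL: "l + d1' \<cdot>\<^sub>v (d2 \<cdot>\<^sub>v b) \<in> L'" by (rule alatD(2)[OF L' l(1)])
    have "w' + (l + d1' \<cdot>\<^sub>v (d2 \<cdot>\<^sub>v b)) = (w' + l) + (d1' * d2) \<cdot>\<^sub>v b"
      using w' lc bc by (intro eq_vecI) auto
    moreover have "row_act ((w' + l) + (d1' * d2) \<cdot>\<^sub>v b) \<gamma> = x + (d1' * d2) \<cdot>\<^sub>v row_act b \<gamma>"
      unfolding l(2) using w' lc bc by (subst row_act_add[OF gc]) (simp_all add: row_act_smult[OF gc])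
    ultimately have "row_act (w' + (l + d1' \<cdot>\<^sub>v (d2 \<cdot>\<^sub>v b))) \<gamma> = x + (d1' * d2) \<cdot>\<^sub>v row_act b \<gamma>"
      by (simp only:)
    also have "\<dots> = x + ?d \<cdot>\<^sub>v a" unfolding bg by (simp add: smult_smult_assoc)
    finally show "x + ?d \<cdot>\<^sub>v a \<in> act \<gamma> (translate w' L')" using lL unfolding act_def translate_def by (metis imageI)
  qed
  then show ?thesis using finite_periodic[OF eA] by (rule finite_subset)
qed

theorem arithmetic_Stab:
  assumes L: "alat r L" and w: "w \<in> carrier_vec r"
  shows "arithmetic_subgroup r A (Stab r (translate w L))"
proof -
  have 0: "translate (0\<^sub>v r) (Avec r) = Avec r"
    unfolding translate_def using Avec_carrier by force
  have wc: "translate w L \<subseteq> carrier_vec r" using w alatD(1)[OF L] by (auto simp: translate_def)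
  have z: "0\<^sub>v r \<in> carrier_vec r" by simp
  have f1: "finite ((\<lambda>\<gamma>. act \<gamma> (Avec r)) ` Stab r (translate w L))"
    using finite_orbit[OF L Avec_alat w z] unfolding 0 .
  have f2: "finite ((\<lambda>\<gamma>. act \<gamma> (translate w L)) ` Stab r (Avec r))"
    using finite_orbit[OF Avec_alat L z w] unfolding 0 .
  show ?thesis unfolding arithmetic_subgroup_def commensurable_def GL_over_eq
    using Stab_subgroup[OF wc] finite_rcosets_Stab[OF wc Avec_carrier f1 refl]
      finite_rcosets_Stab[OF Avec_carrier wc f2 Int_commute] by blast
qed

end

section \<open>Holomorphic functions and Eisenstein series\<close>

locale drinfeld = function_field_at K v + ultrametric ty
  for K :: "'f::field set" and v :: "'f \<Rightarrow> int" and ty :: "'c::{field,complete_space} itself" +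
  fixes \<iota> :: "'f \<Rightarrow> 'c" and \<theta> :: real and \<xi> :: 'c
  assumes hom: "field_hom \<iota>" and \<theta>: "0 < \<theta>" "\<theta> < 1"
    and absv_\<iota>: "\<And>a. a \<noteq> 0 \<Longrightarrow> absv (\<iota> a) = \<theta> powi v a" and \<xi>: "\<xi> \<noteq> 0"
begin

sublocale \<iota>: field_hom \<iota> by (rule hom)

abbreviation nf :: "'f \<Rightarrow> real" where "nf a \<equiv> absv (\<iota> a)"

lemma \<iota>_eq_0 [simp]: "\<iota> a = 0 \<longleftrightarrow> a = 0"
  by (rule \<iota>.hom_0_iff)

text \<open>Bounds for the absolute value translate into bounds for the valuation and back; \<theta>
  < 1 reverses the order.\<close>

lemma nf_vge: "\<exists>c. \<forall>a. nf a \<le> \<rho> \<longrightarrow> vge v c a"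
proof -
  have p: "0 < inverse (max 1 \<rho>)" by (simp add: less_max_iff_disj)
  obtain n where n: "\<theta> ^ n < inverse (max 1 \<rho>)" using real_arch_pow_inv[OF p \<theta>(2)] by blast
  have "\<rho> < inverse (\<theta> ^ n)"
  proof -
    have "inverse (inverse (max 1 \<rho>)) < inverse (\<theta> ^ n)" using n \<theta> by (intro less_imp_inverse_less) auto
    then show ?thesis by simp
  qed
  then have \<rho>: "\<rho> < \<theta> powi (- int n)" by (simp add: power_int_minus)
  have "vge v (- int n) a" if a: "nf a \<le> \<rho>" for a
  proof (cases "a = 0")
    case False
    have "- int n \<le> v a"
    proof (rule ccontr)
      assume "\<not> ?thesis"
      then have "\<theta> powi (- int n) \<le> \<theta> powi v a" using \<theta> by (intro power_int_decreasing) auto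
      then show False using a \<rho> absv_\<iota>[OF False] by simp
    qed
    then show ?thesis by (simp add: vge_def)
  qed simp
  then show ?thesis by blast
qed

lemma vge_nf: "vge v c a \<Longrightarrow> nf a \<le> \<theta> powi c"
proof (cases "a = 0")
  case True
  then show ?thesis using \<theta> by simp
next
  case False
  assume "vge v c a"
  then have "c \<le> v a" using False by (simp add: vge_def)
  then show ?thesis using \<theta> absv_\<iota>[OF False] power_int_decreasing[of c "v a" \<theta>] by simp
qed

text \<open>Maximum norm on vectors over F; the inserted 0 provides the value for the empty
  vector.\<close>

definition vn :: "'f vec \<Rightarrow> real" where
  "vn x = Max (insert 0 ((\<lambda>i. nf (x $ i)) ` {..<dim_vec x}))"

lemma vn_ge: "i < dim_vec x \<Longrightarrow> nf (x $ i) \<le> vn x"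
  unfolding vn_def by (rule Max_ge) auto

lemma vn_nonneg [simp]: "0 \<le> vn x"
  unfolding vn_def by (rule Max_ge) auto

lemma vn_le: "0 \<le> \<rho> \<Longrightarrow> (\<And>i. i < dim_vec x \<Longrightarrow> nf (x $ i) \<le> \<rho>) \<Longrightarrow> vn x \<le> \<rho>"
  unfolding vn_def by (rule Max.boundedI) auto

lemma vn_attained: "0 < vn x \<Longrightarrow> \<exists>i<dim_vec x. nf (x $ i) = vn x"
proof -
  assume p: "0 < vn x"
  have "vn x \<in> insert 0 ((\<lambda>i. nf (x $ i)) ` {..<dim_vec x})" unfolding vn_def by (rule Max_in) auto
  then show ?thesis using p by (elim insertE) auto
qed

lemma vn_pos: "x \<in> carrier_vec n \<Longrightarrow> x \<noteq> 0\<^sub>v n \<Longrightarrow> 0 < vn x"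
proof -
  assume x: "x \<in> carrier_vec n" "x \<noteq> 0\<^sub>v n"
  then obtain i where i: "i < n" "x $ i \<noteq> 0" by (metis carrier_vecD eq_vecI index_zero_vec)
  have "0 < nf (x $ i)" using i by simp
  also have "\<dots> \<le> vn x" using i x by (intro vn_ge) auto
  finally show ?thesis .
qed

lemma vn_0 [simp]: "vn (0\<^sub>v n) = 0"
  by (rule antisym[OF vn_le]) auto

lemma vn_smult: "vn (a \<cdot>\<^sub>v x) \<le> nf a * vn x"
  by (rule vn_le) (auto simp: \<iota>.hom_mult absv_mult intro!: mult_left_mono vn_ge)

lemma vn_uminus [simp]: "vn (- x) = vn x"
proof -
  have "(\<lambda>i. nf ((- x) $ i)) ` {..<dim_vec x} = (\<lambda>i. nf (x $ i)) ` {..<dim_vec x}"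
    by (rule image_cong) (simp_all add: \<iota>.hom_uminus)
  then show ?thesis unfolding vn_def by simp
qed

lemma vn_add:
  assumes "x \<in> carrier_vec n" "y \<in> carrier_vec n" "vn x \<le> \<rho>" "vn y \<le> \<rho>" shows "vn (x + y) \<le> \<rho>"
proof (rule vn_le)
  show "0 \<le> \<rho>" using vn_nonneg[of x] assms by linarith
  fix i assume "i < dim_vec (x + y)"
  then have i: "i < dim_vec x" "i < dim_vec y" using assms by auto
  have "nf (x $ i) \<le> \<rho>" "nf (y $ i) \<le> \<rho>" using vn_ge[OF i(1)] vn_ge[OF i(2)] assms by auto
  then show "nf ((x + y) $ i) \<le> \<rho>" using i by (simp add: \<iota>.hom_add absv_add_le)
qed

lemma max_norm_map:
  assumes "i < dim_vec x" "nf (x $ i) = m" "\<And>j. j < dim_vec x \<Longrightarrow> nf (x $ j) \<le> m"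
  shows "max_norm (map_vec \<iota> x) = m"
  unfolding max_norm_def
proof (rule Max_eqI)
  show "finite (absv ` set\<^sub>v (map_vec \<iota> x))" by (simp add: vec_set_def)
  show "m \<in> absv ` set\<^sub>v (map_vec \<iota> x)" using assms(1,2) by (force simp: vec_set_def)
  fix y assume "y \<in> absv ` set\<^sub>v (map_vec \<iota> x)"
  then show "y \<le> m" using assms(3) by (auto simp: vec_set_def)
qed

lemma pairing_sum:
  "x \<in> carrier_vec d \<Longrightarrow> \<omega> \<in> carrier_vec d \<Longrightarrow> pairing \<iota> x \<omega> = (\<Sum>i<d. \<iota> (x $ i) * \<omega> $ i)"
  unfolding pairing_def scalar_prod_def by (auto simp: lessThan_atLeast0 intro!: sum.cong)

lemma pairing_add:
  "x \<in> carrier_vec d \<Longrightarrow> y \<in> carrier_vec d \<Longrightarrow> \<omega> \<in> carrier_vec d \<Longrightarrow>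
    pairing \<iota> (x + y) \<omega> = pairing \<iota> x \<omega> + pairing \<iota> y \<omega>"
  by (simp add: pairing_sum[of _ d] \<iota>.hom_add distrib_right sum.distrib)

lemma pairing_smult:
  "x \<in> carrier_vec d \<Longrightarrow> \<omega> \<in> carrier_vec d \<Longrightarrow> pairing \<iota> (a \<cdot>\<^sub>v x) \<omega> = \<iota> a * pairing \<iota> x \<omega>"
  by (simp add: pairing_sum[of _ d] \<iota>.hom_mult sum_distrib_left mult.assoc)

lemma pairing_uminus:
  "x \<in> carrier_vec d \<Longrightarrow> \<omega> \<in> carrier_vec d \<Longrightarrow> pairing \<iota> (- x) \<omega> = - pairing \<iota> x \<omega>"
  by (simp add: pairing_sum[of _ d] \<iota>.hom_uminus sum_negf)

lemma pairing_diff: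
  assumes "x \<in> carrier_vec d" "y \<in> carrier_vec d" "\<omega> \<in> carrier_vec d"
  shows "pairing \<iota> (x - y) \<omega> = pairing \<iota> x \<omega> - pairing \<iota> y \<omega>"
proof -
  have "x - y = x + (- y)" using assms by (intro eq_vecI) auto
  then show ?thesis using assms by (simp add: pairing_add[of _ d] pairing_uminus[of _ d])
qed

lemma pairing_smult_right:
  "x \<in> carrier_vec d \<Longrightarrow> \<omega> \<in> carrier_vec d \<Longrightarrow> pairing \<iota> x (c \<cdot>\<^sub>v \<omega>) = c * pairing \<iota> x \<omega>"
  by (simp add: pairing_sum[of _ d] sum_distrib_left mult.left_commute)

lemma pairing_0 [simp]: "\<omega> \<in> carrier_vec d \<Longrightarrow> pairing \<iota> (0\<^sub>v d) \<omega> = 0"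
  by (simp add: pairing_sum[of _ d])

lemma range_F_inf: "set\<^sub>v (map_vec \<iota> x) \<subseteq> F_inf \<iota>"
proof -
  have "set\<^sub>v (map_vec \<iota> x) \<subseteq> range \<iota>" by (auto simp: vec_set_def)
  then show ?thesis unfolding F_inf_def using closure_subset by (rule order_trans)
qed

lemma Omega_carrier: "\<omega> \<in> Omega \<iota> \<xi> d \<Longrightarrow> \<omega> \<in> carrier_vec d"
  by (simp add: Omega_def)

lemma Omega_pairing_nonzero:
  assumes w: "\<omega> \<in> Omega \<iota> \<xi> d" and x: "x \<in> carrier_vec d" "x \<noteq> 0\<^sub>v d"
  shows "pairing \<iota> x \<omega> \<noteq> 0"
proof
  assume p: "pairing \<iota> x \<omega> = 0"
  have "\<forall>z\<in>carrier_vec d. set\<^sub>v z \<subseteq> F_inf \<iota> \<longrightarrow> z \<bullet> \<omega> = 0 \<longrightarrow> z = 0\<^sub>v d" using w unfolding Omega_def by simp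
  moreover have "map_vec \<iota> x \<in> carrier_vec d" using x(1) by simp
  ultimately have "map_vec \<iota> x = 0\<^sub>v d" using range_F_inf[of x] p[unfolded pairing_def] by blast
  then have "map_vec \<iota> x $ i = 0" if "i < d" for i using that by simp
  then have "x $ i = 0" if "i < d" for i using that x(1) by simp
  then have "x = 0\<^sub>v d" using x(1) by (intro eq_vecI) auto
  then show False using x(2) by contradiction
qed

lemma Omega_affinoidD:
  assumes "\<omega> \<in> Omega_affinoid \<iota> \<xi> d a"
  shows "\<omega> \<in> Omega \<iota> \<xi> d" "\<omega> \<in> carrier_vec d" "\<omega> $ (d - 1) = \<xi>"
    and "\<And>x. x \<in> carrier_vec d \<Longrightarrow> max_norm (map_vec \<iota> x) = 1 \<Longrightarrow> nf a * max_norm \<omega> \<le> absv (pairing \<iota> x \<omega>)"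
proof -
  show w: "\<omega> \<in> Omega \<iota> \<xi> d" using assms by (simp add: Omega_affinoid_def)
  then show "\<omega> \<in> carrier_vec d" "\<omega> $ (d - 1) = \<xi>" by (simp_all add: Omega_def)
  fix x :: "'f vec" assume x: "x \<in> carrier_vec d" "max_norm (map_vec \<iota> x) = 1"
  have "\<forall>z\<in>carrier_vec d. set\<^sub>v z \<subseteq> F_inf \<iota> \<longrightarrow> max_norm z = 1 \<longrightarrow> nf a * max_norm \<omega> \<le> absv (z \<bullet> \<omega>)"
    using assms by (simp add: Omega_affinoid_def)
  moreover have "map_vec \<iota> x \<in> carrier_vec d" using x(1) by simp
  ultimately show "nf a * max_norm \<omega> \<le> absv (pairing \<iota> x \<omega>)" using range_F_inf[of x] x(2) unfolding pairing_def by blast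
qed

lemma max_norm_ge: "i < dim_vec \<omega> \<Longrightarrow> absv (\<omega> $ i) \<le> max_norm \<omega>"
  unfolding max_norm_def by (rule Max_ge) (auto simp: vec_set_def)

text \<open>Dividing x by a coordinate of maximal size makes it unimodular, so the inequality
  defining the affinoid applies; the norm of \<omega> is at least the size of its last entry
  \<xi>.\<close>

lemma affinoid_lower:
  assumes w: "\<omega> \<in> Omega_affinoid \<iota> \<xi> d a" and d: "1 \<le> d" and x: "x \<in> carrier_vec d"
  shows "nf a * absv \<xi> * vn x \<le> absv (pairing \<iota> x \<omega>)"
proof (cases "vn x = 0")
  case False
  then have "0 < vn x" using vn_nonneg[of x] by linarith
  then obtain i where i: "i < dim_vec x" "nf (x $ i) = vn x" using vn_attained by blast
  have xi: "x $ i \<noteq> 0" using i \<open>0 < vn x\<close> by auto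
  define y where "y = inverse (x $ i) \<cdot>\<^sub>v x"
  have y: "y \<in> carrier_vec d" using x by (simp add: y_def)
  have ny: "nf (y $ j) = nf (x $ j) / vn x" if "j < dim_vec x" for j
  proof -
    have "nf (y $ j) = inverse (nf (x $ i)) * nf (x $ j)"
      unfolding y_def index_smult_vec(1)[OF that] \<iota>.hom_mult \<iota>.hom_inverse absv_mult absv_inverse ..
    then show ?thesis using i by (simp add: divide_inverse mult.commute)
  qed
  have "max_norm (map_vec \<iota> y) = 1"
  proof (rule max_norm_map)
    show "i < dim_vec y" using i by (simp add: y_def)
    show "nf (y $ i) = 1" using ny[OF i(1)] i \<open>0 < vn x\<close> by simp
    show "nf (y $ j) \<le> 1" if "j < dim_vec y" for j
      using that ny[of j] vn_ge[of j x] \<open>0 < vn x\<close> by (simp add: y_def)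
  qed
  then have "nf a * max_norm \<omega> \<le> absv (pairing \<iota> y \<omega>)" by (rule Omega_affinoidD(4)[OF w y])
  also have "pairing \<iota> y \<omega> = \<iota> (inverse (x $ i)) * pairing \<iota> x \<omega>"
    unfolding y_def by (rule pairing_smult[OF x Omega_affinoidD(2)[OF w]])
  also have "absv \<dots> = absv (pairing \<iota> x \<omega>) / vn x"
    unfolding \<iota>.hom_inverse absv_mult absv_inverse i(2) by (simp add: divide_inverse mult.commute)
  finally have 1: "nf a * max_norm \<omega> \<le> absv (pairing \<iota> x \<omega>) / vn x" .
  have "absv \<xi> \<le> max_norm \<omega>"
    using max_norm_ge[of "d - 1" \<omega>] Omega_affinoidD(2,3)[OF w] d by simp
  then have "nf a * absv \<xi> \<le> nf a * max_norm \<omega>" by (intro mult_left_mono) auto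
  with 1 have "nf a * absv \<xi> \<le> absv (pairing \<iota> x \<omega>) / vn x" by linarith
  then show ?thesis using \<open>0 < vn x\<close> by (simp add: pos_le_divide_eq)
qed simp

text \<open>The last unit vector is unimodular and pairs with \<omega> to \<xi>. The defining
  inequality for it bounds the norm of \<omega> on the affinoid.\<close>

lemma affinoid_upper:
  assumes w: "\<omega> \<in> Omega_affinoid \<iota> \<xi> d a" and d: "1 \<le> d" and a: "a \<noteq> 0" and x: "x \<in> carrier_vec d"
  shows "absv (pairing \<iota> x \<omega>) \<le> absv \<xi> / nf a * vn x"
proof -
  define u :: "'f vec" where "u = unit_vec d (d - 1)"
  have u: "u \<in> carrier_vec d" by (simp add: u_def)
  have uj: "u $ j = (if j = d - 1 then 1 else 0)" if "j < d" for j
    using that d by (simp add: u_def)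
  note wc = Omega_affinoidD(2)[OF w]
  have "max_norm (map_vec \<iota> u) = 1"
    by (rule max_norm_map[of "d - 1"]) (use u uj d in \<open>auto simp: \<iota>.hom_one\<close>)
  then have "nf a * max_norm \<omega> \<le> absv (pairing \<iota> u \<omega>)" by (rule Omega_affinoidD(4)[OF w u])
  also have "pairing \<iota> u \<omega> = (\<Sum>j<d. if j = d - 1 then \<omega> $ j else 0)"
    unfolding pairing_sum[OF u wc] by (rule sum.cong) (simp_all add: uj \<iota>.hom_one)
  also have "\<dots> = \<xi>" using d Omega_affinoidD(3)[OF w] by (simp add: sum.delta)
  finally have "nf a * max_norm \<omega> \<le> absv \<xi>" .
  then have mn: "max_norm \<omega> \<le> absv \<xi> / nf a" using a by (simp add: pos_le_divide_eq mult.commute)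
  have mn0: "0 \<le> absv \<xi> / nf a" by simp
  show ?thesis
    unfolding pairing_sum[OF x wc]
  proof (rule absv_sum_le)
    fix i assume "i \<in> {..<d}"
    then have i: "i < d" by simp
    have "nf (x $ i) \<le> vn x" using i x by (intro vn_ge) auto
    moreover have "absv (\<omega> $ i) \<le> absv \<xi> / nf a" using max_norm_ge[of i \<omega>] i wc mn by simp
    ultimately have "nf (x $ i) * absv (\<omega> $ i) \<le> vn x * (absv \<xi> / nf a)" by (intro mult_mono) auto
    then show "absv (\<iota> (x $ i) * \<omega> $ i) \<le> absv \<xi> / nf a * vn x" by (simp add: absv_mult mult.commute)
  qed simp
qed

section \<open>Bounded uniform limits of rational functions\<close>

text \<open>Boundedness is part of the notion because it is what makes products of uniform limits
  uniform limits again.\<close>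

definition hb :: "nat \<Rightarrow> 'c vec set \<Rightarrow> ('c vec \<Rightarrow> 'c) \<Rightarrow> bool" where
  "hb d U f \<longleftrightarrow> (\<exists>b. \<forall>\<omega>\<in>U. absv (f \<omega>) \<le> b) \<and>
    (\<forall>e>0. \<exists>P\<in>poly_funs d. \<exists>Q\<in>poly_funs d. \<forall>\<omega>\<in>U. Q \<omega> \<noteq> 0 \<and> absv (P \<omega> / Q \<omega> - f \<omega>) \<le> e)"

lemma hbI:
  assumes "\<And>\<omega>. \<omega> \<in> U \<Longrightarrow> absv (f \<omega>) \<le> b"
    and "\<And>e. 0 < e \<Longrightarrow> \<exists>P\<in>poly_funs d. \<exists>Q\<in>poly_funs d. \<forall>\<omega>\<in>U. Q \<omega> \<noteq> 0 \<and> absv (P \<omega> / Q \<omega> - f \<omega>) \<le> e"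
  shows "hb d U f"
  unfolding hb_def using assms(1) by (intro conjI exI[of _ b] ballI allI impI assms(2)) auto

lemma hb_bound: "hb d U f \<Longrightarrow> \<exists>b. \<forall>\<omega>\<in>U. absv (f \<omega>) \<le> b"
  unfolding hb_def by (rule conjunct1)

lemma hb_approx:
  assumes "hb d U f" "0 < e"
  obtains P Q where "P \<in> poly_funs d" "Q \<in> poly_funs d" "\<forall>\<omega>\<in>U. Q \<omega> \<noteq> 0" "\<forall>\<omega>\<in>U. absv (P \<omega> / Q \<omega> - f \<omega>) \<le> e"
  using assms unfolding hb_def by metis

lemma hb_quotient:
  assumes "P \<in> poly_funs d" "Q \<in> poly_funs d" "\<And>\<omega>. \<omega> \<in> U \<Longrightarrow> Q \<omega> \<noteq> 0 \<and> P \<omega> / Q \<omega> = f \<omega>"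
    and "\<And>\<omega>. \<omega> \<in> U \<Longrightarrow> absv (f \<omega>) \<le> b"
  shows "hb d U f"
proof (rule hbI[OF assms(4)])
  fix e :: real assume "0 < e"
  then show "\<exists>P\<in>poly_funs d. \<exists>Q\<in>poly_funs d. \<forall>\<omega>\<in>U. Q \<omega> \<noteq> 0 \<and> absv (P \<omega> / Q \<omega> - f \<omega>) \<le> e"
    using assms(3) by (intro bexI[OF _ assms(1)] bexI[OF _ assms(2)] ballI) auto
qed

lemma hb_const: "hb d U (\<lambda>_. c)"
  by (rule hb_quotient[OF poly_funs.const[of c] poly_funs.const[of 1], where b = "absv c"]) auto

lemma hb_limit:
  assumes "\<And>e. 0 < e \<Longrightarrow> \<exists>g. hb d U g \<and> (\<forall>\<omega>\<in>U. absv (g \<omega> - f \<omega>) \<le> e)"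
  shows "hb d U f"
proof -
  obtain g where g: "hb d U g" "\<forall>\<omega>\<in>U. absv (g \<omega> - f \<omega>) \<le> 1" using assms[of 1] by auto
  obtain b where b: "\<forall>\<omega>\<in>U. absv (g \<omega>) \<le> b" using hb_bound[OF g(1)] by blast
  show ?thesis
  proof (rule hbI)
    show "absv (f \<omega>) \<le> max 1 b" if "\<omega> \<in> U" for \<omega>
      using absv_diff_le[of "g \<omega>" "max 1 b" "g \<omega> - f \<omega>"] b g(2) that by (simp add: le_max_iff_disj)
    fix e :: real assume e: "0 < e"
    obtain h where h: "hb d U h" "\<forall>\<omega>\<in>U. absv (h \<omega> - f \<omega>) \<le> e" using assms[OF e] by blast
    obtain P Q where PQ: "P \<in> poly_funs d" "Q \<in> poly_funs d" "\<forall>\<omega>\<in>U. Q \<omega> \<noteq> 0" "\<forall>\<omega>\<in>U. absv (P \<omega> / Q \<omega> - h \<omega>) \<le> e"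
      by (rule hb_approx[OF h(1) e])
    show "\<exists>P\<in>poly_funs d. \<exists>Q\<in>poly_funs d. \<forall>\<omega>\<in>U. Q \<omega> \<noteq> 0 \<and> absv (P \<omega> / Q \<omega> - f \<omega>) \<le> e"
      using PQ(3,4) h(2) by (intro bexI[OF _ PQ(1)] bexI[OF _ PQ(2)] ballI) (auto intro: absv_trans_le)
  qed
qed

lemma hb_add:
  assumes f: "hb d U f" and g: "hb d U g" shows "hb d U (\<lambda>\<omega>. f \<omega> + g \<omega>)"
proof -
  obtain b where b: "\<forall>\<omega>\<in>U. absv (f \<omega>) \<le> b" using hb_bound[OF f] by blast
  obtain b' where b': "\<forall>\<omega>\<in>U. absv (g \<omega>) \<le> b'" using hb_bound[OF g] by blast
  show ?thesis
  proof (rule hbI)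
    show "absv (f \<omega> + g \<omega>) \<le> max b b'" if "\<omega> \<in> U" for \<omega>
      using absv_add_le[of "f \<omega>" "max b b'" "g \<omega>"] b b' that by (simp add: le_max_iff_disj)
    fix e :: real assume e: "0 < e"
    obtain P Q where PQ: "P \<in> poly_funs d" "Q \<in> poly_funs d" "\<forall>\<omega>\<in>U. Q \<omega> \<noteq> 0" "\<forall>\<omega>\<in>U. absv (P \<omega> / Q \<omega> - f \<omega>) \<le> e"
      by (rule hb_approx[OF f e])
    obtain P' Q' where PQ': "P' \<in> poly_funs d" "Q' \<in> poly_funs d" "\<forall>\<omega>\<in>U. Q' \<omega> \<noteq> 0" "\<forall>\<omega>\<in>U. absv (P' \<omega> / Q' \<omega> - g \<omega>) \<le> e"
      by (rule hb_approx[OF g e])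
    have "Q \<omega> * Q' \<omega> \<noteq> 0 \<and> absv ((P \<omega> * Q' \<omega> + P' \<omega> * Q \<omega>) / (Q \<omega> * Q' \<omega>) - (f \<omega> + g \<omega>)) \<le> e" if w: "\<omega> \<in> U" for \<omega>
    proof -
      have nz: "Q \<omega> \<noteq> 0" "Q' \<omega> \<noteq> 0" using PQ(3) PQ'(3) w by auto
      have "(P \<omega> * Q' \<omega> + P' \<omega> * Q \<omega>) / (Q \<omega> * Q' \<omega>) - (f \<omega> + g \<omega>) = (P \<omega> / Q \<omega> - f \<omega>) + (P' \<omega> / Q' \<omega> - g \<omega>)"
        using nz by (simp add: field_simps)
      then show ?thesis using absv_add_le[OF PQ(4)[rule_format, OF w] PQ'(4)[rule_format, OF w]] nz by (simp only:) simp
    qed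
    then show "\<exists>P\<in>poly_funs d. \<exists>Q\<in>poly_funs d. \<forall>\<omega>\<in>U. Q \<omega> \<noteq> 0 \<and> absv (P \<omega> / Q \<omega> - (f \<omega> + g \<omega>)) \<le> e"
      by (intro bexI[OF _ poly_funs.add[OF poly_funs.mult[OF PQ(1) PQ'(2)] poly_funs.mult[OF PQ'(1) PQ(2)]]]
          bexI[OF _ poly_funs.mult[OF PQ(2) PQ'(2)]] ballI)
  qed
qed

lemma hb_mult:
  assumes f: "hb d U f" and g: "hb d U g" shows "hb d U (\<lambda>\<omega>. f \<omega> * g \<omega>)"
proof -
  obtain b where b: "\<forall>\<omega>\<in>U. absv (f \<omega>) \<le> b" using hb_bound[OF f] by blast
  obtain b' where b': "\<forall>\<omega>\<in>U. absv (g \<omega>) \<le> b'" using hb_bound[OF g] by blast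
  define M where "M = max 1 (max b b')"
  have M: "1 \<le> M" "\<forall>\<omega>\<in>U. absv (f \<omega>) \<le> M" "\<forall>\<omega>\<in>U. absv (g \<omega>) \<le> M"
    using b b' unfolding M_def by (auto simp: le_max_iff_disj)
  show ?thesis
  proof (rule hbI)
    show "absv (f \<omega> * g \<omega>) \<le> M * M" if "\<omega> \<in> U" for \<omega>
      unfolding absv_mult using M that by (intro mult_mono) auto
    fix e :: real assume e: "0 < e"
    define e' where "e' = min 1 (e / M)"
    have e': "0 < e'" "e' \<le> 1" "M * e' \<le> e" using e M(1) by (auto simp: e'_def min_def field_simps)
    obtain P Q where PQ: "P \<in> poly_funs d" "Q \<in> poly_funs d" "\<forall>\<omega>\<in>U. Q \<omega> \<noteq> 0" "\<forall>\<omega>\<in>U. absv (P \<omega> / Q \<omega> - f \<omega>) \<le> e'"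
      by (rule hb_approx[OF f e'(1)])
    obtain P' Q' where PQ': "P' \<in> poly_funs d" "Q' \<in> poly_funs d" "\<forall>\<omega>\<in>U. Q' \<omega> \<noteq> 0" "\<forall>\<omega>\<in>U. absv (P' \<omega> / Q' \<omega> - g \<omega>) \<le> e'"
      by (rule hb_approx[OF g e'(1)])
    have "Q \<omega> * Q' \<omega> \<noteq> 0 \<and> absv ((P \<omega> * P' \<omega>) / (Q \<omega> * Q' \<omega>) - f \<omega> * g \<omega>) \<le> e" if w: "\<omega> \<in> U" for \<omega>
    proof -
      have nz: "Q \<omega> \<noteq> 0" "Q' \<omega> \<noteq> 0" using PQ(3) PQ'(3) w by auto
      define p where "p = P \<omega> / Q \<omega>"
      define q where "q = P' \<omega> / Q' \<omega>"
      have pq: "absv (p - f \<omega>) \<le> e'" "absv (q - g \<omega>) \<le> e'" unfolding p_def q_def using PQ(4) PQ'(4) w by auto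
      have "absv (q - g \<omega> + g \<omega>) \<le> M" by (rule absv_add_le) (use pq e' M w in auto)
      then have qM: "absv q \<le> M" by simp
      have "absv (f \<omega> * (q - g \<omega>)) \<le> M * e'" "absv ((p - f \<omega>) * q) \<le> e' * M"
        unfolding absv_mult using M w pq qM e'(1) by (auto intro!: mult_mono)
      then have "absv (f \<omega> * (q - g \<omega>) + (p - f \<omega>) * q) \<le> e" using e'(3) by (intro absv_add_le) (auto simp: mult.commute)
      moreover have "(P \<omega> * P' \<omega>) / (Q \<omega> * Q' \<omega>) - f \<omega> * g \<omega> = f \<omega> * (q - g \<omega>) + (p - f \<omega>) * q"
        unfolding p_def q_def by (simp add: algebra_simps)
      ultimately show ?thesis using nz by (simp only:) simp
    qed
    then show "\<exists>P\<in>poly_funs d. \<exists>Q\<in>poly_funs d. \<forall>\<omega>\<in>U. Q \<omega> \<noteq> 0 \<and> absv (P \<omega> / Q \<omega> - f \<omega> * g \<omega>) \<le> e"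
      by (intro bexI[OF _ poly_funs.mult[OF PQ(1) PQ'(1)]] bexI[OF _ poly_funs.mult[OF PQ(2) PQ'(2)]] ballI)
  qed
qed

lemma hb_sum: "(\<And>i. i \<in> I \<Longrightarrow> hb d U (f i)) \<Longrightarrow> hb d U (\<lambda>\<omega>. \<Sum>i\<in>I. f i \<omega>)"
  by (induction I rule: infinite_finite_induct) (auto intro: hb_add hb_const)

lemma hb_prod: "(\<And>i. i \<in> I \<Longrightarrow> hb d U (f i)) \<Longrightarrow> hb d U (\<lambda>\<omega>. \<Prod>i\<in>I. f i \<omega>)"
  by (induction I rule: infinite_finite_induct) (auto intro: hb_mult hb_const)

lemma hb_power: "hb d U f \<Longrightarrow> hb d U (\<lambda>\<omega>. f \<omega> ^ n)"
  by (induction n) (auto intro: hb_mult hb_const)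

lemma hb_uminus: "hb d U f \<Longrightarrow> hb d U (\<lambda>\<omega>. - f \<omega>)"
  using hb_mult[OF hb_const[of d U "- 1"], of f] by simp

lemma hb_diff: "hb d U f \<Longrightarrow> hb d U g \<Longrightarrow> hb d U (\<lambda>\<omega>. f \<omega> - g \<omega>)"
  using hb_add[OF _ hb_uminus, of d U f g] by simp

text \<open>The Weierstrass M-test in its ultrametric form: the bounds M i need not be summable,
  they only have to tend to 0.\<close>

lemma hb_infsum:
  assumes g: "\<And>i. i \<in> I \<Longrightarrow> hb d U (g i)" and M: "\<And>i \<omega>. i \<in> I \<Longrightarrow> \<omega> \<in> U \<Longrightarrow> absv (g i \<omega>) \<le> M i"
    and fin: "\<And>e. 0 < e \<Longrightarrow> finite {i \<in> I. e \<le> M i}"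
  shows "hb d U (\<lambda>\<omega>. infsum (\<lambda>i. g i \<omega>) I)"
proof (rule hb_limit)
  fix e :: real assume e: "0 < e"
  let ?F = "{i \<in> I. e \<le> M i}"
  have "absv ((\<Sum>i\<in>?F. g i \<omega>) - infsum (\<lambda>i. g i \<omega>) I) \<le> e" if w: "\<omega> \<in> U" for \<omega>
  proof -
    have "vanishing (\<lambda>i. g i \<omega>) I"
      unfolding vanishing_def
    proof (intro allI impI)
      fix e :: real assume "0 < e"
      then show "finite {i \<in> I. e \<le> absv (g i \<omega>)}"
        by (rule rev_finite_subset[OF fin]) (use M w in \<open>auto intro: order_trans\<close>)
    qed
    then have "((\<lambda>i. g i \<omega>) has_sum infsum (\<lambda>i. g i \<omega>) I) I" by (rule vanishing_summable)
    then have "absv (infsum (\<lambda>i. g i \<omega>) I - (\<Sum>i\<in>?F. g i \<omega>)) \<le> e"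
      by (rule has_sum_error[OF _ fin[OF e] _ e]) (use M w in force)+
    then show ?thesis by (simp add: absv_minus_commute)
  qed
  then show "\<exists>h. hb d U h \<and> (\<forall>\<omega>\<in>U. absv (h \<omega> - infsum (\<lambda>i. g i \<omega>) I) \<le> e)"
    using g by (intro exI[of _ "\<lambda>\<omega>. \<Sum>i\<in>?F. g i \<omega>"] conjI hb_sum ballI) auto
qed

lemma hb_affinoid_function:
  assumes f: "hb d U f" shows "affinoid_function d U f"
proof -
  have "\<forall>n. \<exists>PQ. fst PQ \<in> poly_funs d \<and> snd PQ \<in> poly_funs d \<and> (\<forall>\<omega>\<in>U. snd PQ \<omega> \<noteq> 0) \<and>
     (\<forall>\<omega>\<in>U. absv (fst PQ \<omega> / snd PQ \<omega> - f \<omega>) \<le> inverse (real (Suc n)))"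
  proof
    fix n
    have "0 < inverse (real (Suc n))" by simp
    from hb_approx[OF f this] show "\<exists>PQ. fst PQ \<in> poly_funs d \<and> snd PQ \<in> poly_funs d \<and> (\<forall>\<omega>\<in>U. snd PQ \<omega> \<noteq> 0) \<and>
     (\<forall>\<omega>\<in>U. absv (fst PQ \<omega> / snd PQ \<omega> - f \<omega>) \<le> inverse (real (Suc n)))" by (metis fst_conv snd_conv)
  qed
  from choice[OF this] obtain PQ where PQ: "\<forall>n. fst (PQ n) \<in> poly_funs d \<and> snd (PQ n) \<in> poly_funs d \<and>
     (\<forall>\<omega>\<in>U. snd (PQ n) \<omega> \<noteq> 0) \<and> (\<forall>\<omega>\<in>U. absv (fst (PQ n) \<omega> / snd (PQ n) \<omega> - f \<omega>) \<le> inverse (real (Suc n)))" ..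
  have "uniform_limit U (\<lambda>n \<omega>. fst (PQ n) \<omega> / snd (PQ n) \<omega>) f sequentially"
    unfolding uniform_limit_iff eventually_sequentially
  proof (intro allI impI)
    fix e :: real assume "0 < e"
    then obtain N where N: "inverse (real (Suc N)) < e" using reals_Archimedean by blast
    have "dist (fst (PQ n) \<omega> / snd (PQ n) \<omega>) (f \<omega>) < e" if "N \<le> n" "\<omega> \<in> U" for n \<omega>
    proof -
      have "dist (fst (PQ n) \<omega> / snd (PQ n) \<omega>) (f \<omega>) \<le> inverse (real (Suc n))" unfolding dist_absv using PQ that by blast
      also have "\<dots> \<le> inverse (real (Suc N))" using that by (intro le_imp_inverse_le) auto
      finally show ?thesis using N by simp
    qed
    then show "\<exists>N. \<forall>n\<ge>N. \<forall>\<omega>\<in>U. dist (fst (PQ n) \<omega> / snd (PQ n) \<omega>) (f \<omega>) < e" by blast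
  qed
  then show ?thesis unfolding affinoid_function_def using PQ
    by (intro exI[of _ "\<lambda>n. fst (PQ n)"] exI[of _ "\<lambda>n. snd (PQ n)"]) blast
qed

lemma holomorphicI: "(\<And>a. a \<noteq> 0 \<Longrightarrow> hb d (Omega_affinoid \<iota> \<xi> d a) f) \<Longrightarrow> holomorphic_Omega \<iota> \<xi> d f"
  unfolding holomorphic_Omega_def by (intro allI impI hb_affinoid_function)

lemma poly_funs_pairing: "(\<lambda>\<omega>. \<Sum>i<m. \<iota> (x $ i) * \<omega> $ i) \<in> poly_funs d" if "m \<le> d"
  using that
proof (induction m)
  case 0
  then show ?case using poly_funs.const[of 0] by simp
next
  case (Suc m)
  then show ?case using poly_funs.add[OF Suc.IH poly_funs.mult[OF poly_funs.const[of "\<iota> (x $ m)"] poly_funs.coord[of m]]] by simp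
qed

lemma hb_pairing:
  assumes a: "a \<noteq> 0" and d: "1 \<le> d" and x: "x \<in> carrier_vec d"
  shows "hb d (Omega_affinoid \<iota> \<xi> d a) (pairing \<iota> x)"
  by (rule hb_quotient[OF poly_funs_pairing[OF order_refl, of x] poly_funs.const[of 1]])
    (use pairing_sum[OF x Omega_affinoidD(2)] affinoid_upper[OF _ d a x] in auto)

lemma hb_inverse_pairing:
  assumes a: "a \<noteq> 0" and d: "1 \<le> d" and x: "x \<in> carrier_vec d" "x \<noteq> 0\<^sub>v d"
  shows "hb d (Omega_affinoid \<iota> \<xi> d a) (\<lambda>\<omega>. inverse (pairing \<iota> x \<omega>))"
proof (rule hb_quotient[OF poly_funs.const[of 1] poly_funs_pairing[OF order_refl, of x]])
  fix \<omega> assume w: "\<omega> \<in> Omega_affinoid \<iota> \<xi> d a"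
  show "(\<Sum>i<d. \<iota> (x $ i) * \<omega> $ i) \<noteq> 0 \<and> 1 / (\<Sum>i<d. \<iota> (x $ i) * \<omega> $ i) = inverse (pairing \<iota> x \<omega>)"
    using Omega_pairing_nonzero[OF Omega_affinoidD(1)[OF w] x] pairing_sum[OF x(1) Omega_affinoidD(2)[OF w]]
    by (simp add: divide_inverse)
  have "0 < nf a * absv \<xi> * vn x" using a \<xi> vn_pos[OF x] by simp
  then show "absv (inverse (pairing \<iota> x \<omega>)) \<le> inverse (nf a * absv \<xi> * vn x)"
    unfolding absv_inverse using affinoid_lower[OF w d x(1)] by (intro le_imp_inverse_le) auto
qed

text \<open>For t > 1 the power t^k is at least t, so the bound can be free of k.\<close>

lemma inverse_power_ge_imp_le:
  fixes t e :: real
  assumes "0 < t" "0 < e" "0 < k" "e \<le> inverse (t ^ k)" shows "t \<le> max 1 (inverse e)"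
proof (rule ccontr)
  assume "\<not> ?thesis"
  then have t: "1 < t" "inverse e < t" by auto
  have "inverse e < t ^ k" using t self_le_power[of t k] assms(3) by linarith
  then have "inverse (t ^ k) < inverse (inverse e)" using assms(2) by (intro less_imp_inverse_less) auto
  then show False using assms(4) by simp
qed

text \<open>Multiplication by a common denominator embeds the set into A^d with bounded coordinates,
  where \<open>finite_bounded_Avec\<close> applies.\<close>

lemma disc_of_denominator:
  assumes S: "S \<subseteq> carrier_vec d" and e: "e \<noteq> 0" "\<And>x. x \<in> S \<Longrightarrow> e \<cdot>\<^sub>v x \<in> Avec d"
  shows "finite {x \<in> S. vn x \<le> \<rho>}"
proof -
  obtain c where c: "\<forall>a. nf a \<le> nf e * \<rho> \<longrightarrow> vge v c a" using nf_vge by blast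
  have inj: "inj_on (\<lambda>x. e \<cdot>\<^sub>v x) {x \<in> S. vn x \<le> \<rho>}"
  proof (rule inj_onI)
    fix x y :: "'f vec" assume "e \<cdot>\<^sub>v x = e \<cdot>\<^sub>v y"
    then have "inverse e \<cdot>\<^sub>v (e \<cdot>\<^sub>v x) = inverse e \<cdot>\<^sub>v (e \<cdot>\<^sub>v y)" by simp
    then show "x = y" using e(1) by (simp add: smult_smult_assoc)
  qed
  have "(\<lambda>x. e \<cdot>\<^sub>v x) ` {x \<in> S. vn x \<le> \<rho>} \<subseteq> {x \<in> Avec d. \<forall>i<d. vge v c (x $ i)}"
  proof safe
    fix x assume x: "x \<in> S" "vn x \<le> \<rho>"
    show "e \<cdot>\<^sub>v x \<in> Avec d" by (rule e(2)[OF x(1)])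
    fix i assume i: "i < d"
    have xd: "dim_vec x = d" using x(1) S by auto
    have "nf e * nf (x $ i) \<le> nf e * \<rho>" using vn_ge[of i x] i xd x(2) by (intro mult_left_mono) auto
    then show "vge v c ((e \<cdot>\<^sub>v x) $ i)" using c i xd by (simp add: \<iota>.hom_mult absv_mult)
  qed
  from finite_subset[OF this finite_bounded_Avec] show ?thesis by (rule finite_imageD[OF _ inj])
qed

lemma coset_denominator:
  assumes L: "alat d L" and w: "w \<in> carrier_vec d"
  shows "\<exists>e\<in>A. e \<noteq> 0 \<and> (\<forall>x\<in>translate w L. e \<cdot>\<^sub>v x \<in> Avec d)"
proof -
  obtain c where c: "c \<in> A" "c \<noteq> 0" "\<forall>x\<in>L. c \<cdot>\<^sub>v x \<in> Avec d" using alatD(5)[OF L] by blast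
  have "finite ((\<lambda>i. w $ i) ` {..<d})" by simp
  from common_denominators[OF this] obtain b where b: "b \<in> A" "b \<noteq> 0" "\<forall>i<d. b * w $ i \<in> A" by auto
  have bw: "b \<cdot>\<^sub>v w \<in> Avec d" using b(3) w by (auto simp: Avec_def)
  have "(c * b) \<cdot>\<^sub>v (w + x) \<in> Avec d" if x: "x \<in> L" for x
  proof -
    have "(c * b) \<cdot>\<^sub>v (w + x) = c \<cdot>\<^sub>v (b \<cdot>\<^sub>v w) + b \<cdot>\<^sub>v (c \<cdot>\<^sub>v x)"
      using w x alatD(1)[OF L] by (intro eq_vecI) (auto simp: algebra_simps)
    then show ?thesis using Avec_add[OF Avec_smult[OF c(1) bw] Avec_smult[OF b(1) c(3)[rule_format, OF x]]] by simp
  qed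
  then show ?thesis using b c by (intro bexI[of _ "c * b"] ring_set_mult[OF A_ring]) (auto simp: translate_def)
qed

text \<open>On the affinoid the term of x is at most (\<delta> vn x)^(-k), a bound free of \<omega>,
  and by discreteness only finitely many x make it large.\<close>

lemma hb_eisenstein:
  assumes a: "a \<noteq> 0" and d: "1 \<le> d" and S: "S \<subseteq> carrier_vec d" and fin: "\<And>\<rho>. finite {x \<in> S. vn x \<le> \<rho>}" and k: "0 < k"
  shows "hb d (Omega_affinoid \<iota> \<xi> d a) (eisenstein \<iota> d k S)"
  unfolding eisenstein_def
proof (rule hb_infsum)
  let ?U = "Omega_affinoid \<iota> \<xi> d a"
  define \<delta> where "\<delta> = nf a * absv \<xi>"
  have \<delta>: "0 < \<delta>" using a \<xi> by (simp add: \<delta>_def)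
  have pos: "0 < \<delta> * vn x" if "x \<in> S - {0\<^sub>v d}" for x using \<delta> vn_pos[of x d] that S by auto
  fix x assume x: "x \<in> S - {0\<^sub>v d}"
  then have xc: "x \<in> carrier_vec d" "x \<noteq> 0\<^sub>v d" using S by auto
  show "hb d ?U (\<lambda>\<omega>. inverse (pairing \<iota> x \<omega> ^ k))"
    using hb_power[OF hb_inverse_pairing[OF a d xc], of k] by (simp add: power_inverse)
  fix \<omega> assume w: "\<omega> \<in> ?U"
  have "(\<delta> * vn x) ^ k \<le> absv (pairing \<iota> x \<omega>) ^ k"
    using affinoid_lower[OF w d xc(1)] pos[OF x] by (intro power_mono) (auto simp: \<delta>_def)
  then show "absv (inverse (pairing \<iota> x \<omega> ^ k)) \<le> inverse ((nf a * absv \<xi> * vn x) ^ k)"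
    unfolding absv_inverse absv_power \<delta>_def[symmetric] using pos[OF x] by (intro le_imp_inverse_le) auto
next
  define \<delta> where "\<delta> = nf a * absv \<xi>"
  have \<delta>: "0 < \<delta>" using a \<xi> by (simp add: \<delta>_def)
  have pos: "0 < \<delta> * vn x" if "x \<in> S - {0\<^sub>v d}" for x using \<delta> vn_pos[of x d] that S by auto
  fix e :: real assume e: "0 < e"
  have "{x \<in> S - {0\<^sub>v d}. e \<le> inverse ((nf a * absv \<xi> * vn x) ^ k)} \<subseteq> {x \<in> S. vn x \<le> max 1 (inverse e) / \<delta>}"
  proof safe
    fix x assume x: "x \<in> S" "x \<noteq> 0\<^sub>v d" "e \<le> inverse ((nf a * absv \<xi> * vn x) ^ k)"
    then have "\<delta> * vn x \<le> max 1 (inverse e)" using pos[of x] e k by (intro inverse_power_ge_imp_le) (auto simp: \<delta>_def)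
    then show "vn x \<le> max 1 (inverse e) / \<delta>" using \<delta> by (simp add: pos_le_divide_eq mult.commute)
  qed
  then show "finite {x \<in> S - {0\<^sub>v d}. e \<le> inverse ((nf a * absv \<xi> * vn x) ^ k)}" by (rule finite_subset[OF _ fin])
qed

lemma pairing_mat:
  assumes g: "\<gamma> \<in> carrier_mat d d" and x: "x \<in> carrier_vec d" and w: "\<omega> \<in> carrier_vec d"
  shows "pairing \<iota> x (map_mat \<iota> \<gamma> *\<^sub>v \<omega>) = pairing \<iota> (row_act x \<gamma>) \<omega>"
proof -
  have gw: "map_mat \<iota> \<gamma> *\<^sub>v \<omega> \<in> carrier_vec d" using g w by simp
  have ent: "(map_mat \<iota> \<gamma> *\<^sub>v \<omega>) $ i = (\<Sum>j<d. \<iota> (\<gamma> $$ (i, j)) * \<omega> $ j)" if "i < d" for i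
    using that g w by (auto simp: scalar_prod_def lessThan_atLeast0 intro!: sum.cong)
  have "pairing \<iota> x (map_mat \<iota> \<gamma> *\<^sub>v \<omega>) = (\<Sum>i<d. \<Sum>j<d. \<iota> (x $ i) * (\<iota> (\<gamma> $$ (i, j)) * \<omega> $ j))"
    unfolding pairing_sum[OF x gw] by (intro sum.cong refl) (simp add: ent sum_distrib_left)
  also have "\<dots> = (\<Sum>j<d. \<Sum>i<d. \<iota> (x $ i) * (\<iota> (\<gamma> $$ (i, j)) * \<omega> $ j))" by (rule sum.swap)
  also have "\<dots> = (\<Sum>j<d. \<iota> (row_act x \<gamma> $ j) * \<omega> $ j)"
    by (intro sum.cong refl) (simp add: row_act_index[OF g x] \<iota>.hom_sum \<iota>.hom_mult sum_distrib_right mult.assoc)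
  also have "\<dots> = pairing \<iota> (row_act x \<gamma>) \<omega>" using pairing_sum[OF row_act_carrier[OF g] w, of x] by simp
  finally show ?thesis .
qed

lemma row_act_0: "\<gamma> \<in> carrier_mat d d \<Longrightarrow> row_act (0\<^sub>v d) (\<gamma> :: 'f mat) = 0\<^sub>v d"
  unfolding row_act_def by (intro eq_vecI) auto

lemma row_act_eq_0:
  assumes g: "\<gamma> \<in> carrier (GL d)" and x: "x \<in> carrier_vec d" and 0: "row_act x \<gamma> = 0\<^sub>v d" shows "(x :: 'f vec) = 0\<^sub>v d"
proof -
  note gc = GL_carrier[OF g] and ic = GL_carrier[OF GL_inv(1)[OF g]]
  have "x = row_act (row_act x \<gamma>) (inv\<^bsub>GL d\<^esub> \<gamma>)"
    using row_act_mult[OF gc ic x] GL_inv(3)[OF g] row_act_one[OF x] by simp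
  also have "\<dots> = 0\<^sub>v d" unfolding 0 by (rule row_act_0[OF ic])
  finally show ?thesis .
qed

lemma row_act_inj:
  assumes g: "\<gamma> \<in> carrier (GL d)" shows "inj_on (\<lambda>x. row_act x (\<gamma> :: 'f mat)) (carrier_vec d)"
proof (rule inj_on_inverseI)
  fix x :: "'f vec" assume x: "x \<in> carrier_vec d"
  show "row_act (row_act x \<gamma>) (inv\<^bsub>GL d\<^esub> \<gamma>) = x"
    using row_act_mult[OF GL_carrier[OF g] GL_carrier[OF GL_inv(1)[OF g]] x] GL_inv(3)[OF g] row_act_one[OF x] by simp
qed

text \<open>As x(\<gamma>\<omega>) = (x\<gamma>)\<omega>, the factor j^(-k) of the slash cancels the
  j^k caused by normalising \<gamma>\<omega>, and type 0 leaves no determinant. The sum is then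
  reindexed along x \<mapsto> x\<gamma>.\<close>

theorem slash_eisenstein:
  assumes g: "\<gamma> \<in> carrier (GL d)" and d: "1 \<le> d" and S: "S \<subseteq> carrier_vec d" and w: "\<omega> \<in> Omega \<iota> \<xi> d"
  shows "slash \<iota> \<xi> d (int k) 0 (eisenstein \<iota> d k S) \<gamma> \<omega> = eisenstein \<iota> d k (act \<gamma> S) \<omega>"
proof -
  note gc = GL_carrier[OF g] and wc = Omega_carrier[OF w]
  let ?\<eta> = "map_mat \<iota> \<gamma> *\<^sub>v \<omega>" and ?j = "j_factor \<iota> \<xi> d \<gamma> \<omega>"
  have \<eta>: "?\<eta> \<in> carrier_vec d" using gc wc by simp
  \<comment> \<open>The last entry of \<gamma>\<omega> is the pairing of \<omega> with the last row
    of \<gamma>, a nonzero vector; so j does not vanish.\<close>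
  define u :: "'f vec" where "u = unit_vec d (d - 1)"
  have u: "u \<in> carrier_vec d" by (simp add: u_def)
  have "u $ (d - 1) \<noteq> 0\<^sub>v d $ (d - 1)" using d by (simp add: u_def)
  then have "u \<noteq> 0\<^sub>v d" by auto
  then have "row_act u \<gamma> \<noteq> 0\<^sub>v d" using row_act_eq_0[OF g u] by blast
  then have "pairing \<iota> (row_act u \<gamma>) \<omega> \<noteq> 0" by (intro Omega_pairing_nonzero[OF w]) (use gc in simp)
  then have "pairing \<iota> u ?\<eta> \<noteq> 0" using pairing_mat[OF gc u wc] by simp
  moreover have "pairing \<iota> u ?\<eta> = (\<Sum>j<d. if j = d - 1 then ?\<eta> $ j else 0)"
    unfolding pairing_sum[OF u \<eta>] using d by (intro sum.cong refl) (simp add: u_def \<iota>.hom_one)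
  ultimately have j: "?j \<noteq> 0" using d \<xi> by (simp add: sum.delta j_factor_def)
  have inj: "inj_on (\<lambda>x. row_act x \<gamma>) (S - {0\<^sub>v d})"
    using row_act_inj[OF g] by (rule inj_on_subset) (use S in auto)
  have img: "(\<lambda>x. row_act x \<gamma>) ` (S - {0\<^sub>v d}) = act \<gamma> S - {0\<^sub>v d}"
    unfolding act_def using row_act_eq_0[OF g] row_act_0[OF gc] S by auto
  have "eisenstein \<iota> d k S (GL_act \<iota> \<xi> d \<gamma> \<omega>) =
      (\<Sum>\<^sub>\<infinity>x\<in>S - {0\<^sub>v d}. ?j ^ k * inverse (pairing \<iota> (row_act x \<gamma>) \<omega> ^ k))"
    unfolding eisenstein_def
  proof (rule infsum_cong)
    fix x assume "x \<in> S - {0\<^sub>v d}"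
    then have x: "x \<in> carrier_vec d" using S by auto
    show "inverse (pairing \<iota> x (GL_act \<iota> \<xi> d \<gamma> \<omega>) ^ k) = ?j ^ k * inverse (pairing \<iota> (row_act x \<gamma>) \<omega> ^ k)"
      unfolding GL_act_def pairing_smult_right[OF x \<eta>] pairing_mat[OF gc x wc] using j
      by (simp add: power_mult_distrib power_inverse)
  qed
  also have "\<dots> = ?j ^ k * (\<Sum>\<^sub>\<infinity>x\<in>S - {0\<^sub>v d}. inverse (pairing \<iota> (row_act x \<gamma>) \<omega> ^ k))"
    using j by (intro infsum_cmult) simp
  also have "(\<Sum>\<^sub>\<infinity>x\<in>S - {0\<^sub>v d}. inverse (pairing \<iota> (row_act x \<gamma>) \<omega> ^ k)) = eisenstein \<iota> d k (act \<gamma> S) \<omega>"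
    unfolding eisenstein_def img[symmetric] infsum_reindex[OF inj] by (simp add: o_def)
  finally show ?thesis unfolding slash_def using j by (simp add: power_int_minus)
qed

end

section \<open>Expansion of Goss polynomials\<close>

text \<open>
  The coefficient of \<open>u\<^sup>n\<close> in the \<open>m\<close>-th Goss polynomial, with \<open>\<alpha>\<close> the coefficients of the exponential
  function, evaluated at \<open>u / (1 + \<beta> u)\<close>.
\<close>

fun Gc :: "(nat \<Rightarrow> 'c::field) \<Rightarrow> 'c \<Rightarrow> nat \<Rightarrow> nat \<Rightarrow> 'c" where
  "Gc \<alpha> \<beta> 0 n = 0"
| "Gc \<alpha> \<beta> (Suc m) 0 = 0"
| "Gc \<alpha> \<beta> (Suc m) (Suc n) =
     (if m = 0 then (if n = 0 then 1 else 0) else (\<Sum>i<m. (- 1) ^ i * \<alpha> i * Gc \<alpha> \<beta> (m - i) n)) - \<beta> * Gc \<alpha> \<beta> (Suc m) n"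

context ultrametric
begin

lemma absv_m1_power [simp]: "absv ((- 1 :: 'c) ^ n) = 1"
  by (simp add: absv_power)

text \<open>Each step of the recursion costs at most one factor M in k and one factor b in n; both
  being at least 1, lower powers are absorbed.\<close>

lemma Gc_bound:
  assumes M: "1 \<le> M" "\<And>i. i < k0 \<Longrightarrow> absv (\<alpha> i :: 'c) \<le> M" and b: "1 \<le> b" "absv \<beta> \<le> b"
  shows "k \<le> k0 \<Longrightarrow> absv (Gc \<alpha> \<beta> k n) \<le> M ^ k * b ^ n"
proof (induction n arbitrary: k)
  case 0
  have "0 \<le> M ^ k * b ^ 0" using M(1) b(1) by simp
  then show ?case by (cases k) simp_all
next
  case (Suc n)
  show ?case
  proof (cases k)
    case 0
    have "0 \<le> M ^ k * b ^ Suc n" using M(1) b(1) by simp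
    then show ?thesis unfolding 0 by simp
  next
    case (Suc m)
    have Mk: "1 \<le> M ^ k" "1 \<le> b ^ n" using M(1) b(1) by simp_all
    have bb: "b ^ n \<le> b ^ Suc n" using b(1) Mk by simp
    have p: "0 \<le> M ^ k * b ^ Suc n" using M(1) b(1) by simp
    have 1: "absv (if m = 0 then (if n = 0 then 1 else 0) else (\<Sum>i<m. (- 1) ^ i * \<alpha> i * Gc \<alpha> \<beta> (m - i) n)) \<le> M ^ k * b ^ Suc n"
    proof (cases "m = 0")
      case True
      have "1 \<le> b ^ Suc n" using Mk(2) bb by linarith
      then have "1 * 1 \<le> M ^ k * b ^ Suc n" using Mk(1) by (intro mult_mono) auto
      moreover have "absv (if n = 0 then 1 else 0 :: 'c) \<le> 1" by simp
      ultimately have "absv (if n = 0 then 1 else 0 :: 'c) \<le> M ^ k * b ^ Suc n" by linarith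
      then show ?thesis unfolding if_P[OF True] .
    next
      case False
      have "absv (\<Sum>i<m. (- 1) ^ i * \<alpha> i * Gc \<alpha> \<beta> (m - i) n) \<le> M ^ k * b ^ Suc n"
      proof (rule absv_sum_le)
        fix i assume "i \<in> {..<m}"
        then have i: "i < m" "i < k0" "m - i \<le> k0" using Suc Suc.prems by auto
        have "absv (\<alpha> i) * absv (Gc \<alpha> \<beta> (m - i) n) \<le> M * (M ^ (m - i) * b ^ n)"
          by (rule mult_mono[OF M(2)[OF i(2)] Suc.IH[OF i(3)]]) (use M(1) in auto)
        also have "\<dots> \<le> M * (M ^ m * b ^ Suc n)" using M(1) b(1) bb Mk by (intro mult_left_mono mult_mono power_increasing) auto
        also have "\<dots> = M ^ k * b ^ Suc n" using Suc by simp
        finally show "absv ((- 1) ^ i * \<alpha> i * Gc \<alpha> \<beta> (m - i) n) \<le> M ^ k * b ^ Suc n" by (simp add: absv_mult)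
      qed (rule p)
      then show ?thesis using False by simp
    qed
    have "absv \<beta> * absv (Gc \<alpha> \<beta> k n) \<le> b * (M ^ k * b ^ n)"
      using b Suc.IH[OF Suc.prems] by (intro mult_mono) auto
    then have 2: "absv (\<beta> * Gc \<alpha> \<beta> k n) \<le> M ^ k * b ^ Suc n" by (simp add: absv_mult mult_ac)
    show ?thesis using absv_diff_le[OF 1 2] unfolding Suc by simp
  qed
qed

lemma has_sum_add_absv:
  "(f has_sum (a::'c)) I \<Longrightarrow> (g has_sum b) I \<Longrightarrow> ((\<lambda>i. f i + g i) has_sum (a + b)) I"
  unfolding has_sum_def sum.distrib by (rule tendsto_add_absv)

lemma has_sum_cmult_absv:
  assumes "(f has_sum (s::'c)) I" shows "((\<lambda>i. c * f i) has_sum c * s) I"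
  unfolding has_sum_def sum_distrib_left[symmetric]
  using assms unfolding has_sum_def by (intro tendsto_mult_absv tendsto_const)

lemma has_sum_sum_absv:
  assumes "\<And>j. j \<in> J \<Longrightarrow> (f j has_sum (s j::'c)) I" shows "((\<lambda>i. \<Sum>j\<in>J. f j i) has_sum (\<Sum>j\<in>J. s j)) I"
  using assms
proof (induction J rule: infinite_finite_induct)
  case (insert j J)
  then have "((\<lambda>i. f j i + (\<Sum>j\<in>J. f j i)) has_sum (s j + (\<Sum>j\<in>J. s j))) I" by (intro has_sum_add_absv) auto
  then show ?case using insert.hyps by simp
qed auto

lemma has_sum_delta: "((\<lambda>n. if n = 0 then c else 0) has_sum (c::'c)) (UNIV :: nat set)"
proof -
  have "((\<lambda>n. if n = 0 then c else 0) has_sum c) {0::nat} \<longleftrightarrow> ((\<lambda>n. if n = 0 then c else 0) has_sum c) (UNIV :: nat set)"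
    by (rule has_sum_cong_neutral) auto
  moreover have "((\<lambda>n. if n = 0 then c else 0) has_sum c) {0::nat}"
    using has_sum_finite[of "{0::nat}" "\<lambda>n. if n = 0 then c else 0"] by simp
  ultimately show ?thesis by simp
qed

lemma finite_powers_ge: "0 \<le> q \<Longrightarrow> q < 1 \<Longrightarrow> 0 < e \<Longrightarrow> finite {n. e \<le> c * q ^ n}" for q e c :: real
proof -
  assume q: "0 \<le> q" "q < 1" and e: "0 < e"
  define c' where "c' = max 1 c"
  have c': "0 < c'" "c \<le> c'" by (auto simp: c'_def)
  obtain N where N: "q ^ N < e / c'" using real_arch_pow_inv[of "e / c'" q] q e c' by auto
  have "{n. e \<le> c * q ^ n} \<subseteq> {..<N}"
  proof
    fix n assume "n \<in> {n. e \<le> c * q ^ n}"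
    then have "e \<le> c * q ^ n" by simp
    also have "\<dots> \<le> c' * q ^ n" using c' q by (intro mult_right_mono) auto
    finally have 1: "e / c' \<le> q ^ n" using c' by (simp add: pos_divide_le_eq mult.commute)
    have "n < N"
    proof (rule ccontr)
      assume "\<not> n < N"
      then have "q ^ n \<le> q ^ N" using q by (intro power_decreasing) auto
      then show False using 1 N by simp
    qed
    then show "n \<in> {..<N}" by simp
  qed
  then show ?thesis by (rule finite_subset) simp
qed

lemma geometric_vanishing:
  assumes "\<And>n. absv (f n :: 'c) \<le> c * q ^ n" "0 \<le> q" "q < 1" shows "vanishing f UNIV"
  unfolding vanishing_def
proof (intro allI impI)
  fix e :: real assume e: "0 < e"
  show "finite {n \<in> UNIV. e \<le> absv (f n)}"
    by (rule finite_subset[OF _ finite_powers_ge[OF assms(2,3) e, of c]]) (use assms(1) in \<open>auto intro: order_trans\<close>)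
qed

text \<open>
  Both sides satisfy the same recursion, which comes from comparing coefficients in
  \<open>s\<^sub>k (1 + \<beta> u) = u T\<^sub>k\<close>.
\<close>

lemma Gc_has_sum:
  fixes s :: "nat \<Rightarrow> 'c"
  assumes M: "1 \<le> M" "\<And>i. i < k0 \<Longrightarrow> absv (\<alpha> i) \<le> M" and b: "1 \<le> b" "absv \<beta> \<le> b" and u: "absv u * b \<le> 1 / 2"
    and s1: "s 1 * (1 + \<beta> * u) = u"
    and sm: "\<And>m. 0 < m \<Longrightarrow> s (Suc m) * (1 + \<beta> * u) = u * (\<Sum>i<m. (- 1) ^ i * \<alpha> i * s (m - i))"
  shows "0 < k \<Longrightarrow> k \<le> k0 \<Longrightarrow> ((\<lambda>n. Gc \<alpha> \<beta> k n * u ^ n) has_sum s k) UNIV"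
proof (induction k rule: less_induct)
  case (less k)
  then obtain m where k: "k = Suc m" by (cases k) auto
  define g where "g n = Gc \<alpha> \<beta> k n * u ^ n" for n
  define \<tau> where "\<tau> n = (if m = 0 then (if n = 0 then 1 else 0) else (\<Sum>i<m. (- 1) ^ i * \<alpha> i * (Gc \<alpha> \<beta> (m - i) n * u ^ n)))" for n
  define T where "T = (if m = 0 then 1 else (\<Sum>i<m. (- 1) ^ i * \<alpha> i * s (m - i)))"
  have gb: "absv (g n) \<le> M ^ k * (1 / 2) ^ n" for n
  proof -
    have "absv (g n) \<le> (M ^ k * b ^ n) * absv u ^ n"
      unfolding g_def absv_mult absv_power using Gc_bound[OF M b less.prems(2)] by (intro mult_right_mono) auto
    also have "\<dots> = M ^ k * (absv u * b) ^ n" by (simp add: power_mult_distrib mult_ac)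
    also have "\<dots> \<le> M ^ k * (1 / 2) ^ n" using u M(1) b(1) by (intro mult_left_mono power_mono) auto
    finally show ?thesis .
  qed
  have "vanishing g UNIV" by (rule geometric_vanishing[OF gb]) auto
  then have t: "(g has_sum infsum g UNIV) UNIV" by (rule vanishing_summable)
  have g0: "g 0 = 0" unfolding g_def k by simp
  \<comment> \<open>The constant term is 0, so the series may be shifted by one, in accordance with
    the recursion of \<open>Gc\<close> in n.\<close>
  have "(g has_sum infsum g UNIV) (range Suc)"
    by (rule has_sum_cong_neutral[THEN iffD1, OF _ _ _ t]) (use g0 in \<open>auto simp: image_iff\<close>, metis not0_implies_Suc)
  then have "((\<lambda>n. g (Suc n)) has_sum infsum g UNIV) UNIV" by (subst (asm) has_sum_reindex) (simp_all add: o_def)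
  from has_sum_add_absv[OF this has_sum_cmult_absv[OF t, of "\<beta> * u"]]
  have 1: "((\<lambda>n. g (Suc n) + \<beta> * u * g n) has_sum (infsum g UNIV + \<beta> * u * infsum g UNIV)) UNIV" .
  have shift: "g (Suc n) + \<beta> * u * g n = u * \<tau> n" for n
    unfolding g_def \<tau>_def k by (simp add: algebra_simps sum_distrib_left)
  have "(\<tau> has_sum T) UNIV"
  proof (cases "m = 0")
    case True
    have "\<tau> = (\<lambda>n. if n = 0 then 1 else 0)" "T = 1" unfolding \<tau>_def T_def if_P[OF True] by (rule refl)+
    then show ?thesis using has_sum_delta[of 1] by (simp only:)
  next
    case False
    have "((\<lambda>n. \<Sum>i<m. (- 1) ^ i * \<alpha> i * (Gc \<alpha> \<beta> (m - i) n * u ^ n)) has_sum (\<Sum>i<m. (- 1) ^ i * \<alpha> i * s (m - i))) UNIV"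
    proof (rule has_sum_sum_absv)
      fix i assume "i \<in> {..<m}"
      then have "((\<lambda>n. Gc \<alpha> \<beta> (m - i) n * u ^ n) has_sum s (m - i)) UNIV"
        using k less.prems by (intro less.IH) simp_all
      then show "((\<lambda>n. (- 1) ^ i * \<alpha> i * (Gc \<alpha> \<beta> (m - i) n * u ^ n)) has_sum (- 1) ^ i * \<alpha> i * s (m - i)) UNIV"
        by (rule has_sum_cmult_absv)
    qed
    moreover have "\<tau> = (\<lambda>n. \<Sum>i<m. (- 1) ^ i * \<alpha> i * (Gc \<alpha> \<beta> (m - i) n * u ^ n))" "T = (\<Sum>i<m. (- 1) ^ i * \<alpha> i * s (m - i))"
      unfolding \<tau>_def T_def if_not_P[OF False] by (rule refl)+
    ultimately show ?thesis by (simp only:)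
  qed
  from has_sum_cmult_absv[OF this, of u] have 2: "((\<lambda>n. g (Suc n) + \<beta> * u * g n) has_sum u * T) UNIV" unfolding shift .
  have eq: "infsum g UNIV * (1 + \<beta> * u) = u * T" using infsumI[OF 1] infsumI[OF 2] by (simp add: algebra_simps)
  have "s k * (1 + \<beta> * u) = u * T"
    unfolding T_def k using s1 sm[of m] by (cases "m = 0") auto
  \<comment> \<open>\<beta> u has absolute value at most 1/2. The factor can thus be cancelled, and
    the sum of the series equals \<open>s k\<close>.\<close>
  moreover have "1 + \<beta> * u \<noteq> 0"
  proof
    assume "1 + \<beta> * u = 0"
    then have "\<beta> * u = - 1" by (simp add: add_eq_0_iff)
    then have "absv (\<beta> * u) = 1" by simp
    moreover have "absv \<beta> * absv u \<le> b * absv u" using b by (intro mult_right_mono) auto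
    ultimately show False using u by (simp add: absv_mult mult.commute)
  qed
  ultimately have "infsum g UNIV = s k" using eq by (metis mult_right_cancel)
  then show ?case using t unfolding g_def by simp
qed

text \<open>For a family dominated by p y q^n only finitely many pairs are large: finitely many y
  have p y \<ge> e, and each of them admits finitely many n. Both orders of summation then give the
  same sum.\<close>

lemma iterated_sums:
  fixes a :: "'i \<Rightarrow> nat \<Rightarrow> 'c"
  assumes fin: "\<And>e. 0 < e \<Longrightarrow> finite {y \<in> Y. e \<le> p y}" and a: "\<And>y n. y \<in> Y \<Longrightarrow> absv (a y n) \<le> p y * q ^ n"
    and q: "0 \<le> q" "q < 1"
  shows "((\<lambda>n. infsum (\<lambda>y. a y n) Y) has_sum infsum (\<lambda>y. infsum (a y) UNIV) Y) UNIV"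
proof -
  have key: "finite {x \<in> Y \<times> UNIV. e \<le> absv (case x of (y, n) \<Rightarrow> a y n)}" if e: "0 < e" for e
  proof (rule finite_subset)
    show "finite (SIGMA y : {y \<in> Y. e \<le> p y}. {n. e \<le> p y * q ^ n})"
      by (intro finite_SigmaI fin e finite_powers_ge q)
    show "{x \<in> Y \<times> UNIV. e \<le> absv (case x of (y, n) \<Rightarrow> a y n)} \<subseteq> (SIGMA y : {y \<in> Y. e \<le> p y}. {n. e \<le> p y * q ^ n})"
    proof clarsimp
      fix y n assume y: "y \<in> Y" and "e \<le> absv (a y n)"
      then have 1: "e \<le> p y * q ^ n" using a[OF y, of n] by linarith
      have "q ^ n \<le> 1" using q by (intro power_le_one) auto
      have "0 < p y"
      proof (rule ccontr)
        assume "\<not> 0 < p y"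
        then have "p y * q ^ n \<le> 0" using q by (intro mult_nonpos_nonneg) auto
        then show False using 1 e by simp
      qed
      then have "p y * q ^ n \<le> p y * 1" using \<open>q ^ n \<le> 1\<close> by (intro mult_left_mono) auto
      then show "e \<le> p y \<and> e \<le> p y * q ^ n" using 1 by simp
    qed
  qed
  have v: "vanishing (\<lambda>(y, n). a y n) (Y \<times> UNIV)" unfolding vanishing_def using key by blast
  have v': "vanishing (\<lambda>(n, y). a y n) (UNIV \<times> Y)"
    unfolding vanishing_def
  proof (intro allI impI)
    fix e :: real assume e: "0 < e"
    have "{x \<in> UNIV \<times> Y. e \<le> absv (case x of (n, y) \<Rightarrow> a y n)} = prod.swap ` {x \<in> Y \<times> UNIV. e \<le> absv (case x of (y, n) \<Rightarrow> a y n)}"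
      by (auto simp: image_iff)
    then show "finite {x \<in> UNIV \<times> Y. e \<le> absv (case x of (n, y) \<Rightarrow> a y n)}" using key[OF e] by simp
  qed
  have sw: "infsum (\<lambda>(n, y). a y n) (UNIV \<times> Y) = infsum (\<lambda>(y, n). a y n) (Y \<times> UNIV)"
    by (rule infsum_reindex_bij_witness[of _ prod.swap prod.swap]) auto
  have "((\<lambda>y. infsum (a y) UNIV) has_sum infsum (\<lambda>(y, n). a y n) (Y \<times> UNIV)) Y"
    using has_sum_Sigma_absv(1)[OF v] by simp
  then have "infsum (\<lambda>y. infsum (a y) UNIV) Y = infsum (\<lambda>(n, y). a y n) (UNIV \<times> Y)" unfolding sw by (rule infsumI)
  then show ?thesis using has_sum_Sigma_absv(1)[OF v'] by simp
qed

end

section \<open>Translations at infinity\<close>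

context lattice_family
begin

text \<open>As soon as the ball contains t, h w t is a root of the polynomial of that ball.\<close>

lemma exp_fun_lattice:
  assumes w: "w \<in> W" and t: "t \<in> \<Lambda>" shows "exp_fun (h w ` \<Lambda>) (h w t) = 0"
proof (rule LIMSEQ_unique_c[OF exp_fun_tendsto[OF w]])
  have "h w t * poly (exp_prod h (h w t) (B n) w) 1 = 0" if n: "N t \<le> real n" for n
  proof -
    have "h w t \<in> H w n" unfolding H_def using t n by blast
    then have "poly (finite_subgroup.e (H w n)) (h w t) = 0"
      unfolding finite_subgroup.e_P[OF H_subgroup[OF w]] by (simp add: finite_subgroup.P_root[OF H_subgroup[OF w]])
    then show ?thesis unfolding H_e[OF w] .
  qed
  moreover have "eventually (\<lambda>n. N t \<le> real n) sequentially"
    using eventually_ge_at_top[of "nat \<lceil>N t\<rceil>"] by eventually_elim linarith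
  ultimately have "eventually (\<lambda>n. h w t * poly (exp_prod h (h w t) (B n) w) 1 = 0) sequentially"
    by (rule eventually_mono[rotated])
  then show "(\<lambda>n. h w t * poly (exp_prod h (h w t) (B n) w) 1) \<longlonglongrightarrow> 0" by (rule tendsto_eventually)
qed

end

lemma vec_last_index: "x \<in> carrier_vec (Suc d) \<Longrightarrow> i < d \<Longrightarrow> vec_last x d $ i = x $ Suc i"
  unfolding vec_last_def by simp

lemma vec_Suc_eqI:
  assumes "x \<in> carrier_vec (Suc d)" "y \<in> carrier_vec (Suc d)" "x $ 0 = y $ 0" "vec_last x d = vec_last y d"
  shows "x = y"
proof (rule eq_vecI)
  fix i assume "i < dim_vec y"
  then have i: "i < Suc d" using assms(2) by simp
  show "x $ i = y $ i"
  proof (cases i)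
    case (Suc j)
    then have "j < d" using i by simp
    then show ?thesis using vec_last_index[OF assms(1)] vec_last_index[OF assms(2)] assms(4) Suc by metis
  qed (use assms(3) in simp)
qed (use assms in simp)

text \<open>The right action of the unipotent matrix \<open>um d l\<close> on row vectors in
  coordinates, see \<open>row_act_um\<close>.\<close>

definition sh :: "nat \<Rightarrow> 'f::field vec \<Rightarrow> 'f vec \<Rightarrow> 'f vec" where
  "sh d l x = vec (Suc d) (\<lambda>i. case i of 0 \<Rightarrow> x $ 0 | Suc j \<Rightarrow> x $ Suc j + x $ 0 * l $ j)"

lemma sh_carrier [simp]: "sh d l x \<in> carrier_vec (Suc d)" by (simp add: sh_def)

lemma dim_sh [simp]: "dim_vec (sh d l x) = Suc d" by (simp add: sh_def)

lemma sh_0 [simp]: "sh d l x $ 0 = x $ 0" by (simp add: sh_def)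

lemma sh_Suc: "j < d \<Longrightarrow> sh d l x $ Suc j = x $ Suc j + x $ 0 * l $ j" by (simp add: sh_def)

lemma sh_last:
  assumes "x \<in> carrier_vec (Suc d)" "l \<in> carrier_vec d"
  shows "vec_last (sh d l x) d = vec_last x d + x $ 0 \<cdot>\<^sub>v l"
  by (rule eq_vecI) (use assms in \<open>simp_all add: vec_last_index sh_Suc\<close>)

lemma sh_sh:
  assumes "x \<in> carrier_vec (Suc d)" "l \<in> carrier_vec d" "m \<in> carrier_vec d"
  shows "sh d l (sh d m x) = sh d (l + m) x"
proof (rule vec_Suc_eqI[of _ d])
  show "vec_last (sh d l (sh d m x)) d = vec_last (sh d (l + m) x) d"
    by (rule eq_vecI) (use assms in \<open>simp_all add: vec_last_index sh_Suc algebra_simps\<close>)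
qed simp_all

lemma sh_zero: "x \<in> carrier_vec (Suc d) \<Longrightarrow> sh d (0\<^sub>v d) x = x"
proof (rule vec_Suc_eqI[of _ d])
  assume x: "x \<in> carrier_vec (Suc d)"
  show "vec_last (sh d (0\<^sub>v d) x) d = vec_last x d"
    by (rule eq_vecI) (use x in \<open>simp_all add: vec_last_index sh_Suc\<close>)
qed simp_all

lemma sh_uminus:
  assumes "x \<in> carrier_vec (Suc d)" "l \<in> carrier_vec d"
  shows "sh d (- l) (sh d l x) = x" "sh d l (sh d (- l) x) = x"
proof -
  have "- l + l = 0\<^sub>v d" "l + - l = 0\<^sub>v d" using assms(2) by (auto intro!: eq_vecI)
  then show "sh d (- l) (sh d l x) = x" "sh d l (sh d (- l) x) = x"
    using assms by (simp_all add: sh_sh sh_zero)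
qed

definition um :: "nat \<Rightarrow> 'f::field vec \<Rightarrow> 'f mat" where
  "um d l = four_block_mat (1\<^sub>m 1) (mat_of_rows d [l]) (0\<^sub>m d 1) (1\<^sub>m d)"

lemma um_carrier: "um d l \<in> carrier_mat (Suc d) (Suc d)"
  unfolding um_def using four_block_carrier_mat[of "1\<^sub>m 1" 1 1 "1\<^sub>m d" d d] by simp

lemma um_index:
  assumes "i < Suc d" "j < Suc d"
  shows "um d l $$ (i, j) = (if i = 0 then if j = 0 then 1 else l $ (j - 1) else if i = j then 1 else 0)"
  unfolding um_def using assms by (cases i; cases j) (auto simp: mat_of_rows_def)

lemma um_GL: "um d (l :: 'f::field vec) \<in> carrier (GL (Suc d))"
proof -
  have "det (um d l) = det (1\<^sub>m 1 :: 'f mat) * det (1\<^sub>m d :: 'f mat)"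
    unfolding um_def by (rule det_four_block_mat_lower_left_zero[of _ 1 _ d]) auto
  then have "det (um d l) \<noteq> 0" by simp
  from det_non_zero_imp_unit[OF um_carrier this] show ?thesis by (simp add: GL_def units_of_def)
qed

lemma row_act_um:
  assumes x: "x \<in> carrier_vec (Suc d)" shows "row_act x (um d l) = sh d l x"
proof (rule eq_vecI)
  fix i assume "i < dim_vec (sh d l x)"
  then have i: "i < Suc d" by simp
  have "row_act x (um d l) $ i = (\<Sum>j<Suc d. x $ j * um d l $$ (j, i))" by (rule row_act_index[OF um_carrier x i])
  also have "\<dots> = (\<Sum>j<Suc d. x $ j * (if j = 0 then if i = 0 then 1 else l $ (i - 1) else if j = i then 1 else 0))"
    using i by (intro sum.cong refl) (simp add: um_index)
  also have "\<dots> = x $ 0 * (if i = 0 then 1 else l $ (i - 1)) + (\<Sum>j<d. x $ Suc j * (if Suc j = i then 1 else 0))"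
    by (subst sum.lessThan_Suc_shift) simp
  also have "\<dots> = sh d l x $ i"
  proof (cases i)
    case 0
    then show ?thesis by simp
  next
    case (Suc m)
    have "(\<Sum>j<d. x $ Suc j * (if Suc j = i then 1 else 0)) = (\<Sum>j<d. if j = m then x $ Suc j else 0)"
      using Suc by (intro sum.cong refl) simp
    also have "\<dots> = x $ i" using Suc i by (simp add: sum.delta)
    finally show ?thesis using Suc i by (simp add: sh_Suc)
  qed
  finally show "row_act x (um d l) $ i = sh d l x $ i" .
next
  show "dim_vec (row_act x (um d l)) = dim_vec (sh d l x)"
    using carrier_vecD[OF row_act_carrier[OF um_carrier]] by simp
qed

section \<open>The orbits of the unipotent translations\<close>

text \<open>\<open>Sx\<close> stands for a coset of a lattice in rank d + 1. The lattice itself is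
  represented by its two comparisons with A^(d+1), the common denominator \<open>den\<close> and the
  period \<open>per\<close>. The assumption \<open>nonzero\<close> makes the group of translations
  discrete, see \<open>finite_Lam\<close>.\<close>

locale coset_lattice = drinfeld K v ty \<iota> \<theta> \<xi>
  for K :: "'f::field set" and v :: "'f \<Rightarrow> int" and ty :: "'c::{field,complete_space} itself"
    and \<iota> :: "'f \<Rightarrow> 'c" and \<theta> :: real and \<xi> :: 'c +
  fixes d k :: nat and Sx :: "'f vec set" and den per :: 'f
  assumes d: "1 \<le> d" and k: "0 < k" and Sc: "Sx \<subseteq> carrier_vec (Suc d)"
    and den: "den \<in> A" "den \<noteq> 0" "\<And>x. x \<in> Sx \<Longrightarrow> den \<cdot>\<^sub>v x \<in> Avec (Suc d)"
    and per: "per \<in> A" "per \<noteq> 0" "\<And>x y. x \<in> Sx \<Longrightarrow> y \<in> Avec (Suc d) \<Longrightarrow> x + per \<cdot>\<^sub>v y \<in> Sx"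
    and nonzero: "\<exists>s\<in>Sx. s $ 0 \<noteq> 0"
begin

lemma finite_Sx: "finite {x \<in> Sx. vn x \<le> q}"
  by (rule disc_of_denominator[OF Sc den(2,3)])

text \<open>The group \<Lambda>' of the stabiliser of \<open>Sx\<close>, see
  \<open>unipotent_Stab\<close>.\<close>

definition Lam :: "'f vec set" where "Lam = {l \<in> carrier_vec d. sh d l ` Sx = Sx}"

lemma unipotent_Stab: "unipotent_part (Suc d) (Stab (Suc d) Sx) = Lam"
proof -
  have "act (um d l) Sx = sh d l ` Sx" for l
    unfolding act_def using Sc row_act_um by (intro image_cong refl) blast
  then show ?thesis unfolding unipotent_part_def Lam_def Stab_def um_def[symmetric] using um_GL by auto
qed

lemma LamI:
  assumes l: "l \<in> carrier_vec d" and s: "\<And>x. x \<in> Sx \<Longrightarrow> sh d l x \<in> Sx" "\<And>x. x \<in> Sx \<Longrightarrow> sh d (- l) x \<in> Sx"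
  shows "l \<in> Lam"
proof -
  have "x \<in> sh d l ` Sx" if x: "x \<in> Sx" for x
    using sh_uminus(2)[of x d l] l x Sc s(2)[OF x] by (metis imageI subsetD)
  then have "sh d l ` Sx = Sx" using s(1) by blast
  then show ?thesis unfolding Lam_def using l by simp
qed

lemma Lam_carrier: "l \<in> Lam \<Longrightarrow> l \<in> carrier_vec d"
  by (simp add: Lam_def)

lemma Lam_Sx: "l \<in> Lam \<Longrightarrow> x \<in> Sx \<Longrightarrow> sh d l x \<in> Sx"
  unfolding Lam_def by blast

lemma Lam_0: "0\<^sub>v d \<in> Lam"
proof (rule LamI)
  have "- 0\<^sub>v d = (0\<^sub>v d :: 'f vec)" by (rule eq_vecI) auto
  then show "sh d (- 0\<^sub>v d) x \<in> Sx" if "x \<in> Sx" for x using that sh_zero[of x d] Sc by auto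
  show "sh d (0\<^sub>v d) x \<in> Sx" if "x \<in> Sx" for x using that sh_zero[of x d] Sc by auto
qed simp

lemma Lam_uminus: "l \<in> Lam \<Longrightarrow> - l \<in> Lam"
proof -
  assume l: "l \<in> Lam"
  have s: "sh d (- l) x \<in> Sx" if x: "x \<in> Sx" for x
  proof -
    have "x \<in> sh d l ` Sx" using l x unfolding Lam_def by simp
    then obtain y where y: "y \<in> Sx" "x = sh d l y" by blast
    then show ?thesis using sh_uminus(1)[of y d l] Sc Lam_carrier[OF l] by auto
  qed
  have "- (- l) = l" by (rule eq_vecI) auto
  then show ?thesis using s Lam_Sx[OF l] Lam_carrier[OF l] by (intro LamI) auto
qed

lemma Lam_add: "l \<in> Lam \<Longrightarrow> m \<in> Lam \<Longrightarrow> l + m \<in> Lam"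
proof -
  assume l: "l \<in> Lam" and m: "m \<in> Lam"
  have "sh d (l + m) ` Sx = sh d l ` (sh d m ` Sx)"
    unfolding image_image using sh_sh[of _ d l m] Sc Lam_carrier[OF l] Lam_carrier[OF m] by (intro image_cong refl) auto
  then show ?thesis using l m unfolding Lam_def by auto
qed

text \<open>Translation by per den z moves x by per times (den x_0) z, and den x_0 lies in
  A.\<close>

lemma Lam_multiples: "y \<in> Avec d \<Longrightarrow> (per * den) \<cdot>\<^sub>v y \<in> Lam"
proof -
  have s: "sh d ((per * den) \<cdot>\<^sub>v z) x \<in> Sx" if z: "z \<in> Avec d" and x: "x \<in> Sx" for x z
  proof -
    define c where "c = vec (Suc d) (\<lambda>i. case i of 0 \<Rightarrow> 0 | Suc j \<Rightarrow> (den * x $ 0) * z $ j)"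
    have xc: "x \<in> carrier_vec (Suc d)" and zc: "z \<in> carrier_vec d" using x Sc z Avec_carrier by auto
    have zA: "\<And>i. i < d \<Longrightarrow> z $ i \<in> A" using z by (simp add: Avec_def)
    have "(den \<cdot>\<^sub>v x) $ 0 \<in> A" using den(3)[OF x] by (simp add: Avec_def)
    then have dA: "den * x $ 0 \<in> A" using xc by simp
    have "c \<in> Avec (Suc d)"
      unfolding Avec_def c_def using zA A_0 by (auto split: nat.split intro!: ring_set_mult[OF A_ring dA])
    moreover have "sh d ((per * den) \<cdot>\<^sub>v z) x = x + per \<cdot>\<^sub>v c"
    proof (rule vec_Suc_eqI[of _ d])
      show "vec_last (sh d ((per * den) \<cdot>\<^sub>v z) x) d = vec_last (x + per \<cdot>\<^sub>v c) d"
        by (rule eq_vecI) (use xc zc in \<open>auto simp: vec_last_def sh_Suc c_def algebra_simps\<close>)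
    qed (use xc in \<open>auto simp: c_def\<close>)
    ultimately show ?thesis using per(3)[OF x] by simp
  qed
  assume y: "y \<in> Avec d"
  have "- ((per * den) \<cdot>\<^sub>v y) = (per * den) \<cdot>\<^sub>v (- 1 \<cdot>\<^sub>v y)" by (rule eq_vecI) auto
  then show ?thesis using s[OF y] s[OF Avec_smult[OF A_m1 y]] y Avec_carrier by (intro LamI) auto
qed

text \<open>For s with s_0 \<noteq> 0, both s and its translate by l lie in \<open>Sx\<close>. Their
  difference shows that den s_0 is a common denominator for all l.\<close>

lemma finite_Lam: "finite {l \<in> Lam. vn l \<le> q}"
proof -
  obtain s where s: "s \<in> Sx" "s $ 0 \<noteq> 0" using nonzero by blast
  have sc: "s \<in> carrier_vec (Suc d)" using s Sc by auto
  have A: "den * x $ Suc j \<in> A" if "x \<in> Sx" "j < d" for x j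
  proof -
    have "(den \<cdot>\<^sub>v x) $ Suc j \<in> A" using den(3)[OF that(1)] that(2) by (simp add: Avec_def)
    then show ?thesis using that Sc by auto
  qed
  show ?thesis
  proof (rule disc_of_denominator)
    show "Lam \<subseteq> carrier_vec d" using Lam_carrier by auto
    show "den * s $ 0 \<noteq> 0" using den(2) s(2) by simp
    fix l assume l: "l \<in> Lam"
    have "(den * s $ 0) * l $ j \<in> A" if j: "j < d" for j
    proof -
      have "(den * s $ 0) * l $ j = den * sh d l s $ Suc j - den * s $ Suc j" by (simp add: sh_Suc[OF j] algebra_simps)
      then show ?thesis using ring_set_diff[OF A_ring A[OF Lam_Sx[OF l s(1)] j] A[OF s(1) j]] by simp
    qed
    then show "(den * s $ 0) \<cdot>\<^sub>v l \<in> Avec d" unfolding Avec_def using Lam_carrier[OF l] by simp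
  qed
qed

text \<open>Cocompactness of A is applied in each coordinate, with the multiples (per den) A^d
  contained in \<open>Lam\<close>.\<close>

lemma Lam_cocompact: "\<exists>c>0. \<forall>y\<in>carrier_vec d. \<exists>l\<in>Lam. vn (y - l) \<le> c"
proof -
  obtain c where "\<forall>f. \<exists>a\<in>A. vge v c (f - a)" using A_fractions_cocompact(2) by blast
  then have "\<forall>f. \<exists>a. a \<in> A \<and> vge v c (f - a)" by blast
  from choice[OF this] obtain g where g: "\<forall>f. g f \<in> A \<and> vge v c (f - g f)" ..
  let ?D = "per * den"
  have D: "?D \<noteq> 0" using den per by simp
  have "\<exists>l\<in>Lam. vn (y - l) \<le> nf ?D * \<theta> powi c" if y: "y \<in> carrier_vec d" for y
  proof (rule bexI)
    define z where "z = vec d (\<lambda>i. g (inverse ?D * y $ i))"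
    show "?D \<cdot>\<^sub>v z \<in> Lam" by (rule Lam_multiples) (use g in \<open>simp add: Avec_def z_def\<close>)
    show "vn (y - ?D \<cdot>\<^sub>v z) \<le> nf ?D * \<theta> powi c"
    proof (rule vn_le)
      show "0 \<le> nf ?D * \<theta> powi c" using \<theta> by simp
      fix i assume "i < dim_vec (y - ?D \<cdot>\<^sub>v z)"
      then have i: "i < d" by (simp add: z_def)
      have D': "?D * (inverse ?D * t - s) = t - ?D * s" for t s
        unfolding right_diff_distrib mult.assoc[of ?D, symmetric] right_inverse[OF D] by simp
      have "(y - ?D \<cdot>\<^sub>v z) $ i = y $ i - ?D * g (inverse ?D * y $ i)" using i y by (simp add: z_def)
      also have "\<dots> = ?D * (inverse ?D * y $ i - g (inverse ?D * y $ i))" by (rule D'[symmetric])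
      also have "nf (?D * (inverse ?D * y $ i - g (inverse ?D * y $ i))) = nf ?D * nf (inverse ?D * y $ i - g (inverse ?D * y $ i))"
        unfolding \<iota>.hom_mult[of ?D] absv_mult ..
      also have "\<dots> \<le> nf ?D * \<theta> powi c" by (intro mult_left_mono vge_nf) (use g in auto)
      finally show "nf ((y - ?D \<cdot>\<^sub>v z) $ i) \<le> nf ?D * \<theta> powi c" .
    qed
  qed
  moreover have "0 < nf ?D * \<theta> powi c" using D \<theta> by simp
  ultimately show ?thesis by blast
qed

definition Cb :: real where "Cb = (SOME c. 0 < c \<and> (\<forall>y\<in>carrier_vec d. \<exists>l\<in>Lam. vn (y - l) \<le> c))"

lemma Cb: "0 < Cb" "\<And>y. y \<in> carrier_vec d \<Longrightarrow> \<exists>l\<in>Lam. vn (y - l) \<le> Cb"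
  using someI_ex[OF Lam_cocompact[unfolded Bex_def]] unfolding Cb_def by (auto simp: Bex_def)

definition Sp :: "'f vec set" where "Sp = {x \<in> Sx. x $ 0 \<noteq> 0}"

definition orb :: "'f vec \<Rightarrow> 'f vec set" where "orb x = (\<lambda>l. sh d l x) ` Lam"

text \<open>The choice depends on x only through its orbit, which makes \<open>rp\<close> idempotent
  and constant on orbits. The inequality asks that y'/y_0 have norm at most
  \<open>Cb\<close>.\<close>

definition rp :: "'f vec \<Rightarrow> 'f vec" where
  "rp x = (SOME y. y \<in> orb x \<and> vn (vec_last y d) \<le> Cb * nf (y $ 0))"

definition Rp :: "'f vec set" where "Rp = rp ` Sp"

lemma Sp_carrier: "x \<in> Sp \<Longrightarrow> x \<in> carrier_vec (Suc d)" "x \<in> Sp \<Longrightarrow> x \<in> Sx" "x \<in> Sp \<Longrightarrow> x $ 0 \<noteq> 0"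
  using Sc by (auto simp: Sp_def)

lemma sh_Sp: "x \<in> Sp \<Longrightarrow> l \<in> Lam \<Longrightarrow> sh d l x \<in> Sp"
  using Lam_Sx by (simp add: Sp_def)

lemma rp:
  assumes x: "x \<in> Sp" shows "rp x \<in> orb x" "vn (vec_last (rp x) d) \<le> Cb * nf (rp x $ 0)"
proof -
  note xs = Sp_carrier[OF x]
  \<comment> \<open>Translation by -m replaces x'/x_0 by x'/x_0 - m; m is chosen in
    \<open>Lam\<close> close to x'/x_0.\<close>
  define q where "q = inverse (x $ 0) \<cdot>\<^sub>v vec_last x d"
  have q: "q \<in> carrier_vec d" by (simp add: q_def)
  obtain m where m: "m \<in> Lam" "vn (q - m) \<le> Cb" using Cb(2)[OF q] by blast
  have mc: "m \<in> carrier_vec d" by (rule Lam_carrier[OF m(1)])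
  have "vec_last (sh d (- m) x) d = x $ 0 \<cdot>\<^sub>v (q - m)"
    by (rule eq_vecI) (use xs mc in \<open>simp_all add: vec_last_index sh_Suc q_def right_diff_distrib mult.assoc[symmetric]\<close>)
  then have "vn (vec_last (sh d (- m) x) d) \<le> nf (x $ 0) * vn (q - m)" using vn_smult by simp
  also have "\<dots> \<le> nf (x $ 0) * Cb" using m(2) by (intro mult_left_mono) auto
  finally have "\<exists>y. y \<in> orb x \<and> vn (vec_last y d) \<le> Cb * nf (y $ 0)"
    using Lam_uminus[OF m(1)] by (intro exI[of _ "sh d (- m) x"]) (simp add: orb_def mult.commute)
  from someI_ex[OF this] show "rp x \<in> orb x" "vn (vec_last (rp x) d) \<le> Cb * nf (rp x $ 0)" unfolding rp_def by blast+
qed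

lemma orb_sh:
  assumes x: "x \<in> carrier_vec (Suc d)" and l: "l \<in> Lam" shows "orb (sh d l x) = orb x"
proof
  note lc = Lam_carrier[OF l]
  have 1: "orb (sh d m y) \<subseteq> orb y" if "y \<in> carrier_vec (Suc d)" "m \<in> Lam" for y m
    unfolding orb_def using sh_sh[OF that(1) Lam_carrier Lam_carrier[OF that(2)]] Lam_add[OF _ that(2)] by auto
  show "orb (sh d l x) \<subseteq> orb x" by (rule 1[OF x l])
  show "orb x \<subseteq> orb (sh d l x)" using 1[OF sh_carrier[of d l x] Lam_uminus[OF l]] sh_uminus(1)[OF x lc] by simp
qed

lemma rp_orb: "orb x = orb y \<Longrightarrow> rp x = rp y"
  unfolding rp_def by simp

lemma Rp_Sp: "y \<in> Rp \<Longrightarrow> y \<in> Sp"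
proof -
  assume "y \<in> Rp"
  then obtain x where x: "x \<in> Sp" "y = rp x" unfolding Rp_def by blast
  obtain l where "l \<in> Lam" "y = sh d l x" using rp(1)[OF x(1)] x(2) unfolding orb_def by blast
  then show "y \<in> Sp" using sh_Sp[OF x(1)] by simp
qed

lemma Rp_rp: "y \<in> Rp \<Longrightarrow> rp y = y"
proof -
  assume "y \<in> Rp"
  then obtain x where x: "x \<in> Sp" "y = rp x" unfolding Rp_def by blast
  obtain l where l: "l \<in> Lam" "y = sh d l x" using rp(1)[OF x(1)] x(2) unfolding orb_def by blast
  have "orb y = orb x" unfolding l(2) by (rule orb_sh[OF Sp_carrier(1)[OF x(1)] l(1)])
  then show ?thesis using rp_orb x(2) by blast
qed

lemma Rp_bound: "y \<in> Rp \<Longrightarrow> vn (vec_last y d) \<le> Cb * nf (y $ 0)"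
  using rp(2)[OF Rp_Sp] Rp_rp by simp

text \<open>Translations act freely on vectors with x_0 \<noteq> 0, and every orbit contains exactly
  one representative.\<close>

lemma Sp_bij: "bij_betw (\<lambda>(y, l). sh d l y) (Rp \<times> Lam) Sp"
  unfolding bij_betw_def
proof
  show "inj_on (\<lambda>(y, l). sh d l y) (Rp \<times> Lam)"
  proof (rule inj_onI, clarify)
    fix y l y' l' assume yl: "y \<in> Rp" "l \<in> Lam" "y' \<in> Rp" "l' \<in> Lam" and eq: "sh d l y = sh d l' y'"
    note yc = Sp_carrier[OF Rp_Sp[OF yl(1)]] and yc' = Sp_carrier[OF Rp_Sp[OF yl(3)]]
    have "orb y = orb y'" using orb_sh[OF yc(1) yl(2)] orb_sh[OF yc'(1) yl(4)] eq by simp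
    then have y: "y = y'" using rp_orb Rp_rp[OF yl(1)] Rp_rp[OF yl(3)] by metis
    have "l = l'"
    proof (rule eq_vecI)
      fix i assume "i < dim_vec l'"
      then have i: "i < d" using Lam_carrier[OF yl(4)] by simp
      have "sh d l y $ Suc i = sh d l' y $ Suc i" using eq y by simp
      then show "l $ i = l' $ i" using yc(3) by (simp add: sh_Suc[OF i])
    qed (use Lam_carrier[OF yl(2)] Lam_carrier[OF yl(4)] in simp)
    then show "y = y' \<and> l = l'" using y by simp
  qed
  show "(\<lambda>(y, l). sh d l y) ` (Rp \<times> Lam) = Sp"
  proof
    show "(\<lambda>(y, l). sh d l y) ` (Rp \<times> Lam) \<subseteq> Sp" using sh_Sp Rp_Sp by auto
    show "Sp \<subseteq> (\<lambda>(y, l). sh d l y) ` (Rp \<times> Lam)"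
    proof
      fix x assume x: "x \<in> Sp"
      obtain l where l: "l \<in> Lam" "rp x = sh d l x" using rp(1)[OF x] unfolding orb_def by blast
      have "x = sh d (- l) (rp x)" unfolding l(2) using sh_uminus(1)[OF Sp_carrier(1)[OF x] Lam_carrier[OF l(1)]] by simp
      then show "x \<in> (\<lambda>(y, l). sh d l y) ` (Rp \<times> Lam)"
        using x Lam_uminus[OF l(1)] by (intro image_eqI[of _ _ "(rp x, - l)"]) (auto simp: Rp_def)
    qed
  qed
qed

text \<open>For a representative the first coordinate controls the whole vector, so a bound on it
  leaves finitely many elements of the discrete set \<open>Sx\<close>.\<close>

lemma finite_Rp:
  assumes e: "0 < e" and M: "0 < M" shows "finite {y \<in> Rp. e \<le> inverse (nf (y $ 0) ^ k) * M}"
proof (rule finite_subset[OF _ finite_Sx])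
  define q where "q = max 1 (inverse (e / M))"
  show "{y \<in> Rp. e \<le> inverse (nf (y $ 0) ^ k) * M} \<subseteq> {x \<in> Sx. vn x \<le> max q (Cb * q)}"
  proof safe
    fix y assume y: "y \<in> Rp" "e \<le> inverse (nf (y $ 0) ^ k) * M"
    note ys = Sp_carrier[OF Rp_Sp[OF y(1)]]
    show "y \<in> Sx" by (rule ys(2))
    have "e / M \<le> inverse (nf (y $ 0) ^ k)" using y(2) M by (simp add: pos_divide_le_eq)
    then have nq: "nf (y $ 0) \<le> q" unfolding q_def using e M k ys(3) by (intro inverse_power_ge_imp_le) auto
    have q1: "1 \<le> q" by (simp add: q_def)
    have "vn (vec_last y d) \<le> Cb * q" using Rp_bound[OF y(1)] nq Cb(1) by (meson mult_left_mono less_imp_le order_trans)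
    then have "nf (y $ i) \<le> max q (Cb * q)" if "i < Suc d" for i
    proof (cases i)
      case 0
      then show ?thesis using nq by simp
    next
      case (Suc j)
      then have "j < d" using that by simp
      then have "nf (y $ i) \<le> vn (vec_last y d)" using vn_ge[of j "vec_last y d"] vec_last_index[OF ys(1)] Suc by simp
      then show ?thesis using \<open>vn (vec_last y d) \<le> Cb * q\<close> by simp
    qed
    then show "vn y \<le> max q (Cb * q)" using q1 ys(1) by (intro vn_le) auto
  qed
qed

lemma pairing_split:
  assumes "x \<in> carrier_vec (Suc d)" "\<omega> \<in> carrier_vec (Suc d)"
  shows "pairing \<iota> x \<omega> = \<iota> (x $ 0) * \<omega> $ 0 + pairing \<iota> (vec_last x d) (vec_last \<omega> d)"
proof -
  have "pairing \<iota> x \<omega> = \<iota> (x $ 0) * \<omega> $ 0 + (\<Sum>i<d. \<iota> (x $ Suc i) * \<omega> $ Suc i)"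
    unfolding pairing_sum[OF assms] by (rule sum.lessThan_Suc_shift)
  also have "(\<Sum>i<d. \<iota> (x $ Suc i) * \<omega> $ Suc i) = pairing \<iota> (vec_last x d) (vec_last \<omega> d)"
    unfolding pairing_sum[OF vec_last_carrier vec_last_carrier] using assms by (intro sum.cong refl) (simp add: vec_last_index)
  finally show ?thesis .
qed

abbreviation lform :: "'c vec \<Rightarrow> 'f vec \<Rightarrow> 'c" where "lform \<equiv> \<lambda>w l. pairing \<iota> l w"

abbreviation ec :: "nat \<Rightarrow> 'c vec \<Rightarrow> 'c" where "ec \<equiv> exp_coeff lform Lam (0\<^sub>v d) vn"

text \<open>The point y'/y_0, by which y\<omega> factors as y_0 times \<omega>_1 + b with b =
  \<open>lform \<omega>' (by0 y)\<close>.\<close>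

definition by0 :: "'f vec \<Rightarrow> 'f vec" where "by0 y = inverse (y $ 0) \<cdot>\<^sub>v vec_last y d"

definition \<beta> :: "'f vec \<Rightarrow> 'c vec \<Rightarrow> 'c" where "\<beta> y w = exp_fun (lform w ` Lam) (lform w (by0 y))"

definition Sz :: "'f vec set" where "Sz = (\<lambda>x. vec_last x d) ` {x \<in> Sx. x $ 0 = 0}"

text \<open>The coefficient of u^n: the orbit of y contributes y_0^(-k) times the k-th Goss
  polynomial at u / (1 + \<beta> u). As \<open>Gc\<close> is 0 for n = 0, the Eisenstein series of
  \<open>Sz\<close> is all of the constant coefficient.\<close>

definition cf :: "nat \<Rightarrow> 'c vec \<Rightarrow> 'c" where
  "cf n w = (if n = 0 then eisenstein \<iota> d k Sz w else 0) +
     infsum (\<lambda>y. inverse (\<iota> (y $ 0) ^ k) * Gc (\<lambda>i. ec i w) (\<beta> y w) k n) Rp"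

lemma by0_carrier [simp]: "by0 y \<in> carrier_vec d" by (simp add: by0_def)

lemma by0_bound: "y \<in> Rp \<Longrightarrow> vn (by0 y) \<le> Cb"
proof -
  assume y: "y \<in> Rp"
  have "vn (by0 y) \<le> nf (inverse (y $ 0)) * vn (vec_last y d)" unfolding by0_def by (rule vn_smult)
  also have "\<dots> \<le> nf (inverse (y $ 0)) * (Cb * nf (y $ 0))" using Rp_bound[OF y] by (intro mult_left_mono) auto
  also have "\<dots> = Cb" using Sp_carrier(3)[OF Rp_Sp[OF y]] by (simp add: \<iota>.hom_inverse absv_inverse)
  finally show ?thesis .
qed

lemma finite_Sz: "finite {x \<in> Sz. vn x \<le> q}"
proof (rule finite_subset)
  show "finite ((\<lambda>x. vec_last x d) ` {x \<in> Sx. vn x \<le> max 0 q})" by (intro finite_imageI finite_Sx)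
  show "{x \<in> Sz. vn x \<le> q} \<subseteq> (\<lambda>x. vec_last x d) ` {x \<in> Sx. vn x \<le> max 0 q}"
  proof safe
    fix z assume "z \<in> Sz" and q: "vn z \<le> q"
    then obtain x where x: "x \<in> Sx" "x $ 0 = 0" "z = vec_last x d" unfolding Sz_def by blast
    have xc: "x \<in> carrier_vec (Suc d)" using x Sc by auto
    have "vn x \<le> max 0 q"
    proof (rule vn_le)
      fix i assume "i < dim_vec x"
      then have i: "i < Suc d" using xc by simp
      show "nf (x $ i) \<le> max 0 q"
      proof (cases i)
        case 0
        then show ?thesis using x(2) by simp
      next
        case (Suc j)
        then have "j < d" using i by simp
        then have "nf (x $ i) \<le> vn z" using vn_ge[of j z] vec_last_index[OF xc] Suc x(3) by simp
        then show ?thesis using q by simp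
      qed
    qed simp
    then show "z \<in> (\<lambda>x. vec_last x d) ` {x \<in> Sx. vn x \<le> max 0 q}" using x by blast
  qed
qed

end

section \<open>The expansion at infinity\<close>

text \<open>One affinoid in rank d is fixed; over it the lattices attached to \<open>Lam\<close>
  form a \<open>lattice_family\<close> with uniform constants.\<close>

locale coset_lattice_at = coset_lattice K v ty \<iota> \<theta> \<xi> d k Sx den per
  for K :: "'f::field set" and v :: "'f \<Rightarrow> int" and ty :: "'c::{field,complete_space} itself"
    and \<iota> :: "'f \<Rightarrow> 'c" and \<theta> :: real and \<xi> :: 'c and d k :: nat and Sx :: "'f vec set" and den per :: 'f +
  fixes a :: 'f
  assumes a: "a \<noteq> 0"
begin

abbreviation W :: "'c vec set" where "W \<equiv> Omega_affinoid \<iota> \<xi> d a"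

abbreviation \<delta> :: real where "\<delta> \<equiv> nf a * absv \<xi>"

lemma \<delta>_pos: "0 < \<delta>" using a \<xi> by simp

lemma W_carrier: "w \<in> W \<Longrightarrow> w \<in> carrier_vec d" by (rule Omega_affinoidD(2))

sublocale F: lattice_family ty lform Lam "0\<^sub>v d" vn W \<delta>
proof unfold_locales
  show "finite {t \<in> Lam. vn t \<le> q}" for q by (rule finite_Lam)
  show "0\<^sub>v d \<in> Lam" by (rule Lam_0)
  show "vn (0\<^sub>v d) = 0" by simp
  show "0 < vn t" if "t \<in> Lam" "t \<noteq> 0\<^sub>v d" for t by (rule vn_pos[OF Lam_carrier[OF that(1)] that(2)])
  show "0 < \<delta>" by (rule \<delta>_pos)
  show "\<delta> * vn t \<le> absv (pairing \<iota> t w)" if "w \<in> W" "t \<in> Lam" for w t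
    by (rule affinoid_lower[OF that(1) d Lam_carrier[OF that(2)]])
  show "pairing \<iota> (0\<^sub>v d) w = 0" if "w \<in> W" for w using W_carrier[OF that] by simp
  show "inj_on (lform w) Lam" if w: "w \<in> W" for w
  proof (rule inj_onI)
    fix l m assume l: "l \<in> Lam" and m: "m \<in> Lam" and eq: "pairing \<iota> l w = pairing \<iota> m w"
    note lc = Lam_carrier[OF l] and mc = Lam_carrier[OF m]
    have "pairing \<iota> (l - m) w = 0" using eq pairing_diff[OF lc mc W_carrier[OF w]] by simp
    then have 0: "l - m = 0\<^sub>v d"
      using Omega_pairing_nonzero[OF Omega_affinoidD(1)[OF w], of "l - m"] lc mc by auto
    show "l = m"
    proof (rule eq_vecI)
      fix i assume "i < dim_vec m"
      then have i: "i < d" using mc by simp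
      have "(l - m) $ i = 0" unfolding 0 using i by simp
      then show "l $ i = m $ i" using i lc mc by simp
    qed (use lc mc in simp)
  qed
  show "x + y \<in> lform w ` {t \<in> Lam. vn t \<le> real n}"
    if w: "w \<in> W" and x: "x \<in> lform w ` {t \<in> Lam. vn t \<le> real n}" and y: "y \<in> lform w ` {t \<in> Lam. vn t \<le> real n}" for w n x y
  proof -
    from x obtain l where l: "l \<in> Lam" "vn l \<le> real n" "x = pairing \<iota> l w" by blast
    from y obtain m where m: "m \<in> Lam" "vn m \<le> real n" "y = pairing \<iota> m w" by blast
    note lc = Lam_carrier[OF l(1)] and mc = Lam_carrier[OF m(1)]
    have "x + y = pairing \<iota> (l + m) w" using pairing_add[OF lc mc W_carrier[OF w]] l m by simp
    moreover have "l + m \<in> {t \<in> Lam. vn t \<le> real n}" using Lam_add[OF l(1) m(1)] vn_add[OF lc mc l(2) m(2)] by simp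
    ultimately show ?thesis by blast
  qed
  show "- x \<in> lform w ` {t \<in> Lam. vn t \<le> real n}" if w: "w \<in> W" and x: "x \<in> lform w ` {t \<in> Lam. vn t \<le> real n}" for w n x
  proof -
    from x obtain l where l: "l \<in> Lam" "vn l \<le> real n" "x = pairing \<iota> l w" by blast
    have "- x = pairing \<iota> (- l) w" using pairing_uminus[OF Lam_carrier[OF l(1)] W_carrier[OF w]] l by simp
    moreover have "- l \<in> {t \<in> Lam. vn t \<le> real n}" using Lam_uminus[OF l(1)] l(2) by simp
    ultimately show ?thesis by blast
  qed
qed

lemma hb_inverse_lform: "t \<in> Lam - {0\<^sub>v d} \<Longrightarrow> hb d W (\<lambda>w. inverse (lform w t))"
  by (rule hb_inverse_pairing[OF a d]) (auto dest: Lam_carrier)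

lemma hb_coeff_exp_prod:
  assumes "finite T" "T \<subseteq> Lam - {0\<^sub>v d}" shows "hb d W (\<lambda>w. coeff (exp_prod lform 1 T w) i)"
  using assms
proof (induction T arbitrary: i rule: finite_induct)
  case empty
  then show ?case unfolding exp_prod_def by (simp add: hb_const)
next
  case (insert t T)
  have IH: "hb d W (\<lambda>w. coeff (exp_prod lform 1 T w) j)" for j using insert by blast
  have ht: "hb d W (\<lambda>w. inverse (lform w t))" by (rule hb_inverse_lform) (use insert in auto)
  have eq: "coeff (exp_prod lform 1 (insert t T) w) i = coeff (exp_prod lform 1 T w) i +
      (case i of 0 \<Rightarrow> 0 | Suc j \<Rightarrow> - inverse (lform w t) * coeff (exp_prod lform 1 T w) j)" for w
    unfolding exp_prod_def prod.insert[OF insert.hyps] by (simp add: coeff_pCons split: nat.split)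
  show ?case
    unfolding eq by (cases i) (auto intro!: hb_diff hb_const hb_mult IH ht)
qed

lemma hb_exp_coeff: "hb d W (ec i)"
proof (rule hb_limit)
  fix e :: real assume e: "0 < e"
  obtain n0 where n0: "\<forall>w\<in>W. \<forall>i. \<forall>n\<ge>n0. absv (ec i w - coeff (exp_prod lform 1 (F.B n) w) i) \<le> e"
    by (rule F.exp_coeff_uniform[OF e])
  then have "\<forall>w\<in>W. absv (coeff (exp_prod lform 1 (F.B n0) w) i - ec i w) \<le> e" by (simp add: absv_minus_commute)
  then show "\<exists>g. hb d W g \<and> (\<forall>\<omega>\<in>W. absv (g \<omega> - ec i \<omega>) \<le> e)"
    using hb_coeff_exp_prod[OF F.finite_B F.B_sub, of n0 i] by (intro exI conjI)
qed

lemma hb_exp_fun: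
  assumes f: "hb d W f" and D: "0 < D1" "\<And>w. w \<in> W \<Longrightarrow> absv (f w) \<le> D1"
  shows "hb d W (\<lambda>w. exp_fun (lform w ` Lam) (f w))"
proof (rule hb_limit)
  fix e :: real assume e: "0 < e"
  then have "0 < e / D1" using D by simp
  obtain n0 where n0: "\<forall>w\<in>W. \<forall>z. absv z \<le> D1 \<longrightarrow> (\<forall>n\<ge>n0. absv (exp_fun (lform w ` Lam) z - z * poly (exp_prod lform z (F.B n) w) 1) \<le> D1 * (e / D1))"
    by (rule F.exp_fun_uniform[OF D(1) \<open>0 < e / D1\<close>])
  have "hb d W (\<lambda>w. f w * (\<Prod>t\<in>F.B n0. 1 + - f w * inverse (lform w t)))"
    by (intro hb_mult[OF f] hb_prod hb_add hb_const hb_mult[OF hb_uminus[OF f]] hb_inverse_lform) (use F.B_sub in blast)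
  moreover have "absv (f w * (\<Prod>t\<in>F.B n0. 1 + - f w * inverse (lform w t)) - exp_fun (lform w ` Lam) (f w)) \<le> e" if w: "w \<in> W" for w
  proof -
    have "poly (exp_prod lform (f w) (F.B n0) w) 1 = (\<Prod>t\<in>F.B n0. 1 + - f w * inverse (lform w t))"
      by (simp add: exp_prod_def poly_prod)
    then show ?thesis using n0[rule_format, OF w D(2)[OF w] order_refl] D(1) by (simp add: absv_minus_commute)
  qed
  ultimately show "\<exists>g. hb d W g \<and> (\<forall>\<omega>\<in>W. absv (g \<omega> - exp_fun (lform \<omega> ` Lam) (f \<omega>)) \<le> e)" by blast
qed

lemma hb_Gc:
  assumes "\<And>i. hb d W (\<alpha> i)" "hb d W b" shows "hb d W (\<lambda>w. Gc (\<lambda>i. \<alpha> i w) (b w) m n)"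
proof (induction n arbitrary: m)
  case 0
  show ?case by (cases m) (simp_all add: hb_const)
next
  case (Suc n)
  show ?case
  proof (cases m)
    case 0
    then show ?thesis by (simp add: hb_const)
  next
    case m: (Suc j)
    have "hb d W (\<lambda>w. (if j = 0 then (if n = 0 then 1 else 0) else (\<Sum>i<j. (- 1) ^ i * \<alpha> i w * Gc (\<lambda>i. \<alpha> i w) (b w) (j - i) n)))"
      by (cases "j = 0") (auto intro!: hb_const hb_sum hb_mult assms Suc.IH)
    then show ?thesis unfolding m Gc.simps by (intro hb_diff hb_mult assms(2) Suc.IH)
  qed
qed

text \<open>A bound on the affinoid for \<open>lform w q\<close> with q of norm at most
  \<open>Cb\<close>. The maximum with 1 lets \<open>expansion\<close> treat elements of absolute
  value at most 1 in the same disc.\<close>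

definition Dl :: real where "Dl = max 1 (absv \<xi> / nf a * Cb)"

lemma lform_Dl: "w \<in> W \<Longrightarrow> q \<in> carrier_vec d \<Longrightarrow> vn q \<le> Cb \<Longrightarrow> absv (lform w q) \<le> Dl"
proof -
  assume w: "w \<in> W" and q: "q \<in> carrier_vec d" "vn q \<le> Cb"
  have "absv (lform w q) \<le> absv \<xi> / nf a * vn q" by (rule affinoid_upper[OF w d a q(1)])
  also have "\<dots> \<le> absv \<xi> / nf a * Cb" using q(2) by (intro mult_left_mono) auto
  finally show ?thesis by (simp add: Dl_def)
qed

text \<open>b will bound \<beta> for all representatives and all points of the affinoid at once; M
  bounds the coefficients of the exponential function that occur in weight k.\<close>

lemma bounds:
  obtains b M where "1 \<le> b" "1 \<le> M" "\<forall>w\<in>W. \<forall>z. absv z \<le> Dl \<longrightarrow> absv (exp_fun (lform w ` Lam) z) \<le> b"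
    "\<forall>w\<in>W. \<forall>i<k. absv (ec i w) \<le> M"
proof -
  have "0 < Dl" by (simp add: Dl_def less_max_iff_disj)
  then obtain b0 where b0: "0 < b0" "\<forall>w\<in>W. \<forall>z. absv z \<le> Dl \<longrightarrow> absv (exp_fun (lform w ` Lam) z) \<le> b0"
    by (rule F.exp_fun_bounded)
  have "\<forall>i. \<exists>m. \<forall>w\<in>W. absv (ec i w) \<le> m" using hb_bound[OF hb_exp_coeff] by blast
  from choice[OF this] obtain m where m: "\<forall>i. \<forall>w\<in>W. absv (ec i w) \<le> m i" ..
  define M where "M = Max (insert 1 (m ` {..<k}))"
  have 1: "1 \<le> M" unfolding M_def by (rule Max_ge) auto
  have mM: "m i \<le> M" if "i < k" for i unfolding M_def by (rule Max_ge) (use that in auto)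
  have 2: "\<forall>w\<in>W. \<forall>i<k. absv (ec i w) \<le> M"
  proof (intro ballI allI impI)
    fix w i assume "w \<in> W" "i < k"
    then show "absv (ec i w) \<le> M" using m[rule_format, of w i] mM[of i] by linarith
  qed
  have 3: "\<forall>w\<in>W. \<forall>z. absv z \<le> Dl \<longrightarrow> absv (exp_fun (lform w ` Lam) z) \<le> max 1 b0"
    using b0(2) by (simp add: le_max_iff_disj)
  have 4: "1 \<le> max 1 b0" by simp
  show ?thesis by (rule that[OF 4 1 3 2])
qed

lemma hb_\<beta>: "y \<in> Rp \<Longrightarrow> hb d W (\<beta> y)"
  unfolding \<beta>_def
proof (rule hb_exp_fun)
  assume y: "y \<in> Rp"
  show "hb d W (\<lambda>w. lform w (by0 y))" by (rule hb_pairing[OF a d by0_carrier])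
  show "0 < Dl" by (simp add: Dl_def less_max_iff_disj)
  show "absv (lform w (by0 y)) \<le> Dl" if "w \<in> W" for w by (rule lform_Dl[OF that by0_carrier by0_bound[OF y]])
qed

lemma hb_cf: "hb d W (cf n)"
proof -
  obtain b M where b0: "1 \<le> b" "1 \<le> M" "\<forall>w\<in>W. \<forall>z. absv z \<le> Dl \<longrightarrow> absv (exp_fun (lform w ` Lam) z) \<le> b"
    "\<forall>w\<in>W. \<forall>i<k. absv (ec i w) \<le> M" by (rule bounds)
  note b = b0(1,2) b0(3)[rule_format] b0(4)[rule_format]
  have Mb: "0 < M ^ k * b ^ n" using b(1,2) by simp
  have "hb d W (\<lambda>w. infsum (\<lambda>y. inverse (\<iota> (y $ 0) ^ k) * Gc (\<lambda>i. ec i w) (\<beta> y w) k n) Rp)"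
  proof (rule hb_infsum[where M = "\<lambda>y. inverse (nf (y $ 0) ^ k) * (M ^ k * b ^ n)"])
    fix y assume y: "y \<in> Rp"
    show "hb d W (\<lambda>w. inverse (\<iota> (y $ 0) ^ k) * Gc (\<lambda>i. ec i w) (\<beta> y w) k n)"
      by (intro hb_mult[OF hb_const] hb_Gc hb_exp_coeff hb_\<beta>[OF y])
    fix w assume w: "w \<in> W"
    have bb: "absv (\<beta> y w) \<le> b" unfolding \<beta>_def by (intro b(3) w lform_Dl by0_carrier by0_bound y)
    have "absv (Gc (\<lambda>i. ec i w) (\<beta> y w) k n) \<le> M ^ k * b ^ n"
      by (rule Gc_bound[OF b(2) b(4)[OF w] b(1) bb order_refl])
    then show "absv (inverse (\<iota> (y $ 0) ^ k) * Gc (\<lambda>i. ec i w) (\<beta> y w) k n) \<le> inverse (nf (y $ 0) ^ k) * (M ^ k * b ^ n)"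
      unfolding absv_mult absv_inverse absv_power by (intro mult_left_mono) auto
  qed (rule finite_Rp[OF _ Mb])
  moreover have "hb d W (\<lambda>w. if n = 0 then eisenstein \<iota> d k Sz w else 0)"
  proof (cases "n = 0")
    case True
    have "Sz \<subseteq> carrier_vec d" by (auto simp: Sz_def)
    from hb_eisenstein[OF a d this finite_Sz k] show ?thesis using True by simp
  qed (simp add: hb_const)
  ultimately have "hb d W (\<lambda>w. (if n = 0 then eisenstein \<iota> d k Sz w else 0) +
     infsum (\<lambda>y. inverse (\<iota> (y $ 0) ^ k) * Gc (\<lambda>i. ec i w) (\<beta> y w) k n) Rp)" by (rule hb_add[rotated])
  then show ?thesis unfolding cf_def .
qed

text \<open>The smallness of u says that e(\<omega>_1) is at least 2b in absolute value. This makes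
  the geometric series of all orbits converge at a common rate, and it also forces \<omega>_1 +
  q\<omega>' to exceed 1 for every q in F^d. The latter yields the summability at \<omega>, of which
  only the part \<omega>' is known to lie in the given affinoid.\<close>

lemma expansion:
  assumes bM: "1 \<le> b" "1 \<le> M" "\<And>w z. w \<in> W \<Longrightarrow> absv z \<le> Dl \<Longrightarrow> absv (exp_fun (lform w ` Lam) z) \<le> b"
      "\<And>w i. w \<in> W \<Longrightarrow> i < k \<Longrightarrow> absv (ec i w) \<le> M"
    and om: "\<omega> \<in> Omega \<iota> \<xi> (Suc d)" and w: "vec_last \<omega> d \<in> W"
    and u: "u = inverse (exp_fun (lform (vec_last \<omega> d) ` Lam) (\<omega> $ 0))" and small: "absv u * b \<le> 1 / 2"
  shows "((\<lambda>n. cf n (vec_last \<omega> d) * u ^ n) has_sum eisenstein \<iota> (Suc d) k Sx \<omega>) UNIV"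
proof -
  let ?w = "vec_last \<omega> d" and ?z = "\<omega> $ 0"
  let ?E = "exp_fun (lform ?w ` Lam)"
  note oc = Omega_carrier[OF om] and wc = W_carrier[OF w]
  \<comment> \<open>(1, q) turns \<omega>_1 + q\<omega>' into a pairing with \<omega>, which cannot
    vanish.\<close>
  define row where "row q = vec (Suc d) (\<lambda>i. case i of 0 \<Rightarrow> 1 | Suc j \<Rightarrow> q $ j)" for q :: "'f vec"
  have nz: "?z + lform ?w q \<noteq> 0" if q: "q \<in> carrier_vec d" for q
  proof -
    have rc: "row q \<in> carrier_vec (Suc d)" by (simp add: row_def)
    have r0: "row q $ 0 = 1" by (simp add: row_def)
    then have "row q \<noteq> 0\<^sub>v (Suc d)" by auto
    then have "pairing \<iota> (row q) \<omega> \<noteq> 0" by (rule Omega_pairing_nonzero[OF om rc])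
    moreover have "vec_last (row q) d = q" by (rule eq_vecI) (use q in \<open>auto simp: vec_last_index[OF rc], auto simp: row_def\<close>)
    ultimately show ?thesis using pairing_split[OF rc oc] r0 by (simp add: \<iota>.hom_one)
  qed
  have notin: "?z + lform ?w q \<notin> lform ?w ` Lam" if q: "q \<in> carrier_vec d" for q
  proof
    assume "?z + lform ?w q \<in> lform ?w ` Lam"
    then obtain l where l: "l \<in> Lam" "?z + lform ?w q = lform ?w l" by blast
    have "?z + lform ?w (q - l) = 0" unfolding pairing_diff[OF q Lam_carrier[OF l(1)] wc] using l(2) by (simp add: algebra_simps)
    then show False using nz[of "q - l"] q Lam_carrier[OF l(1)] by auto
  qed
  have z0: "?z + lform ?w (0\<^sub>v d) = ?z" using wc by simp
  have Ez: "?E ?z \<noteq> 0" using F.exp_fun_nonzero[OF w notin[of "0\<^sub>v d"]] z0 by simp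
  have u0: "u \<noteq> 0" and uE: "u * ?E ?z = 1" using Ez by (simp_all add: u)
  have bE: "b < absv (?E ?z)"
  proof -
    have "absv u * absv (?E ?z) = 1" using uE by (metis absv_mult absv_one)
    moreover have "0 < absv u" using u0 by simp
    ultimately have "absv u * b < absv u * absv (?E ?z)" using small by linarith
    then show ?thesis using \<open>0 < absv u\<close> by simp
  qed
  \<comment> \<open>If \<omega>_1 + q\<omega>' were small, b would bound its exponential. It also
    bounds e(q\<omega>'), after reducing q modulo \<open>Lam\<close>, hence by additivity
    e(\<omega>_1) as well, contrary to \<open>bE\<close>.\<close>
  have large: "1 < absv (?z + lform ?w q)" if q: "q \<in> carrier_vec d" for q
  proof (rule ccontr)
    assume "\<not> ?thesis"
    then have 1: "absv (?z + lform ?w q) \<le> Dl" by (simp add: Dl_def)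
    obtain l where l: "l \<in> Lam" "vn (q - l) \<le> Cb" using Cb(2)[OF q] by blast
    note lc = Lam_carrier[OF l(1)]
    have qc: "q - l \<in> carrier_vec d" using q lc by simp
    have "?E (lform ?w q) = ?E (lform ?w (q - l) + lform ?w l)" unfolding pairing_diff[OF q lc wc] by simp
    also have "\<dots> = ?E (lform ?w (q - l))" unfolding F.exp_fun_additive[OF w] F.exp_fun_lattice[OF w l(1)] by simp
    finally have 2: "absv (?E (lform ?w q)) \<le> b" using bM(3)[OF w lform_Dl[OF w qc l(2)]] by simp
    have "?E (?z + lform ?w q) = ?E (lform ?w q) + ?E ?z" unfolding F.exp_fun_additive[OF w] by simp
    then have "absv (?E ?z) \<le> b"
      using absv_diff_le[OF bM(3)[OF w 1] 2] by simp
    then show False using bE by simp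
  qed
  \<comment> \<open>The analogue of \<open>affinoid_lower\<close> for this single \<omega>:
    x\<omega> controls x_0 by \<open>large\<close>, and then x' by the lower bound over the affinoid
    of \<omega>'.\<close>
  have lower: "\<exists>c>0. \<forall>x\<in>carrier_vec (Suc d). vn x \<le> c * absv (pairing \<iota> x \<omega>)"
  proof (intro exI conjI ballI)
    let ?m = "absv ?z"
    have m1: "1 < ?m" using large[of "0\<^sub>v d"] z0 by simp
    define c where "c = max 1 (?m / \<delta>)"
    show "0 < c" by (simp add: c_def less_max_iff_disj)
    fix x :: "'f vec" assume x: "x \<in> carrier_vec (Suc d)"
    let ?t = "absv (pairing \<iota> x \<omega>)"
    have t0: "nf (x $ 0) \<le> ?t"
    proof (cases "x $ 0 = 0")
      case False
      have q: "by0 x \<in> carrier_vec d" by simp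
      have "pairing \<iota> x \<omega> = \<iota> (x $ 0) * (?z + lform ?w (by0 x))"
        unfolding pairing_split[OF x oc] by0_def pairing_smult[OF vec_last_carrier wc] using False by (simp add: distrib_left \<iota>.hom_inverse mult.assoc[symmetric])
      then have "?t = nf (x $ 0) * absv (?z + lform ?w (by0 x))" by (simp add: absv_mult)
      moreover have "nf (x $ 0) * 1 \<le> nf (x $ 0) * absv (?z + lform ?w (by0 x))" using large[OF q] by (intro mult_left_mono) auto
      ultimately show ?thesis by simp
    qed simp
    have "pairing \<iota> x \<omega> - \<iota> (x $ 0) * ?z = lform ?w (vec_last x d)" unfolding pairing_split[OF x oc] by simp
    moreover have "absv (pairing \<iota> x \<omega> - \<iota> (x $ 0) * ?z) \<le> ?m * ?t"
    proof (rule absv_diff_le)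
      have "1 * ?t \<le> ?m * ?t" using m1 by (intro mult_right_mono) auto
      then show "absv (pairing \<iota> x \<omega>) \<le> ?m * ?t" by simp
      show "absv (\<iota> (x $ 0) * ?z) \<le> ?m * ?t" unfolding absv_mult using t0 by (subst mult.commute) (intro mult_left_mono, auto)
    qed
    ultimately have "\<delta> * vn (vec_last x d) \<le> ?m * ?t" using affinoid_lower[OF w d vec_last_carrier[of x d]] by simp
    then have v1: "vn (vec_last x d) \<le> ?m / \<delta> * ?t" using \<delta>_pos by (simp add: field_simps)
    show "vn x \<le> c * ?t"
    proof (rule vn_le)
      show "0 \<le> c * ?t" using \<open>0 < c\<close> by simp
      fix i assume "i < dim_vec x"
      then have i: "i < Suc d" using x by simp
      have c1: "1 * ?t \<le> c * ?t" "?m / \<delta> * ?t \<le> c * ?t" by (intro mult_right_mono; simp add: c_def)+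
      show "nf (x $ i) \<le> c * ?t"
      proof (cases i)
        case 0
        then show ?thesis using t0 c1(1) by simp
      next
        case (Suc j)
        then have "j < d" using i by simp
        then have "nf (x $ i) \<le> vn (vec_last x d)" using vn_ge[of j "vec_last x d"] vec_last_index[OF x] Suc by simp
        then show ?thesis using v1 c1(2) by linarith
      qed
    qed
  qed
  define f where "f x = inverse (pairing \<iota> x \<omega> ^ k)" for x
  define S0 where "S0 = {x \<in> Sx - {0\<^sub>v (Suc d)}. x $ 0 = 0}"
  have Spart: "Sx - {0\<^sub>v (Suc d)} = S0 \<union> Sp" "S0 \<inter> Sp = {}" unfolding S0_def Sp_def by auto
  have van: "vanishing f (Sx - {0\<^sub>v (Suc d)})"
    unfolding vanishing_def
  proof (intro allI impI)
    fix e :: real assume e: "0 < e"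
    obtain c where c: "0 < c" "\<forall>x\<in>carrier_vec (Suc d). vn x \<le> c * absv (pairing \<iota> x \<omega>)" using lower by blast
    show "finite {x \<in> Sx - {0\<^sub>v (Suc d)}. e \<le> absv (f x)}"
    proof (rule finite_subset[OF _ finite_Sx])
      show "{x \<in> Sx - {0\<^sub>v (Suc d)}. e \<le> absv (f x)} \<subseteq> {x \<in> Sx. vn x \<le> c * max 1 (inverse e)}"
      proof safe
        fix x assume x: "x \<in> Sx" "x \<noteq> 0\<^sub>v (Suc d)" "e \<le> absv (f x)"
        have xc: "x \<in> carrier_vec (Suc d)" using x Sc by auto
        have "0 < absv (pairing \<iota> x \<omega>)" using Omega_pairing_nonzero[OF om xc x(2)] by simp
        then have "absv (pairing \<iota> x \<omega>) \<le> max 1 (inverse e)"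
          using x(3) e k unfolding f_def absv_inverse absv_power by (intro inverse_power_ge_imp_le)
        then have "c * absv (pairing \<iota> x \<omega>) \<le> c * max 1 (inverse e)" using c(1) by (intro mult_left_mono) auto
        then show "vn x \<le> c * max 1 (inverse e)" using c(2) xc by (meson order_trans)
      qed
    qed
  qed
  have sub: "S0 \<subseteq> Sx - {0\<^sub>v (Suc d)}" "Sp \<subseteq> Sx - {0\<^sub>v (Suc d)}" using Spart(1) by auto
  have total: "eisenstein \<iota> (Suc d) k Sx \<omega> = infsum f S0 + infsum f Sp"
    unfolding eisenstein_def Spart(1) f_def[symmetric]
    by (intro infsumI has_sum_union vanishing_summable vanishing_subset[OF van] sub Spart(2))
  have S0sum: "infsum f S0 = eisenstein \<iota> d k Sz ?w"
  proof -
    have S0c: "x \<in> carrier_vec (Suc d)" "x $ 0 = 0" if "x \<in> S0" for x using that Sc by (auto simp: S0_def)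
    have inj: "inj_on (\<lambda>x. vec_last x d) S0"
      by (rule inj_onI) (rule vec_Suc_eqI[of _ d], use S0c in auto)
    have zero: "vec_last x d = 0\<^sub>v d \<longleftrightarrow> x = 0\<^sub>v (Suc d)" if x: "x \<in> carrier_vec (Suc d)" "x $ 0 = 0" for x :: "'f vec"
    proof -
      have v0: "vec_last (0\<^sub>v (Suc d)) d = (0\<^sub>v d :: 'f vec)" by (rule eq_vecI) (auto simp: vec_last_index[of _ d])
      then show ?thesis using vec_Suc_eqI[of x d "0\<^sub>v (Suc d)"] x by auto
    qed
    have img: "(\<lambda>x. vec_last x d) ` S0 = Sz - {0\<^sub>v d}" unfolding S0_def Sz_def using zero Sc by auto
    have "infsum f S0 = infsum ((\<lambda>z. inverse (pairing \<iota> z ?w ^ k)) \<circ> (\<lambda>x. vec_last x d)) S0"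
      by (rule infsum_cong) (use S0c in \<open>simp add: f_def pairing_split[OF _ oc]\<close>)
    then show ?thesis unfolding eisenstein_def img[symmetric] infsum_reindex[OF inj] .
  qed
  define zy where "zy y = ?z + lform ?w (by0 y)" for y
  define an where "an y n = inverse (\<iota> (y $ 0) ^ k) * (Gc (\<lambda>i. ec i ?w) (\<beta> y ?w) k n * u ^ n)" for y n
  have fsh: "f (sh d l y) = inverse (\<iota> (y $ 0) ^ k) * inverse ((zy y + lform ?w l) ^ k)" if y: "y \<in> Rp" and l: "l \<in> Lam" for y l
  proof -
    note ys = Sp_carrier[OF Rp_Sp[OF y]] and lc = Lam_carrier[OF l]
    have "pairing \<iota> (sh d l y) \<omega> = \<iota> (y $ 0) * (zy y + lform ?w l)"
      unfolding pairing_split[OF sh_carrier oc] sh_last[OF ys(1) lc] zy_def by0_def sh_0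
        pairing_smult[OF vec_last_carrier wc] pairing_add[OF vec_last_carrier smult_carrier_vec[THEN iffD2, OF lc] wc] pairing_smult[OF lc wc]
      using ys(3) by (simp add: distrib_left \<iota>.hom_inverse mult.assoc[symmetric])
    then show ?thesis unfolding f_def by (simp add: power_mult_distrib)
  qed
  \<comment> \<open>\<open>F.S\<close> at z + b obeys the recursion behind \<open>Gc\<close>,
    because e(z + b) = e(z) + \<beta> and u e(z) = 1 turn 1/e(z + b) into u / (1 + \<beta>
    u).\<close>
  have inner: "infsum (\<lambda>l. f (sh d l y)) Lam = infsum (an y) UNIV" if y: "y \<in> Rp" for y
  proof -
    note ys = Sp_carrier[OF Rp_Sp[OF y]]
    have i0: "inverse (\<iota> (y $ 0) ^ k) \<noteq> 0" using ys(3) by simp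
    have zn: "zy y \<notin> lform ?w ` Lam" unfolding zy_def by (rule notin) simp
    have Ezy: "?E (zy y) = ?E ?z + \<beta> y ?w" unfolding zy_def \<beta>_def F.exp_fun_additive[OF w] ..
    have bb: "absv (\<beta> y ?w) \<le> b" unfolding \<beta>_def by (intro bM(3) w lform_Dl by0_carrier by0_bound y)
    have S1: "F.S ?w 1 (zy y) * (1 + \<beta> y ?w * u) = u"
    proof -
      have e1: "u * (?E (zy y) * F.S ?w 1 (zy y)) = u" unfolding F.S_1[OF w zn] by simp
      have e2: "u * (?E (zy y) * F.S ?w 1 (zy y)) = F.S ?w 1 (zy y) * (u * ?E ?z + \<beta> y ?w * u)"
        unfolding Ezy by (simp add: algebra_simps)
      show ?thesis using trans[OF e2[symmetric] e1] unfolding uE .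
    qed
    have Sm: "F.S ?w (Suc m) (zy y) * (1 + \<beta> y ?w * u) = u * (\<Sum>i<m. (- 1) ^ i * ec i ?w * F.S ?w (m - i) (zy y))" if m: "0 < m" for m
    proof -
      have "F.S ?w (Suc m) (zy y) * (1 + \<beta> y ?w * u) = (F.S ?w 1 (zy y) * (1 + \<beta> y ?w * u)) * (\<Sum>i<m. (- 1) ^ i * ec i ?w * F.S ?w (m - i) (zy y))"
        unfolding F.S_rec[OF w zn m] by (simp only: mult_ac)
      then show ?thesis unfolding S1 .
    qed
    have "infsum (\<lambda>l. f (sh d l y)) Lam = infsum (\<lambda>l. inverse (\<iota> (y $ 0) ^ k) * inverse ((zy y + lform ?w l) ^ k)) Lam"
      by (rule infsum_cong) (rule fsh[OF y])
    also have "\<dots> = inverse (\<iota> (y $ 0) ^ k) * F.S ?w k (zy y)"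
      unfolding F.S_def by (rule infsum_cmult[OF i0])
    also have "F.S ?w k (zy y) = infsum (\<lambda>n. Gc (\<lambda>i. ec i ?w) (\<beta> y ?w) k n * u ^ n) UNIV"
      by (rule infsumI[symmetric]) (rule Gc_has_sum[OF bM(2) bM(4)[OF w] bM(1) bb small S1 Sm k order_refl])
    also have "inverse (\<iota> (y $ 0) ^ k) * \<dots> = infsum (an y) UNIV" unfolding an_def by (rule infsum_cmult[OF i0, symmetric])
    finally show ?thesis .
  qed
  have vP: "vanishing (\<lambda>p. f (case p of (y, l) \<Rightarrow> sh d l y)) (Rp \<times> Lam)"
    unfolding vanishing_def
  proof (intro allI impI)
    fix e :: real assume e: "0 < e"
    let ?g = "\<lambda>(y, l). sh d l y"
    have fin: "finite {x \<in> Sp. e \<le> absv (f x)}"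
      using vanishing_subset[OF van sub(2)] e unfolding vanishing_def by blast
    have inj: "inj_on ?g {p \<in> Rp \<times> Lam. e \<le> absv (f (?g p))}"
      using bij_betw_imp_inj_on[OF Sp_bij] by (rule inj_on_subset) auto
    have "?g ` {p \<in> Rp \<times> Lam. e \<le> absv (f (?g p))} \<subseteq> {x \<in> Sp. e \<le> absv (f x)}"
      using sh_Sp Rp_Sp by auto
    from finite_subset[OF this fin] show "finite {p \<in> Rp \<times> Lam. e \<le> absv (f (?g p))}" by (rule finite_imageD[OF _ inj])
  qed
  have "infsum (\<lambda>y. infsum (\<lambda>l. f (sh d l y)) Lam) Rp = infsum (\<lambda>p. f (case p of (y, l) \<Rightarrow> sh d l y)) (Rp \<times> Lam)"
    using infsumI[OF has_sum_Sigma_absv(1)[OF vP]] by simp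
  also have "\<dots> = infsum f Sp" by (rule infsum_reindex_bij_betw[OF Sp_bij])
  finally have "infsum f Sp = infsum (\<lambda>y. infsum (\<lambda>l. f (sh d l y)) Lam) Rp" ..
  also have "\<dots> = infsum (\<lambda>y. infsum (an y) UNIV) Rp" by (rule infsum_cong) (rule inner)
  finally have Spsum: "infsum f Sp = infsum (\<lambda>y. infsum (an y) UNIV) Rp" .
  \<comment> \<open>The domination that allows the sum over orbits and the sum over n to be
    exchanged: the first factor tends to 0 over \<open>Rp\<close>, the last is geometric with a
    ratio common to all orbits.\<close>
  have abound: "absv (an y n) \<le> inverse (nf (y $ 0) ^ k) * M ^ k * (1 / 2) ^ n" if y: "y \<in> Rp" for y n
  proof -
    have bb: "absv (\<beta> y ?w) \<le> b" unfolding \<beta>_def by (intro bM(3) w lform_Dl by0_carrier by0_bound y)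
    have "absv (Gc (\<lambda>i. ec i ?w) (\<beta> y ?w) k n) * absv u ^ n \<le> (M ^ k * b ^ n) * absv u ^ n"
      by (intro mult_right_mono Gc_bound[OF bM(2) bM(4)[OF w] bM(1) bb order_refl]) auto
    also have "\<dots> = M ^ k * (absv u * b) ^ n" by (simp add: power_mult_distrib mult_ac)
    also have "\<dots> \<le> M ^ k * (1 / 2) ^ n" using small bM(1,2) by (intro mult_left_mono power_mono) auto
    finally have "inverse (nf (y $ 0) ^ k) * (absv (Gc (\<lambda>i. ec i ?w) (\<beta> y ?w) k n) * absv u ^ n) \<le> inverse (nf (y $ 0) ^ k) * (M ^ k * (1 / 2) ^ n)"
      by (rule mult_left_mono) simp
    then show ?thesis unfolding an_def absv_mult absv_inverse absv_power by (simp only: mult.assoc)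
  qed
  have "((\<lambda>n. infsum (\<lambda>y. an y n) Rp) has_sum infsum f Sp) UNIV"
    unfolding Spsum by (rule iterated_sums[OF finite_Rp abound]) (use bM(2) in auto)
  from has_sum_add_absv[OF has_sum_delta[of "infsum f S0"] this]
  have "((\<lambda>n. (if n = 0 then infsum f S0 else 0) + infsum (\<lambda>y. an y n) Rp) has_sum eisenstein \<iota> (Suc d) k Sx \<omega>) UNIV"
    unfolding total .
  moreover have "cf n ?w * u ^ n = (if n = 0 then infsum f S0 else 0) + infsum (\<lambda>y. an y n) Rp" for n
  proof -
    have un: "u ^ n \<noteq> 0" using u0 by simp
    have "infsum (\<lambda>y. an y n) Rp = infsum (\<lambda>y. u ^ n * (inverse (\<iota> (y $ 0) ^ k) * Gc (\<lambda>i. ec i ?w) (\<beta> y ?w) k n)) Rp"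
      unfolding an_def by (rule infsum_cong) (simp only: mult_ac)
    also have "\<dots> = u ^ n * infsum (\<lambda>y. inverse (\<iota> (y $ 0) ^ k) * Gc (\<lambda>i. ec i ?w) (\<beta> y ?w) k n) Rp"
      by (rule infsum_cmult[OF un])
    finally show ?thesis unfolding cf_def S0sum by (cases "n = 0") (simp_all add: distrib_right mult.commute)
  qed
  ultimately show ?thesis by simp
qed

end

context coset_lattice
begin

definition cz :: "int \<Rightarrow> 'c vec \<Rightarrow> 'c" where "cz n w = (if n < 0 then 0 else cf (nat n) w)"

theorem u_expansion_eisenstein:
  assumes f: "\<And>\<omega>. \<omega> \<in> Omega \<iota> \<xi> (Suc d) \<Longrightarrow> f \<omega> = eisenstein \<iota> (Suc d) k Sx \<omega>"
  shows "holomorphic_at_infinity \<iota> \<xi> (Suc d) (Stab (Suc d) Sx) f"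
  unfolding holomorphic_at_infinity_def
proof (intro exI conjI)
  show "\<forall>n<0. \<forall>\<omega>'\<in>Omega \<iota> \<xi> (Suc d - 1). cz n \<omega>' = 0" by (simp add: cz_def)
  show "u_expansion \<iota> \<xi> (Suc d) (Stab (Suc d) Sx) f cz"
    unfolding u_expansion_def diff_Suc_1
  proof (intro conjI allI impI)
    fix n
    show "holomorphic_Omega \<iota> \<xi> d (cz n)"
    proof (rule holomorphicI)
      fix a :: 'f assume a: "a \<noteq> 0"
      interpret coset_lattice_at K v ty \<iota> \<theta> \<xi> d k Sx den per a by unfold_locales (rule a)
      show "hb d (Omega_affinoid \<iota> \<xi> d a) (cz n)"
        using hb_cf[of "nat n"] hb_const[of d _ 0] unfolding cz_def by (cases "n < 0") simp_all
    qed
  next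
    fix a :: 'f assume a: "a \<noteq> 0"
    interpret coset_lattice_at K v ty \<iota> \<theta> \<xi> d k Sx den per a by unfold_locales (rule a)
    obtain b M where b0: "1 \<le> b" "1 \<le> M" "\<forall>w\<in>W. \<forall>z. absv z \<le> Dl \<longrightarrow> absv (exp_fun (lform w ` Lam) z) \<le> b"
      "\<forall>w\<in>W. \<forall>i<k. absv (ec i w) \<le> M" by (rule bounds)
    note bM = b0(1,2) b0(3)[rule_format] b0(4)[rule_format]
    show "\<exists>\<rho>>0. \<forall>\<omega>\<in>Omega \<iota> \<xi> (Suc d). vec_last \<omega> d \<in> W \<longrightarrow> absv (u_param \<iota> (Suc d) (Stab (Suc d) Sx) \<omega>) \<le> \<rho> \<longrightarrow>
      ((\<lambda>n. cz n (vec_last \<omega> d) * u_param \<iota> (Suc d) (Stab (Suc d) Sx) \<omega> powi n) has_sum f \<omega>) UNIV"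
    proof (intro exI conjI ballI impI)
      \<comment> \<open>The radius depends on the affinoid through b alone.\<close>
      show "0 < 1 / (2 * b)" using bM(1) by simp
      fix \<omega> assume om: "\<omega> \<in> Omega \<iota> \<xi> (Suc d)" and w: "vec_last \<omega> d \<in> W"
        and small: "absv (u_param \<iota> (Suc d) (Stab (Suc d) Sx) \<omega>) \<le> 1 / (2 * b)"
      let ?u = "u_param \<iota> (Suc d) (Stab (Suc d) Sx) \<omega>"
      have u: "?u = inverse (exp_fun (lform (vec_last \<omega> d) ` Lam) (\<omega> $ 0))"
        unfolding u_param_def unipotent_Stab by simp
      have "absv ?u * b \<le> 1 / (2 * b) * b" using small bM(1) by (intro mult_right_mono) auto
      then have sm: "absv ?u * b \<le> 1 / 2" using bM(1) by simp
      have "((\<lambda>n. cf n (vec_last \<omega> d) * ?u ^ n) has_sum f \<omega>) UNIV"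
        unfolding f[OF om] by (rule expansion[OF bM om w u sm])
      then have "((\<lambda>n. cz (int n) (vec_last \<omega> d) * ?u powi int n) has_sum f \<omega>) UNIV" by (simp add: cz_def)
      then have r: "((\<lambda>n. cz n (vec_last \<omega> d) * ?u powi n) has_sum f \<omega>) (range int)"
        by (subst has_sum_reindex) (simp_all add: o_def)
      have "((\<lambda>n. cz n (vec_last \<omega> d) * ?u powi n) has_sum f \<omega>) (range int) \<longleftrightarrow> ((\<lambda>n. cz n (vec_last \<omega> d) * ?u powi n) has_sum f \<omega>) UNIV"
      proof (rule has_sum_cong_neutral)
        fix n :: int assume "n \<in> UNIV - range int"
        then have "n < 0" by (metis Diff_iff nonneg_int_cases not_le rangeI)
        then show "cz n (vec_last \<omega> d) * ?u powi n = 0" by (simp add: cz_def)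
      qed auto
      then show "((\<lambda>n. cz n (vec_last \<omega> d) * ?u powi n) has_sum f \<omega>) UNIV" using r by simp
    qed
  qed
qed

end

section \<open>Modularity\<close>

lemma act_translate:
  assumes g: "\<gamma> \<in> carrier (GL r)" and w: "w \<in> carrier_vec r" and L: "L \<subseteq> carrier_vec r"
  shows "act \<gamma> (translate w L) = translate (row_act w \<gamma>) (act \<gamma> L)"
  unfolding translate_def act_def image_image
  using row_act_add[OF GL_carrier[OF g] w] L by (intro image_cong refl) auto

context drinfeld
begin

lemma translate_carrier: "alat r L \<Longrightarrow> w \<in> carrier_vec r \<Longrightarrow> translate w L \<subseteq> carrier_vec r"
  using alatD(1)[of r L] by (auto simp: translate_def)

lemma holomorphic_eisenstein:
  assumes L: "alat r L" and w: "w \<in> carrier_vec r" and r: "1 \<le> r" and k: "0 < k"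
  shows "holomorphic_Omega \<iota> \<xi> r (eisenstein \<iota> r k (translate w L))"
proof (rule holomorphicI)
  fix a :: 'f assume a: "a \<noteq> 0"
  obtain e where e: "e \<noteq> 0" "\<forall>x\<in>translate w L. e \<cdot>\<^sub>v x \<in> Avec r" using coset_denominator[OF L w] by blast
  note Sc = translate_carrier[OF L w]
  show "hb r (Omega_affinoid \<iota> \<xi> r a) (eisenstein \<iota> r k (translate w L))"
    by (rule hb_eisenstein[OF a r Sc disc_of_denominator[OF Sc e(1) e(2)[rule_format]] k])
qed

lemma eisenstein_at_infinity:
  assumes L: "alat (Suc d) L" and w: "w \<in> carrier_vec (Suc d)" and d: "1 \<le> d" and k: "0 < k"
    and f: "\<forall>\<omega>\<in>Omega \<iota> \<xi> (Suc d). f \<omega> = eisenstein \<iota> (Suc d) k (translate w L) \<omega>"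
  shows "holomorphic_at_infinity \<iota> \<xi> (Suc d) (Stab (Suc d) (translate w L)) f"
proof -
  obtain e where e: "e \<in> A" "e \<noteq> 0" "\<forall>x\<in>translate w L. e \<cdot>\<^sub>v x \<in> Avec (Suc d)" using coset_denominator[OF L w] by blast
  obtain p where p: "p \<in> A" "p \<noteq> 0" "\<forall>x\<in>Avec (Suc d). p \<cdot>\<^sub>v x \<in> L" using alatD(4)[OF L] by blast
  note Lc = alatD(1)[OF L]
  have per: "x + p \<cdot>\<^sub>v y \<in> translate w L" if x: "x \<in> translate w L" and y: "y \<in> Avec (Suc d)" for x y
  proof -
    obtain l where l: "l \<in> L" "x = w + l" using x unfolding translate_def by blast
    have yc: "y \<in> carrier_vec (Suc d)" using y Avec_carrier by auto
    have "x + p \<cdot>\<^sub>v y = w + (l + p \<cdot>\<^sub>v y)" unfolding l(2) using w l(1) Lc yc by (intro assoc_add_vec[of _ "Suc d"]) auto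
    moreover have "l + p \<cdot>\<^sub>v y \<in> L" by (rule alatD(2)[OF L l(1) p(3)[rule_format, OF y]])
    ultimately show ?thesis unfolding translate_def by blast
  qed
  have w0: "w \<in> translate w L"
    unfolding translate_def using alat_0[OF L] w by (intro image_eqI[of _ _ "0\<^sub>v (Suc d)"]) auto
  \<comment> \<open>If w itself has first entry 0, adding the multiple by p of the first unit vector
    stays in the coset and changes that entry.\<close>
  have "\<exists>s\<in>translate w L. s $ 0 \<noteq> 0"
  proof (cases "w $ 0 = 0")
    case True
    have "unit_vec (Suc d) 0 \<in> Avec (Suc d)" using A_0 A_1 by (auto simp: Avec_def)
    from per[OF w0 this] show ?thesis using True w p(2) by (intro bexI[of _ "w + p \<cdot>\<^sub>v unit_vec (Suc d) 0"]) auto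
  qed (use w0 in blast)
  then interpret coset_lattice K v ty \<iota> \<theta> \<xi> d k "translate w L" e p
    using d k translate_carrier[OF L w] e p per by unfold_locales blast+
  show ?thesis by (rule u_expansion_eisenstein[OF f[rule_format]])
qed

theorem eisenstein_modular:
  assumes L: "alat r L" and w: "w \<in> carrier_vec r" and r: "2 \<le> r" and k: "0 < k"
  shows "eisenstein \<iota> r k (translate w L) \<in> modular_forms \<iota> \<xi> r A (int k) 0 (Stab r (translate w L))"
proof -
  let ?S = "translate w L" and ?E = "eisenstein \<iota> r k (translate w L)"
  obtain d where d: "r = Suc d" "1 \<le> d" using r by (cases r) auto
  have r1: "1 \<le> r" using r by simp
  note Sc = translate_carrier[OF L w]
  have inv: "slash \<iota> \<xi> r (int k) 0 ?E \<gamma> \<omega> = ?E \<omega>" if g: "\<gamma> \<in> Stab r ?S" and om: "\<omega> \<in> Omega \<iota> \<xi> r" for \<gamma> \<omega>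
  proof -
    have g': "\<gamma> \<in> carrier (GL r)" and act: "act \<gamma> ?S = ?S" using g by (simp_all add: Stab_def)
    show ?thesis using slash_eisenstein[OF g' r1 Sc om, of k] unfolding act .
  qed
  have weak: "weak_modular_form \<iota> \<xi> r A (int k) 0 (Stab r ?S) ?E"
    unfolding weak_modular_form_def
    by (intro conjI ballI arithmetic_Stab[OF L w] holomorphic_eisenstein[OF L w r1 k] inv)
  have inf: "holomorphic_at_infinity \<iota> \<xi> r (conj_subgroup r \<gamma> (Stab r ?S)) (slash \<iota> \<xi> r (int k) 0 ?E \<gamma>)"
    if g: "\<gamma> \<in> carrier (GL r)" for \<gamma>
  proof -
    have S': "act \<gamma> ?S = translate (row_act w \<gamma>) (act \<gamma> L)" by (rule act_translate[OF g w alatD(1)[OF L]])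
    have wc: "row_act w \<gamma> \<in> carrier_vec r" using GL_carrier[OF g] by (rule row_act_carrier)
    have "\<forall>\<omega>\<in>Omega \<iota> \<xi> r. slash \<iota> \<xi> r (int k) 0 ?E \<gamma> \<omega> = eisenstein \<iota> r k (translate (row_act w \<gamma>) (act \<gamma> L)) \<omega>"
      unfolding S'[symmetric] by (rule ballI) (rule slash_eisenstein[OF g r1 Sc])
    then have "holomorphic_at_infinity \<iota> \<xi> r (Stab r (translate (row_act w \<gamma>) (act \<gamma> L))) (slash \<iota> \<xi> r (int k) 0 ?E \<gamma>)"
      using alat_act[OF g L] wc unfolding d(1) by (intro eisenstein_at_infinity[OF _ _ d(2) k])
    then show ?thesis unfolding conj_Stab[OF g Sc] S' .
  qed
  show ?thesis unfolding modular_forms_def mem_Collect_eq by (intro conjI ballI weak inf)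
qed

end

theorem theorem13p16:
  fixes \<iota> :: "'f::field \<Rightarrow> 'c::{field,complete_space}"
    and K :: "'f set" and ord_inf :: "'f \<Rightarrow> int" and \<theta> :: real
    and \<xi> :: 'c and r k :: nat and L :: "'f vec set" and v :: "'f vec"
  assumes "global_function_field K"
    and "place ord_inf"
    and "is_C_inf ord_inf \<theta> \<iota>"
    and "2 \<le> r"
    and "\<xi> \<noteq> 0"
    and "1 \<le> k"
    and "lattice_in r (regular_ring ord_inf) L"
    and "v \<in> carrier_vec r"
  shows "eisenstein \<iota> r k (translate v L)
           \<in> modular_forms \<iota> \<xi> r (regular_ring ord_inf) (int k) 0 (coset_stabilizer r v L)"
proof -
  interpret function_field K by (rule function_field_of_global[OF assms(1)])
  interpret function_field_at K ord_inf by unfold_locales (rule assms(2))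
  note C1 = assms(3)[unfolded is_C_inf_def]
  note C2 = conjunct2[OF C1]
  note C3 = conjunct2[OF C2]
  note C4 = conjunct2[OF C3]
  note C5 = conjunct2[OF C4]
  note C6 = conjunct2[OF C5]
  interpret ultrametric "TYPE('c)"
  proof
    show "dist x y = absv (x - y)" for x y :: 'c by (rule conjunct1[OF C1, rule_format])
    show "absv (x * y) = absv x * absv y" for x y :: 'c by (rule conjunct1[OF C2, rule_format])
    show "absv (x + y) \<le> max (absv x) (absv y)" for x y :: 'c by (rule conjunct1[OF C3, rule_format])
  qed
  interpret field_hom \<iota> by (rule conjunct1[OF C4])
  interpret drinfeld K ord_inf "TYPE('c)" \<iota> \<theta> \<xi>
  proof unfold_locales
    show "0 < \<theta>" by (rule conjunct1[OF C5])
    show "\<theta> < 1" by (rule conjunct1[OF C6])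
    show "absv (\<iota> a) = \<theta> powi ord_inf a" if "a \<noteq> 0" for a by (rule conjunct1[OF conjunct2[OF C6], rule_format, OF that])
    show "\<xi> \<noteq> 0" by (rule assms(5))
  qed
  have L: "alat r L" by (rule alat_of_lattice_in[OF assms(7)])
  show ?thesis
    unfolding coset_stabilizer_eq[OF assms(8) alatD(1)[OF L]]
    by (rule eisenstein_modular[OF L assms(8,4)]) (use assms(6) in linarith)
qed

end
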